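(* Let $(D,b)$ be a continuous regular lake and let $f$ satisfy (H1). Suppose that $\delta(\varepsilon)\ln\frac1\varepsilon=o_\varepsilon(1)$ as $\varepsilon\to0^+$. Let $\mathcal M:=\{x\in\bar D: q(x)=\max_{\bar D}q\}$. Then for all sufficiently small $\varepsilon>0$ there exists a family of solutions $(\psi^\varepsilon,\zeta^\varepsilon)$ (in the sense of (i)) with the following properties: (i) For any $p>1$, $\zeta^\varepsilon\in L^p(D)$, $\psi^\varepsilon\in W^{2,p}_{\mathrm{loc}}(D)$ and $\mathcal L\psi^\varepsilon=\zeta^\varepsilon$ a.e. in $D$. Moreover, for some $\mu^\varepsilon\in\mathbb R$ depending on $\varepsilon$, $$\psi^\varepsilon=\mathcal K\zeta^\varepsilon+q-\mu^\varepsilon,\qquad \zeta^\varepsilon=\frac{\delta(\varepsilon)}{\varepsilon^2}f(\psi^\varepsilon),\qquad \int_D\zeta^\varepsilon\,d\nu=\kappa_0\delta(\varepsilon).$$ (ii) One has $\mathcal K\zeta^\varepsilon=o_\varepsilon(1)$ and $\mu^\varepsilon=\max_{\bar D}q+o_\varepsilon(1)$. Furthermore, for every $l>0$, $\mathrm{supp}(\zeta^\varepsilon)\subset\mathcal M_l:=\{x\in D:\mathrm{dist}(x,\mathcal M)<l\}$ provided $\varepsilon>0$ is sufficiently small.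
   Context: Measures and notation: $m$ is Lebesgue measure on $\mathbb R^2$; given a depth function $b$, $\nu$ is the measure with density $b$ with respect to $m$ ($d\nu=b\,dm$). $L^p$ and Sobolev spaces are with respect to $m$ unless stated otherwise. $o_\varepsilon(1)$ is a quantity bounded in absolute value by a function of $\varepsilon$ only that tends to $0$ as $\varepsilon\to0^+$ (for functions on $D$: uniformly on $D$). $\mathrm{supp}$ is the support of a function on $D$ (relative to $D$). Lake: $D\subset\mathbb R^2$ is a bounded simply-connected Lipschitz domain, $b:\bar D\to[0,\infty)$ belongs to $C^\alpha(\bar D)\cap C^1(D)$ for some $\alpha\in(0,1)$, and $b>0$ in $D$. $H(D)$ is the completion of $C_0^\infty(D)$ for the scalar product $\langle u,v\rangle_H=\int_D\frac1{b^2}\nabla u\cdot\nabla v\,d\nu$. The operator $\mathcal L$ is $\mathcal Lu=-\frac1b\,\mathrm{div}\frac{\nabla u}{b}$, and its inverse $\mathcal K$ is defined weakly: for $u\in L^p(D)$, $p>1$, $\mathcal Ku\in H(D)$ satisfies $\langle\mathcal Ku,v\rangle_H=\int_D uv\,d\nu$ for all $v\in H(D)$. $(D,b)$ is a continuous lake if $\mathcal K\zeta(x)=b(x)\int_DG(x,y)\zeta(y)\,d\nu(y)+\int_DR(x,y)\zeta(y)\,d\nu(y)$ for all $\zeta\in L^p(D,d\nu)$, $p>1$, where $G$ is the Green's function of $-\Delta$ in $D$ with Dirichlet boundary conditions and $R:D\times D\to\mathbb R$ is bounded and measurable. A continuous regular lake is a continuous lake $(D,b)$ such that $D\subset\mathbb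 R^2$ is a bounded simply-connected Lipschitz domain and $b:\bar D\to[0,\infty)$ belongs to $C^\alpha(\bar D)\cap C^1(D)$ for some $\alpha\in(0,1)$, with $b>0$ in $D$. Background flow: $g\not\equiv0$ is a given function on $\partial D$ (the penetration condition) with $\int_{\partial D}g\,d\sigma=0$, and $q\in C^1(\bar D)\cap C^2(D)$ is the solution of $-\mathrm{div}(b^{-1}\nabla q)=0$ in $D$, $\nabla^\perp q\cdot\mathbf n=g$ on $\partial D$, where $(x_1,x_2)^\perp=(x_2,-x_1)$ and $\mathbf n$ is the unit outward normal. $\kappa_0>0$ is a fixed constant; $\delta(\varepsilon)>0$ is a given function of $\varepsilon>0$. (H1) $f:\mathbb R\to\mathbb R$ is continuous on $\mathbb R\setminus\{0\}$, $f(s)=0$ for $s\le0$, $f$ is strictly increasing in $[0,+\infty)$, with $f(0^+):=\lim_{s\to0^+}f(s)\ge0$. *)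

theory Defs
  imports "HOL-Analysis.Analysis"
begin

type_synonym plane = "real^2"

section \<open>Differential operators and spaces of differentiable functions\<close>

definition partial :: "2 \<Rightarrow> (plane \<Rightarrow> real) \<Rightarrow> plane \<Rightarrow> real" where
  "partial i u x = frechet_derivative u (at x) (axis i 1)"

definition grad :: "(plane \<Rightarrow> real) \<Rightarrow> plane \<Rightarrow> plane" where
  "grad u x = (\<chi> i. partial i u x)"

definition divergence :: "(plane \<Rightarrow> plane) \<Rightarrow> plane \<Rightarrow> real" where
  "divergence F x = (\<Sum>i\<in>UNIV. partial i (\<lambda>y. F y $ i) x)"

definition perp :: "plane \<Rightarrow> plane" where
  "perp x = vector [x $ 2, - x $ 1]"

text \<open>\<open>Ck_on k D u\<close> is $u \in C^k(D)$; it is meant for open \<open>D\<close>.\<close>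

fun Ck_on :: "nat \<Rightarrow> plane set \<Rightarrow> (plane \<Rightarrow> real) \<Rightarrow> bool" where
  "Ck_on 0 D u \<longleftrightarrow> continuous_on D u"
| "Ck_on (Suc k) D u \<longleftrightarrow> (\<forall>x\<in>D. u differentiable (at x)) \<and> (\<forall>i. Ck_on k D (partial i u))"

definition test_fun :: "plane set \<Rightarrow> (plane \<Rightarrow> real) \<Rightarrow> bool" where
  "test_fun D \<phi> \<longleftrightarrow> (\<forall>k. Ck_on k UNIV \<phi>) \<and>
     compact (closure {x. \<phi> x \<noteq> 0}) \<and> closure {x. \<phi> x \<noteq> 0} \<subseteq> D"

definition holder_on :: "real \<Rightarrow> plane set \<Rightarrow> (plane \<Rightarrow> real) \<Rightarrow> bool" where
  "holder_on \<alpha> S u \<longleftrightarrow> (\<exists>C. \<forall>x\<in>S. \<forall>y\<in>S. \<bar>u x - u y\<bar> \<le> C * dist x y powr \<alpha>)"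

section \<open>Lebesgue and Sobolev spaces, weak derivatives\<close>

definition Lp :: "'a measure \<Rightarrow> real \<Rightarrow> ('a \<Rightarrow> real) set" where
  "Lp M p = {u \<in> borel_measurable M. integrable M (\<lambda>x. \<bar>u x\<bar> powr p)}"

definition Lp_loc :: "plane set \<Rightarrow> real \<Rightarrow> (plane \<Rightarrow> real) set" where
  "Lp_loc D p = {u. \<forall>K. compact K \<and> K \<subseteq> D \<longrightarrow> u \<in> Lp (lebesgue_on K) p}"

definition has_weak_partial ::
    "plane set \<Rightarrow> 2 \<Rightarrow> (plane \<Rightarrow> real) \<Rightarrow> (plane \<Rightarrow> real) \<Rightarrow> bool" where
  "has_weak_partial D i u v \<longleftrightarrow> u \<in> Lp_loc D 1 \<and> v \<in> Lp_loc D 1 \<and>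
     (\<forall>\<phi>. test_fun D \<phi> \<longrightarrow>
        (\<integral>x. u x * partial i \<phi> x \<partial>lebesgue_on D) = - (\<integral>x. v x * \<phi> x \<partial>lebesgue_on D))"

definition W2p_loc :: "plane set \<Rightarrow> real \<Rightarrow> (plane \<Rightarrow> real) set" where
  "W2p_loc D p = {u \<in> Lp_loc D p.
     \<forall>i. \<exists>v\<in>Lp_loc D p. has_weak_partial D i u v \<and>
       (\<forall>j. \<exists>w\<in>Lp_loc D p. has_weak_partial D j v w)}"

section \<open>Lipschitz domains: charts, outward normal, surface measure\<close>

text \<open>
  In the orthonormal frame \<open>(e1, e2)\<close> centred at the boundary point \<open>x0\<close>, the part of \<open>D\<close> in the
  rectangle \<open>|s| < r\<close>, \<open>|t| < h\<close> is the region above the graph of the Lipschitz function \<open>\<gamma>\<close>.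
\<close>

definition lipschitz_chart ::
    "plane set \<Rightarrow> plane \<Rightarrow> plane \<Rightarrow> plane \<Rightarrow> real \<Rightarrow> real \<Rightarrow> (real \<Rightarrow> real) \<Rightarrow> bool" where
  "lipschitz_chart D x0 e1 e2 r h \<gamma> \<longleftrightarrow>
     norm e1 = 1 \<and> norm e2 = 1 \<and> e1 \<bullet> e2 = 0 \<and> r > 0 \<and> h > 0 \<and>
     (\<exists>L. L-lipschitz_on {-r<..<r} \<gamma>) \<and> \<gamma> 0 = 0 \<and> (\<forall>s\<in>{-r<..<r}. \<bar>\<gamma> s\<bar> < h) \<and>
     (\<forall>s\<in>{-r<..<r}. \<forall>t\<in>{-h<..<h}. x0 + s *\<^sub>R e1 + t *\<^sub>R e2 \<in> D \<longleftrightarrow> \<gamma> s < t)"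

definition lipschitz_domain :: "plane set \<Rightarrow> bool" where
  "lipschitz_domain D \<longleftrightarrow> open D \<and> connected D \<and> D \<noteq> {} \<and>
     (\<forall>x0\<in>frontier D. \<exists>e1 e2 r h \<gamma>. lipschitz_chart D x0 e1 e2 r h \<gamma>)"

text \<open>
  The normal exists at the boundary points where the graph is differentiable, hence (Rademacher)
  almost everywhere with respect to the surface measure.
\<close>

definition outward_unit_normal :: "plane set \<Rightarrow> plane \<Rightarrow> plane \<Rightarrow> bool" where
  "outward_unit_normal D x n \<longleftrightarrow> x \<in> frontier D \<and>
     (\<exists>e1 e2 r h \<gamma> c. lipschitz_chart D x e1 e2 r h \<gamma> \<and> (\<gamma> has_real_derivative c) (at 0) \<and>
        n = (1 / sqrt (1 + c\<^sup>2)) *\<^sub>R (c *\<^sub>R e1 - e2))"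

text \<open>One-dimensional Hausdorff outer measure, normalised so that segments have their length.\<close>

definition hausdorff1 :: "plane set \<Rightarrow> ennreal" where
  "hausdorff1 A = (SUP d\<in>{0<..}.
     INF C\<in>{C :: nat \<Rightarrow> plane set. A \<subseteq> (\<Union>i. C i) \<and> (\<forall>i. bounded (C i) \<and> diameter (C i) \<le> d)}.
       \<Sum>i. ennreal (diameter (C i)))"

text \<open>
  The surface measure $\sigma$ on $\partial D$: the Hausdorff outer measure on its Caratheodory
  measurable sets.
\<close>

definition surface_measure :: "plane set \<Rightarrow> plane measure" where
  "surface_measure D =
     measure_of (frontier D) (lambda_system (frontier D) (Pow (frontier D)) hausdorff1) hausdorff1"

lemma outer_measure_space_hausdorff1: "outer_measure_space (Pow S) hausdorff1"
proof -
  define cov where "cov d A = {C :: nat \<Rightarrow> plane set. A \<subseteq> (\<Union>i. C i) \<and>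
      (\<forall>i. bounded (C i) \<and> diameter (C i) \<le> d)}" for d :: real and A
  define P where "P d A = (INF C\<in>cov d A. \<Sum>i. ennreal (diameter (C i)))" for d A
  have H: "hausdorff1 A = (SUP d\<in>{0<..}. P d A)" for A
    by (simp add: hausdorff1_def P_def cov_def)
  have mono: "hausdorff1 A \<le> hausdorff1 B" if "A \<subseteq> B" for A B
    unfolding H P_def using that
    by (intro SUP_mono bexI[where x = "_ :: real"] INF_superset_mono) (auto simp: cov_def)
  have pos: "hausdorff1 {} = 0"
  proof -
    have "P d {} = 0" if "d > 0" for d
    proof -
      have "P d {} \<le> (\<Sum>i. ennreal (diameter (({} :: plane set))))"
        unfolding P_def using that by (intro INF_lower2[where i = "\<lambda>_. {}"]) (auto simp: cov_def)
      then show ?thesis by simp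
    qed
    then show ?thesis unfolding H by (simp add: SUP_constant)
  qed
  have sub: "hausdorff1 (\<Union>i. A i) \<le> (\<Sum>i. hausdorff1 (A i))" for A :: "nat \<Rightarrow> plane set"
  proof (rule ennreal_le_epsilon)
    fix e :: real assume e: "0 < e" and fin: "(\<Sum>i. hausdorff1 (A i)) < top"
    have "P d (\<Union>i. A i) \<le> (\<Sum>i. hausdorff1 (A i)) + e" if d: "d > 0" for d
    proof -
      have "\<exists>C\<in>cov d (A n). (\<Sum>i. ennreal (diameter (C i))) \<le> hausdorff1 (A n) + e * (1/2)^Suc n" for n
      proof -
        have "hausdorff1 (A n) < hausdorff1 (A n) + e * (1/2)^Suc n"
          using fin e by (auto simp add: less_top dest!: ennreal_suminf_lessD)
        moreover have "P d (A n) \<le> hausdorff1 (A n)"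
          unfolding H using d by (intro SUP_upper) auto
        ultimately have "P d (A n) < hausdorff1 (A n) + e * (1/2)^Suc n" by (rule le_less_trans[rotated])
        then show ?thesis unfolding P_def INF_less_iff by (auto intro: less_imp_le)
      qed
      then obtain B where B: "\<And>n. B n \<in> cov d (A n)"
        and Ble: "\<And>n. (\<Sum>i. ennreal (diameter (B n i))) \<le> hausdorff1 (A n) + e * (1/2)^Suc n"
        by metis
      define C where "C = case_prod B o prod_decode"
      have C: "C \<in> cov d (\<Union>i. A i)"
      proof -
        have "\<exists>k. x \<in> C k" if x: "x \<in> A n" for x n
        proof -
          obtain i where "x \<in> B n i" using B[of n] x by (auto simp: cov_def)
          then have "x \<in> C (prod_encode (n, i))" by (simp add: C_def)
          then show ?thesis ..
        qed
        moreover have "bounded (C k) \<and> diameter (C k) \<le> d" for k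
          using B by (auto simp: C_def cov_def split: prod.split)
        ultimately show ?thesis by (auto simp: cov_def)
      qed
      have "P d (\<Union>i. A i) \<le> (\<Sum>k. ennreal (diameter (C k)))"
        unfolding P_def by (intro INF_lower C)
      also have "\<dots> = (\<Sum>n. \<Sum>i. ennreal (diameter (B n i)))"
        unfolding C_def
        by (intro suminf_ennreal_2dimen[of "\<lambda>n. \<Sum>i. ennreal (diameter (B n i))"
              "\<lambda>(n, i). ennreal (diameter (B n i))", unfolded comp_def, THEN trans[rotated]])
           (auto simp: split_def)
      also have "\<dots> \<le> (\<Sum>n. hausdorff1 (A n) + e * (1/2) ^ Suc n)"
        by (intro suminf_le allI Ble) auto
      also have "\<dots> = (\<Sum>n. hausdorff1 (A n)) + (\<Sum>n. ennreal e * ennreal ((1/2) ^ Suc n))"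
        using e by (subst suminf_add[symmetric])
          (auto simp del: ennreal_suminf_cmult simp add: ennreal_mult[symmetric])
      also have "\<dots> = (\<Sum>n. hausdorff1 (A n)) + e"
        unfolding ennreal_suminf_cmult
        by (subst suminf_ennreal_eq[OF zero_le_power power_half_series]) auto
      finally show ?thesis .
    qed
    then show "hausdorff1 (\<Union>i. A i) \<le> (\<Sum>i. hausdorff1 (A i)) + e"
      unfolding H[of "\<Union>i. A i"] by (intro SUP_least) auto
  qed
  show ?thesis
    unfolding outer_measure_space_def positive_def increasing_def countably_subadditive_def
    using mono pos sub by auto
qed

lemma measure_space_surface:
  "measure_space (frontier D) (lambda_system (frontier D) (Pow (frontier D)) hausdorff1) hausdorff1"
  by (rule sigma_algebra.caratheodory_lemma[OF sigma_algebra_Pow outer_measure_space_hausdorff1])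

lemma emeasure_surface_measure:
  assumes "A \<in> lambda_system (frontier D) (Pow (frontier D)) hausdorff1"
  shows "emeasure (surface_measure D) A = hausdorff1 A"
  using measure_space_surface[of D] assms unfolding surface_measure_def
  by (intro emeasure_measure_of_sigma) (auto simp: measure_space_def)

section \<open>Lakes\<close>

text \<open>The measure $\nu$ on \<open>D\<close>, $d\nu = b\,dm$.\<close>

definition lake_measure :: "plane set \<Rightarrow> (plane \<Rightarrow> real) \<Rightarrow> plane measure" where
  "lake_measure D b = density (lebesgue_on D) (\<lambda>x. ennreal (b x))"

text \<open>
  \<open>in_H D b u U\<close>: the function \<open>u\<close>, with gradient \<open>U\<close>, belongs to the completion $H(D)$ of the test
  functions for $\langle u,v\rangle_H = \int_D b^{-2}\,\nabla u\cdot\nabla v\,d\nu$.  For bounded \<open>D\<close>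
  and \<open>b\<close> the norm of $H(D)$ dominates that of $H^1_0(D)$, so a Cauchy sequence of test functions
  also converges in $L^2(D)$, to a function \<open>u\<close> that determines the abstract limit; the completion
  is the space of these functions.
\<close>

definition in_H ::
    "plane set \<Rightarrow> (plane \<Rightarrow> real) \<Rightarrow> (plane \<Rightarrow> real) \<Rightarrow> (plane \<Rightarrow> plane) \<Rightarrow> bool" where
  "in_H D b u U \<longleftrightarrow>
     u \<in> borel_measurable (lebesgue_on D) \<and> U \<in> borel_measurable (lebesgue_on D) \<and>
     (\<exists>\<phi>. (\<forall>n::nat. test_fun D (\<phi> n)) \<and>
        (\<lambda>n. \<integral>\<^sup>+x. ennreal ((\<phi> n x - u x)\<^sup>2) \<partial>lebesgue_on D) \<longlonglongrightarrow> 0 \<and>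
        (\<lambda>n. \<integral>\<^sup>+x. ennreal (1 / (b x)\<^sup>2 * (norm (grad (\<phi> n) x - U x))\<^sup>2) \<partial>lake_measure D b) \<longlonglongrightarrow> 0)"

text \<open>
  \<open>is_K D b \<zeta> w\<close>: the function \<open>w\<close> represents $\mathcal K\zeta$; it is unique up to a null set.
\<close>

definition is_K :: "plane set \<Rightarrow> (plane \<Rightarrow> real) \<Rightarrow> (plane \<Rightarrow> real) \<Rightarrow> (plane \<Rightarrow> real) \<Rightarrow> bool" where
  "is_K D b \<zeta> w \<longleftrightarrow> (\<exists>W. in_H D b w W \<and>
     (\<forall>v V. in_H D b v V \<longrightarrow>
        (\<integral>x. 1 / (b x)\<^sup>2 * (W x \<bullet> V x) \<partial>lake_measure D b) = (\<integral>x. \<zeta> x * v x \<partial>lake_measure D b)))"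

text \<open>
  \<open>is_L_ae D b u h\<close>: $-\frac1b\,\mathrm{div}\frac{\nabla u}{b} = h$ a.e. in \<open>D\<close>, all derivatives
  being weak; \<open>v\<close> is the gradient of \<open>u\<close> and \<open>d 1 + d 2\<close> the divergence of \<open>v / b\<close>.
\<close>

definition is_L_ae :: "plane set \<Rightarrow> (plane \<Rightarrow> real) \<Rightarrow> (plane \<Rightarrow> real) \<Rightarrow> (plane \<Rightarrow> real) \<Rightarrow> bool" where
  "is_L_ae D b u h \<longleftrightarrow> (\<exists>v d.
     (\<forall>i. has_weak_partial D i u (v i) \<and> has_weak_partial D i (\<lambda>x. v i x / b x) (d i)) \<and>
     (AE x in lebesgue_on D. - (1 / b x) * (\<Sum>i\<in>UNIV. d i x) = h x))"

definition harmonic_on :: "plane set \<Rightarrow> (plane \<Rightarrow> real) \<Rightarrow> bool" where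
  "harmonic_on D h \<longleftrightarrow> Ck_on 2 D h \<and> (\<forall>x\<in>D. divergence (grad h) x = 0)"

text \<open>
  Green's function of $-\Delta$ in \<open>D\<close> with Dirichlet boundary conditions.  The value on the diagonal
  (a null set) is left open.
\<close>

definition is_dirichlet_green :: "plane set \<Rightarrow> (plane \<Rightarrow> plane \<Rightarrow> real) \<Rightarrow> bool" where
  "is_dirichlet_green D G \<longleftrightarrow> (\<forall>y\<in>D. \<exists>h.
     continuous_on (closure D) h \<and> harmonic_on D h \<and>
     (\<forall>x\<in>frontier D. h x = 1 / (2 * pi) * ln (1 / dist x y)) \<and>
     (\<forall>x\<in>D - {y}. G x y = 1 / (2 * pi) * ln (1 / dist x y) - h x))"

definition continuous_lake :: "plane set \<Rightarrow> (plane \<Rightarrow> real) \<Rightarrow> bool" where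
  "continuous_lake D b \<longleftrightarrow> (\<exists>G R. is_dirichlet_green D G \<and>
     (\<lambda>(x, y). R x y) \<in> borel_measurable (lebesgue_on (D \<times> D)) \<and>
     (\<exists>B. \<forall>x\<in>D. \<forall>y\<in>D. \<bar>R x y\<bar> \<le> B) \<and>
     (\<forall>p>1. \<forall>\<zeta>\<in>Lp (lake_measure D b) p.
        is_K D b \<zeta> (\<lambda>x. b x * (\<integral>y. G x y * \<zeta> y \<partial>lake_measure D b)
                       + (\<integral>y. R x y * \<zeta> y \<partial>lake_measure D b))))"

definition continuous_regular_lake :: "plane set \<Rightarrow> (plane \<Rightarrow> real) \<Rightarrow> bool" where
  "continuous_regular_lake D b \<longleftrightarrow>
     bounded D \<and> simply_connected D \<and> lipschitz_domain D \<and>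
     (\<forall>x\<in>closure D. b x \<ge> 0) \<and> (\<exists>\<alpha>\<in>{0<..<1}. holder_on \<alpha> (closure D) b) \<and>
     Ck_on 1 D b \<and> (\<forall>x\<in>D. b x > 0) \<and> continuous_lake D b"

text \<open>
  The boundary data \<open>g\<close> is a function on $\partial D$ up to $\sigma$-null sets, since the normal
  exists only almost everywhere.  \<open>Q\<close> is the continuous extension of $\nabla q$ to $\bar D$ that
  $q \in C^1(\bar D)$ provides.
\<close>

definition background_flow ::
    "plane set \<Rightarrow> (plane \<Rightarrow> real) \<Rightarrow> (plane \<Rightarrow> real) \<Rightarrow> (plane \<Rightarrow> real) \<Rightarrow> bool" where
  "background_flow D b g q \<longleftrightarrow>
     continuous_on (closure D) q \<and> Ck_on 2 D q \<and>
     (\<forall>x\<in>D. - divergence (\<lambda>y. (1 / b y) *\<^sub>R grad q y) x = 0) \<and>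
     (\<exists>Q. continuous_on (closure D) Q \<and> (\<forall>x\<in>D. Q x = grad q x) \<and>
        (AE x in surface_measure D. \<forall>n. outward_unit_normal D x n \<longrightarrow> perp (Q x) \<bullet> n = g x))"

definition vorticity_profile :: "(real \<Rightarrow> real) \<Rightarrow> bool" where
  "vorticity_profile f \<longleftrightarrow> continuous_on (UNIV - {0}) f \<and> (\<forall>s\<le>0. f s = 0) \<and> strict_mono_on {0..} f \<and>
     (\<exists>l\<ge>0. (f \<longlongrightarrow> l) (at_right 0))"

text \<open>Support relative to \<open>D\<close>.\<close>

definition supp_in :: "plane set \<Rightarrow> (plane \<Rightarrow> real) \<Rightarrow> plane set" where
  "supp_in D u = D \<inter> closure {x\<in>D. u x \<noteq> 0}"

definition max_set :: "plane set \<Rightarrow> (plane \<Rightarrow> real) \<Rightarrow> plane set" where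
  "max_set D q = {x\<in>closure D. q x = (SUP y\<in>closure D. q y)}"

definition max_nbhd :: "plane set \<Rightarrow> (plane \<Rightarrow> real) \<Rightarrow> real \<Rightarrow> plane set" where
  "max_nbhd D q l = {x\<in>D. infdist x (max_set D q) < l}"

end

(* Since psi = q - mu + o(1) is at most 1 a posteriori, f may be replaced by the bounded function f(min s 1). The
   vorticity is then a fixed point of z |-> lam f(K z + q - mu(z)), lam = delta / eps^2, where the multiplier mu(z)
   makes the right-hand side have the prescribed mass. With F a primitive of f, the energy
   - <K z, z> / 2 + lam (integral of F(K z + q - mu(z))) + mu(z) * mass increases under this map by at least half the
   quadratic form of K at the increment, so along the iteration the increments vanish; interior gradient bounds give
   compactness of K z, and a weak limit of the iterates is a fixed point. The jump of f at 0 is harmless: a Sobolev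
   function has zero weak gradient almost everywhere on its level sets, so L psi = z forces z = 0 where psi = 0.

   The second derivatives needed for the local W^{2,p} regularity are bounded without singular integrals: a Bellman
   function of two variables is run along the discrete heat flow (the average over the four neighbours on a grid of
   mesh h), and h -> 0 yields an L log L bound for the pairing of the Hessian with a test function g. Taking for g a
   power of the Hessian bounds it in every L^p.

   The limit eps -> 0 rests on the logarithmic bound for the Green function: the vorticity has mass kappa delta and
   height O(delta / eps^2), so K z = O(delta ln (1 / eps)) = o(1). The mass constraint then pins mu to the maximum of
   q and the support to a neighbourhood of the maximum points. *)
theory Submission
  imports Defs "HOL-Library.Diagonal_Subsequence"
begin

text \<open>The depth may vanish on the boundary, so \<open>1 / b\<close> is controlled only inside
  \<open>D\<close>. Hence all regularity estimates are interior, and compactness of K z is wanted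
  only as almost everywhere convergence in \<open>D\<close>: with a uniform bound it passes to the
  limit against the finite measure b dm. Up to the boundary only the sup bound for K z is used,
  which rests on the maximum principle.

  Truncating f at 1 bounds the vorticities of the iteration uniformly, although f may grow
  arbitrarily fast. All iterates then obey estimates with one constant M, and gradients are improved
  from L^2 to L^4 to sup by two inequalities for smooth functions.

  A weak limit cannot be inserted into the nonlinearity. Off the level set {psi = 0} the iterates
  converge pointwise, so limits of convex combinations are identified there; on the level set
  nothing of the kind is known and the elliptic equation decides the value. The fraction of the jump
  of f used in one step of the iteration serves to meet the mass constraint; it is invisible in the
  final equation.\<close>

abbreviation lint :: "('a::euclidean_space \<Rightarrow> real) \<Rightarrow> real" (binder "LI " 10) where
  "lint f \<equiv> integral\<^sup>L lborel f"

abbreviation nlint :: "('a::euclidean_space \<Rightarrow> ennreal) \<Rightarrow> ennreal" (binder "NI " 10) where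
  "nlint f \<equiv> integral\<^sup>N lborel f"

abbreviation AEl :: "('a::euclidean_space \<Rightarrow> bool) \<Rightarrow> bool" (binder "AEL " 10) where
  "AEl P \<equiv> almost_everywhere lborel P"

abbreviation integ :: "('a::euclidean_space \<Rightarrow> 'b::{banach, second_countable_topology}) \<Rightarrow> bool" where
  "integ \<equiv> integrable lborel"

abbreviation BM :: "('a::topological_space \<Rightarrow> 'b::topological_space) set" where
  "BM \<equiv> borel_measurable borel"

abbreviation BL :: "plane set \<Rightarrow> (plane \<Rightarrow> 'b::topological_space) set" where
  "BL D \<equiv> borel_measurable (lebesgue_on D)"

abbreviation scR :: "real \<Rightarrow> 'a::real_vector \<Rightarrow> 'a" (infixr "*R" 75) where
  "c *R x \<equiv> c *\<^sub>R x"

abbreviation pd :: "2 \<Rightarrow> (plane \<Rightarrow> real) \<Rightarrow> plane \<Rightarrow> real" where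
  "pd \<equiv> partial"

abbreviation ind :: "'a set \<Rightarrow> 'a \<Rightarrow> 'b::zero_neq_one" where
  "ind \<equiv> indicator"

abbreviation seq_lim :: "(nat \<Rightarrow> 'a::topological_space) \<Rightarrow> 'a \<Rightarrow> bool" ("((_)/ ~~> (_))" [60, 60] 60) where
  "X ~~> L \<equiv> X \<longlonglongrightarrow> L"

lemmas integ_add = Bochner_Integration.integrable_add
  and integ_diff = Bochner_Integration.integrable_diff
  and integ_bound = Bochner_Integration.integrable_bound
  and integ_cong = Bochner_Integration.integrable_cong
  and lint_cong = Bochner_Integration.integral_cong
  and lint_add = Bochner_Integration.integral_add
  and lint_diff = Bochner_Integration.integral_diff

section \<open>Smooth functions\<close>

abbreviation e :: "2 => plane" where "e i \<equiv> axis i 1"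

lemma norm_e [simp]: "norm (e i) = 1"
 by (simp add: norm_axis_1)

lemma plane_decomp: "h = (SUM i:UNIV. (h $ i) *R e i)" for h :: plane
 using basis_expansion[of h] by (simp add: scalar_mult_eq_scaleR)

lemma has_derivative_grad:
 assumes "u differentiable (at x)"
 shows "(u has_derivative (%h. grad u x \<bullet> h)) (at x)"
proof -
 have d: "(u has_derivative frechet_derivative u (at x)) (at x)"
  using assms by (simp add: frechet_derivative_works)
 then have l: "linear (frechet_derivative u (at x))"
  by (simp add: has_derivative_linear)
 have "frechet_derivative u (at x) h = grad u x \<bullet> h" for h
 proof -
  have "frechet_derivative u (at x) h = frechet_derivative u (at x) (SUM i:UNIV. (h $ i) *R e i)"
   using plane_decomp[of h] by simp
  also have "... = (SUM i:UNIV. (h $ i) * pd i u x)"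
   by (simp add: linear_sum[OF l] linear_cmul[OF l] partial_def)
  finally show ?thesis
   by (simp add: grad_def inner_vec_def mult.commute)
 qed
 then have "frechet_derivative u (at x) = (%h. grad u x \<bullet> h)" by auto
 with d show ?thesis by simp
qed

lemma grad_nth [simp]: "grad u x $ i = pd i u x"
 by (simp add: grad_def)

lemma inner_e [simp]: "v \<bullet> e i = v $ i" for v :: plane
 by (simp add: inner_axis)

lemma partial_eqI:
 assumes "(u has_derivative u') (at x)"
 shows "pd i u x = u' (e i)"
 using frechet_derivative_at[OF assms] by (simp add: partial_def)

lemma partial_cong:
 assumes "open D" "x : D" "!!y. y : D ==> u y = v y"
 shows "pd i u x = pd i v x"
proof -
 have "(u has_derivative d) (at x) \<longleftrightarrow> (v has_derivative d) (at x)" for d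
  using has_derivative_transform_within_open[of u d x UNIV D v]
   has_derivative_transform_within_open[of v d x UNIV D u] assms by auto
 then show ?thesis
  by (simp add: partial_def frechet_derivative_def)
qed

lemma differentiable_cong_open:
 assumes "open D" "x : D" "!!y. y : D ==> u y = v y" "u differentiable (at x)"
 shows "v differentiable (at x)"
 using assms has_derivative_transform_within_open[of u _ x UNIV D v]
 unfolding differentiable_def by blast

lemma Ck_on_cong:
 assumes "open D" "!!y. y : D ==> u y = v y" "Ck_on k D u"
 shows "Ck_on k D v"
 using assms(2,3)
proof (induction k arbitrary: u v)
 case 0
 then show ?case by (simp cong: continuous_on_cong)
next
 case (Suc k)
 have "Ck_on k D (pd i v)" for i
  using Suc.IH[of "pd i u" "pd i v"] Suc.prems
   partial_cong[OF \<open>open D\<close>, of _ u v] by auto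
 moreover have "v differentiable (at x)" if "x : D" for x
  using Suc.prems that by (auto intro: differentiable_cong_open[OF \<open>open D\<close> that, of u v])
 ultimately show ?case by simp
qed

lemma Ck_on_mono: "Ck_on k D u ==> D' <= D ==> Ck_on k D' u"
proof (induction k arbitrary: u)
 case 0
 then show ?case by (auto intro: continuous_on_subset)
qed auto

lemma Ck_on_imp_continuous_on: "Ck_on k D u ==> continuous_on D u"
 by (cases k) (auto simp: differentiable_imp_continuous_within
   intro!: continuous_at_imp_continuous_on)

lemma Ck_on_SucD: "Ck_on (Suc k) D u ==> Ck_on k D u"
proof (induction k arbitrary: u)
 case 0
 then show ?case using Ck_on_imp_continuous_on[of "Suc 0" D u] by simp
qed simp

lemma partial_add:
 assumes "u differentiable (at x)" "v differentiable (at x)"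
 shows "pd i (%x. u x + v x) x = pd i u x + pd i v x"
 using partial_eqI[OF has_derivative_add[OF has_derivative_grad[OF assms(1)] has_derivative_grad[OF assms(2)]]]
 by simp

lemma partial_diff:
 assumes "u differentiable (at x)" "v differentiable (at x)"
 shows "pd i (%x. u x - v x) x = pd i u x - pd i v x"
 using partial_eqI[OF has_derivative_diff[OF has_derivative_grad[OF assms(1)] has_derivative_grad[OF assms(2)]]]
 by simp

lemma partial_mult:
 assumes "u differentiable (at x)" "v differentiable (at x)"
 shows "pd i (%x. u x * v x) x = u x * pd i v x + pd i u x * v x"
 using partial_eqI[OF has_derivative_mult[OF has_derivative_grad[OF assms(1)] has_derivative_grad[OF assms(2)]]]
 by simp

lemma partial_const [simp]: "pd i (%x. c) x = 0"
 by (simp add: partial_def)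

lemma partial_cmult:
 assumes "u differentiable (at x)"
 shows "pd i (%x. c * u x) x = c * pd i u x"
 using partial_mult[of "%x. c" x u i] assms by simp

lemma partial_inverse:
 assumes "u differentiable (at x)" "u x ~= 0"
 shows "pd i (%x. inverse (u x)) x = - (pd i u x) / (u x)^2"
 using partial_eqI[OF Deriv.has_derivative_inverse[OF assms(2) has_derivative_grad[OF assms(1)]]]
 by (simp add: power2_eq_square field_simps)

lemma partial_chain:
 assumes "u differentiable (at x)" "(g has_real_derivative g') (at (u x))"
 shows "pd i (%x. g (u x)) x = g' * pd i u x" "(%x. g (u x)) differentiable (at x)"
proof -
 have "((%x. g (u x)) has_derivative (%h. g' * (grad u x \<bullet> h))) (at x)"
  using has_derivative_compose[OF has_derivative_grad[OF assms(1)] assms(2)[unfolded has_field_derivative_def]]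
  by simp
 then show "pd i (%x. g (u x)) x = g' * pd i u x" "(%x. g (u x)) differentiable (at x)"
  by (auto dest: partial_eqI intro: differentiableI)
qed

lemma partial_nth [simp]: "pd i (%x. x $ j) x = (if i = j then 1 else 0)"
 using partial_eqI[OF bounded_linear_imp_has_derivative[OF bounded_linear_vec_nth, of j "at x"], of i]
 by (simp add: axis_def)

lemma differentiable_nth [simp]: "(%x. x $ j) differentiable (at (x::plane))"
 using bounded_linear_imp_has_derivative[OF bounded_linear_vec_nth] unfolding differentiable_def by blast

lemma Ck_on_const [simp]: "Ck_on k D (%x. c)"
proof (induction k arbitrary: c)
 case (Suc k)
 have "pd i (%x. c) = (%x. 0)" for i by auto
 then show ?case using Suc by simp
qed simp

lemma Ck_on_nth [simp]: "Ck_on k D (%x. x $ j)"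
proof (cases k)
 case (Suc k')
 have "pd i (%x. x $ j) = (%x. if i = j then 1 else 0)" for i by auto
 then show ?thesis using Suc by simp
qed (auto intro!: continuous_intros)

lemma Ck_on_add:
 assumes "open D" "Ck_on k D u" "Ck_on k D v"
 shows "Ck_on k D (%x. u x + v x)"
 using assms(2,3)
proof (induction k arbitrary: u v)
 case 0
 then show ?case by (auto intro: continuous_intros)
next
 case (Suc k)
 have "Ck_on k D (pd i (%x. u x + v x))" for i
  by (rule Ck_on_cong[OF \<open>open D\<close> _ Suc.IH[of "pd i u" "pd i v"]])
   (use Suc.prems in \<open>auto simp: partial_add\<close>)
 then show ?case using Suc.prems by auto
qed

lemma Ck_on_mult:
 assumes "open D" "Ck_on k D u" "Ck_on k D v"
 shows "Ck_on k D (%x. u x * v x)"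
 using assms(2,3)
proof (induction k arbitrary: u v)
 case 0
 then show ?case by (auto intro: continuous_intros)
next
 case (Suc k)
 have "Ck_on k D (pd i (%x. u x * v x))" for i
  by (rule Ck_on_cong[OF \<open>open D\<close> _ Ck_on_add[OF \<open>open D\<close>
   Suc.IH[of u "pd i v"] Suc.IH[of "pd i u" v]]])
   (use Suc.prems in \<open>auto simp: partial_mult intro: Ck_on_SucD\<close>)
 then show ?case using Suc.prems by auto
qed

lemma Ck_on_cmult: "open D ==> Ck_on k D u ==> Ck_on k D (%x. c * u x)"
 by (intro Ck_on_mult) auto

lemma Ck_on_diff: "open D ==> Ck_on k D u ==> Ck_on k D v ==> Ck_on k D (%x. u x - v x)"
 using Ck_on_add[of D k u "%x. (-1) * v x"] Ck_on_cmult[of D k v "-1"] by simp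

definition smooth :: "(plane => real) => bool" where
 "smooth u \<longleftrightarrow> (ALL k. Ck_on k UNIV u)"

lemma smooth_partial: "smooth u ==> smooth (pd i u)"
 unfolding smooth_def using Ck_on.simps(2) by blast

lemma smooth_differentiable: "smooth u ==> u differentiable (at x)"
 unfolding smooth_def using Ck_on.simps(2) by blast

lemma smooth_continuous: "smooth u ==> continuous_on S u"
 unfolding smooth_def using Ck_on.simps(1) continuous_on_subset by blast

lemma smooth_diff: "smooth u ==> smooth v ==> smooth (%x. u x - v x)"
 and smooth_mult: "smooth u ==> smooth v ==> smooth (%x. u x * v x)"
 and smooth_cmult: "smooth u ==> smooth (%x. c * u x)"
 and smooth_const: "smooth (%x. c)"
 unfolding smooth_def by (simp_all add: Ck_on_add Ck_on_diff Ck_on_mult Ck_on_cmult)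

text \<open>Smoothness by coinduction: any class of differentiable functions stable under partial
  derivatives will do as \<open>P\<close>. It spares explicit formulas for the higher derivatives of
  bumps, translates and convolutions.\<close>

lemma smooth_coinduct:
 assumes "P u"
  and step: "!!u x. P u ==> u differentiable (at x)" "!!u i. P u ==> P (pd i u)"
 shows "smooth u"
proof -
 have "ALL u. P u --> Ck_on k UNIV u" for k
 proof (induction k)
  case 0
  then show ?case using step(1)
   by (auto simp: differentiable_imp_continuous_within intro!: continuous_at_imp_continuous_on)
 qed (use step in auto)
 then show ?thesis using \<open>P u\<close> by (auto simp: smooth_def)
qed

text \<open>The powers of \<open>1 / t\<close> are carried along because differentiating exp(-1/t)
  produces them; the family is stable under derivatives up to linear combinations.\<close>

definition flat_exp :: "nat => real => real" where
 "flat_exp k t = (if t > 0 then exp (- 1 / t) / t ^ k else 0)"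

lemma flat_exp_tendsto_0: "(flat_exp k \<longlongrightarrow> 0) (at 0)"
proof -
 have "((%t. (inverse t) ^ k / exp (inverse t)) \<longlongrightarrow> 0) (at_right (0::real))"
  by (rule filterlim_compose[OF tendsto_power_div_exp_0 filterlim_inverse_at_top_right])
 then have "(flat_exp k \<longlongrightarrow> 0) (at_right 0)"
  by (rule Lim_transform_eventually)
   (auto simp: flat_exp_def eventually_at_filter exp_minus field_simps)
 moreover have "(flat_exp k \<longlongrightarrow> 0) (at_left 0)"
  by (rule Lim_transform_eventually[OF tendsto_const])
   (auto simp: flat_exp_def eventually_at_filter)
 ultimately show ?thesis by (simp add: filterlim_at_split)
qed

lemma flat_exp_deriv:
 "(flat_exp k has_real_derivative (- real k * flat_exp (Suc k) t + flat_exp (k + 2) t)) (at t)"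
proof -
 consider "t > 0" | "t < 0" | "t = 0" by linarith
 then show ?thesis
 proof cases
  case 1
  have "((%t. exp (- 1 / t) / t ^ k) has_real_derivative (- real k * flat_exp (Suc k) t + flat_exp (k + 2) t)) (at t)"
  proof (cases k)
   case (Suc j)
   show ?thesis
   unfolding Suc using 1
   by (auto intro!: derivative_eq_intros simp: flat_exp_def field_simps power2_eq_square)
   (cases j; simp)
  qed (use 1 in \<open>auto intro!: derivative_eq_intros simp: flat_exp_def field_simps power2_eq_square\<close>)
  then show ?thesis
   by (rule DERIV_cong_ev[THEN iffD1, rotated 3])
   (use 1 in \<open>auto simp: flat_exp_def eventually_nhds intro!: exI[of _ "{0<..}"]\<close>)
 next
  case 2
  have "((%t. 0) has_real_derivative (- real k * flat_exp (Suc k) t + flat_exp (k + 2) t)) (at t)"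
   using 2 by (auto simp: flat_exp_def)
  then show ?thesis
   by (rule DERIV_cong_ev[THEN iffD1, rotated 3])
   (use 2 in \<open>auto simp: flat_exp_def eventually_nhds intro!: exI[of _ "{..<0}"]\<close>)
 next
  case 3
  \<comment> \<open>Dividing by \<open>h\<close> only raises the index: the difference quotient at 0
    is \<open>flat_exp (Suc k)\<close>, which tends to 0.\<close>
  have "((%h. flat_exp k h / h) \<longlongrightarrow> 0) (at 0)"
   by (rule Lim_transform_eventually[OF flat_exp_tendsto_0[of "Suc k"]])
   (auto simp: flat_exp_def eventually_at_filter)
  then show ?thesis using 3 by (simp add: DERIV_def flat_exp_def)
 qed
qed

text \<open>The algebra generated by the coordinates and the radial flat exponentials is stable
  under partial derivatives, which makes it the invariant for
  \<open>smooth_coinduct\<close>.\<close>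

inductive bump_alg :: "real => (plane => real) => bool" for r where
 "bump_alg r (%x. c)"
| "bump_alg r (%x. x $ i)"
| "bump_alg r (%x. flat_exp k (r - x \<bullet> x))"
| "bump_alg r u ==> bump_alg r v ==> bump_alg r (%x. u x + v x)"
| "bump_alg r u ==> bump_alg r v ==> bump_alg r (%x. u x * v x)"

lemma bump_alg_step: "bump_alg r u ==> (ALL x. u differentiable (at x)) & (ALL i. bump_alg r (pd i u))"
proof (induction rule: bump_alg.induct)
 case (1 c)
 have "pd i (%x. c) = (%x. 0)" for i by auto
 then show ?case by (simp add: bump_alg.intros)
next
 case (2 j)
 have "pd i (%x. x $ j) = (%x. if i = j then 1 else 0)" for i by auto
 then show ?case by (simp add: bump_alg.intros)
next
 case (3 k)
 have d: "((%x. r - x \<bullet> x) has_derivative (%h. - 2 * (x \<bullet> h))) (at x)" for x :: plane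
  by (auto intro!: derivative_eq_intros simp: inner_commute)
 have p: "pd i (%x. r - x \<bullet> x) x = (-2) * (x $ i)" for i x
  using partial_eqI[OF d] by simp
 have dd: "(%x. r - x \<bullet> x) differentiable (at x)" for x :: plane
  using d unfolding differentiable_def by blast
 have "pd i (%x. flat_exp k (r - x \<bullet> x)) =
   (%x. ((- real k) * flat_exp (Suc k) (r - x \<bullet> x) + flat_exp (k + 2) (r - x \<bullet> x)) * ((-2) * x $ i))" for i
  using partial_chain(1)[OF dd flat_exp_deriv] by (auto simp: p)
 moreover have "bump_alg r (%x. ((- real k) * flat_exp (Suc k) (r - x \<bullet> x) + flat_exp (k + 2) (r - x \<bullet> x)) * ((-2) * x $ i))" for i
  by (intro bump_alg.intros)
 ultimately show ?case
  using partial_chain(2)[OF dd flat_exp_deriv] by auto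
next
 case (4 u v)
 then have "pd i (%x. u x + v x) = (%x. pd i u x + pd i v x)" for i
  by (auto simp: partial_add)
 then show ?case using 4 by (auto intro: bump_alg.intros)
next
 case (5 u v)
 then have "pd i (%x. u x * v x) = (%x. u x * pd i v x + pd i u x * v x)" for i
  by (auto simp: partial_mult)
 moreover have "bump_alg r (%x. u x * pd i v x + pd i u x * v x)" for i
  using 5 by (intro bump_alg.intros) auto
 ultimately show ?case using 5 by auto
qed

lemma smooth_flat_bump: "smooth (%x. flat_exp k (r - x \<bullet> x))"
 by (rule smooth_coinduct[of "bump_alg r"]) (auto dest: bump_alg_step intro: bump_alg.intros)

text \<open>\<open>b\<close> and \<open>1 / b\<close> are only C^1 in \<open>D\<close>, so
  multiplying a test function by them leads out of the test functions but stays in this class. The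
  compact set is a parameter and not the exact support, which lets whole sequences share one
  set.\<close>

definition C1c :: "plane set => (plane => real) => bool" where
 "C1c K u \<longleftrightarrow> compact K & (ALL x. u differentiable (at x)) \<and>
  (ALL i. continuous_on UNIV (pd i u)) & (ALL x. x ~: K --> u x = 0)"

lemma partial_zero_outside:
 assumes "closed K" "!!x. x ~: K ==> u x = 0" "x ~: K"
 shows "pd i u x = 0"
 using partial_cong[of "- K" x u "%_. 0" i] assms by (simp add: open_Compl)

lemma C1cD:
 assumes "C1c K u"
 shows "compact K" "u differentiable (at x)" "continuous_on S (pd i u)" "continuous_on S u"
  "x ~: K ==> u x = 0" "x ~: K ==> pd i u x = 0"
proof -
 show *: "compact K" "u differentiable (at x)" "continuous_on S (pd i u)"
  "x ~: K ==> u x = 0" for x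
  using assms continuous_on_subset unfolding C1c_def by blast+
 show "continuous_on S u"
  using *(2) by (intro continuous_at_imp_continuous_on ballI differentiable_imp_continuous_within)
 show "x ~: K ==> pd i u x = 0"
  using *(1,4) by (intro partial_zero_outside) (auto simp: compact_imp_closed)
qed

lemma smooth_C1c: "smooth u ==> compact K ==> (!!x. x ~: K ==> u x = 0) ==> C1c K u"
 by (simp add: C1c_def smooth_differentiable smooth_continuous smooth_partial)

lemma test_funD:
 assumes "test_fun D u"
 obtains K where "compact K" "K <= D" "smooth u" "C1c K u"
proof -
 let ?K = "closure {x. u x ~= 0}"
 have s: "smooth u" using assms by (simp add: test_fun_def smooth_def)
 have z: "u x = 0" if "x ~: ?K" for x
  using that closure_subset[of "{x. u x ~= 0}"] by blast
 have "C1c ?K u"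
  using assms by (intro smooth_C1c s z) (simp add: test_fun_def)
 with that[of ?K] s assms show ?thesis unfolding test_fun_def by blast
qed

lemma test_funI:
 assumes "smooth u" "compact K" "K <= D" "!!x. x ~: K ==> u x = 0"
 shows "test_fun D u"
proof -
 have "closure {x. u x ~= 0} <= K"
  using assms by (intro closure_minimal) (auto simp: compact_imp_closed)
 then show ?thesis
  using assms compact_Int_closed[of K "closure {x. u x ~= 0}"]
  by (auto simp: test_fun_def smooth_def Int_absorb1)
qed

text \<open>\<open>v\<close> is controlled only in \<open>D\<close>. The product is glued from its
  restriction to \<open>D\<close> and from zero on the complement of \<open>K\<close>, two open sets
  that cover the plane.\<close>

lemma C1c_mult:
 assumes "open D" "Ck_on 1 D v" "C1c K u" "K <= D"
 shows "C1c K (%x. v x * u x)"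
  and "!!x i. x : D ==> pd i (%x. v x * u x) x = v x * pd i u x + pd i v x * u x"
proof -
 note u = C1cD[OF assms(3)]
 have v: "v differentiable (at x)" if "x : D" for x using that assms(2) by simp
 have oc: "open (- K)" using u(1) by (simp add: compact_imp_closed open_Compl)
 have d: "(%x. v x * u x) differentiable (at x)" for x
 proof (cases "x : D")
  case False
  then have "x : - K" using assms(4) by auto
  then show ?thesis
   by (rule differentiable_cong_open[OF oc, of x "%_. 0"]) (auto simp: u)
 qed (use u(2) v in auto)
 show p: "pd i (%x. v x * u x) x = v x * pd i u x + pd i v x * u x" if "x : D" for x i
  using v u that by (simp add: partial_mult)
 have c: "continuous_on (D Un - K) (pd i (%x. v x * u x))" for i
 proof (rule continuous_on_open_Un[OF \<open>open D\<close> oc])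
  have "continuous_on D (%x. v x * pd i u x + pd i v x * u x)"
   using assms(2) u Ck_on_imp_continuous_on[OF assms(2)] by (intro continuous_intros) auto
  then show "continuous_on D (pd i (%x. v x * u x))"
   by (rule continuous_on_cong[THEN iffD1, rotated 2]) (auto simp: p)
  have "pd i (%x. v x * u x) x = 0" if "x : - K" for x
   using that u by (intro partial_zero_outside[of K]) (auto simp: compact_imp_closed)
  then show "continuous_on (- K) (pd i (%x. v x * u x))"
   by (intro continuous_on_cong[THEN iffD1, OF refl _ continuous_on_const[of "- K" 0]]) auto
 qed
 moreover have "D Un - K = UNIV" using assms(4) by auto
 ultimately show "C1c K (%x. v x * u x)"
  using d u by (simp add: C1c_def)
qed

lemma continuous_cpt_bounded:
 fixes u :: "plane => real"
 assumes "continuous_on UNIV u" "compact K" "!!x. x ~: K ==> u x = 0"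
 obtains B where "B > 0" "!!x. abs (u x) <= B"
proof -
 have "compact (u ` K)"
  using assms by (intro compact_continuous_image) (auto intro: continuous_on_subset)
 then obtain B where B: "ALL y:u ` K. abs y <= B" using compact_imp_bounded bounded_real by metis
 have "abs (u x) <= abs B + 1" for x using B assms(3)[of x] by (cases "x : K") force+
 then show ?thesis using that[of "abs B + 1"] by auto
qed

lemma continuous_cpt_integrable:
 fixes u :: "plane => real"
 assumes "continuous_on UNIV u" "compact K" "!!x. x ~: K ==> u x = 0"
 shows "integ u"
proof -
 have "set_integrable lborel K u"
  using assms unfolding set_integrable_def
  by (intro borel_integrable_compact) (auto intro: continuous_on_subset)
 moreover have "(%x. indicat_real K x *R u x) = u" using assms(3) by (force simp: indicator_def)
 ultimately show ?thesis by (simp add: set_integrable_def)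
qed

lemma integrable_indicator_cpt: "compact K ==> integ (indicat_real K)" for K :: "plane set"
 using emeasure_bounded_finite[OF compact_imp_bounded, of K] by (intro integrable_real_indicator) (auto simp: compact_imp_closed)

section \<open>Integration by parts\<close>

lemma lborel_integral_translate:
 fixes f :: "plane => real"
 shows "(LI x. f (x + a)) = (LI x. f x)"
  and "integ (%x. f (x + a)) \<longleftrightarrow> integ f"
proof -
 have *: "integ (%x. f (x + a))" if "integ f" for f :: "plane => real" and a
 proof -
  have "integrable (distr lborel borel ((+) a)) f \<longleftrightarrow> integ (%x. f (a + x))"
   using that by (intro integrable_distr_eq) auto
  then show ?thesis using that by (simp add: lborel_distr_plus add.commute)
 qed
 show i: "integ (%x. f (x + a)) \<longleftrightarrow> integ f"
  using *[of f a] *[of "%x. f (x + a)" "-a"] by auto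
 show "(LI x. f (x + a)) = (LI x. f x)"
 proof (cases "integ f")
  case True
  then have "f : BM" by auto
  then have "integral\<^sup>L (distr lborel borel ((+) a)) f = (LI x. f (a + x))"
   by (intro integral_distr) auto
  then show ?thesis by (simp add: lborel_distr_plus add.commute)
 next
  case False
  then show ?thesis using i by (simp add: not_integrable_integral_eq)
 qed
qed

lemma nn_integral_translate:
 fixes f :: "plane => ennreal"
 assumes "f : BM"
 shows "(NI x. f (x + a)) = (NI x. f x)"
proof -
 have "integral\<^sup>N (distr lborel borel ((+) a)) f = (NI x. f (a + x))"
  using assms by (intro nn_integral_distr) auto
 then show ?thesis by (simp add: lborel_distr_plus add.commute)
qed

lemma lborel_distr_reflect: "distr lborel borel (%x. a - x) = (lborel :: plane measure)"
proof -
 have "distr lborel borel (%x. a + (-1) *R x) = (lborel :: plane measure)"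
  using lborel_affine[of "-1" a] by (simp add: density_1)
 then show ?thesis by simp
qed

lemma lborel_integral_reflect:
 fixes f :: "plane => real"
 assumes "f : BM"
 shows "(LI x. f (a - x)) = (LI x. f x)"
  and "integ (%x. f (a - x)) \<longleftrightarrow> integ f"
proof -
 have "integral\<^sup>L (distr lborel borel (%x. a - x)) f = (LI x. f (a - x))"
  using assms by (intro integral_distr) auto
 then show "(LI x. f (a - x)) = (LI x. f x)" by (simp add: lborel_distr_reflect)
 have "integrable (distr lborel borel (%x. a - x)) f = integ (%x. f (a - x))"
  using assms by (intro integrable_distr_eq) auto
 then show "integ (%x. f (a - x)) \<longleftrightarrow> integ f"
  by (simp add: lborel_distr_reflect)
qed

lemma line_deriv:
 assumes "u differentiable (at (x + t *R e i))"
 shows "((%t. u (x + t *R e i)) has_real_derivative pd i u (x + t *R e i)) (at t)"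
proof -
 have "((%t. x + t *R e i) has_derivative (%h. h *R e i)) (at t)"
  by (auto intro!: derivative_eq_intros)
 from has_derivative_compose[OF this has_derivative_grad[OF assms]]
 show ?thesis by (simp add: has_field_derivative_def mult.commute[of _ "pd i u _"])
qed

lemma lipschitz_line:
 assumes "!!x. u differentiable (at x)" "!!x. abs (pd i u x) <= B"
 shows "abs (u (x + t *R e i) - u x) <= B * abs t"
proof -
 have "norm (u (x + t *R e i) - u (x + 0 *R e i)) <= B * norm (t - 0)"
  by (rule field_differentiable_bound[of UNIV "%t. u (x + t *R e i)"
   "%t. pd i u (x + t *R e i)" B t 0])
   (use assms line_deriv in auto)
 then show ?thesis by simp
qed

text \<open>Difference quotients integrate to zero by translation invariance. They are dominated by
  the Lipschitz constant on the ball of radius \<open>R + 1\<close>, which contains all their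
  supports because the shifts are at most 1.\<close>

lemma integral_partial_zero:
 assumes "C1c K u"
 shows "(LI x. pd i u x) = 0"
proof -
 note u = C1cD[OF assms]
 obtain B where B: "B > 0" "!!x. abs (pd i u x) <= B"
  using continuous_cpt_bounded[of "pd i u" K] u by metis
 obtain R where R: "!!x. x : K ==> norm x <= R"
  using compact_imp_bounded[OF u(1)] by (auto simp: bounded_iff)
 define F where "F n x = real (Suc n) * (u (x + (1 / real (Suc n)) *R e i) - u x)" for n x
 have iu: "integ u"
  using continuous_cpt_integrable[of u K] u by auto
 have "(%n. (LI x. F n x)) ~~> (LI x. pd i u x)"
 proof (rule integral_dominated_convergence[where w="%x. B * ind (cball 0 (R + 1)) x"])
  have "continuous_on UNIV (F n)" for n
   unfolding F_def
   by (intro continuous_intros continuous_on_compose2[OF u(4)[where S=UNIV]] u(4)) auto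
  then show "F n : borel_measurable lborel" for n
   by (simp add: borel_measurable_continuous_onI)
  show "pd i u : borel_measurable lborel"
   using u(3) by (simp add: borel_measurable_continuous_onI)
  show "integ (%x::plane. B * indicat_real (cball 0 (R + 1)) x)"
   by (intro integrable_mult_right integrable_indicator_cpt compact_cball)
  show "AEL x. (%n. F n x) ~~> pd i u x"
  proof (intro AE_I2)
   fix x
   have "((%t. u (x + t *R e i)) has_real_derivative pd i u (x + 0 *R e i)) (at 0)"
   by (rule line_deriv) (use u in auto)
   then have "((%h. (u (x + h *R e i) - u x) / h) \<longlongrightarrow> pd i u x) (at 0)"
   by (simp add: DERIV_def)
   moreover have "filterlim (%n. 1 / real (Suc n)) (at 0) sequentially"
   unfolding filterlim_at using lim_1_over_n[THEN LIMSEQ_Suc] by auto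
   ultimately have "(%n. (u (x + (1 / real (Suc n)) *R e i) - u x) / (1 / real (Suc n))) ~~> pd i u x"
   by (rule filterlim_compose)
   then show "(%n. F n x) ~~> pd i u x"
   unfolding F_def by (simp add: field_simps)
  qed
  show "AEL x. norm (F n x) <= B * ind (cball 0 (R + 1)) x" for n
  proof (intro AE_I2)
   fix x
   let ?t = "1 / real (Suc n)"
   show "norm (F n x) <= B * ind (cball 0 (R + 1)) x"
   proof (cases "x : cball 0 (R + 1)")
   case True
   have "abs (u (x + ?t *R e i) - u x) <= B * abs ?t"
   by (rule lipschitz_line) (use u B in auto)
   then have "real (Suc n) * abs (u (x + ?t *R e i) - u x) <= real (Suc n) * (B * abs ?t)"
   by (rule mult_left_mono) auto
   then show ?thesis using True by (simp add: F_def abs_mult)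
   next
   case False
   have "norm x <= norm (x + ?t *R e i) + norm (?t *R e i)"
   using norm_triangle_ineq4[of "x + ?t *R e i" "?t *R e i"] by simp
   moreover have "norm (?t *R e i) <= 1" by simp
   moreover have "R + 1 < norm x" using False by simp
   ultimately have "norm (x + ?t *R e i) > R" "norm x > R" by linarith+
   then have "x ~: K" "x + ?t *R e i ~: K" using R by force+
   then show ?thesis using u False by (simp add: F_def)
   qed
  qed
 qed
 moreover have "(LI x. F n x) = 0" for n
  unfolding F_def using iu lborel_integral_translate[of u "(1 / real (Suc n)) *R e i"]
  by (simp add: lint_diff)
 ultimately show ?thesis by (simp add: LIMSEQ_const_iff)
qed

lemma integrable_mult_cpt:
 fixes u v :: "plane => real"
 assumes "continuous_on K u" "continuous_on K v" "compact K" "!!x. x ~: K ==> v x = 0"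
 shows "integ (%x. u x * v x)"
proof -
 have "set_integrable lborel K (%x. u x * v x)"
  using assms unfolding set_integrable_def
  by (intro borel_integrable_compact) (auto intro: continuous_intros)
 moreover have "(%x. indicat_real K x *R (u x * v x)) = (%x. u x * v x)"
  using assms(4) by (force simp: indicator_def)
 ultimately show ?thesis by (simp add: set_integrable_def)
qed

lemma by_parts:
 assumes "open D" "Ck_on 1 D u" "C1c K v" "K <= D"
 shows "integ (%x. u x * pd i v x)"
  and "integ (%x. pd i u x * v x)"
  and "(LI x. u x * pd i v x) = - (LI x. pd i u x * v x)"
proof -
 note v = C1cD[OF assms(3)]
 have cu: "continuous_on K u" "continuous_on K (pd i u)"
  using Ck_on_imp_continuous_on[OF assms(2)] assms(2,4) by (auto intro: continuous_on_subset)
 show i: "integ (%x. u x * pd i v x)" "integ (%x. pd i u x * v x)"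
  using cu v by (auto intro!: integrable_mult_cpt)
 note m = C1c_mult[OF assms]
 have "u x * pd i v x + pd i u x * v x = pd i (%x. u x * v x) x" for x
 proof (cases "x : D")
  case False
  then have "x ~: K" using assms(4) by auto
  then show ?thesis using v C1cD(6)[OF m(1)] by simp
 qed (use m(2) in auto)
 then have "(LI x. u x * pd i v x + pd i u x * v x) = 0"
  using integral_partial_zero[OF m(1)] by simp
 then show "(LI x. u x * pd i v x) = - (LI x. pd i u x * v x)"
  using i by simp
qed

section \<open>Mollification\<close>

definition bump0 :: "nat => plane => real" where
 "bump0 n x = flat_exp 0 ((1 / real (Suc n))^2 - x \<bullet> x)"

definition moll :: "nat => plane => real" where
 "moll n x = bump0 n x / (LI y. bump0 n y)"

definition cv :: "(plane => real) => (plane => real) => plane => real" where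
 "cv f kap x = (LI y. f y * kap (x - y))"

abbreviation mcv :: "nat => (plane => real) => plane => real" where
 "mcv n f \<equiv> cv f (moll n)"

lemma bump0_nonneg: "bump0 n x >= 0"
 by (simp add: bump0_def flat_exp_def)

lemma bump0_zero: "norm x >= 1 / real (Suc n) ==> bump0 n x = 0"
proof -
 assume "norm x >= 1 / real (Suc n)"
 then have "(norm x)^2 >= (1 / real (Suc n))^2" by (intro power_mono) auto
 then show ?thesis by (simp add: bump0_def flat_exp_def power2_norm_eq_inner)
qed

lemma bump0_pos: "norm x < 1 / real (Suc n) ==> bump0 n x > 0"
proof -
 assume "norm x < 1 / real (Suc n)"
 then have "(norm x)^2 < (1 / real (Suc n))^2" by (intro power_strict_mono) auto
 then show ?thesis by (simp add: bump0_def flat_exp_def power2_norm_eq_inner)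
qed

lemma smooth_bump0: "smooth (bump0 n)"
 unfolding bump0_def by (rule smooth_flat_bump)

lemma integrable_bump0: "integ (bump0 n)"
 using bump0_zero[of n]
 by (intro continuous_cpt_integrable[of _ "cball 0 (1 / real (Suc n))"] smooth_continuous smooth_bump0)
  auto

lemma integral_bump0_pos: "(LI y. bump0 n y) > 0"
proof -
 have "(LI y. bump0 n y) ~= 0"
 proof
  assume "(LI y. bump0 n y) = 0"
  then have "AEL y. bump0 n y = 0"
   using integral_nonneg_eq_0_iff_AE[OF integrable_bump0[of n]] by (simp add: bump0_nonneg)
  then have "AEL y::plane. y ~: ball 0 (1 / real (Suc n))"
  proof (rule eventually_mono)
   fix y assume "bump0 n y = 0"
   then show "y ~: ball 0 (1 / real (Suc n))" using bump0_pos[of y n] by auto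
  qed
  then have "emeasure lborel (ball (0::plane) (1 / real (Suc n))) = 0"
   by (subst (asm) AE_iff_measurable[of "ball 0 (1 / real (Suc n))"]) auto
  then have "ball (0::plane) (1 / real (Suc n)) : null_sets lborel" by auto
  then show False
   using open_not_negligible[of "ball (0::plane) (1 / real (Suc n))"]
   by (auto simp: negligible_iff_null_sets null_sets_completionI)
 qed
 moreover have "(LI y. bump0 n y) >= 0" by (simp add: bump0_nonneg)
 ultimately show ?thesis by simp
qed

lemma moll_nonneg: "moll n x >= 0"
 using integral_bump0_pos[of n] by (simp add: moll_def bump0_nonneg)

lemma moll_zero: "norm x >= 1 / real (Suc n) ==> moll n x = 0"
 by (simp add: moll_def bump0_zero)

lemma moll_sym: "moll n (x - y) = moll n (y - x)"
proof -
 have "(x - y) \<bullet> (x - y) = (y - x) \<bullet> (y - x)" by (simp add: algebra_simps inner_commute)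
 then show ?thesis unfolding moll_def bump0_def by simp
qed

lemma smooth_moll: "smooth (moll n)"
proof -
 have "moll n = (%x. (1 / (LI y. bump0 n y)) * bump0 n x)" by (auto simp: moll_def)
 then show ?thesis using smooth_cmult[OF smooth_bump0] by metis
qed

lemma integrable_moll: "integ (moll n)"
 using integrable_bump0 by (simp add: moll_def[abs_def])

lemma integral_moll: "(LI x. moll n x) = 1"
 using integral_bump0_pos[of n] by (simp add: moll_def[abs_def])

lemma C1c_moll: "C1c (cball 0 1) (moll n)"
proof (rule smooth_C1c[OF smooth_moll])
 fix x :: plane assume "x ~: cball 0 1"
 moreover have "1 / real (Suc n) <= 1" by simp
 ultimately have "1 / real (Suc n) <= norm x" by (simp only: mem_cball_0 not_le)
 then show "moll n x = 0" by (rule moll_zero)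
qed simp

lemma continuous_moll [continuous_intros]: "continuous_on S (moll n)"
 by (rule smooth_continuous[OF smooth_moll])

lemma measurable_moll [measurable]: "moll n : BM"
 by (intro borel_measurable_continuous_onI continuous_moll)

lemma nn_integral_moll_shift: "(NI x. ennreal (moll n (x - y))) = 1"
 "(NI x. ennreal (moll n (y - x))) = 1"
proof -
 have "(NI x. ennreal (moll n x)) = 1"
  using nn_integral_eq_integral[OF integrable_moll[of n]] integral_moll[of n]
  by (simp add: moll_nonneg)
 then show "(NI x. ennreal (moll n (x - y))) = 1"
  using nn_integral_translate[of "%x. ennreal (moll n x)" "-y"] by simp
 then show "(NI x. ennreal (moll n (y - x))) = 1"
  using moll_sym by simp
qed

lemma integrable_moll_shift: "integ (%y. moll n (x - y))"
 and integral_moll_shift: "(LI y. moll n (x - y)) = 1"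
 using lborel_integral_reflect[of "moll n" x] integrable_moll[of n] integral_moll[of n] by auto

lemma integrable_bounded_mult:
 fixes f g :: "'a => real"
 assumes "integrable M f" "g : borel_measurable M" "!!x. x : space M ==> abs (g x) <= B"
 shows "integrable M (%x. f x * g x)" "integrable M (%x. g x * f x)"
proof -
 show "integrable M (%x. f x * g x)"
 proof (rule integ_bound[of M "%x. B * f x"])
  show "AE x in M. norm (f x * g x) <= norm (B * f x)"
  proof (intro AE_I2)
   fix x assume "x : space M"
   then have "abs (g x) <= abs B" using assms(3)[of x] by linarith
   then show "norm (f x * g x) <= norm (B * f x)"
   using mult_left_mono[of "abs (g x)" "abs B" "abs (f x)"] by (simp add: abs_mult mult.commute)
  qed
 qed (use assms in auto)
 then show "integrable M (%x. g x * f x)" by (simp add: mult.commute)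
qed

lemma cv_integrand:
 fixes kap :: "plane => real"
 assumes "integ f" "continuous_on UNIV kap" "compact K" "!!x. x ~: K ==> kap x = 0"
 shows "integ (%y. f y * kap (x - y))"
proof -
 obtain B where B: "!!x. abs (kap x) <= B" using continuous_cpt_bounded[OF assms(2-4)] by metis
 have [measurable]: "kap : BM"
  using assms(2) by (rule borel_measurable_continuous_onI)
 show ?thesis by (rule integrable_bounded_mult(1)[where B=B]) (use assms B in auto)
qed

lemma onorm_inner_le: "norm a <= N ==> onorm (%h. a \<bullet> h) <= N" for a :: plane
proof (rule onorm_le)
 fix h assume "norm a <= N"
 have "norm (a \<bullet> h) <= norm a * norm h" using Cauchy_Schwarz_ineq2[of a h] by simp
 also have "... <= N * norm h" by (rule mult_right_mono) (use \<open>norm a <= N\<close> in auto)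
 finally show "norm (a \<bullet> h) <= N * norm h" .
qed

text \<open>Compact support bounds the second partials, hence the gradient is Lipschitz and the
  Taylor remainder is quadratic uniformly in the base point. Uniformity in \<open>z\<close> is what
  allows differentiation under the convolution integral.\<close>

lemma smooth_second_order:
 assumes "smooth kap" "compact K" "!!x. x ~: K ==> kap x = 0"
 obtains M where "M > 0" "!!z h. abs (kap (z + h) - kap z - grad kap z \<bullet> h) <= M * norm h * norm h"
proof -
 have c: "C1c K kap" using assms by (intro smooth_C1c)
 have cp: "C1c K (pd i kap)" for i
  using assms C1cD(6)[OF c] by (intro smooth_C1c smooth_partial) auto
 have "EX B>0. ALL x. abs (pd j (pd i kap) x) <= B" for i j
  using continuous_cpt_bounded[of "pd j (pd i kap)" K] C1cD[OF cp] by metis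
 then have "EX B. ALL i j. B i j > 0 & (ALL x. abs (pd j (pd i kap) x) <= B i j)"
  by (intro choice allI) auto
 then obtain B where B: "!!i j. B i j > 0" "!!i j x. abs (pd j (pd i kap) x) <= B i j"
  by blast
 define N where "N = (SUM i:UNIV. SUM j:UNIV. B i j)"
 have Bij: "B i j <= N" for i j
 proof -
  have "B i j <= (SUM j:UNIV. B i j)" by (rule member_le_sum) (use B(1) in \<open>auto intro: less_imp_le\<close>)
  also have "... <= N" unfolding N_def
   by (rule member_le_sum) (use B(1) in \<open>auto intro: less_imp_le sum_nonneg\<close>)
  finally show ?thesis .
 qed
 have N: "N > 0" using Bij[of 1 1] B(1)[of 1 1] by linarith
 have gl: "norm (grad (pd i kap) x) <= 2 * N" for i x
 proof -
  have "norm (grad (pd i kap) x) <= (SUM j:UNIV. abs (grad (pd i kap) x $ j))"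
   by (rule norm_le_l1_cart)
  also have "... <= (SUM j:(UNIV::2 set). N)"
   by (intro sum_mono) (use B(2) Bij in \<open>force intro: order_trans\<close>)
  finally show ?thesis by simp
 qed
 have lip: "abs (pd i kap y - pd i kap x) <= 2 * N * norm (y - x)" for i x y
 proof -
  have "norm (pd i kap y - pd i kap x) <= 2 * N * norm (y - x)"
  proof (rule differentiable_bound[of UNIV "pd i kap" "%x h. grad (pd i kap) x \<bullet> h"])
   show "onorm ((\<bullet>) (grad (pd i kap) z)) <= 2 * N" for z
   using gl[of i z] by (rule onorm_inner_le)
  qed (auto intro!: has_derivative_grad smooth_differentiable smooth_partial assms(1))
  then show ?thesis by simp
 qed
 have lip2: "norm (grad kap y - grad kap x) <= 4 * N * norm (y - x)" for x y
 proof -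
  have "norm (grad kap y - grad kap x) <= (SUM i:UNIV. abs ((grad kap y - grad kap x) $ i))"
   by (rule norm_le_l1_cart)
  also have "... <= (SUM i:(UNIV::2 set). 2 * N * norm (y - x))"
   by (intro sum_mono) (use lip in simp)
  finally show ?thesis by simp
 qed
 have "abs (kap (z + h) - kap z - grad kap z \<bullet> h) <= 4 * N * norm h * norm h" for z h
 proof -
  let ?S = "cball z (norm h)"
  have "norm ((%y. kap y - grad kap z \<bullet> y) (z + h) - (%y. kap y - grad kap z \<bullet> y) z) <= 4 * N * norm h * norm (z + h - z)"
  proof (rule differentiable_bound[of ?S _ "%y k. grad kap y \<bullet> k - grad kap z \<bullet> k"])
   fix y assume y: "y : ?S"
   have "((%y. kap y - grad kap z \<bullet> y) has_derivative (%k. grad kap y \<bullet> k - grad kap z \<bullet> k)) (at y)"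
   by (intro has_derivative_diff has_derivative_grad smooth_differentiable assms(1)
   has_derivative_inner_right has_derivative_ident)
   then show "((%y. kap y - grad kap z \<bullet> y) has_derivative (%k. grad kap y \<bullet> k - grad kap z \<bullet> k)) (at y within ?S)"
   by (rule has_derivative_at_withinI)
   have "norm (grad kap y - grad kap z) <= 4 * N * norm h"
   using lip2[of y z] y N by (auto simp: dist_norm norm_minus_commute intro: order_trans[OF _ mult_left_mono])
   then show "onorm (%k. grad kap y \<bullet> k - grad kap z \<bullet> k) <= 4 * N * norm h"
   unfolding inner_diff_left[symmetric]
   by (rule onorm_inner_le)
  qed (auto simp: dist_norm)
  then show ?thesis by (simp add: inner_add_right algebra_simps)
 qed
 then show ?thesis using that[of "4 * N"] N by simp
qed

text \<open>The uniform Taylor remainder of \<open>kap\<close>, integrated against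
  \<open>abs f\<close>, is quadratic in \<open>h\<close>, so integrability of \<open>f\<close>
  suffices.\<close>

lemma cv_has_derivative:
 assumes f: "integ f" and k: "smooth kap" "compact K" "!!x. x ~: K ==> kap x = 0"
 shows "(cv f kap has_derivative (%h. SUM i:UNIV. cv f (pd i kap) x * h $ i)) (at x)"
proof -
 note c = smooth_C1c[OF k]
 note i0 = cv_integrand[OF f smooth_continuous[OF k(1)] k(2,3)]
 note i1 = cv_integrand[OF f smooth_continuous[OF smooth_partial[OF k(1)]] k(2) C1cD(6)[OF c]]
 obtain M where M: "M > 0" "!!z h. abs (kap (z + h) - kap z - grad kap z \<bullet> h) <= M * norm h * norm h"
  using smooth_second_order[OF k] by metis
 define A where "A = (LI y. abs (f y))"
 have A: "A >= 0" by (simp add: A_def)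
 have key: "abs (cv f kap (x + h) - cv f kap x - (SUM i:UNIV. cv f (pd i kap) x * h $ i)) <= A * M * norm h * norm h" for h
 proof -
  have eq: "f y * kap (x + h - y) - f y * kap (x - y) - (SUM i:UNIV. (f y * pd i kap (x - y)) * h $ i)
   = f y * (kap (x - y + h) - kap (x - y) - grad kap (x - y) \<bullet> h)" for y
   by (simp add: inner_vec_def sum_distrib_left algebra_simps)
  have ints: "integ (%y. f y * kap (x + h - y) - f y * kap (x - y) - (SUM i:UNIV. (f y * pd i kap (x - y)) * h $ i))"
   using i0[of "x + h"] i0[of x] i1[of _ x]
   by (intro integ_diff Bochner_Integration.integrable_sum integrable_mult_left) auto
  have "cv f kap (x + h) - cv f kap x - (SUM i:UNIV. cv f (pd i kap) x * h $ i)
   = (LI y. f y * kap (x + h - y) - f y * kap (x - y) - (SUM i:UNIV. (f y * pd i kap (x - y)) * h $ i))"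
   unfolding cv_def using i0[of "x + h"] i0[of x] i1[of _ x]
   by (subst lint_diff Bochner_Integration.integral_sum;
   (intro integ_diff Bochner_Integration.integrable_sum integrable_mult_left)?; simp)+
  also have "... = (LI y. f y * (kap (x - y + h) - kap (x - y) - grad kap (x - y) \<bullet> h))"
   by (simp only: eq)
  finally have e1: "cv f kap (x + h) - cv f kap x - (SUM i:UNIV. cv f (pd i kap) x * h $ i)
   = (LI y. f y * (kap (x - y + h) - kap (x - y) - grad kap (x - y) \<bullet> h))" .
  have "abs ((LI y. f y * (kap (x - y + h) - kap (x - y) - grad kap (x - y) \<bullet> h)))
   <= (LI y. abs (f y * (kap (x - y + h) - kap (x - y) - grad kap (x - y) \<bullet> h)))"
   by (rule integral_abs_bound)
  also have "... <= (LI y. abs (f y) * (M * norm h * norm h))"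
  proof (rule integral_mono)
   show "integ (%y. abs (f y * (kap (x - y + h) - kap (x - y) - grad kap (x - y) \<bullet> h)))"
   using ints unfolding eq by (rule integrable_abs)
   show "abs (f y * (kap (x - y + h) - kap (x - y) - grad kap (x - y) \<bullet> h)) <= abs (f y) * (M * norm h * norm h)" for y
   using M(2)[of "x - y" h] by (simp only: abs_mult) (rule mult_left_mono, auto)
  qed (use f in auto)
  also have "... = A * M * norm h * norm h" by (simp add: A_def)
  finally show ?thesis unfolding e1 .
 qed
 show ?thesis
  unfolding has_derivative_at_within
 proof (intro conjI)
  show "bounded_linear (%h. SUM i:UNIV. cv f (pd i kap) x * h $ i)"
   by (intro bounded_linear_sum bounded_linear_const_mult bounded_linear_vec_nth)
  show "((%y. (cv f kap y - cv f kap x - (SUM i:UNIV. cv f (pd i kap) x * (y - x) $ i)) /\<^sub>R norm (y - x)) \<longlongrightarrow> 0) (at x)"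
  proof (rule tendsto_0_le[where K=1 and f="%y. A * M * norm (y - x)"])
   show "((%y. A * M * norm (y - x)) \<longlongrightarrow> 0) (at x)"
   by (auto intro!: tendsto_eq_intros)
   have "norm ((cv f kap y - cv f kap x - (SUM i:UNIV. cv f (pd i kap) x * (y - x) $ i)) /\<^sub>R norm (y - x)) <= norm (A * M * norm (y - x)) * 1"
   if "y ~= x" for y
   using key[of "y - x"] A M(1) that by (simp add: abs_mult field_simps)
   then show "\<forall>\<^sub>F y in at x. norm ((cv f kap y - cv f kap x - (SUM i:UNIV. cv f (pd i kap) x * (y - x) $ i)) /\<^sub>R norm (y - x)) <= norm (A * M * norm (y - x)) * 1"
   by (auto simp: eventually_at_filter)
  qed
 qed
qed

lemma
 assumes "integ f" "smooth kap" "compact K" "!!x. x ~: K ==> kap x = 0"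
 shows partial_cv: "pd i (cv f kap) = cv f (pd i kap)"
  and smooth_cv: "smooth (cv f kap)"
proof -
 have *: "cv f kap differentiable (at x) & pd i (cv f kap) x = cv f (pd i kap) x"
  if "smooth kap" "!!x. x ~: K ==> kap x = 0" for kap i x
 proof -
  note d = cv_has_derivative[OF assms(1) that(1) assms(3) that(2)]
  have "(SUM j:UNIV. cv f (pd j kap) x * e i $ j) = cv f (pd i kap) x"
   by (simp add: axis_def if_distrib cong: if_cong)
  then show ?thesis using d partial_eqI[OF d] unfolding differentiable_def by auto
 qed
 then show "pd i (cv f kap) = cv f (pd i kap)" using assms by blast
 show "smooth (cv f kap)"
 proof (rule smooth_coinduct[of "%w. EX kap. w = cv f kap & smooth kap & (ALL x. x ~: K --> kap x = 0)"])
  fix u i assume "EX kap. u = cv f kap & smooth kap & (ALL x. x ~: K --> kap x = 0)"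
  then obtain kap where k: "u = cv f kap" "smooth kap" "!!x. x ~: K ==> kap x = 0" by auto
  have "pd i u = cv f (pd i kap)" using *[OF k(2,3)] k(1) by auto
  then show "EX kap. pd i u = cv f kap & smooth kap & (ALL x. x ~: K --> kap x = 0)"
   using k smooth_partial C1cD(6)[OF smooth_C1c[OF k(2) assms(3) k(3)]] by blast
 qed (use assms * in blast)+
qed

lemma smooth_mcv: "integ f ==> smooth (mcv n f)"
 and partial_mcv: "integ f ==> pd i (mcv n f) = cv f (pd i (moll n))"
 using smooth_cv[OF _ smooth_moll, of f "cball 0 1" n] partial_cv[OF _ smooth_moll, of f "cball 0 1" n]
  C1cD(5)[OF C1c_moll] by auto

lemma cv_measurable [measurable]:
 assumes [measurable]: "f : BM" "kap : BM"
 shows "cv f kap : BM"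
 unfolding cv_def[abs_def] by measurable

lemma mcv_integrand: "integ f ==> integ (%y. f y * moll n (x - y))"
 by (rule cv_integrand[of _ _ "cball 0 1"]) (auto intro: continuous_moll C1cD(5)[OF C1c_moll])

lemma mcv_continuous: "integ f ==> continuous_on S (mcv n f)"
 by (rule smooth_continuous[OF smooth_mcv])

lemma mcv_diff:
 assumes "integ f" "integ g"
 shows "mcv n (%x. f x - g x) x = mcv n f x - mcv n g x"
 using mcv_integrand[OF assms(1), of n x] mcv_integrand[OF assms(2), of n x]
 by (simp add: cv_def left_diff_distrib)

lemma mcv_local:
 assumes "!!y. y : cball x (1 / real (Suc n)) ==> f y = g y"
 shows "mcv n f x = mcv n g x"
 unfolding cv_def
proof (rule lint_cong)
 fix y
 show "f y * moll n (x - y) = g y * moll n (x - y)"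
  using assms[of y] moll_zero[of n "x - y"]
  by (cases "y : cball x (1 / real (Suc n))") (auto simp: dist_norm)
qed simp

lemma mcv_zero:
 assumes "!!y. y : cball x (1 / real (Suc n)) ==> f y = 0"
 shows "mcv n f x = 0"
 using mcv_local[of x n f "%_. 0"] assms by (simp add: cv_def)

lemma mcv_abs_bound:
 assumes "integ f" "AEL y. abs (f y) <= M"
 shows "abs (mcv n f x) <= M"
proof -
 have "abs (mcv n f x) <= (LI y. abs (f y * moll n (x - y)))"
  unfolding cv_def by (rule integral_abs_bound)
 also have "... <= (LI y. M * moll n (x - y))"
  using assms(2)
  by (intro integral_mono_AE integrable_abs mcv_integrand assms(1) integrable_mult_right integrable_moll_shift)
   (auto simp: abs_mult moll_nonneg intro!: mult_right_mono)
 also have "... = M" by (simp add: integral_moll_shift)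
 finally show ?thesis .
qed

text \<open>Jensen's inequality for the probability density \<open>moll n (x - y)\<close>: the
  variance of \<open>f\<close> under it is non-negative.\<close>

lemma mcv_square:
 assumes f: "integ f" "integ (%x. (f x)^2)"
 shows "(mcv n f x)^2 <= mcv n (%x. (f x)^2) x"
proof -
 let ?c = "mcv n f x"
 note i1 = mcv_integrand[OF f(1), of n x] and i2 = mcv_integrand[OF f(2), of n x]
  and i3 = integrable_moll_shift[of n x]
 have "0 <= (LI y. (f y - ?c)^2 * moll n (x - y))"
  by (intro integral_nonneg_AE AE_I2 mult_nonneg_nonneg) (auto simp: moll_nonneg)
 also have "... = (LI y. (f y)^2 * moll n (x - y) - 2 * ?c * (f y * moll n (x - y)) + ?c^2 * moll n (x - y))"
  by (intro lint_cong) (auto simp: power2_eq_square algebra_simps)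
 also have "... = mcv n (%x. (f x)^2) x - 2 * ?c * ?c + ?c^2"
  using i1 i2 i3 by (simp add: integral_moll_shift cv_def)
 finally show ?thesis by (simp add: power2_eq_square)
qed

lemma nn_integral_mcv:
 assumes f: "integ f" and pos: "!!x. f x >= 0"
 shows "(NI x. ennreal (mcv n f x)) = (NI x. ennreal (f x))"
proof -
 have [measurable]: "f : BM" using f by auto
 have "ennreal (mcv n f x) = (NI y. ennreal (f y * moll n (x - y)))" for x
  unfolding cv_def using mcv_integrand[OF f] pos moll_nonneg
  by (intro nn_integral_eq_integral[symmetric]) auto
 then have "(NI x. ennreal (mcv n f x)) = (NI x. (NI y. ennreal (f y * moll n (x - y))))"
  by simp
 also have "... = (NI y. (NI x. ennreal (f y * moll n (x - y))))"
  by (rule lborel_pair.Fubini') simp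
 also have "... = (NI y. ennreal (f y) * (NI x. ennreal (moll n (x - y))))"
  using pos moll_nonneg by (simp add: ennreal_mult nn_integral_cmult)
 finally show ?thesis by (simp add: nn_integral_moll_shift)
qed

lemma nn_integral_mcv_le:
 assumes f: "integ f"
 shows "(NI x. ennreal (abs (mcv n f x))) <= (NI x. ennreal (abs (f x)))"
proof -
 have "abs (mcv n f x) <= mcv n (%x. abs (f x)) x" for x
 proof -
  have "abs (mcv n f x) <= (LI y. abs (f y * moll n (x - y)))"
   unfolding cv_def by (rule integral_abs_bound)
  then show ?thesis by (simp add: cv_def abs_mult moll_nonneg)
 qed
 then have "(NI x. ennreal (abs (mcv n f x))) <= (NI x. ennreal (mcv n (%x. abs (f x)) x))"
  by (intro nn_integral_mono) (simp add: ennreal_leI)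
 also have "... = (NI x. ennreal (abs (f x)))"
  using f by (intro nn_integral_mcv) auto
 finally show ?thesis .
qed

lemma integrable_mcv:
 assumes "integ f"
 shows "integ (mcv n f)"
proof (rule integrableI_bounded)
 show "mcv n f : borel_measurable lborel" using assms by auto
 have "(NI x. ennreal (abs (f x))) < \<infinity>" using assms by (simp add: integrable_iff_bounded)
 then show "(NI x. ennreal (norm (mcv n f x))) < \<infinity>"
  using nn_integral_mcv_le[OF assms, of n] by (simp add: order_le_less_trans)
qed

lemma mcv_cpt:
 fixes f :: "plane => real"
 assumes "!!x. x ~: cball x0 R ==> f x = 0" "x ~: cball x0 (R + 1)"
 shows "mcv n f x = 0"
proof (rule mcv_zero)
 fix y assume "y : cball x (1 / real (Suc n))"
 moreover have "1 / real (Suc n) <= 1" by simp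
 ultimately have "dist x y <= 1" unfolding mem_cball by linarith
 then have "y ~: cball x0 R" using assms(2) dist_triangle[of x0 x y] by (auto simp: dist_commute)
 then show "f y = 0" by (rule assms(1))
qed

lemma mcv_uniform:
 assumes "continuous_on UNIV f" "compact K" "!!x. x ~: K ==> f x = 0" "d > 0"
 shows "\<forall>\<^sub>F n in sequentially. ALL x. abs (mcv n f x - f x) <= d"
proof -
 have i: "integ f" by (rule continuous_cpt_integrable[OF assms(1-3)])
 obtain R where R: "K <= cball 0 R" using compact_imp_bounded[OF assms(2)] by (auto simp: bounded_iff subset_iff)
 have "uniformly_continuous_on (cball 0 (R + 2)) f"
  using assms(1) by (intro compact_uniformly_continuous) (auto intro: continuous_on_subset)
 then obtain r where r: "r > 0" "!!x y. x : cball 0 (R + 2) ==> y : cball 0 (R + 2) ==> dist y x < r ==> dist (f y) (f x) < d"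
  using assms(4) unfolding uniformly_continuous_on_def by metis
 have close: "abs (f y - f x) <= d" if "dist y x < min r 1" for x y
 proof -
  have n: "norm x <= norm y + 1" "norm y <= norm x + 1"
   using that norm_triangle_ineq2[of x y] norm_triangle_ineq2[of y x] by (simp_all add: dist_norm norm_minus_commute)
  show ?thesis
  proof (cases "norm x <= R + 1")
   case True
   then show ?thesis using r(2)[of x y] that n by (simp add: dist_real_def)
  next
   case False
   then have "x ~: K" "y ~: K" using R n by auto
   then show ?thesis using assms(3,4) by simp
  qed
 qed
 have "\<forall>\<^sub>F n in sequentially. 1 / real (Suc n) < min r 1"
  using order_tendstoD(2)[OF lim_1_over_n[THEN LIMSEQ_Suc], of "min r 1"] r(1) by auto
 then show ?thesis
 proof eventually_elim
  fix n assume n: "1 / real (Suc n) < min r 1"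
  show "ALL x. abs (mcv n f x - f x) <= d"
  proof
   fix x
   have "mcv n f x - f x = (LI y. (f y - f x) * moll n (x - y))"
   using mcv_integrand[OF i, of n x] integrable_moll_shift[of n x] integral_moll_shift[of n x]
   by (simp add: cv_def left_diff_distrib)
   also have "abs (...) <= (LI y. abs ((f y - f x) * moll n (x - y)))"
   by (rule integral_abs_bound)
   also have "... <= (LI y. d * moll n (x - y))"
   proof (rule integral_mono)
   show "integ (%y. abs ((f y - f x) * moll n (x - y)))"
   using mcv_integrand[OF i, of n x] integrable_moll_shift[of n x] by (auto simp: left_diff_distrib)
   show "integ (%y. d * moll n (x - y))" using integrable_moll_shift by auto
   show "abs ((f y - f x) * moll n (x - y)) <= d * moll n (x - y)" for y
   proof (cases "norm (x - y) >= 1 / real (Suc n)")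
   case False
   then have "dist y x < min r 1" using n unfolding dist_norm norm_minus_commute[of y x] by linarith
   then show ?thesis using close[of y x] moll_nonneg[of n "x - y"]
   by (simp add: abs_mult mult_right_mono)
   qed (simp add: moll_zero)
   qed
   also have "... = d" by (simp add: integral_moll_shift)
   finally show "abs (mcv n f x - f x) <= d" .
  qed
 qed
qed

section \<open>Convergence of mollified functions in L^1\<close>

lemma ennreal_tendsto_0I:
 fixes X :: "nat => ennreal"
 assumes "!!d::real. d > 0 ==> \<forall>\<^sub>F n in sequentially. X n <= ennreal d"
 shows "X ~~> 0"
proof (rule order_tendstoI)
 fix a :: ennreal assume "0 < a"
 then obtain c where c: "0 < c" "c < a" using dense by auto
 then have "c < top" using top.not_eq_extremum order_less_le_trans[of c a top] by auto
 then obtain r where r: "c = ennreal r" "r > 0" using c by (cases c) (auto simp: ennreal_less_zero_iff)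
 show "\<forall>\<^sub>F n in sequentially. X n < a" using assms[OF r(2)] by (rule eventually_mono) (use c r in \<open>auto intro: le_less_trans\<close>)
qed auto

abbreviation L1conv :: "(plane => real) => bool" where
 "L1conv f \<equiv> (%n. (NI x. ennreal (abs (mcv n f x - f x)))) ~~> 0"

text \<open>Mollification contracts L^1, so the error splits into three parts of size
  \<open>d / 3\<close>, of which the two that involve the limit are controlled before
  \<open>n\<close> is chosen.\<close>

lemma L1conv_limit:
 assumes s: "!!k. integ (s k)" "!!k. L1conv (s k)" and f: "integ f" "AEL x. (%k. s k x) ~~> f x"
  and w: "integ w" "!!k x. abs (s k x) <= w x"
 shows "L1conv f"
proof (rule ennreal_tendsto_0I)
 fix d :: real assume d: "d > 0"
 have [measurable]: "f : BM" "!!k. s k : BM" using f s by auto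
 have "(%k. (LI x. abs (f x - s k x))) ~~> (\<integral>x. 0 \<partial>(lborel::plane measure))"
 proof (rule integral_dominated_convergence[where w="%x. abs (f x) + w x"])
  show "AEL x. (%k. abs (f x - s k x)) ~~> 0" using f(2)
   by (rule eventually_mono) (auto intro!: tendsto_eq_intros)
  show "AEL x. norm (abs (f x - s k x)) <= abs (f x) + w x" for k
   using order_trans[OF abs_triangle_ineq4 add_left_mono[OF w(2)]] by (intro AE_I2) simp
 qed (use f w in auto)
 then have "\<forall>\<^sub>F k in sequentially. (LI x. abs (f x - s k x)) < d / 3" using d by (intro order_tendstoD) auto
 then obtain k where k: "(LI x. abs (f x - s k x)) < d / 3" unfolding eventually_sequentially by auto
 have fs: "(NI x. ennreal (abs (f x - s k x))) <= ennreal (d / 3)"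
  using k f s by (simp add: nn_integral_eq_integral ennreal_leI)
 have "\<forall>\<^sub>F n in sequentially. (NI x. ennreal (abs (mcv n (s k) x - s k x))) < ennreal (d / 3)"
  using s(2)[of k] d by (intro order_tendstoD) auto
 then show "\<forall>\<^sub>F n in sequentially. (NI x. ennreal (abs (mcv n f x - f x))) <= ennreal d"
 proof eventually_elim
  fix n assume n: "(NI x. ennreal (abs (mcv n (s k) x - s k x))) < ennreal (d / 3)"
  have "(NI x. ennreal (abs (mcv n f x - f x)))
   <= (NI x. ennreal (abs (mcv n (%x. f x - s k x) x)) + (ennreal (abs (mcv n (s k) x - s k x)) + ennreal (abs (f x - s k x))))"
   unfolding mcv_diff[OF f(1) s(1)] by (intro nn_integral_mono) (simp add: ennreal_leI flip: ennreal_plus)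
  also have "... = (NI x. ennreal (abs (mcv n (%x. f x - s k x) x))) +
   ((NI x. ennreal (abs (mcv n (s k) x - s k x))) + (NI x. ennreal (abs (f x - s k x))))"
   by (simp add: nn_integral_add)
  also have "... <= ennreal (d / 3) + (ennreal (d / 3) + ennreal (d / 3))"
   using f s by (intro add_mono less_imp_le[OF n] fs order_trans[OF nn_integral_mcv_le fs]) auto
  also have "... = ennreal d" using d by (simp flip: ennreal_plus)
  finally show "(NI x. ennreal (abs (mcv n f x - f x))) <= ennreal d" .
 qed
qed

lemma L1conv_continuous:
 assumes f: "continuous_on UNIV f" "!!x. x ~: cball 0 R ==> f x = 0"
 shows "L1conv f"
proof (rule ennreal_tendsto_0I)
 fix d :: real assume d: "d > 0"
 let ?J = "cball (0::plane) (R + 1)"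
 define \<mu> where "\<mu> = measure lborel ?J + 1"
 have \<mu>: "\<mu> > 0" by (simp add: \<mu>_def add_nonneg_pos)
 have "\<forall>\<^sub>F n in sequentially. ALL x. abs (mcv n f x - f x) <= d / \<mu>"
  by (rule mcv_uniform[OF f(1) compact_cball[of 0 R] f(2)]) (use d \<mu> in auto)
 then show "\<forall>\<^sub>F n in sequentially. (NI x. ennreal (abs (mcv n f x - f x))) <= ennreal d"
 proof eventually_elim
  fix n assume n: "ALL x. abs (mcv n f x - f x) <= d / \<mu>"
  have "(NI x. ennreal (abs (mcv n f x - f x))) <= (NI x. ennreal (d / \<mu>) * ind ?J x)"
   using n mcv_cpt[of 0 R f _ n] f(2) by (intro nn_integral_mono) (auto simp: indicator_def ennreal_leI)
  also have "... = ennreal (d / \<mu>) * ennreal (measure lborel ?J)"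
   using emeasure_bounded_finite[OF bounded_cball, of "0::plane" "R + 1"] by (subst nn_integral_cmult_indicator) (auto simp: emeasure_eq_ennreal_measure)
  also have "... = ennreal (d / \<mu> * measure lborel ?J)" using d \<mu> by (intro ennreal_mult[symmetric]) auto
  also have "... <= ennreal d"
  proof (rule ennreal_leI)
   have "d / \<mu> * measure lborel ?J <= d / \<mu> * \<mu>" using d \<mu> by (intro mult_left_mono) (auto simp: \<mu>_def)
   then show "d / \<mu> * measure lborel ?J <= d" using \<mu> by simp
  qed
  finally show "(NI x. ennreal (abs (mcv n f x - f x))) <= ennreal d" .
 qed
qed

text \<open>Measurable functions are almost everywhere limits of continuous ones; truncating both makes the convergence dominated.\<close>

lemma mcv_L1conv:
 assumes f: "integ f"
 shows "L1conv f"
proof -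
 have [measurable]: "f : BM" using f by auto
 have "f measurable_on UNIV" by (intro lebesgue_measurable_imp_measurable_on_real measurable_completion) auto
 then obtain N g where g: "negligible N" "!!n. continuous_on UNIV (g n)" "!!x. x ~: N ==> (%n. g n x) ~~> f x"
  unfolding measurable_on_def by auto
 \<comment> \<open>Truncation at height \<open>k\<close>, times a cutoff that falls from 1 to 0
   between the radii \<open>k\<close> and \<open>k + 1\<close>. It is continuous in both arguments,
   so it turns the approximants \<open>g n\<close> into continuous functions with compact support
   and a common bound.\<close>
 define c where "c k x t = max (- real k) (min (real k) t) * max 0 (min 1 (real k + 1 - norm x))" for k t and x :: plane
 have cb: "abs (c k x t) <= real k * ind (cball 0 (real k + 1)) x" "abs (c k x t) <= abs t" for k x t
 proof -
  have 1: "abs (max (- real k) (min (real k) t)) <= min (real k) (abs t)" by auto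
  have 2: "abs (max 0 (min 1 (real k + 1 - norm x))) <= ind (cball 0 (real k + 1)) x" by (auto simp: indicator_def)
  have 3: "abs (c k x t) <= min (real k) (abs t) * ind (cball 0 (real k + 1)) x" unfolding c_def abs_mult by (intro mult_mono 1 2) auto
  then show "abs (c k x t) <= real k * ind (cball 0 (real k + 1)) x" "abs (c k x t) <= abs t"
   by (cases "x : cball 0 (real k + 1)"; simp)+
 qed
 have ik: "integ (%x::plane. real k * ind (cball 0 (real k + 1)) x)" for k
  by (intro integrable_mult_right integrable_indicator_cpt) auto
 have ic: "integ (%x. c k x (h x))" if [measurable]: "h : BM" for h k
 proof (rule integ_bound[OF ik[of k]])
  show "AEL x. norm (c k x (h x)) <= norm (real k * indicat_real (cball 0 (real k + 1)) x)"
   using order_trans[OF cb(1) abs_ge_self] by (intro AE_I2) simp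
 qed (simp add: c_def)
 have gm: "g n : BM" for n using g(2) by (rule borel_measurable_continuous_onI)
 have "L1conv (%x. c k x (f x))" for k
 proof (rule L1conv_limit[OF ic[OF gm] _ ic _ ik[of k] cb(1)])
  show "L1conv (%x. c k x (g n x))" for n
   by (rule L1conv_continuous[of _ "real k + 1"]) (auto simp: c_def intro!: continuous_intros g(2))
  have "AE x in lebesgue. (%n. c k x (g n x)) ~~> c k x (f x)"
   by (rule AE_I'[of N]) (use g in \<open>auto simp: negligible_iff_null_sets c_def intro!: tendsto_intros\<close>)
  then show "AEL x. (%n. c k x (g n x)) ~~> c k x (f x)" by (simp add: AE_completion_iff)
 qed measurable
 then show ?thesis
 proof (rule L1conv_limit[OF ic _ f _ integrable_abs[OF f] cb(2), rotated])
  have "(%k. c k x (f x)) ~~> f x" for x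
  proof (rule tendsto_eventually)
   obtain m where m: "abs (f x) + norm x <= real m" using real_arch_simple by blast
   then have "c k x (f x) = f x" if "k >= m" for k
   proof -
   have "abs (f x) <= real k" "norm x <= real k" using m that of_nat_mono[OF that, where 'a=real] abs_ge_zero[of "f x"] norm_ge_zero[of x] by linarith+
   then show ?thesis by (auto simp: c_def)
   qed
   then show "\<forall>\<^sub>F k in sequentially. c k x (f x) = f x" by (rule eventually_sequentiallyI)
  qed
  then show "AEL x. (%k. c k x (f x)) ~~> f x" by simp
 qed measurable
qed

section \<open>Weak derivatives\<close>

definition loc_int :: "plane set => (plane => real) => bool" where
 "loc_int D f \<longleftrightarrow> (ALL K. compact K & K <= D --> integ (%x. ind K x * f x))"

text \<open>Counterpart of \<open>has_weak_partial\<close> with integrals over the whole plane; the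
  test function does the restriction to \<open>D\<close>. The estimates are made in this form, and
  \<open>has_weak_partialI\<close> translates back.\<close>

definition wpd :: "plane set => 2 => (plane => real) => (plane => real) => bool" where
 "wpd D i u v \<longleftrightarrow> loc_int D u & loc_int D v \<and>
  (ALL phi. test_fun D phi --> (LI x. u x * pd i phi x) = - (LI x. v x * phi x))"

lemma loc_intD: "loc_int D f ==> compact K ==> K <= D ==> integ (%x. ind K x * f x)"
 by (simp add: loc_int_def)

lemma loc_int_mult:
 assumes "loc_int D f" "compact K" "K <= D" "phi : BM"
  "!!x. abs (phi x) <= B" "!!x. x ~: K ==> phi x = 0"
 shows "integ (%x. f x * phi x)"
proof -
 have "integ (%x. (ind K x * f x) * phi x)"
  by (rule integrable_bounded_mult(1)[OF loc_intD[OF assms(1-3)], where B=B]) (use assms in auto)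
 moreover have "(ind K x * f x) * phi x = f x * phi x" for x
  using assms(6)[of x] by (cases "x : K") auto
 ultimately show ?thesis by simp
qed

lemma loc_int_mult_cont:
 assumes "loc_int D f" "compact K" "K <= D" "continuous_on UNIV phi" "!!x. x ~: K ==> phi x = 0"
 shows "integ (%x. f x * phi x)"
proof -
 obtain B where "!!x. abs (phi x) <= B" using continuous_cpt_bounded[OF assms(4,2,5)] by metis
 with assms show ?thesis by (intro loc_int_mult) (auto intro: borel_measurable_continuous_onI)
qed

lemma wpd_integrable:
 assumes "wpd D i u v" "C1c K phi" "K <= D"
 shows "integ (%x. u x * phi x)" "integ (%x. u x * pd j phi x)"
  "integ (%x. v x * phi x)" "integ (%x. v x * pd j phi x)"
 using assms C1cD[OF assms(2)] unfolding wpd_def by (auto intro: loc_int_mult_cont)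

lemma loc_int_continuous: "continuous_on D f ==> loc_int D f"
 unfolding loc_int_def
proof (intro allI impI)
 fix K assume "continuous_on D f" "compact K & K <= D"
 then have "integ (%x. ind K x *R f x)"
  by (intro borel_integrable_compact) (auto intro: continuous_on_subset)
 then show "integ (%x. ind K x * f x)" by simp
qed

lemma loc_int_add: "loc_int D f ==> loc_int D g ==> loc_int D (%x. f x + g x)"
 unfolding loc_int_def by (auto simp: distrib_left)

lemma loc_int_mult_C:
 assumes "loc_int D f" "continuous_on D c"
 shows "loc_int D (%x. c x * f x)"
 unfolding loc_int_def
proof (intro allI impI)
 fix K assume K: "compact K & K <= D"
 have cK: "continuous_on K c" using assms(2) K by (auto intro: continuous_on_subset)
 then obtain B where B: "ALL y:c ` K. abs y <= B"
  using compact_imp_bounded[OF compact_continuous_image[OF cK]] K bounded_real by metis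
 have "(%x. ind K x *R c x) : BM"
  using K cK by (intro borel_measurable_continuous_on_indicator) (auto simp: compact_imp_closed)
 then have "integ (%x. (ind K x * f x) * (ind K x * c x))"
  using B by (intro integrable_bounded_mult(1)[OF loc_intD[OF assms(1)], where B="abs B"])
   (use K in \<open>force simp: indicator_def\<close>)+
 moreover have "(indicat_real K x * f x) * (ind K x * c x) = ind K x * (c x * f x)" for x
  by (auto simp: indicator_def)
 ultimately show "integ (%x. ind K x * (c x * f x))" by simp
qed

lemma integral_test_limit:
 assumes u: "loc_int D u" and K: "compact K" "K <= D"
  and f: "!!n. continuous_on UNIV (f n)" "!!n x. n >= N ==> x ~: K ==> f n x = 0"
  and g: "continuous_on UNIV g" "!!x. x ~: K ==> g x = 0"
  and lim: "!!d. d > 0 ==> \<forall>\<^sub>F n in sequentially. ALL x. abs (f n x - g x) <= d"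
 shows "(%n. (LI x. u x * f n x)) ~~> (LI x. u x * g x)"
proof (rule LIMSEQ_I)
 fix r :: real assume r: "r > 0"
 define A where "A = (LI x. abs (ind K x * u x))"
 have A: "A >= 0" by (simp add: A_def)
 have "\<forall>\<^sub>F n in sequentially. n >= N & (ALL x. abs (f n x - g x) <= r / (2 * (A + 1)))"
  using lim[of "r / (2 * (A + 1))"] r A by (intro eventually_conj eventually_ge_at_top) auto
 then obtain N' where N': "!!n. n >= N' ==> n >= N & (ALL x. abs (f n x - g x) <= r / (2 * (A + 1)))"
  by (auto simp: eventually_sequentially)
 have "norm ((LI x. u x * f n x) - (LI x. u x * g x)) < r" if n: "n >= N'" for n
 proof -
  note n' = N'[OF n]
  have i: "integ (%x. u x * f n x)" "integ (%x. u x * g x)"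
   using n' by (auto intro!: loc_int_mult_cont[OF u K] f g)
  have iu: "integ (%x. abs (ind K x * u x))" using loc_intD[OF u K] by auto
  have "(LI x. u x * f n x) - (LI x. u x * g x) = (LI x. u x * f n x - u x * g x)"
   using i by simp
  moreover have "abs ((LI x. u x * f n x - u x * g x)) <= (LI x. abs (u x * f n x - u x * g x))"
   by (rule integral_abs_bound)
  moreover have "... <= (LI x. abs (ind K x * u x) * (r / (2 * (A + 1))))"
  proof (rule integral_mono)
   show "abs (u x * f n x - u x * g x) <= abs (ind K x * u x) * (r / (2 * (A + 1)))" for x
   proof (cases "x : K")
   case True
   have "abs (u x) * abs (f n x - g x) <= abs (u x) * (r / (2 * (A + 1)))"
   using n' by (intro mult_left_mono) auto
   then show ?thesis using True by (simp add: right_diff_distrib[symmetric] abs_mult)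
   qed (use n' f(2)[of n x] g(2)[of x] in simp)
  qed (use i iu in auto)
  moreover have "(LI x. abs (ind K x * u x) * (r / (2 * (A + 1)))) = A * (r / (2 * (A + 1)))"
   by (simp add: A_def)
  moreover have "A * (r / (2 * (A + 1))) < r"
   using A r by (simp add: field_simps) (smt (verit) mult_nonneg_nonneg)
  ultimately show ?thesis unfolding real_norm_def by linarith
 qed
 then show "EX no. ALL n>=no. norm ((LI x. u x * f n x) - (LI x. u x * g x)) < r" by blast
qed

lemma C1c_Ck: "C1c K phi ==> Ck_on 1 UNIV phi"
 using C1cD[of K phi] by simp

lemma C1c_integrable:
 assumes "C1c K phi"
 shows "integ phi" "integ (pd i phi)"
 using C1cD[OF assms] by (auto intro!: continuous_cpt_integrable[of _ K])

lemma moll_shift: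
 shows "C1c (cball x (1 / real (Suc n))) (%y. moll n (x - y))"
  and "pd i (%y. moll n (x - y)) y = - pd i (moll n) (x - y)"
  and "smooth (%y. moll n (x - y))"
proof -
 have d: "((%y. kap (x - y)) has_derivative (%h. - (grad kap (x - y) \<bullet> h))) (at y)"
  if "smooth kap" for kap y
 proof -
  have "((%y. x - y) has_derivative (%h. - h)) (at y)" by (auto intro!: derivative_eq_intros)
  from has_derivative_compose[OF this has_derivative_grad[OF smooth_differentiable[OF that]]]
  show ?thesis by simp
 qed
 show p: "pd i (%y. moll n (x - y)) y = - pd i (moll n) (x - y)" for i y
  using partial_eqI[OF d[OF smooth_moll]] by simp
 show s: "smooth (%y. moll n (x - y))"
 proof (rule smooth_coinduct[of "%w. EX kap. smooth kap & w = (%y. kap (x - y))"])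
  fix u i assume "EX kap. smooth kap & u = (%y. kap (x - y))"
  then obtain kap where k: "smooth kap" "u = (%y. kap (x - y))" by blast
  have "pd i u = (%y. (%z. (-1) * pd i kap z) (x - y))"
   using partial_eqI[OF d[OF k(1)], of i] k(2) by auto
  then show "EX kap. smooth kap & pd i u = (%y. kap (x - y))"
   using smooth_cmult[OF smooth_partial[OF k(1)]] by blast
 next
  fix u y assume "EX kap. smooth kap & u = (%y. kap (x - y))"
  then show "u differentiable (at y)" using d unfolding differentiable_def by blast
 qed (use smooth_moll in blast)
 show "C1c (cball x (1 / real (Suc n))) (%y. moll n (x - y))"
  by (rule smooth_C1c[OF s]) (auto simp: dist_norm intro: moll_zero)
qed

text \<open>The indicator makes \<open>u\<close> integrable on the plane. The reflected mollifier
  centred at \<open>x\<close> is a test function supported in \<open>K\<close>, so the weak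
  derivative can be evaluated on it.\<close>

lemma partial_mcv_local:
 assumes "wpd D i u v" "compact K" "K <= D" "cball x (1 / real (Suc n)) <= K"
 shows "pd i (mcv n (%y. ind K y * u y)) x = mcv n (%y. ind K y * v y) x"
proof -
 let ?phi = "%y. moll n (x - y)"
 note c = C1cD[OF moll_shift(1)[of x n]]
 have "test_fun D ?phi"
  using assms c(5) moll_shift(3) by (intro test_funI[of _ "cball x (1 / real (Suc n))"]) auto
 then have w: "(LI y. u y * pd i ?phi y) = - (LI y. v y * ?phi y)"
  using assms(1) by (auto simp: wpd_def)
 have iu: "integ (%y. ind K y * u y)"
  using assms by (auto simp: wpd_def intro: loc_intD)
 have "pd i (mcv n (%y. ind K y * u y)) x = (LI y. (ind K y * u y) * pd i (moll n) (x - y))"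
  using partial_mcv[OF iu] by (simp add: cv_def)
 also have "... = - (LI y. u y * pd i ?phi y)"
  unfolding Bochner_Integration.integral_minus[symmetric]
 proof (rule lint_cong)
  fix y show "(ind K y * u y) * pd i (moll n) (x - y) = - (u y * pd i ?phi y)"
  proof (cases "y : K")
   case False
   then have "pd i ?phi y = 0" using assms(4) by (intro c(6)) blast
   then show ?thesis using False by simp
  qed (simp add: moll_shift(2))
 qed simp
 also have "... = (LI y. v y * ?phi y)" using w by simp
 also have "... = mcv n (%y. ind K y * v y) x"
  unfolding cv_def
 proof (rule lint_cong)
  fix y show "v y * ?phi y = (ind K y * v y) * ?phi y"
  proof (cases "y : K")
   case False
   then have "?phi y = 0" using assms(4) by (intro c(5)) blast
   then show ?thesis using False by simp
  qed simp
 qed simp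
 finally show ?thesis .
qed

lemma partial_mcv_C1c:
 assumes "C1c K phi"
 shows "pd i (mcv n phi) = mcv n (pd i phi)"
proof
 fix x
 have "pd i (mcv n phi) x = (LI y. phi y * pd i (moll n) (x - y))"
  using partial_mcv[OF C1c_integrable(1)[OF assms]] by (simp add: cv_def)
 also have "... = - (LI y. phi y * pd i (%y. moll n (x - y)) y)"
  by (simp add: moll_shift(2))
 also have "... = (LI y. pd i phi y * moll n (x - y))"
  using by_parts(3)[OF open_UNIV C1c_Ck[OF assms] moll_shift(1)] by simp
 finally show "pd i (mcv n phi) x = mcv n (pd i phi) x" by (simp add: cv_def)
qed

lemma mcv_support:
 assumes "compact K" "!!x. x ~: K ==> f x = 0" "r >= 1 / real (Suc n)" "x ~: (UN y:K. cball y r)"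
 shows "mcv n f x = 0"
proof (rule mcv_zero)
 fix y assume "y : cball x (1 / real (Suc n))"
 then have "x : cball y r" using assms(3) by (auto simp: dist_commute)
 then show "f y = 0" using assms(2,4) by auto
qed

lemma compact_thicken: "compact K ==> compact (UN y:K. cball y r)" for K :: "plane set"
proof -
 assume "compact K"
 have "(UN y:K. cball y r) = {a + c | a c. a : K & c : cball 0 r}"
 proof (intro set_eqI iffI)
  fix x assume "x : (UN y:K. cball y r)"
  then obtain y where "y : K" "dist y x <= r" by auto
  then show "x : {a + c | a c. a : K & c : cball 0 r}"
   by (intro CollectI exI[of _ y] exI[of _ "x - y"]) (auto simp: dist_norm norm_minus_commute)
 next
  fix x assume "x : {a + c | a c. a : K & c : cball 0 r}"
  then obtain a c where "a : K" "norm c <= r" "x = a + c" by auto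
  then show "x : (UN y:K. cball y r)" by (intro UN_I[of a]) (auto simp: dist_norm)
 qed
 then show ?thesis using compact_sums[OF \<open>compact K\<close> compact_cball[of 0 r]] by simp
qed

lemma C1c_approx:
 assumes "open D" "C1c K phi" "K <= D"
 obtains K' N where "compact K'" "K' <= D" "K <= K'" "!!n. n >= N ==> test_fun D (mcv n phi)"
  "!!n. n >= N ==> C1c K' (mcv n phi)"
  "!!d. d > 0 ==> \<forall>\<^sub>F n in sequentially. ALL x. abs (mcv n phi x - phi x) <= d"
  "!!d i. d > 0 ==> \<forall>\<^sub>F n in sequentially. ALL x. abs (pd i (mcv n phi) x - pd i phi x) <= d"
proof -
 note p = C1cD[OF assms(2)]
 obtain r where r: "r > 0" "(UN x:K. cball x r) <= D"
  using compact_subset_open_imp_cball_epsilon_subset[OF p(1) assms(1,3)] by metis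
 let ?K = "UN x:K. cball x r"
 have K: "compact ?K" by (rule compact_thicken[OF p(1)])
 have "\<forall>\<^sub>F n in sequentially. 1 / real (Suc n) < r"
  using order_tendstoD(2)[OF lim_1_over_n[THEN LIMSEQ_Suc]] r(1) by auto
 then obtain N where N: "!!n. n >= N ==> 1 / real (Suc n) < r" by (auto simp: eventually_sequentially)
 have z: "mcv n phi x = 0" if "n >= N" "x ~: ?K" for n x
  using N[OF that(1)] that(2) p by (intro mcv_support[of K phi n r]) auto
 have s: "smooth (mcv n phi)" for n by (rule smooth_mcv[OF C1c_integrable(1)[OF assms(2)]])
 show ?thesis
 proof (rule that[of ?K N])
  show "test_fun D (mcv n phi)" if "n >= N" for n
   using s K r(2) z[OF that] by (rule test_funI)
  show "C1c ?K (mcv n phi)" if "n >= N" for n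
   using s K z[OF that] by (rule smooth_C1c)
  show "\<forall>\<^sub>F n in sequentially. ALL x. abs (mcv n phi x - phi x) <= d" if "d > 0" for d
   using p that by (intro mcv_uniform) auto
  show "\<forall>\<^sub>F n in sequentially. ALL x. abs (pd i (mcv n phi) x - pd i phi x) <= d" if "d > 0" for d i
   unfolding partial_mcv_C1c[OF assms(2)] using p that by (intro mcv_uniform[of _ K]) auto
  show "K <= ?K" using r(1) by force
 qed (use K r in auto)
qed

text \<open>Mollifying \<open>phi\<close> gives test functions with a common compact support that
  converge uniformly together with their partials. The sum over \<open>I\<close> covers both a
  single weak derivative and an equation in divergence form.\<close>

lemma weak_identity_C1c:
 assumes "open D" "loc_int D v" "!!i. loc_int D (u i)" "finite I"
  and t: "!!phi. test_fun D phi ==> (SUM i:I. (LI x. u i x * pd i phi x)) = - (LI x. v x * phi x)"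
  and "C1c K phi" "K <= D"
 shows "(SUM i:I. (LI x. u i x * pd i phi x)) = - (LI x. v x * phi x)"
proof -
 note p = C1cD[OF assms(6)]
 obtain K' N where K': "compact K'" "K' <= D" "K <= K'"
  and tf: "!!n. n >= N ==> test_fun D (mcv n phi)" and c1: "!!n. n >= N ==> C1c K' (mcv n phi)"
  and l: "!!d. d > 0 ==> \<forall>\<^sub>F n in sequentially. ALL x. abs (mcv n phi x - phi x) <= d"
  "!!d i. d > 0 ==> \<forall>\<^sub>F n in sequentially. ALL x. abs (pd i (mcv n phi) x - pd i phi x) <= d"
  by (rule C1c_approx[OF assms(1,6,7)]) blast
 note i = C1c_integrable[OF assms(6)]
 have 1: "(%n. (LI x. u i x * pd i (mcv n phi) x)) ~~> (LI x. u i x * pd i phi x)" for i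
 proof (rule integral_test_limit[OF assms(3) K'(1,2), where N=N])
  show "continuous_on UNIV (pd i (mcv n phi))" for n
   by (intro smooth_continuous smooth_partial smooth_mcv i(1))
  show "pd i phi x = 0" if "x ~: K'" for x using that K'(3) by (intro p(6)) auto
 qed (use C1cD(6)[OF c1] p(3) l(2) in auto)
 have 2: "(%n. (LI x. v x * mcv n phi x)) ~~> (LI x. v x * phi x)"
 proof (rule integral_test_limit[OF assms(2) K'(1,2), where N=N])
  show "continuous_on UNIV (mcv n phi)" for n
   by (intro smooth_continuous smooth_mcv i(1))
  show "phi x = 0" if "x ~: K'" for x using that K'(3) by (intro p(5)) auto
 qed (use C1cD(5)[OF c1] p(4) l(1) in auto)
 have 3: "(%n. SUM i:I. (LI x. u i x * pd i (mcv n phi) x)) ~~> (SUM i:I. (LI x. u i x * pd i phi x))"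
  by (intro tendsto_sum 1)
 have "\<forall>\<^sub>F n in sequentially. - (LI x. v x * mcv n phi x) = (SUM i:I. (LI x. u i x * pd i (mcv n phi) x))"
  using eventually_ge_at_top[of N] by eventually_elim (simp add: t tf)
 from Lim_transform_eventually[OF tendsto_minus[OF 2] this] 3 show ?thesis
  by (rule LIMSEQ_unique[symmetric])
qed

lemma wpd_C1c:
 assumes "open D" "wpd D i u v" "C1c K phi" "K <= D"
 shows "(LI x. u x * pd i phi x) = - (LI x. v x * phi x)"
 using weak_identity_C1c[OF assms(1), of v "%_. u" "{i}" K phi] assms by (simp add: wpd_def)

lemma wpd_mult:
 assumes "open D" "wpd D i u v" "Ck_on 1 D c"
 shows "wpd D i (%x. c x * u x) (%x. c x * v x + pd i c x * u x)"
 unfolding wpd_def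
proof (intro conjI allI impI)
 have cc: "continuous_on D c" "continuous_on D (pd i c)"
  using Ck_on_imp_continuous_on[OF assms(3)] assms(3) by auto
 have uv: "loc_int D u" "loc_int D v" using assms(2) by (auto simp: wpd_def)
 show "loc_int D (%x. c x * u x)" using uv cc by (intro loc_int_mult_C)
 show "loc_int D (%x. c x * v x + pd i c x * u x)" using uv cc by (intro loc_int_mult_C loc_int_add)
 fix phi assume "test_fun D phi"
 then obtain K where K: "compact K" "K <= D" "smooth phi" "C1c K phi" by (rule test_funD)
 note m = C1c_mult[OF assms(1,3) K(4,2)] and p = C1cD[OF K(4)]
 have "(LI x. u x * pd i (%x. c x * phi x) x) = - (LI x. v x * (c x * phi x))"
  by (rule wpd_C1c[OF assms(1,2) m(1) K(2)])
 moreover have "u x * pd i (%x. c x * phi x) x = c x * u x * pd i phi x + pd i c x * u x * phi x" for x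
 proof (cases "x : D")
  case False
  then have "x ~: K" using K(2) by auto
  then show ?thesis using p(5,6) C1cD(6)[OF m(1)] by simp
 next
  case True
  show ?thesis unfolding m(2)[OF True] by (simp add: algebra_simps)
 qed
 moreover have "integ (%x. c x * u x * pd i phi x)" "integ (%x. pd i c x * u x * phi x)"
  "integ (%x. c x * v x * phi x)"
  using p K by (auto intro!: loc_int_mult_cont[of D _ K] loc_int_mult_C uv cc)
 ultimately show "(LI x. c x * u x * pd i phi x) = - (LI x. (c x * v x + pd i c x * u x) * phi x)"
  by (simp add: distrib_right mult.left_commute mult.assoc)
qed

lemma wpd_add:
 assumes "wpd D i u v" "wpd D i u' v'"
 shows "wpd D i (%x. u x + u' x) (%x. v x + v' x)"
 unfolding wpd_def
proof (intro conjI allI impI)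
 show "loc_int D (%x. u x + u' x)" "loc_int D (%x. v x + v' x)"
  using assms by (auto simp: wpd_def loc_int_add)
 fix phi assume t: "test_fun D phi"
 then obtain K where K: "K <= D" "C1c K phi" by (rule test_funD)
 note i = wpd_integrable[OF assms(1) K(2,1)] wpd_integrable[OF assms(2) K(2,1)]
 show "(LI x. (u x + u' x) * pd i phi x) = - (LI x. (v x + v' x) * phi x)"
  using t assms i by (simp add: distrib_right wpd_def)
qed

lemma wpd_Ck:
 assumes "open D" "Ck_on 1 D c"
 shows "wpd D i c (pd i c)"
 unfolding wpd_def
proof (intro conjI allI impI)
 show "loc_int D c" "loc_int D (pd i c)"
  using Ck_on_imp_continuous_on[OF assms(2)] assms(2) by (auto intro: loc_int_continuous)
 fix phi assume t: "test_fun D phi"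
 then obtain K where K: "K <= D" "C1c K phi" by (rule test_funD)
 show "(LI x. c x * pd i phi x) = - (LI x. pd i c x * phi x)"
  using by_parts(3)[OF assms K(2,1)] .
qed

section \<open>Almost everywhere statements about weak derivatives\<close>

lemma AE_open_local:
 fixes D :: "plane set"
 assumes "!!x. x : D ==> EX r>0. AEL y. y : ball x r --> P y"
 shows "AEL y. y : D --> P y"
proof -
 obtain r where r: "!!x. x : D ==> r x > 0 & (AEL y. y : ball x (r x) --> P y)"
  using assms by metis
 obtain F where F: "F <= (%x. ball x (r x)) ` D" "countable F" "\<Union>F = \<Union>((%x. ball x (r x)) ` D)"
  by (rule Lindelof[of "(%x. ball x (r x)) ` D"]) auto
 have "AEL y. ALL B:F. y : B --> P y"
  using F(1,2) r by (subst AE_ball_countable) auto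
 then show ?thesis
 proof (rule eventually_mono)
  fix y assume y: "ALL B:F. y : B --> P y"
  show "y : D --> P y"
  proof
   assume "y : D"
   then have "y : \<Union>F" using F(3) r by force
   then show "P y" using y by auto
  qed
 qed
qed

lemma L1_subseq_AE:
 fixes f :: "nat => plane => real"
 assumes "(%n. (NI x. ennreal (abs (f n x - g x)))) ~~> 0" "!!n. integ (f n)" "integ g"
 obtains r where "strict_mono r" "AEL x. (%n. f (r n) x) ~~> g x"
proof -
 have "ennreal (LI x. norm (f n x - g x)) = (NI x. ennreal (abs (f n x - g x)))" for n
  using assms(2,3) by (subst nn_integral_eq_integral) auto
 then have "(%n. ennreal (LI x. norm (f n x - g x))) ~~> ennreal 0" using assms(1) by simp
 then have "(%n. (LI x. norm (f n x - g x))) ~~> 0"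
  by (subst (asm) tendsto_ennreal_iff) auto
 then obtain r where "strict_mono r" "AEL x. (%n. f (r n) x - g x) ~~> 0"
  using tendsto_L1_AE_subseq[of lborel "%n x. f n x - g x"] assms(2,3) by auto
 moreover from this(2) have "AEL x. (%n. f (r n) x) ~~> g x"
  by (rule eventually_mono) (simp add: LIM_zero_iff)
 ultimately show ?thesis using that by blast
qed

lemma mcv_AE:
 assumes "integ f"
 obtains r where "strict_mono r" "AEL x. (%n. mcv (r n) f x) ~~> f x"
 by (rule L1_subseq_AE[OF mcv_L1conv[OF assms] integrable_mcv[OF assms] assms]) (rule that)

lemma eventually_small: "r > 0 ==> \<forall>\<^sub>F n in sequentially. 1 / real (Suc n) < r"
 using order_tendstoD(2)[OF lim_1_over_n[THEN LIMSEQ_Suc]] by auto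

text \<open>On the reflected mollifiers the hypothesis says that the mollifications of
  \<open>f\<close> vanish near \<open>x\<close>; a subsequence of them converges to \<open>f\<close>
  almost everywhere.\<close>

lemma fundamental_lemma:
 assumes "open D" "loc_int D f" "!!phi. test_fun D phi ==> (LI x. f x * phi x) = 0"
 shows "AEL x. x : D --> f x = 0"
proof (rule AE_open_local)
 fix x assume "x : D"
 then obtain r where r: "r > 0" "cball x r <= D" using assms(1) open_contains_cball by metis
 let ?f = "%y. ind (cball x r) y * f y"
 have f: "integ ?f" using assms(2) r by (intro loc_intD) auto
 obtain s where s: "strict_mono s" "AEL y. (%n. mcv (s n) ?f y) ~~> ?f y" by (rule mcv_AE[OF f])
 have z: "\<forall>\<^sub>F n in sequentially. mcv n ?f y = 0" if y: "y : ball x (r/2)" for y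
 proof (rule eventually_mono[OF eventually_small[of "r/2"]])
  fix n assume elim: "1 / real (Suc n) < r / 2"
  note c = C1cD[OF moll_shift(1)[of y n]]
  have sub: "cball y (1 / real (Suc n)) <= cball x r"
  proof
   fix z assume "z : cball y (1 / real (Suc n))"
   then have "dist y z < r / 2" using elim by (simp del: of_nat_Suc)
   then show "z : cball x r" using y dist_triangle[of x z y] by simp
  qed
  have "test_fun D (%z. moll n (y - z))"
   using sub r c(5) moll_shift(3) by (intro test_funI[of _ "cball y (1 / real (Suc n))"]) auto
  then have "(LI z. f z * moll n (y - z)) = 0" by (rule assms(3))
  moreover have e: "?f z * moll n (y - z) = f z * moll n (y - z)" for z
  proof (cases "z : cball x r")
   case False
   then have "moll n (y - z) = 0" using sub by (intro c(5)) blast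
   then show ?thesis by simp
  qed simp
  ultimately show "mcv n ?f y = 0" unfolding cv_def e by blast
 qed (use r in auto)
 have "AEL y. y : ball x (r/2) --> f y = 0"
  using s(2)
 proof (rule eventually_mono)
  fix y assume l: "(%n. mcv (s n) ?f y) ~~> ?f y"
  show "y : ball x (r/2) --> f y = 0"
  proof
   assume y: "y : ball x (r/2)"
   have "(%n. mcv n ?f y) ~~> 0" using z[OF y] by (rule tendsto_eventually)
   then have "(%n. mcv (s n) ?f y) ~~> 0" using LIMSEQ_subseq_LIMSEQ[OF _ s(1)] by (auto simp: o_def)
   then have "?f y = 0" using l LIMSEQ_unique by blast
   then show "f y = 0" using y r by auto
  qed
 qed
 then show "EX r>0. AEL y. y : ball x r --> f y = 0" using r by (intro exI[of _ "r/2"]) auto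
qed

lemma nn_integral_abs_product_null:
 fixes a b :: "nat => plane => real"
 assumes L: "(%n. (NI x. ennreal (abs (a n x)))) ~~> 0"
  and i: "!!n. integ (a n)" and b: "!!n x. abs (b n x) <= B" "!!n. b n : BM"
 shows "(%n. (LI x. a n x * b n x)) ~~> 0"
proof -
 have B: "B >= 0" using b(1)[of 0 0] by linarith
 have ib: "integ (%x. a n x * b n x)" for n
  by (rule integrable_bounded_mult(1)[OF i, where B=B]) (use b in auto)
 have "(%n. ennreal (LI x. abs (a n x))) ~~> ennreal 0"
  using L i by (simp add: nn_integral_eq_integral)
 then have "(%n. (LI x. abs (a n x))) ~~> 0" by (subst (asm) tendsto_ennreal_iff) auto
 then have "(%n. B * (LI x. abs (a n x))) ~~> B * 0" by (intro tendsto_mult tendsto_const)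
 then have B0: "(%n. B * (LI x. abs (a n x))) ~~> 0" by simp
 show ?thesis
 proof (rule Lim_null_comparison[OF _ B0], intro always_eventually allI)
  fix n
  have "norm (LI x. a n x * b n x) <= (LI x. abs (a n x * b n x))"
   by (simp add: integral_abs_bound)
  also have "... <= (LI x. B * abs (a n x))"
  proof (rule integral_mono)
   show "abs (a n x * b n x) <= B * abs (a n x)" for x
   using mult_left_mono[OF b(1)[of n x], of "abs (a n x)"] by (simp add: abs_mult mult.commute)
  qed (use i ib in auto)
  finally show "norm (LI x. a n x * b n x) <= B * (LI x. abs (a n x))" by simp
 qed
qed

lemma Ck_on_1I:
 assumes "!!x. x : D ==> u differentiable (at x)" "!!i. continuous_on D (pd i u)"
 shows "Ck_on 1 D u"
 using assms by simp

text \<open>The chain rule for H(t) = h arctan(t / h): H is at most 2h in size while H' lies in (0,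
  1] and equals 1 at 0. Such functions isolate the zero set of \<open>w\<close> when h tends to
  0.\<close>

lemma arctan_identity:
 assumes D: "open D" and w: "wpd D i w v" and c: "C1c K phi" "K <= D" and h: "h > 0"
 shows "(LI x. h * arctan (w x / h) * pd i phi x) = - (LI x. (1 / (1 + (w x / h)^2) * v x) * phi x)"
proof -
 note p = C1cD[OF c(1)]
 obtain r where r: "r > 0" "(UN x:K. cball x r) <= D"
  using compact_subset_open_imp_cball_epsilon_subset[OF p(1) D c(2)] by metis
 define J where "J = (UN x:K. cball x r)"
 have J: "compact J" "J <= D" "K <= J" using compact_thicken[OF p(1)] r unfolding J_def by force+
 let ?w = "%x. ind J x * w x" and ?v = "%x. ind J x * v x"
 have i: "integ ?w" "integ ?v"
  using w J by (auto simp: wpd_def intro: loc_intD)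
 have [measurable]: "?w : BM" "?v : BM" using i by auto
 have [measurable]: "phi : BM" "pd i phi : BM"
  using p by (auto intro: borel_measurable_continuous_onI)
 obtain s where s: "strict_mono s" "AEL x. (%n. mcv (s n) ?w x) ~~> ?w x"
  by (rule mcv_AE[OF i(1)])
 obtain B where B: "B > 0" "!!x. abs (phi x) <= B"
  using continuous_cpt_bounded[OF p(4) p(1) p(5)] by metis
 define H where "H t = h * arctan (t / h)" for t
 define H' where "H' t = 1 / (1 + (t / h)^2)" for t
 have dH: "(H has_real_derivative H' t) (at t)" for t
  unfolding H_def[abs_def] H'_def using h
  by (auto intro!: derivative_eq_intros simp: power_divide divide_simps)
 have cH: "continuous_on S H" "continuous_on S H'" for S
  unfolding H_def[abs_def] H'_def[abs_def] using h
  by (auto intro!: continuous_intros simp: add_nonneg_eq_0_iff)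
 have [measurable]: "H : BM" "H' : BM"
  by (auto intro: borel_measurable_continuous_onI cH)
 have H'b: "abs (H' t) <= 1" for t unfolding H'_def by (simp add: divide_simps add_nonneg_nonneg)
 have Hb: "abs (H t) <= h * 2" for t
 proof -
  have "abs (arctan (t / h)) <= 2" using arctan_bounded[of "t / h"] pi_less_4 by linarith
  then show ?thesis unfolding H_def using h by (simp add: abs_mult)
 qed
 have eq: "\<forall>\<^sub>F n in sequentially. (LI x. H (mcv n ?w x) * pd i phi x)
   = - (LI x. H' (mcv n ?w x) * mcv n ?v x * phi x)"
 proof (rule eventually_mono[OF eventually_small[OF r(1)]])
  fix n assume n: "1 / real (Suc n) < r"
  have sm: "smooth (mcv n ?w)" by (rule smooth_mcv[OF i(1)])
  have pc: "pd j (%x. H (mcv n ?w x)) x = H' (mcv n ?w x) * pd j (mcv n ?w) x"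
   "(%x. H (mcv n ?w x)) differentiable (at x)" for j x
   using partial_chain[OF smooth_differentiable[OF sm] dH] by auto
  have "Ck_on 1 UNIV (%x. H (mcv n ?w x))"
  proof (rule Ck_on_1I)
   show "continuous_on UNIV (pd j (%x. H (mcv n ?w x)))" for j
   unfolding pc(1)[abs_def]
   by (intro continuous_intros continuous_on_compose2[OF cH(2)[of UNIV]] smooth_continuous smooth_partial sm) auto
  qed (rule pc)
  from by_parts(3)[OF open_UNIV this c(1), of i]
  have "(LI x. H (mcv n ?w x) * pd i phi x) = - (LI x. H' (mcv n ?w x) * pd i (mcv n ?w) x * phi x)"
   by (simp add: pc(1))
  also have "(LI x. H' (mcv n ?w x) * pd i (mcv n ?w) x * phi x) = (LI x. H' (mcv n ?w x) * mcv n ?v x * phi x)"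
  proof (rule lint_cong)
   fix x show "H' (mcv n ?w x) * pd i (mcv n ?w) x * phi x = H' (mcv n ?w x) * mcv n ?v x * phi x"
   proof (cases "x : K")
   case True
   have "cball x (1 / real (Suc n)) <= cball x r" using n by (intro subset_cball) linarith
   then have "cball x (1 / real (Suc n)) <= J" using True unfolding J_def by blast
   then show ?thesis using partial_mcv_local[OF w J(1,2)] by simp
   qed (simp add: p)
  qed simp
  finally show "(LI x. H (mcv n ?w x) * pd i phi x) = - (LI x. H' (mcv n ?w x) * mcv n ?v x * phi x)" .
 qed
 have ip: "integ (pd i phi)" by (rule C1c_integrable(2)[OF c(1)])
 have L1: "(%n. (LI x. H (mcv (s n) ?w x) * pd i phi x)) ~~> (LI x. H (?w x) * pd i phi x)"
 proof (rule integral_dominated_convergence[where w="%x. h * 2 * abs (pd i phi x)"])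
  show "AEL x. (%n. H (mcv (s n) ?w x) * pd i phi x) ~~> H (?w x) * pd i phi x"
   using s(2)
  proof (rule eventually_mono)
   fix x assume "(%n. mcv (s n) ?w x) ~~> ?w x"
   then show "(%n. H (mcv (s n) ?w x) * pd i phi x) ~~> H (?w x) * pd i phi x"
   by (intro tendsto_mult tendsto_const continuous_on_tendsto_compose[OF cH(1)[of UNIV]]) auto
  qed
  show "AEL x. norm (H (mcv (s n) ?w x) * pd i phi x) <= h * 2 * abs (pd i phi x)" for n
   using Hb by (intro AE_I2) (auto simp: abs_mult intro!: mult_right_mono)
 qed (use ip in auto)
 have ivp: "integ (%x. ?v x * phi x)"
  by (rule integrable_bounded_mult(1)[OF i(2), where B=B]) (use B in auto)
 have L2: "(%n. (LI x. H' (mcv (s n) ?w x) * (?v x * phi x))) ~~> (LI x. H' (?w x) * (?v x * phi x))"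
 proof (rule integral_dominated_convergence[where w="%x. abs (?v x * phi x)"])
  show "AEL x. (%n. H' (mcv (s n) ?w x) * (?v x * phi x)) ~~> H' (?w x) * (?v x * phi x)"
   using s(2)
  proof (rule eventually_mono)
   fix x assume "(%n. mcv (s n) ?w x) ~~> ?w x"
   then show "(%n. H' (mcv (s n) ?w x) * (?v x * phi x)) ~~> H' (?w x) * (?v x * phi x)"
   by (intro tendsto_mult tendsto_const continuous_on_tendsto_compose[OF cH(2)[of UNIV]]) auto
  qed
  show "AEL x. norm (H' (mcv (s n) ?w x) * (?v x * phi x)) <= abs (?v x * phi x)" for n
   using mult_right_mono[OF H'b] by (intro AE_I2) (force simp: abs_mult)
 qed (use ivp in auto)
 have "(%n. (NI x. ennreal (abs (mcv (s n) ?v x - ?v x)))) ~~> 0"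
  using LIMSEQ_subseq_LIMSEQ[OF mcv_L1conv[OF i(2)] s(1)] by (simp add: o_def)
 then have L3: "(%n. (LI x. (mcv (s n) ?v x - ?v x) * (H' (mcv (s n) ?w x) * phi x))) ~~> 0"
 proof (rule nn_integral_abs_product_null)
  show "abs (H' (mcv (s n) ?w x) * phi x) <= B" for n x
   using mult_mono[OF H'b B(2)] B(1) by (simp add: abs_mult)
 qed (use i integrable_mcv[OF i(2)] in auto)
 \<comment> \<open>The weights H'(w_n) converge only almost everywhere and the gradients only in
   L^1, so the product is split: a converging bounded weight against the fixed gradient, and a
   bounded weight against the L^1 error.\<close>
 have split: "(LI x. H' (mcv n ?w x) * mcv n ?v x * phi x) =
   (LI x. H' (mcv n ?w x) * (?v x * phi x)) + (LI x. (mcv n ?v x - ?v x) * (H' (mcv n ?w x) * phi x))" for n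
 proof (subst lint_add[symmetric])
  show "integ (%x. H' (mcv n ?w x) * (?v x * phi x))"
   by (rule integrable_bounded_mult(2)[OF ivp, where B=1]) (use H'b in auto)
  show "integ (%x. (mcv n ?v x - ?v x) * (H' (mcv n ?w x) * phi x))"
  proof (rule integrable_bounded_mult(1)[where B=B])
   show "abs (H' (mcv n ?w x) * phi x) <= B" for x
   using mult_mono[OF H'b B(2)] B(1) by (simp add: abs_mult)
  qed (use i integrable_mcv[OF i(2)] in auto)
 qed (auto intro!: lint_cong simp: algebra_simps)
 have "(%n. - (LI x. H' (mcv (s n) ?w x) * mcv (s n) ?v x * phi x)) ~~> - ((LI x. H' (?w x) * (?v x * phi x)) + 0)"
  unfolding split by (intro tendsto_minus tendsto_add L2 L3)
 moreover have "\<forall>\<^sub>F n in sequentially. - (LI x. H' (mcv (s n) ?w x) * mcv (s n) ?v x * phi x) = (LI x. H (mcv (s n) ?w x) * pd i phi x)"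
  using eventually_subseq[OF s(1) eq] by (rule eventually_mono) simp
 ultimately have "(%n. (LI x. H (mcv (s n) ?w x) * pd i phi x)) ~~> - ((LI x. H' (?w x) * (?v x * phi x)) + 0)"
  by (rule Lim_transform_eventually)
 from LIMSEQ_unique[OF L1 this] have "(LI x. H (?w x) * pd i phi x) = - (LI x. H' (?w x) * (?v x * phi x))"
  by simp
 moreover have "H (?w x) * pd i phi x = H (w x) * pd i phi x" for x
  using p(6)[of x i] J(3) by (cases "x : J") auto
 moreover have "H' (?w x) * (?v x * phi x) = H' (w x) * v x * phi x" for x
  using p(5)[of x] J(3) by (cases "x : J") auto
 ultimately show ?thesis by (simp only: H_def H'_def)
qed

text \<open>In \<open>arctan_identity\<close> the left side is O(h), while 1 / (1 + (w/h)^2) tends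
  to the indicator of {w = 0}. Hence \<open>v\<close> times this indicator annihilates all test
  functions.\<close>

lemma wpd_level_set:
 assumes D: "open D" and w: "wpd D i w v"
 shows "AEL x. x : D --> w x = 0 --> v x = 0"
proof -
 let ?z = "%x. (if w x = 0 then 1 else 0) * v x"
 have lv: "loc_int D v" "loc_int D w" using w by (auto simp: wpd_def)
 have lz: "loc_int D ?z"
  unfolding loc_int_def
 proof (intro allI impI)
  fix K assume K: "compact K & K <= D"
  have "(%x. ind K x * w x) : BM"
   using loc_intD[OF lv(2)] K by auto
  then have m: "(%x. if ind K x * w x = 0 then 1 else 0 :: real) : borel_measurable lborel" by measurable
  have "integ (%x. (if ind K x * w x = 0 then 1 else 0) * (ind K x * v x))"
   by (rule integrable_bounded_mult(2)[OF loc_intD[OF lv(1)] m, where B=1]) (use K in auto)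
  moreover have "(if ind K x * w x = 0 then 1 else 0) * (ind K x * v x) = ind K x * ?z x" for x
   by (auto simp: indicator_def)
  ultimately show "integ (%x. ind K x * ?z x)" by (simp only:)
 qed
 have "AEL x. x : D --> ?z x = 0"
 proof (rule fundamental_lemma[OF D lz])
  fix phi assume "test_fun D phi"
  then obtain K where K: "compact K" "K <= D" "smooth phi" "C1c K phi" by (rule test_funD)
  note p = C1cD[OF K(4)]
  have [measurable]: "phi : BM" "pd i phi : BM"
   using p by (auto intro: borel_measurable_continuous_onI)
  have [measurable]: "(%x. ind K x * w x) : BM"
   using loc_intD[OF lv(2) K(1,2)] by auto
  let ?h = "%n. 1 / real (Suc n)"
  have id: "(LI x. ?h n * arctan (w x / ?h n) * pd i phi x) = - (LI x. (1 / (1 + (w x / ?h n)^2) * v x) * phi x)" for n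
   by (rule arctan_identity[OF D w K(4,2)]) simp
  have ip: "integ (pd i phi)" by (rule C1c_integrable(2)[OF K(4)])
  have ivp: "integ (%x. v x * phi x)" by (rule wpd_integrable[OF w K(4,2)])
  have hn: "?h ~~> 0" using lim_1_over_n[THEN LIMSEQ_Suc] .
  have L1: "(%n. (LI x. ?h n * arctan (w x / ?h n) * pd i phi x)) ~~> (LI x. 0 * abs (pd i phi x))"
  proof (rule integral_dominated_convergence[where w="%x. 2 * abs (pd i phi x)"])
   have b: "abs (?h n * arctan (w x / ?h n) * pd i phi x) <= ?h n * (2 * abs (pd i phi x))" for n x
   proof -
   have "abs (arctan (w x / ?h n)) <= 2" using arctan_bounded[of "w x / ?h n"] pi_less_4 by linarith
   then have "?h n * (abs (arctan (w x / ?h n)) * abs (pd i phi x)) <= ?h n * (2 * abs (pd i phi x))"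
   by (intro mult_left_mono mult_right_mono) auto
   then show ?thesis by (simp add: abs_mult mult.assoc del: of_nat_Suc)
   qed
   show "AEL x. norm (?h n * arctan (w x / ?h n) * pd i phi x) <= 2 * abs (pd i phi x)" for n
   proof (intro AE_I2)
   fix x
   have "?h n * (2 * abs (pd i phi x)) <= 1 * (2 * abs (pd i phi x))" by (intro mult_right_mono) auto
   then show "norm (?h n * arctan (w x / ?h n) * pd i phi x) <= 2 * abs (pd i phi x)" using b[of n x] by simp
   qed
   show "AEL x. (%n. ?h n * arctan (w x / ?h n) * pd i phi x) ~~> 0 * abs (pd i phi x)"
   proof (intro AE_I2)
   fix x
   have "(%n. ?h n * (2 * abs (pd i phi x))) ~~> 0 * (2 * abs (pd i phi x))"
   by (intro tendsto_mult hn tendsto_const)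
   then have l: "(%n. ?h n * (2 * abs (pd i phi x))) ~~> 0" by simp
   have "(%n. ?h n * arctan (w x / ?h n) * pd i phi x) ~~> 0"
   by (rule Lim_null_comparison[OF _ l]) (use b in auto)
   then show "(%n. ?h n * arctan (w x / ?h n) * pd i phi x) ~~> 0 * abs (pd i phi x)" by simp
   qed
   show "(%x. ?h n * arctan (w x / ?h n) * pd i phi x) : borel_measurable lborel" for n
   proof -
   have e: "?h n * arctan (w x / ?h n) * pd i phi x = ?h n * arctan ((ind K x * w x) / ?h n) * pd i phi x" for x
   using p(6)[of x i] by (cases "x : K") auto
   have [measurable]: "arctan : BM"
   by (intro borel_measurable_continuous_onI continuous_intros)
   show ?thesis unfolding e by measurable
   qed
  qed (use ip in auto)
  have L2: "(%n. (LI x. (1 / (1 + (w x / ?h n)^2) * v x) * phi x)) ~~> (LI x. ?z x * phi x)"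
  proof (rule integral_dominated_convergence[where w="%x. abs (v x * phi x)"])
   have e: "(1 / (1 + (w x / ?h n)^2) * v x) * phi x = 1 / (1 + ((ind K x * w x) / ?h n)^2) * (v x * phi x)" for n x
   using p(5)[of x] by (cases "x : K") auto
   show "(%x. (1 / (1 + (w x / ?h n)^2) * v x) * phi x) : borel_measurable lborel" for n
   unfolding e using ivp by measurable
   show "(%x. ?z x * phi x) : borel_measurable lborel"
   using loc_int_mult_cont[OF lz K(1,2) p(4,5)] by auto
   show "AEL x. norm ((1 / (1 + (w x / ?h n)^2) * v x) * phi x) <= abs (v x * phi x)" for n
   proof (intro AE_I2)
   fix x
   have "0 <= 1 / (1 + (w x / ?h n)^2)" "1 / (1 + (w x / ?h n)^2) <= 1"
   by (auto simp: divide_le_eq add_pos_nonneg simp del: of_nat_Suc)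
   then have "abs (1 / (1 + (w x / ?h n)^2)) * abs (v x * phi x) <= 1 * abs (v x * phi x)"
   by (intro mult_right_mono) auto
   then show "norm ((1 / (1 + (w x / ?h n)^2) * v x) * phi x) <= abs (v x * phi x)"
   by (simp only: real_norm_def abs_mult[symmetric] mult.assoc)
   qed
   show "AEL x. (%n. (1 / (1 + (w x / ?h n)^2) * v x) * phi x) ~~> ?z x * phi x"
   proof (intro AE_I2 tendsto_mult tendsto_const)
   fix x
   show "(%n. 1 / (1 + (w x / ?h n)^2)) ~~> (if w x = 0 then 1 else 0)"
   proof (cases "w x = 0")
   case False
   have "filterlim (%n. abs (w x) * real (Suc n)) at_top sequentially"
   using False filterlim_compose[OF filterlim_real_sequentially filterlim_Suc]
   by (intro filterlim_tendsto_pos_mult_at_top[OF tendsto_const]) auto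
   then have "filterlim (%n. (abs (w x) * real (Suc n))^2) at_top sequentially"
   by (intro filterlim_pow_at_top) auto
   then have "filterlim (%n. 1 + (abs (w x) * real (Suc n))^2) at_top sequentially"
   by (rule filterlim_tendsto_add_at_top[OF tendsto_const])
   then have "(%n. inverse (1 + (abs (w x) * real (Suc n))^2)) ~~> 0"
   by (rule tendsto_inverse_0_at_top)
   then show ?thesis using False by (simp add: inverse_eq_divide power_mult_distrib)
   qed simp
   qed
  qed (use ivp in auto)
  have "(%n. - (LI x. (1 / (1 + (w x / ?h n)^2) * v x) * phi x)) ~~> 0"
   using L1 unfolding id by simp
  from LIMSEQ_unique[OF tendsto_minus[OF L2] this] show "(LI x. ?z x * phi x) = 0" by simp
 qed
 then show ?thesis by (rule eventually_mono) auto
qed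

section \<open>From \<open>lebesgue_on D\<close> to Borel functions on the plane\<close>

lemma borel_version:
 fixes f :: "plane => real"
 assumes "f : BL D" "D : sets borel"
 obtains g where "g : BM" "AEL x. x : D --> f x = g x" "!!x. x ~: D ==> g x = 0"
proof -
 have "(%x. ind D x * f x) : borel_measurable lebesgue"
  using assms borel_measurable_restrict_space_iff[of D lebesgue f] by (simp add: sets_completionI_sets)
 then obtain g where g: "g : borel_measurable lborel" "AEL x. ind D x * f x = g x"
  using completion_ex_borel_measurable_real by blast
 show ?thesis
 proof (rule that[of "%x. ind D x * g x"])
  show "AEL x. x : D --> f x = ind D x * g x"
   using g(2) by (rule eventually_mono) (auto simp: indicator_def)
 qed (use g assms(2) in auto)
qed

lemma integral_lebesgue_on:
 fixes f :: "plane => real"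
 assumes "D : sets borel" "g : BM" "AEL x. x : D --> f x = g x"
  "f : BL D"
 shows "(\<integral>x. f x \<partial>lebesgue_on D) = (LI x. ind D x * g x)"
  and "integrable (lebesgue_on D) f \<longleftrightarrow> integ (%x. ind D x * g x)"
proof -
 have m: "(%x. ind D x * f x) : borel_measurable lebesgue"
  using assms borel_measurable_restrict_space_iff[of D lebesgue f] by (simp add: sets_completionI_sets)
 have g: "(%x. ind D x * g x) : BM" using assms by measurable
 then have gl: "(%x. ind D x * g x) : borel_measurable lebesgue" by (simp add: measurable_completion)
 have ae: "AE x in lebesgue. ind D x * f x = ind D x * g x"
  using AE_completion[OF assms(3)] by (rule eventually_mono) (auto simp: indicator_def)
 have D: "D Int space lebesgue : sets lebesgue" using assms(1) by (simp add: sets_completionI_sets)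
 have "(\<integral>x. f x \<partial>lebesgue_on D) = (\<integral>x. ind D x * f x \<partial>lebesgue)"
  using integral_restrict_space[OF D, of f] by simp
 also have "... = (\<integral>x. ind D x * g x \<partial>lebesgue)" by (rule integral_cong_AE[OF m gl ae])
 also have "... = (LI x. ind D x * g x)" using g by (intro integral_completion) simp
 finally show "(\<integral>x. f x \<partial>lebesgue_on D) = (LI x. ind D x * g x)" .
 have "integrable (lebesgue_on D) f \<longleftrightarrow> integrable lebesgue (%x. ind D x * f x)"
  using integrable_restrict_space[OF D, of f] by simp
 also have "... \<longleftrightarrow> integrable lebesgue (%x. ind D x * g x)" by (rule integrable_cong_AE[OF m gl ae])
 also have "... \<longleftrightarrow> integ (%x. ind D x * g x)" using g by (intro integrable_completion) simp
 finally show "integrable (lebesgue_on D) f \<longleftrightarrow> integ (%x. ind D x * g x)" .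
qed

lemma nn_integral_lebesgue_on:
 fixes f :: "plane => ennreal"
 assumes "D : sets borel" "g : BM" "AEL x. x : D --> f x = g x"
 shows "(\<integral>\<^sup>+x. f x \<partial>lebesgue_on D) = (NI x. g x * ind D x)"
proof -
 have D: "D Int space lebesgue : sets lebesgue" using assms(1) by (simp add: sets_completionI_sets)
 have "(\<integral>\<^sup>+x. f x \<partial>lebesgue_on D) = (\<integral>\<^sup>+x. f x * ind D x \<partial>lebesgue)"
  by (rule nn_integral_restrict_space[OF D])
 also have "... = (\<integral>\<^sup>+x. g x * ind D x \<partial>lebesgue)"
  by (rule nn_integral_cong_AE) (use AE_completion[OF assms(3)] in eventually_elim, auto simp: indicator_def)
 also have "... = (NI x. g x * ind D x)"
  using assms(1,2) by (intro nn_integral_completion) measurable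
 finally show ?thesis .
qed

section \<open>A discrete Bellman function\<close>

definition llog :: "real => real" where
 "llog g = (1 + g) * ln (1 + g) - g"

text \<open>The Bellman function. The cross term of (1 + g) w^2 is indefinite and
  \<open>24 * llog g\<close> compensates it: \<open>llog_tangent\<close> yields (g - a)^2 / (8 (1 +
  a)), so 24 = 8 * 3 supplies three units of (g - a)^2 / (1 + a), two of which absorb the cross
  term.\<close>

definition bell :: "real => real => real" where
 "bell g w = 24 * llog g + (1 + g) * w^2"

text \<open>The second derivative 1/t is at least 1/4 on (0, 4]. The range ends at 4 because a
  non-negative value is at most four times the mean over the four grid neighbours.\<close>

lemma xlogx_quadratic:
 fixes t :: real
 assumes "0 < t" "t <= 4"
 shows "t * ln t - t + 1 >= (t - 1)^2 / 8"
proof -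
 let ?f = "%t::real. t * ln t - t + 1 - (t - 1)^2 / 8"
 have d: "(?f has_real_derivative (ln t - (t - 1) / 4)) (at t)" if "t > 0" for t
  using that by (auto intro!: derivative_eq_intros simp: field_simps)
 have "?f t >= ?f 1"
 proof (cases "t >= 1")
  case True
  show ?thesis
  proof (rule DERIV_nonneg_imp_nondecreasing[OF True])
   fix s assume s: "1 <= s" "s <= t"
   then have "ln s >= 1 - 1 / s" using ln_le_minus_one[of "1 / s"] by (simp add: ln_div)
   moreover have "1 - 1 / s >= (s - 1) / 4"
   proof -
   have "(s - 1) / 4 <= (s - 1) / s" using s assms(2) by (intro divide_left_mono) auto
   then show ?thesis using s by (simp add: diff_divide_distrib)
   qed
   ultimately show "EX y. (?f has_real_derivative y) (at s) & 0 <= y" using d[of s] s by force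
  qed
 next
  case False
  then have "t <= 1" by simp
  then show ?thesis
  proof (rule DERIV_nonpos_imp_nonincreasing)
   fix s assume s: "t <= s" "s <= 1"
   then have "ln s <= s - 1" using assms by (intro ln_le_minus_one) auto
   moreover have "s - 1 <= (s - 1) / 4" using s by simp
   ultimately show "EX y. (?f has_real_derivative y) (at s) & y <= 0" using d[of s] s assms by force
  qed
 qed
 then show ?thesis by simp
qed

text \<open>Up to the factor \<open>1 + a\<close> this is \<open>xlogx_quadratic\<close> at the
  ratio (1 + g) / (1 + a).\<close>

lemma llog_tangent:
 assumes "0 <= g" "0 <= a" "g <= 4 * a"
 shows "llog g >= llog a + ln (1 + a) * (g - a) + (g - a)^2 / (8 * (1 + a))"
proof -
 let ?t = "(1 + g) / (1 + a)"
 have t: "0 < ?t" "?t <= 4" using assms by (auto simp: divide_le_eq add_pos_nonneg)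
 have l: "ln ?t = ln (1 + g) - ln (1 + a)" using assms by (simp add: ln_div)
 have e: "(1 + a) * ?t = 1 + g" using assms by simp
 have "(1 + a) * ((?t - 1)^2 / 8) <= (1 + a) * (?t * ln ?t - ?t + 1)"
  using xlogx_quadratic[OF t] assms by (intro mult_left_mono) auto
 also have "... = (1 + g) * ln ?t - (g - a)"
  using e by (simp only: distrib_left right_diff_distrib mult.assoc[symmetric]) simp
 also have "... = llog g - llog a - ln (1 + a) * (g - a)"
  unfolding llog_def l by (simp add: algebra_simps)
 finally have "(1 + a) * ((?t - 1)^2 / 8) <= llog g - llog a - ln (1 + a) * (g - a)" .
 moreover have "(1 + a) * ((?t - 1)^2 / 8) = (g - a)^2 / (8 * (1 + a))"
 proof -
  have "?t - 1 = (g - a) / (1 + a)" using assms by (simp add: field_simps)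
  moreover have "k * ((d / k)^2 / 8) = d^2 / (8 * k)" if "k ~= 0" for k d :: real
   using that by (simp add: power2_eq_square)
  ultimately show ?thesis using assms by simp
 qed
 ultimately show ?thesis by linarith
qed

lemma llog_nonneg: "0 <= g ==> 0 <= llog g"
 using llog_tangent[of g 0] xlogx_quadratic[of 1] ln_ge_zero[of "1 + g"]
  ln_le_minus_one[of "1 / (1 + g)"]
 by (simp add: llog_def ln_div field_simps)

lemma llog_le: "0 <= g ==> llog g <= g * ln (1 + g)"
 using ln_add_one_self_le_self[of g] by (simp add: llog_def algebra_simps)

lemma llog_le_square: "0 <= g ==> llog g <= g^2"
 using llog_le[of g] mult_left_mono[OF ln_add_one_self_le_self[of g], of g]
 by (simp add: power2_eq_square)

lemma bell_nonneg: "0 <= g ==> 0 <= bell g w"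
 using llog_nonneg[of g] by (simp add: bell_def)

text \<open>The linear part is the gradient of \<open>bell\<close> at (a, c). Beyond it the only
  term without a sign is x y (c + w) with |c + w| at most 2, which is absorbed by completing a
  square.\<close>

lemma bell_tangent:
 assumes "0 <= g" "0 <= a" "g <= 4 * a" "abs w <= 1" "abs c <= 1"
 shows "bell g w >= bell a c + (24 * ln (1 + a) + c^2) * (g - a) + 2 * (1 + a) * c * (w - c)
  + ((g - a)^2 / (1 + a) + (1 + a) * (w - c)^2 / 2)"
proof -
 define x y k where "x = g - a" and "y = w - c" and "k = 1 + a"
 have k: "k > 0" using assms by (simp add: k_def)
 have 1: "24 * llog g >= 24 * llog a + 24 * ln (1 + a) * x + 3 * (x^2 / k)"
 proof -
  have "llog g >= llog a + ln (1 + a) * x + x^2 / (8 * k)"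
   using llog_tangent[OF assms(1-3)] unfolding x_def k_def .
  moreover have "24 * (x^2 / (8 * k)) = 3 * (x^2 / k)" by simp
  ultimately show ?thesis by linarith
 qed
 have id: "(1 + g) * w^2 = (1 + a) * c^2 + c^2 * x + 2 * k * c * y + k * y^2 + x * y * (c + w)"
  unfolding x_def y_def k_def by (simp add: algebra_simps power2_eq_square)
 have "abs (x * y * (c + w)) <= abs (x * y) * 2"
  unfolding abs_mult[of "x * y"] using assms by (intro mult_left_mono) auto
 moreover have "abs (x * y) * 2 <= k * y^2 / 2 + 2 * (x^2 / k)"
 proof -
  have "0 <= (k * abs y - 2 * abs x)^2 / (2 * k)" using k by simp
  also have "... = k * y^2 / 2 + 2 * (x^2 / k) - abs (x * y) * 2"
   using k by (simp add: power2_eq_square field_simps abs_mult)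
  finally show ?thesis by simp
 qed
 ultimately have "x * y * (c + w) >= - (k * y^2 / 2) - 2 * (x^2 / k)" by linarith
 with 1 id show ?thesis
  unfolding bell_def x_def[symmetric] y_def[symmetric] k_def[symmetric] by (simp add: algebra_simps)
qed

text \<open>Summed over the four neighbours the linear terms of \<open>bell_tangent\<close> cancel,
  since a and c are the means. What remains dominates, by the arithmetic-geometric inequality, the
  product of one difference of \<open>g\<close> and one of \<open>w\<close>.\<close>

lemma bell_average:
 fixes g w :: "2 => bool => real"
 assumes "!!i s. 0 <= g i s" "!!i s. abs (w i s) <= 1"
 defines "a \<equiv> (SUM i:UNIV. g i True + g i False) / 4" and "c \<equiv> (SUM i:UNIV. w i True + w i False) / 4"
 shows "(SUM i:UNIV. bell (g i True) (w i True) + bell (g i False) (w i False)) / 4 - bell a c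
  >= abs (g i True - g i False) * abs (w j True - w j False) / 8"
proof -
 have U: "(SUM i:(UNIV::2 set). F i) = F 1 + F 2" for F :: "2 => real" by (simp add: sum_2)
 have a: "4 * a = g 1 True + g 1 False + g 2 True + g 2 False" by (simp add: a_def U)
 have c: "4 * c = w 1 True + w 1 False + w 2 True + w 2 False" by (simp add: c_def U)
 have a0: "a >= 0" using a assms(1) by (smt (verit))
 have ga: "g k s <= 4 * a" for k s
  using a assms(1)[of 1 True] assms(1)[of 1 False] assms(1)[of 2 True] assms(1)[of 2 False] exhaust_2[of k]
  by (cases s) auto
 have c1: "abs c <= 1" using c assms(2)[of 1 True] assms(2)[of 1 False] assms(2)[of 2 True] assms(2)[of 2 False] by linarith
 define P where "P = 24 * ln (1 + a) + c^2"
 define Q where "Q = 2 * (1 + a) * c"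
 define X where "X k s = (g k s - a)^2" for k s
 define Y where "Y k s = (w k s - c)^2" for k s
 have t: "bell (g k s) (w k s) >= bell a c + P * (g k s - a) + Q * (w k s - c) + (X k s / (1 + a) + (1 + a) * Y k s / 2)" for k s
  unfolding P_def Q_def X_def Y_def using bell_tangent[OF assms(1) a0 ga assms(2) c1] .
 define SX where "SX = X 1 True + X 1 False + X 2 True + X 2 False"
 define SY where "SY = Y 1 True + Y 1 False + Y 2 True + Y 2 False"
 have lin: "P * (g 1 True - a) + P * (g 1 False - a) + P * (g 2 True - a) + P * (g 2 False - a) = 0"
  "Q * (w 1 True - c) + Q * (w 1 False - c) + Q * (w 2 True - c) + Q * (w 2 False - c) = 0"
  unfolding distrib_left[symmetric] using a c by (auto simp: algebra_simps)
 have S: "SX / (1 + a) = X 1 True / (1 + a) + X 1 False / (1 + a) + X 2 True / (1 + a) + X 2 False / (1 + a)"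
  "(1 + a) * SY / 2 = (1 + a) * Y 1 True / 2 + (1 + a) * Y 1 False / 2 + (1 + a) * Y 2 True / 2 + (1 + a) * Y 2 False / 2"
  unfolding SX_def SY_def by (simp_all add: add_divide_distrib distrib_left)
 have "(SUM i:UNIV. bell (g i True) (w i True) + bell (g i False) (w i False)) >= 4 * bell a c + (SX / (1 + a) + (1 + a) * SY / 2)"
  unfolding U using t[of 1 True] t[of 1 False] t[of 2 True] t[of 2 False] lin S by linarith
 moreover have "SX / (1 + a) + (1 + a) * SY / 2 >= abs (g i True - g i False) * abs (w j True - w j False) / 2"
 proof -
  let ?x = "abs (g i True - g i False)" and ?y = "abs (w j True - w j False)"
  have sq: "(p - q)^2 <= 2 * ((p - m)^2 + (q - m)^2)" for p q m :: real
   using zero_le_power2[of "p + q - 2 * m"] by (simp add: power2_eq_square algebra_simps)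
  have Xn: "X k s >= 0" "Y k s >= 0" for k s by (auto simp: X_def Y_def)
  have four: "s <= 2 * (p + q) ==> 0 <= p' ==> 0 <= q' ==> s <= 2 * (p + q + p' + q')"
   "s <= 2 * (p + q) ==> 0 <= p' ==> 0 <= q' ==> s <= 2 * (p' + q' + p + q)" for s p q p' q' :: real
   by simp_all
  have gX: "(g k True - g k False)^2 <= 2 * (X k True + X k False)"
   and wY: "(w k True - w k False)^2 <= 2 * (Y k True + Y k False)" for k
   unfolding X_def Y_def by (rule sq)+
  have "?x^2 <= 2 * SX"
  proof (cases "i = 1")
   case True
   show ?thesis unfolding SX_def power2_abs True by (rule four(1)[OF gX Xn(1) Xn(1)])
  next
   case False
   then have i: "i = 2" using exhaust_2[of i] by auto
   show ?thesis unfolding SX_def power2_abs i by (rule four(2)[OF gX Xn(1) Xn(1)])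
  qed
  moreover have "?y^2 <= 2 * SY"
  proof (cases "j = 1")
   case True
   show ?thesis unfolding SY_def power2_abs True by (rule four(1)[OF wY Xn(2) Xn(2)])
  next
   case False
   then have j: "j = 2" using exhaust_2[of j] by auto
   show ?thesis unfolding SY_def power2_abs j by (rule four(2)[OF wY Xn(2) Xn(2)])
  qed
  ultimately have "SX / (1 + a) + (1 + a) * SY / 2 >= (?x^2 / 2) / (1 + a) + (1 + a) * (?y^2 / 2) / 2"
   using a0 by (intro add_mono divide_right_mono mult_left_mono) auto
  moreover have "(?x^2 / 2) / (1 + a) + (1 + a) * (?y^2 / 2) / 2 - ?x * ?y / 2 >= 0"
  proof -
   have "0 <= ((?x - (1 + a) * ?y / 2)^2 + ((1 + a) * ?y / 2)^2) / (2 * (1 + a))" using a0 by simp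
   also have "... = (?x^2 / 2) / (1 + a) + (1 + a) * (?y^2 / 2) / 2 - ?x * ?y / 2"
   using a0 by (simp add: power2_eq_square divide_simps) (simp add: algebra_simps)
   finally show ?thesis .
  qed
  ultimately show ?thesis by linarith
 qed
 ultimately show ?thesis by linarith
qed

section \<open>Averages and central differences on a grid\<close>

definition avg :: "real => (plane => real) => plane => real" where
 "avg h u x = (SUM i:UNIV. u (x + h *R e i) + u (x - h *R e i)) / 4"

definition dif :: "real => 2 => (plane => real) => plane => real" where
 "dif h i u x = u (x + h *R e i) - u (x - h *R e i)"

text \<open>Integrable bounded functions are closed under products, shifts and differences, so every
  bilinear integral below converges.\<close>

definition nice :: "(plane => real) => bool" where
 "nice u \<longleftrightarrow> integ u & (EX B. ALL x. abs (u x) <= B)"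

lemma nice_integrable [simp]: "nice u ==> integ u"
 by (simp add: nice_def)

lemma nice_measurable [simp]: "nice u ==> u : BM"
 using borel_measurable_integrable[of lborel u] by (simp add: nice_def)

lemma nice_shift: "nice u ==> nice (%x. u (x + a))"
 using lborel_integral_translate(2)[of u a] unfolding nice_def by blast

lemma nice_add: "nice u ==> nice v ==> nice (%x. u x + v x)"
proof -
 assume uv: "nice u" "nice v"
 then obtain B C where b: "!!x. abs (u x) <= B" "!!x. abs (v x) <= C" by (auto simp: nice_def)
 have "abs (u x + v x) <= B + C" for x using b[of x] by linarith
 then show ?thesis using uv by (auto simp: nice_def)
qed

lemma nice_cmult: "nice u ==> nice (%x. c * u x)"
proof -
 assume u: "nice u"
 then obtain B where "!!x. abs (u x) <= B" by (auto simp: nice_def)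
 then have "abs (c * u x) <= abs c * B" for x by (simp add: abs_mult mult_left_mono)
 then show ?thesis using u by (auto simp: nice_def)
qed

lemma nice_diff: "nice u ==> nice v ==> nice (%x. u x - v x)"
 using nice_add[of u "%x. (-1) * v x"] nice_cmult[of v "-1"] by simp

lemma nice_abs: "nice u ==> nice (%x. abs (u x))"
 by (auto simp: nice_def)

lemma nice_mult: "nice u ==> nice v ==> nice (%x. u x * v x)"
proof -
 assume uv: "nice u" "nice v"
 then obtain B C where b: "!!x. abs (u x) <= B" "!!x. abs (v x) <= C" by (auto simp: nice_def)
 have "abs (u x * v x) <= B * C" for x
  unfolding abs_mult using b[of x] by (intro mult_mono) (auto intro: order_trans[OF abs_ge_zero])
 moreover have "integ (%x. u x * v x)"
  using uv b by (intro integrable_bounded_mult(1)[where B=C]) auto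
 ultimately show ?thesis by (auto simp: nice_def)
qed

lemma avg_expand: "avg h u x = (u (x + h *R e 1) + u (x - h *R e 1) + u (x + h *R e 2) + u (x - h *R e 2)) / 4"
 by (simp add: avg_def sum_2)

lemma nice_avg: "nice u ==> nice (avg h u)"
proof -
 assume u: "nice u"
 have "nice (%x. (1/4) * (u (x + h *R e 1) + u (x + (- h *R e 1)) + u (x + h *R e 2) + u (x + (- h *R e 2))))"
  by (intro nice_cmult nice_add nice_shift u)
 moreover have "avg h u = (%x. (1/4) * (u (x + h *R e 1) + u (x + (- h *R e 1)) + u (x + h *R e 2) + u (x + (- h *R e 2))))"
  by (auto simp: avg_expand)
 ultimately show ?thesis by simp
qed

lemma nice_dif: "nice u ==> nice (dif h i u)"
proof -
 assume u: "nice u"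
 have "nice (%x. u (x + h *R e i) - u (x + (- h *R e i)))" by (intro nice_diff nice_shift u)
 then show ?thesis by (simp add: dif_def[abs_def])
qed

lemma integral_shift_mult:
 assumes "nice u" "nice v"
 shows "(LI x. u (x + a) * v x) = (LI x. u x * v (x - a))"
 using lborel_integral_translate(1)[of "%x. u x * v (x - a)" a] by simp

lemma shift_mult_integrable:
 assumes "nice u" "nice v"
 shows "integ (%x. u (x + a) * v (x + c))" "integ (%x. u (x - a) * v (x + c))"
  "integ (%x. u (x + a) * v (x - c))" "integ (%x. u (x - a) * v (x - c))"
  "integ (%x. u (x + a) * v x)" "integ (%x. u (x - a) * v x)"
  "integ (%x. u x * v (x + a))" "integ (%x. u x * v (x - a))"
 using nice_mult[OF nice_shift[OF assms(1), of a] nice_shift[OF assms(2), of c]]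
  nice_mult[OF nice_shift[OF assms(1), of "-a"] nice_shift[OF assms(2), of c]]
  nice_mult[OF nice_shift[OF assms(1), of a] nice_shift[OF assms(2), of "-c"]]
  nice_mult[OF nice_shift[OF assms(1), of "-a"] nice_shift[OF assms(2), of "-c"]]
  nice_mult[OF nice_shift[OF assms(1), of a] assms(2)]
  nice_mult[OF nice_shift[OF assms(1), of "-a"] assms(2)]
  nice_mult[OF assms(1) nice_shift[OF assms(2), of a]]
  nice_mult[OF assms(1) nice_shift[OF assms(2), of "-a"]]
 by auto

lemma avg_self_adjoint:
 assumes "nice u" "nice v"
 shows "(LI x. avg h u x * v x) = (LI x. u x * avg h v x)"
proof -
 note i = shift_mult_integrable[OF assms]
 have s: "(LI x. u (x - a) * v x) = (LI x. u x * v (x + a))" for a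
  using integral_shift_mult[OF assms, of "-a"] by simp
 show ?thesis
  unfolding avg_expand using i
  by (simp add: add_divide_distrib distrib_left distrib_right integral_shift_mult[OF assms] s)
qed

lemma dif_skew:
 assumes "nice u" "nice v"
 shows "(LI x. dif h i u x * v x) = - (LI x. u x * dif h i v x)"
proof -
 note i = shift_mult_integrable[OF assms]
 have s: "(LI x. u (x - a) * v x) = (LI x. u x * v (x + a))" for a
  using integral_shift_mult[OF assms, of "-a"] by simp
 show ?thesis
  unfolding dif_def using i
  by (simp add: left_diff_distrib right_diff_distrib integral_shift_mult[OF assms] s)
qed

lemma integral_avg:
 assumes "nice u"
 shows "(LI x. avg h u x) = (LI x. u x)"
proof -
 have i: "integ (%x. u (x + a))" "integ (%x. u (x - a))" for a
  using nice_shift[OF assms, of a] nice_shift[OF assms, of "-a"] by auto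
 have s: "(LI x. u (x - a)) = (LI x. u x)" for a
  using lborel_integral_translate(1)[of u "-a"] by simp
 show ?thesis unfolding avg_expand using i by (simp add: lborel_integral_translate(1) s)
qed

lemma avg_dif: "avg h (dif h i u) = dif h i (avg h u)"
 by (auto simp: avg_expand dif_def algebra_simps diff_divide_distrib add_divide_distrib)

lemma dif_dif_commute: "dif h i (dif k j u) = dif k j (dif h i u)"
 by (auto simp: dif_def algebra_simps)

lemma nice_avg_pow: "nice u ==> nice ((avg h ^^ n) u)"
 by (induction n) (auto simp: nice_avg)

lemma avg_pow_self_adjoint:
 assumes "nice u" "nice v"
 shows "(LI x. (avg h ^^ n) u x * v x) = (LI x. u x * (avg h ^^ n) v x)"
 using assms
proof (induction n arbitrary: v)
 case (Suc n)
 have "(LI x. (avg h ^^ Suc n) u x * v x) = (LI x. (avg h ^^ n) u x * avg h v x)"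
  using Suc.prems by (simp add: avg_self_adjoint nice_avg_pow)
 also have "... = (LI x. u x * (avg h ^^ n) (avg h v) x)"
  using Suc by (simp add: nice_avg)
 finally show ?case by (simp add: funpow_swap1)
qed simp

lemma avg_pow_dif: "(avg h ^^ n) (dif h i u) = dif h i ((avg h ^^ n) u)"
 by (induction n) (auto simp: avg_dif)

lemma avg_mono_bounds:
 assumes "!!x. lo <= u x" "!!x. u x <= hi"
 shows "lo <= avg h u x" "avg h u x <= hi"
proof -
 note b = assms[of "x + h *R e 1"] assms[of "x - h *R e 1"] assms[of "x + h *R e 2"] assms[of "x - h *R e 2"]
 show "lo <= avg h u x" "avg h u x <= hi" unfolding avg_expand using b by simp_all
qed

lemma avg_abs_le: "(!!x. abs (u x) <= B) ==> abs (avg h u x) <= B"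
 using avg_mono_bounds[of "-B" u B h x] by (auto simp: abs_le_iff minus_le_iff)

lemma avg_pow_abs_le: "(!!x. abs (u x) <= B) ==> abs ((avg h ^^ n) u x) <= B"
 by (induction n arbitrary: x) (auto intro!: avg_abs_le)

lemma avg_pow_nonneg: "(!!x. 0 <= u x) ==> 0 <= (avg h ^^ n) u x"
proof (induction n arbitrary: x)
 case (Suc n)
 then show ?case by (auto simp: avg_expand intro!: add_nonneg_nonneg)
qed simp

lemma bell_avg_pointwise:
 assumes "!!x. 0 <= g x" "!!x. abs (w x) <= 1"
 shows "avg h (%x. bell (g x) (w x)) x - bell (avg h g x) (avg h w x) >= abs (dif h i g x) * abs (dif h j w x) / 8"
 using bell_average[of "%i s. g (if s then x + h *R e i else x - h *R e i)"
   "%i s. w (if s then x + h *R e i else x - h *R e i)" i j] assms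
 by (simp add: avg_def dif_def)

lemma nice_square: "nice u ==> nice (%x. (u x)^2)"
 using nice_mult[of u u] by (simp add: power2_eq_square)

lemma nice_llog:
 assumes "nice g" "!!x. 0 <= g x"
 shows "nice (%x. llog (g x))"
proof -
 have [measurable]: "g : BM" using assms by simp
 obtain B where B: "!!x. abs ((g x)^2) <= B" using nice_square[OF assms(1)] unfolding nice_def by blast
 have b: "abs (llog (g x)) <= (g x)^2" for x using llog_nonneg llog_le_square assms(2) by simp
 have "integ (%x. llog (g x))"
 proof (rule integ_bound[of _ "%x. (g x)^2"])
  show "(%x. llog (g x)) : borel_measurable lborel" unfolding llog_def by measurable
 qed (use nice_square[OF assms(1)] b in auto)
 moreover have "abs (llog (g x)) <= B" for x using b[of x] B[of x] by linarith
 ultimately show ?thesis by (auto simp: nice_def)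
qed

lemma nice_bell:
 assumes "nice g" "!!x. 0 <= g x" "nice w"
 shows "nice (%x. bell (g x) (w x))"
proof -
 have "nice (%x. 24 * llog (g x) + ((w x)^2 + g x * (w x)^2))"
  using assms by (intro nice_add nice_cmult nice_llog nice_square nice_mult)
 then show ?thesis by (simp add: bell_def distrib_right)
qed

text \<open>\<open>avg\<close> preserves integrals, so the pointwise gains of
  \<open>bell_avg_pointwise\<close> telescope. The bound depends neither on the number of steps nor
  on \<open>h\<close>.\<close>

lemma bell_sum:
 assumes "nice g" "!!x. 0 <= g x" "nice w" "!!x. abs (w x) <= 1"
 shows "(\<Sum>n<N. (LI x. abs (dif h i ((avg h ^^ n) g) x) * abs (dif h j ((avg h ^^ n) w) x)))
  <= 8 * (LI x. bell (g x) (w x))"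
proof -
 define G W where "G n = (avg h ^^ n) g" and "W n = (avg h ^^ n) w" for n
 have G: "nice (G n)" "!!x. 0 <= G n x" and W: "nice (W n)" "!!x. abs (W n x) <= 1" for n
  unfolding G_def W_def using assms by (auto intro: nice_avg_pow avg_pow_nonneg avg_pow_abs_le)
 define I where "I n = (LI x. bell (G n x) (W n x))" for n
 have nb: "nice (%x. bell (G n x) (W n x))" for n using G W by (intro nice_bell)
 have step: "(LI x. abs (dif h i (G n) x) * abs (dif h j (W n) x)) <= 8 * (I n - I (Suc n))" for n
 proof -
  have "(LI x. abs (dif h i (G n) x) * abs (dif h j (W n) x))
   <= (LI x. 8 * (avg h (%x. bell (G n x) (W n x)) x - bell (G (Suc n) x) (W (Suc n) x)))"
  proof (rule integral_mono)
   show "integ (%x. abs (dif h i (G n) x) * abs (dif h j (W n) x))"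
   by (intro nice_integrable nice_mult nice_abs nice_dif G W)
   show "integ (%x. 8 * (avg h (%x. bell (G n x) (W n x)) x - bell (G (Suc n) x) (W (Suc n) x)))"
   by (intro nice_integrable nice_cmult nice_diff nice_avg nb)
   show "abs (dif h i (G n) x) * abs (dif h j (W n) x) <= 8 * (avg h (%x. bell (G n x) (W n x)) x - bell (G (Suc n) x) (W (Suc n) x))" for x
   using bell_avg_pointwise[OF G(2)[of n] W(2)[of n], where i=i and j=j and h=h and x=x]
   unfolding G_def W_def by (simp add: field_simps)
  qed
  also have "... = 8 * (I n - I (Suc n))"
   using nice_integrable[OF nice_avg[OF nb[of n]]] nice_integrable[OF nb[of "Suc n"]]
   by (simp add: I_def integral_avg[OF nb])
  finally show ?thesis .
 qed
 have "(\<Sum>n<N. (LI x. abs (dif h i (G n) x) * abs (dif h j (W n) x))) <= (\<Sum>n<N. 8 * (I n - I (Suc n)))"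
  by (intro sum_mono step)
 also have "... = 8 * (I 0 - I N)"
  by (simp only: sum_distrib_left[symmetric] sum_lessThan_telescope')
 also have "... <= 8 * I 0"
  using bell_nonneg G(2) by (auto simp: I_def intro!: integral_nonneg_AE)
 finally show ?thesis by (simp add: G_def W_def I_def)
qed

section \<open>A Calderon-Zygmund estimate for bounded right-hand sides\<close>

lemma central_mvt:
 assumes "!!x. u differentiable (at x)" "t > 0"
 obtains tht where "abs tht <= t" "dif t i u x = 2 * t * pd i u (x + tht *R e i)"
proof -
 have "EX tht. - t < tht & tht < t & u (x + t *R e i) - u (x + (- t) *R e i) = (t - (- t)) * pd i u (x + tht *R e i)"
  by (rule MVT2) (use assms line_deriv in auto)
 then show ?thesis using that unfolding dif_def by force
qed

lemma dif_smooth: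
 assumes "smooth u"
 shows "smooth (dif h i u)" "pd j (dif h i u) = dif h i (pd j u)"
proof -
 have sh: "smooth (%x. u (x + a)) & pd j (%x. u (x + a)) = (%x. pd j u (x + a))" for a
 proof -
  have d: "((%x. v (x + a)) has_derivative (%h. grad v (x + a) \<bullet> h)) (at x)" if "smooth v" for v x
  proof -
   have "((%x. x + a) has_derivative (%h. h)) (at x)" by (auto intro!: derivative_eq_intros)
   from has_derivative_compose[OF this has_derivative_grad[OF smooth_differentiable[OF that]]] show ?thesis .
  qed
  have p: "pd j (%x. v (x + a)) = (%x. pd j v (x + a))" if "smooth v" for v j
   using partial_eqI[OF d[OF that]] by auto
  have "smooth (%x. u (x + a))"
  proof (rule smooth_coinduct[of "%w. EX v. smooth v & w = (%x. v (x + a))"])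
   show "EX v. smooth v & pd i w = (%x. v (x + a))" if "EX v. smooth v & w = (%x. v (x + a))" for w i
   using that p smooth_partial by blast
   show "w differentiable (at x)" if "EX v. smooth v & w = (%x. v (x + a))" for w x
   using that d unfolding differentiable_def by blast
  qed (use assms in blast)
  then show ?thesis using p[OF assms] by simp
 qed
 have eq: "dif h i u = (%x. u (x + h *R e i) - u (x + (- h *R e i)))" by (auto simp: dif_def)
 have "smooth (%x. u (x + h *R e i))" "smooth (%x. u (x + (- h *R e i)))" using sh by blast+
 then show "smooth (dif h i u)" unfolding eq by (rule smooth_diff)
 show "pd j (dif h i u) = dif h i (pd j u)"
  unfolding eq using sh[of "h *R e i"] sh[of "- h *R e i"]
  by (auto simp: partial_diff smooth_differentiable dif_def)
qed

lemma dif_dif_approx: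
 assumes s: "smooth phi" and L: "!!i j k x. abs (pd k (pd j (pd i phi)) x) <= L" and h: "h > 0"
 shows "abs (dif h i (dif h j phi) x / (4 * h^2) - pd j (pd i phi) x) <= 2 * L * h"
proof -
 note s1 = dif_smooth[OF s, where h=h and i=j]
 have sp: "smooth (pd i phi)" by (rule smooth_partial[OF s])
 obtain tht where t: "abs tht <= h" "dif h i (dif h j phi) x = 2 * h * pd i (dif h j phi) (x + tht *R e i)"
  using central_mvt[OF smooth_differentiable[OF s1(1)] h] by metis
 obtain eta where n: "abs eta <= h" "dif h j (pd i phi) (x + tht *R e i) = 2 * h * pd j (pd i phi) (x + tht *R e i + eta *R e j)"
  using central_mvt[OF smooth_differentiable[OF sp] h] by metis
 let ?p = "pd j (pd i phi)"
 have "dif h i (dif h j phi) x / (4 * h^2) = ?p (x + tht *R e i + eta *R e j)"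
  using t(2) n(2) h unfolding s1(2) by (simp add: power2_eq_square)
 moreover have "abs (?p (x + tht *R e i + eta *R e j) - ?p (x + tht *R e i)) <= L * abs eta"
  "abs (?p (x + tht *R e i) - ?p x) <= L * abs tht"
  by (intro lipschitz_line smooth_differentiable smooth_partial s L)+
 moreover have "L * abs eta <= L * h" "L * abs tht <= L * h"
  using t(1) n(1) order_trans[OF abs_ge_zero L[of 1 1 1 0]] by (auto intro: mult_left_mono)
 ultimately show ?thesis by linarith
qed

lemma third_bound:
 assumes "smooth phi" "compact K" "!!x. x ~: K ==> phi x = 0"
 obtains L where "L > 0" "!!i j k x. abs (pd k (pd j (pd i phi)) x) <= L"
proof -
 have z: "u x = 0 ==> True" for u :: "plane => real" and x by simp
 have c1: "C1c K (pd i phi)" for i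
  using assms C1cD(6)[OF smooth_C1c[OF assms]] by (intro smooth_C1c smooth_partial)
 have c2: "C1c K (pd j (pd i phi))" for i j
  using assms C1cD(6)[OF c1] by (intro smooth_C1c smooth_partial)
 have "EX B>0. ALL x. abs (pd k (pd j (pd i phi)) x) <= B" for i j k
  using continuous_cpt_bounded[OF C1cD(3)[OF c2] assms(2) C1cD(6)[OF c2]] by metis
 then have "ALL i j k. EX B>0. ALL x. abs (pd k (pd j (pd i phi)) x) <= B" by blast
 then obtain B where B: "!!i j k. B i j k > 0 & (ALL x. abs (pd k (pd j (pd i phi)) x) <= B i j k)"
  by metis
 define L where "L = Max (range (%(i, j, k). B i j k))"
 have "B i j k <= L" for i j k
  unfolding L_def by (rule Max_ge) (auto intro!: rev_image_eqI[of "(i, j, k)"])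
 then show ?thesis using that[of L] B by (meson order_trans less_le_trans)
qed

lemma vanish_limit:
 fixes a c :: real
 assumes "!!h. h > 0 ==> a <= c * h"
 shows "a <= 0"
proof (rule field_le_epsilon)
 fix d :: real assume d: "d > 0"
 have "a <= c * (d / (abs c + 1))" using d by (intro assms) auto
 also have "... <= (abs c + 1) * (d / (abs c + 1))" using d by (intro mult_right_mono) auto
 finally show "a <= 0 + d" by simp
qed

text \<open>Central differences commute exactly, and one difference quotient approximates both mixed
  derivatives.\<close>

lemma partial_commute:
 assumes "smooth phi" "compact K" "!!x. x ~: K ==> phi x = 0"
 shows "pd j (pd i phi) x = pd i (pd j phi) x"
proof -
 obtain L where L: "L > 0" "!!i j k x. abs (pd k (pd j (pd i phi)) x) <= L"
  using third_bound[OF assms] by metis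
 have "abs (pd j (pd i phi) x - pd i (pd j phi) x) <= (4 * L) * h" if "h > 0" for h
  using dif_dif_approx[OF assms(1) L(2) that, of i j x] dif_dif_approx[OF assms(1) L(2) that, of j i x]
  unfolding dif_dif_commute[of h j h i] by linarith
 from vanish_limit[OF this] show ?thesis by simp
qed

definition lap :: "(plane => real) => plane => real" where
 "lap u x = (SUM i:UNIV. pd i (pd i u) x)"

text \<open>With r = 1 / (1 + a) the assumption reads (1 + a) U = avg U - a V. Iterating it gives
  the Neumann series for the resolvent of the averaging operator, with a remainder of order
  r^N.\<close>

lemma avg_identity:
 assumes "!!x. U x = r * avg h U x - r * a * V x"
 shows "U x = r ^ N * (avg h ^^ N) U x - a * (\<Sum>n<N. r ^ Suc n * (avg h ^^ n) V x)"
proof (induction N arbitrary: x)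
 case (Suc N)
 have "avg h (%x. p * A x - c * B x) = (%x. p * avg h A x - c * avg h B x)" for p c A B
  by (auto simp: avg_expand algebra_simps add_divide_distrib diff_divide_distrib)
 then have "(avg h ^^ N) (%x. p * A x - c * B x) = (%x. p * (avg h ^^ N) A x - c * (avg h ^^ N) B x)" for p c A B
  by (induction N) simp_all
 then have lin: "(avg h ^^ N) (%x. r * avg h U x - r * a * V x) x = r * (avg h ^^ N) (avg h U) x - r * a * (avg h ^^ N) V x" for x
  by simp
 have "(avg h ^^ N) U x = r * (avg h ^^ Suc N) U x - r * a * (avg h ^^ N) V x"
 proof -
  have "(avg h ^^ N) U x = (avg h ^^ N) (%x. r * avg h U x - r * a * V x) x"
   by (rule arg_cong[where f="%u. (avg h ^^ N) u x", OF ext[OF assms]])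
  then show ?thesis unfolding lin by (simp add: funpow_swap1)
 qed
 then have "r ^ N * (avg h ^^ N) U x = r ^ Suc N * (avg h ^^ Suc N) U x - a * (r ^ Suc N * (avg h ^^ N) V x)"
  by (simp only: right_diff_distrib power_Suc) (simp only: mult_ac)
 moreover have "a * (\<Sum>n<Suc N. r ^ Suc n * (avg h ^^ n) V x) = a * (\<Sum>n<N. r ^ Suc n * (avg h ^^ n) V x) + a * (r ^ Suc N * (avg h ^^ N) V x)"
  by (simp only: sum.lessThan_Suc distrib_left)
 ultimately show ?case using Suc.IH[of x] by linarith
qed simp

lemma bell_integral_le:
 assumes "nice g" "!!x. 0 <= g x" "nice w" "!!x. abs (w x) <= 1"
 shows "(LI x. bell (g x) (w x)) <= 24 * (LI x. llog (g x)) + (LI x. g x) + (LI x. (w x)^2)"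
proof -
 note i = nice_integrable[OF nice_llog[OF assms(1,2)]] nice_integrable[OF assms(1)] nice_integrable[OF nice_square[OF assms(3)]]
 have "(LI x. bell (g x) (w x)) <= (LI x. 24 * llog (g x) + g x + (w x)^2)"
 proof (rule integral_mono)
  show "integ (%x. bell (g x) (w x))" by (intro nice_integrable nice_bell assms)
  show "bell (g x) (w x) <= 24 * llog (g x) + g x + (w x)^2" for x
  proof -
   have "(w x)^2 <= 1" using assms(4)[of x] by (simp add: abs_square_le_1)
   then have "g x * (w x)^2 <= g x * 1" using assms(2) by (intro mult_left_mono) auto
   then show ?thesis by (simp add: bell_def algebra_simps)
  qed
 qed (use i in auto)
 then show ?thesis using i by simp
qed

lemma integral_avg_square:
 assumes "nice w"
 shows "(LI x. (avg h w x)^2) <= (LI x. (w x)^2)"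
proof -
 have "((p + q + r + s) / 4)^2 <= (p^2 + q^2 + r^2 + s^2) / 4" for p q r s :: real
 proof -
  have "0 <= (p - q)^2 + (p - r)^2 + (p - s)^2 + (q - r)^2 + (q - s)^2 + (r - s)^2" by simp
  then show ?thesis by (simp add: power2_eq_square field_simps)
 qed
 then have "(avg h w x)^2 <= avg h (%x. (w x)^2) x" for x by (simp add: avg_expand)
 then have "(LI x. (avg h w x)^2) <= (LI x. avg h (%x. (w x)^2) x)"
  by (intro integral_mono nice_integrable nice_square nice_avg assms)
 then show ?thesis using integral_avg[OF nice_square[OF assms]] by simp
qed

text \<open>Here \<open>w\<close> is the discrete form of lap phi - phi on the mesh
  \<open>h\<close>. The zeroth-order term makes the factor r of \<open>avg_identity\<close> smaller
  than 1, so the remainder disappears and phi becomes a series of averages of \<open>w\<close>. Each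
  term of this series, paired with \<open>g\<close>, is bounded by a term of
  \<open>bell_sum\<close>.\<close>

lemma discrete_CZ:
 fixes h :: real
 assumes h: "h > 0" and phi: "nice phi" and g: "nice g" "!!x. 0 <= g x"
 defines "w \<equiv> %x. (avg h phi x - phi x) / (h^2 / 4) - phi x"
 assumes w1: "!!x. abs (w x) <= 1"
 shows "abs ((LI x. dif h i (dif h j phi) x / (4 * h^2) * g x))
  <= 24 * (LI x. llog (g x)) + (LI x. g x) + (LI x. (w x)^2)"
proof -
 define a where "a = h^2 / 4"
 define r where "r = 1 / (1 + a)"
 have a: "a > 0" using h by (simp add: a_def)
 have r: "0 < r" "r < 1" using a by (auto simp: r_def)
 have nw: "nice w"
 proof -
  have "w = (%x. (1 / a) * (avg h phi x - phi x) - phi x)" by (auto simp: w_def a_def)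
  moreover have "nice (%x. (1 / a) * (avg h phi x - phi x) - phi x)" by (intro nice_diff nice_cmult nice_avg phi)
  ultimately show ?thesis by simp
 qed
 have w': "phi x = r * avg h phi x - r * a * w x" for x
 proof -
  have "a * w x = avg h phi x - phi x - a * phi x" using a unfolding w_def a_def[symmetric] by (simp add: field_simps)
  then have "(1 + a) * phi x = avg h phi x - a * w x" by (simp add: algebra_simps)
  then have "r * ((1 + a) * phi x) = r * avg h phi x - r * a * w x" by (simp add: right_diff_distrib mult.assoc)
  moreover have "r * ((1 + a) * phi x) = phi x" using a by (simp add: r_def)
  ultimately show ?thesis by simp
 qed
 define U V where "U = dif h i (dif h j phi)" and "V = dif h i (dif h j w)"
 have UV: "U x = r * avg h U x - r * a * V x" for x
 proof -
  have d: "dif h k A x = r * dif h k B x - r * a * dif h k C x"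
   if "!!x. A x = r * B x - r * a * C x" for k A B C x
   by (simp only: dif_def that) (simp add: algebra_simps)
  show ?thesis unfolding U_def V_def avg_dif by (intro d w')
 qed
 have nU: "nice U" and nV: "nice V" unfolding U_def V_def by (intro nice_dif phi nw)+
 obtain B where B: "!!x. abs (U x) <= B" using nU by (auto simp: nice_def)
 define E where "E = 24 * (LI x. llog (g x)) + (LI x. g x) + (LI x. (w x)^2)"
 define T where "T v m = (LI x. abs (dif h i ((avg h ^^ m) g) x) * abs (dif h j ((avg h ^^ m) v) x))" for v m
 have pair: "abs ((LI x. (avg h ^^ m) (dif h i (dif h j v)) x * (avg h ^^ m) g x)) <= T v m"
  if v: "nice v" for v m
 proof -
  let ?v = "(avg h ^^ m) v" and ?g = "(avg h ^^ m) g"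
  have n: "nice (dif h j ?v)" "nice ?g" by (intro nice_dif nice_avg_pow v g)+
  have "(LI x. (avg h ^^ m) (dif h i (dif h j v)) x * ?g x) = (LI x. dif h i (dif h j ?v) x * ?g x)"
   by (simp add: avg_pow_dif)
  also have "... = - (LI x. dif h j ?v x * dif h i ?g x)" by (rule dif_skew[OF n])
  finally have "abs ((LI x. (avg h ^^ m) (dif h i (dif h j v)) x * ?g x)) = abs ((LI x. dif h j ?v x * dif h i ?g x))"
   by simp
  also have "... <= (LI x. abs (dif h j ?v x * dif h i ?g x))" by (rule integral_abs_bound)
  also have "... = T v m" unfolding T_def by (simp add: abs_mult mult.commute)
  finally show ?thesis .
 qed
 have Tsum: "(\<Sum>m<M. T v m) <= 8 * (LI x. bell (g x) (v x))" if "nice v" "!!x. abs (v x) <= 1" for v M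
  unfolding T_def by (rule bell_sum) (use g that in auto)
 have bw: "(LI x. bell (g x) (w x)) <= E" unfolding E_def by (rule bell_integral_le[OF g nw w1])
 have baw: "(LI x. bell (g x) (avg h w x)) <= E"
  using bell_integral_le[OF g nice_avg[OF nw], of h] avg_abs_le[OF w1] integral_avg_square[OF nw, of h]
  unfolding E_def by simp
 have Tn: "T v m >= 0" for v m unfolding T_def by (intro integral_nonneg_AE AE_I2) auto
 \<comment> \<open>Self-adjointness moves half of the averages onto \<open>g\<close>, and skewness
   (inside \<open>pair\<close>) one of the two differences, so both factors carry the same power of
   \<open>avg\<close>.\<close>
 have term_even: "abs ((LI x. (avg h ^^ (2 * m)) V x * g x)) <= T w m" for m
 proof -
  have "(LI x. (avg h ^^ (2 * m)) V x * g x) = (LI x. (avg h ^^ m) ((avg h ^^ m) V) x * g x)"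
   by (simp add: mult_2 funpow_add)
  also have "... = (LI x. (avg h ^^ m) V x * (avg h ^^ m) g x)"
   by (rule avg_pow_self_adjoint[OF nice_avg_pow[OF nV] g(1)])
  finally show ?thesis using pair[OF nw, of m] by (simp add: V_def)
 qed
 \<comment> \<open>An odd power leaves one average over; it is given to \<open>w\<close>, whose
   bounds it preserves.\<close>
 have term_odd: "abs ((LI x. (avg h ^^ (2 * m + 1)) V x * g x)) <= T (avg h w) m" for m
 proof -
  have V': "avg h V = dif h i (dif h j (avg h w))" by (simp add: V_def avg_dif)
  have "(avg h ^^ (2 * m + 1)) V = (avg h ^^ m) ((avg h ^^ m) (avg h V))"
   by (simp add: mult_2 funpow_add funpow_swap1)
  then have "(LI x. (avg h ^^ (2 * m + 1)) V x * g x) = (LI x. (avg h ^^ m) (avg h V) x * (avg h ^^ m) g x)"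
   using avg_pow_self_adjoint[OF nice_avg_pow[OF nice_avg[OF nV]] g(1)] by simp
  then show ?thesis using pair[OF nice_avg[OF nw], of m] by (simp add: V')
 qed
 have nVg: "integ (%x. (avg h ^^ n) V x * g x)" "integ (%x. (avg h ^^ n) U x * g x)" for n
  by (intro nice_integrable nice_mult nice_avg_pow nV nU g)+
 have bound: "abs ((LI x. U x * g x)) <= r ^ (2 * M) * (B * (LI x. g x)) + a * (16 * E)" for M
 proof -
  let ?N = "2 * M"
  have "(LI x. U x * g x) = (LI x. r ^ ?N * ((avg h ^^ ?N) U x * g x) - a * (\<Sum>n<?N. r ^ Suc n * ((avg h ^^ n) V x * g x)))"
   by (subst avg_identity[OF UV, of _ ?N]) (simp add: left_diff_distrib sum_distrib_right mult.assoc del: power_Suc)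
  also have "... = r ^ ?N * (LI x. (avg h ^^ ?N) U x * g x) - a * (\<Sum>n<?N. r ^ Suc n * (LI x. (avg h ^^ n) V x * g x))"
   using nVg by simp
  finally have eq: "(LI x. U x * g x) = r ^ ?N * (LI x. (avg h ^^ ?N) U x * g x) - a * (\<Sum>n<?N. r ^ Suc n * (LI x. (avg h ^^ n) V x * g x))" .
  have 1: "abs ((LI x. (avg h ^^ ?N) U x * g x)) <= B * (LI x. g x)"
  proof -
   have "abs ((LI x. (avg h ^^ ?N) U x * g x)) <= (LI x. abs ((avg h ^^ ?N) U x * g x))" by (rule integral_abs_bound)
   also have "... <= (LI x. B * g x)"
   proof (rule integral_mono)
   have "abs ((avg h ^^ ?N) U x) <= B" for x by (rule avg_pow_abs_le) (rule B)
   then show "abs ((avg h ^^ ?N) U x * g x) <= B * g x" for x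
   using g(2)[of x] by (auto simp: abs_mult intro!: mult_right_mono)
   qed (use g integrable_abs[OF nVg(2)] in auto)
   finally show ?thesis by simp
  qed
  have "abs (\<Sum>n<?N. r ^ Suc n * (LI x. (avg h ^^ n) V x * g x)) <= (\<Sum>n<?N. abs ((LI x. (avg h ^^ n) V x * g x)))"
  proof (intro order_trans[OF sum_abs] sum_mono)
   fix n
   have "r ^ Suc n <= 1" "0 <= r ^ Suc n" using r by (auto intro: power_le_one simp del: power_Suc)
   then have "r ^ Suc n * abs ((LI x. (avg h ^^ n) V x * g x)) <= 1 * abs ((LI x. (avg h ^^ n) V x * g x))"
   by (intro mult_right_mono) auto
   then show "abs (r ^ Suc n * (LI x. (avg h ^^ n) V x * g x)) <= abs ((LI x. (avg h ^^ n) V x * g x))"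
   using \<open>0 <= r ^ Suc n\<close> by (simp add: abs_mult del: power_Suc)
  qed
  also have "... <= (\<Sum>m<M. T w m + T (avg h w) m)"
  proof (induction M)
   case (Suc M)
   have "{..<2 * Suc M} = insert (2 * M + 1) (insert (2 * M) {..<2 * M})" by auto
   then show ?case using Suc term_even[of M] term_odd[of M] by simp
  qed simp
  also have "... <= 8 * E + 8 * E"
  proof -
   have "(\<Sum>m<M. T (avg h w) m) <= 8 * (LI x. bell (g x) (avg h w x))"
   by (rule Tsum) (auto intro: nice_avg nw avg_abs_le w1)
   then show ?thesis unfolding sum.distrib using Tsum[OF nw w1, of M] bw baw by linarith
  qed
  finally have 2: "abs (\<Sum>n<?N. r ^ Suc n * (LI x. (avg h ^^ n) V x * g x)) <= 16 * E" by simp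
  have "abs ((LI x. U x * g x)) <= abs (r ^ ?N * (LI x. (avg h ^^ ?N) U x * g x)) + abs (a * (\<Sum>n<?N. r ^ Suc n * (LI x. (avg h ^^ n) V x * g x)))"
   unfolding eq by (rule abs_triangle_ineq4)
  also have "... <= r ^ ?N * (B * (LI x. g x)) + a * (16 * E)"
   unfolding abs_mult using 1 2 r a by (intro add_mono mult_mono) auto
  finally show ?thesis .
 qed
 have "(%M. r ^ (2 * M)) ~~> 0"
  using LIMSEQ_subseq_LIMSEQ[OF LIMSEQ_realpow_zero[of r], of "%M. 2 * M"] r by (auto simp: o_def strict_mono_def)
 then have "(%M. r ^ (2 * M) * (B * (LI x. g x)) + a * (16 * E)) ~~> 0 * (B * (LI x. g x)) + a * (16 * E)"
  by (intro tendsto_intros)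
 then have "abs ((LI x. U x * g x)) <= 0 * (B * (LI x. g x)) + a * (16 * E)"
  by (rule LIMSEQ_le_const) (use bound in auto)
 \<comment> \<open>\<open>16 * a\<close> is \<open>4 * h^2\<close>, the normalisation of two central
   differences, so the mesh drops out of the bound.\<close>
 then have "abs ((LI x. U x * g x)) <= 4 * h^2 * E" by (simp add: a_def mult_ac)
 moreover have "(LI x. U x / (4 * h^2) * g x) = (LI x. U x * g x) / (4 * h^2)" by simp
 ultimately have "abs ((LI x. U x / (4 * h^2) * g x)) <= E" using h by (simp add: divide_le_eq mult_ac)
 then show ?thesis unfolding U_def E_def .
qed

lemma continuous_cpt_nice:
 assumes "continuous_on UNIV u" "compact K" "!!x. x ~: K ==> u x = 0"
 shows "nice u"
 using continuous_cpt_integrable[OF assms] continuous_cpt_bounded[OF assms] unfolding nice_def by metis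

lemma lap_approx:
 assumes s: "smooth phi" and L: "!!i j k x. abs (pd k (pd j (pd i phi)) x) <= L" and h: "h > 0"
 shows "abs ((avg h phi x - phi x) / (h^2 / 4) - lap phi x) <= 2 * L * h"
proof -
 \<comment> \<open>Two central differences of step \<open>h/2\<close> compose to the second
   difference of step \<open>h\<close>, so the Laplacian is covered by
   \<open>dif_dif_approx\<close>.\<close>
 have d: "dif (h/2) i (dif (h/2) i phi) x / (4 * (h/2)^2) = (phi (x + h *R e i) + phi (x - h *R e i) - 2 * phi x) / h^2" for i
 proof -
  have eqs: "x + (h/2) *R e i + (h/2) *R e i = x + h *R e i" "x + (h/2) *R e i - (h/2) *R e i = x"
   "x - (h/2) *R e i + (h/2) *R e i = x" "x - (h/2) *R e i - (h/2) *R e i = x - h *R e i"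
   by (simp_all add: vec_eq_iff field_simps)
  show ?thesis unfolding dif_def by (simp only: eqs) (simp add: power2_eq_square)
 qed
 have "(avg h phi x - phi x) / (h^2 / 4) = (SUM i:UNIV. dif (h/2) i (dif (h/2) i phi) x / (4 * (h/2)^2))"
  unfolding d sum_2 avg_expand using h by (simp add: field_simps)
 then have "abs ((avg h phi x - phi x) / (h^2 / 4) - lap phi x)
  = abs (SUM i:UNIV. dif (h/2) i (dif (h/2) i phi) x / (4 * (h/2)^2) - pd i (pd i phi) x)"
  by (simp add: lap_def sum_subtractf)
 also have "... <= (SUM i:(UNIV::2 set). 2 * L * (h/2))"
  by (intro order_trans[OF sum_abs] sum_mono dif_dif_approx s L) (use h in auto)
 finally show ?thesis by simp
qed

text \<open>The limit h -> 0 of \<open>discrete_CZ\<close>. The hypothesis has 1/2 in place of 1 so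
  that the discretisation error fits below the bound \<open>abs w <= 1\<close>; the enlarged ball
  contains the support of \<open>w\<close>, whose square it bounds in the mean.\<close>

lemma CZ_bilinear:
 assumes s: "smooth phi" and z: "!!x. x ~: cball x0 R ==> phi x = 0"
  and b: "!!x. abs (lap phi x - phi x) <= 1 / 2" and g: "nice g" "!!x. 0 <= g x"
 shows "abs ((LI x. pd j (pd i phi) x * g x))
  <= 24 * (LI x. llog (g x)) + (LI x. g x) + measure lborel (cball x0 (R + 1))"
proof -
 obtain L where L: "L > 0" "!!i j k x. abs (pd k (pd j (pd i phi)) x) <= L"
  using third_bound[OF s compact_cball z] by metis
 have nphi: "nice phi" by (rule continuous_cpt_nice[OF smooth_continuous[OF s] compact_cball z])
 have pz: "pd j (pd i phi) x = 0" if "x ~: cball x0 R" for x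
  using that z by (intro partial_zero_outside[of "cball x0 R"]) auto
 have np: "nice (pd j (pd i phi))"
  by (rule continuous_cpt_nice[OF smooth_continuous[OF smooth_partial[OF smooth_partial[OF s]]] compact_cball pz])
 let ?I = "(LI x. pd j (pd i phi) x * g x)"
 let ?E = "24 * (LI x. llog (g x)) + (LI x. g x) + measure lborel (cball x0 (R + 1))"
 define h0 where "h0 = min 1 (1 / (4 * L))"
 have h0: "h0 > 0" using L(1) by (simp add: h0_def)
 have main: "abs ?I - ?E <= (2 * L * (LI x. g x)) * h" if h: "h > 0" "h <= h0" for h
 proof -
  define w where "w x = (avg h phi x - phi x) / (h^2 / 4) - phi x" for x
  have w1: "abs (w x) <= 1" for x
  proof -
   have "2 * L * h <= 2 * L * (1 / (4 * L))" using h L(1) by (intro mult_left_mono) (auto simp: h0_def)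
   then have "2 * L * h <= 1 / 2" using L(1) by simp
   then show ?thesis using lap_approx[OF s L(2) h(1), of x] b[of x] unfolding w_def by linarith
  qed
  have wz: "w x = 0" if "x ~: cball x0 (R + 1)" for x
  proof -
   have "x + t *R e i ~: cball x0 R" if "abs t <= 1" for t i
   proof
   assume "x + t *R e i : cball x0 R"
   moreover have "dist (x + t *R e i) x <= 1" using that by (simp add: dist_norm)
   ultimately have "dist x0 x <= R + 1" using dist_triangle[of x0 x "x + t *R e i"] by simp
   then show False using \<open>x ~: cball x0 (R + 1)\<close> by simp
   qed
   from this[of h] this[of "-h"] this[of 0] have "phi (x + h *R e i) = 0" "phi (x - h *R e i) = 0" "phi x = 0" for i
   using h by (auto intro!: z simp: h0_def)
   then show ?thesis by (simp add: w_def avg_expand)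
  qed
  have nw: "nice w"
  proof -
   have "w = (%x. (4 / h^2) * (avg h phi x - phi x) - phi x)" by (auto simp: w_def)
   moreover have "nice (%x. (4 / h^2) * (avg h phi x - phi x) - phi x)" by (intro nice_diff nice_cmult nice_avg nphi)
   ultimately show ?thesis by simp
  qed
  have "(LI x. (w x)^2) <= (LI x. ind (cball x0 (R + 1)) x)"
  proof (rule integral_mono)
   show "integ (indicat_real (cball x0 (R + 1)))"
   by (rule integrable_indicator_cpt[OF compact_cball])
   show "(w x)^2 <= ind (cball x0 (R + 1)) x" for x
   using w1[of x] wz[of x] by (auto simp: indicator_def abs_square_le_1)
  qed (intro nice_integrable nice_square nw)
  then have w2: "(LI x. (w x)^2) <= measure lborel (cball x0 (R + 1))" by simp
  have D: "abs ((LI x. dif h i (dif h j phi) x / (4 * h^2) * g x)) <= ?E"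
   using discrete_CZ[OF h(1) nphi g, of i j] w1 w2 unfolding w_def by fastforce
  have nd: "nice (%x. dif h i (dif h j phi) x / (4 * h^2))"
   using nice_cmult[OF nice_dif[OF nice_dif[OF nphi]], of "1 / (4 * h^2)" h i h j] by simp
  have "abs (?I - (LI x. dif h i (dif h j phi) x / (4 * h^2) * g x))
   = abs ((LI x. (pd j (pd i phi) x - dif h i (dif h j phi) x / (4 * h^2)) * g x))"
   using nice_integrable[OF nice_mult[OF np g(1)]] nice_integrable[OF nice_mult[OF nd g(1)]]
   by (simp add: left_diff_distrib)
  also have "... <= (LI x. abs ((pd j (pd i phi) x - dif h i (dif h j phi) x / (4 * h^2)) * g x))"
   by (rule integral_abs_bound)
  also have "... <= (LI x. (2 * L * h) * g x)"
  proof (rule integral_mono)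
   show "abs ((pd j (pd i phi) x - dif h i (dif h j phi) x / (4 * h^2)) * g x) <= (2 * L * h) * g x" for x
   using dif_dif_approx[OF s L(2) h(1), of i j x] g(2)[of x]
   by (auto simp: abs_mult abs_minus_commute intro!: mult_right_mono)
  qed (use g(1) in \<open>auto intro!: nice_integrable nice_abs nice_mult nice_diff np nd\<close>)
  also have "... = (2 * L * (LI x. g x)) * h" by simp
  finally show ?thesis using D by linarith
 qed
 \<comment> \<open>\<open>vanish_limit\<close> asks for a linear bound for every positive
   \<open>h\<close>; beyond \<open>h0\<close> the second entry of the maximum provides it.\<close>
 have "abs ?I - ?E <= max (2 * L * (LI x. g x)) ((abs ?I - ?E) / h0) * h" if "h > 0" for h
 proof (cases "h <= h0")
  case True
  then have "abs ?I - ?E <= (2 * L * (LI x. g x)) * h" using main that by simp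
  also have "... <= max (2 * L * (LI x. g x)) ((abs ?I - ?E) / h0) * h"
   using that by (intro mult_right_mono) auto
  finally show ?thesis .
 next
  case False
  have "0 <= (2 * L * (LI x. g x))" using L(1) g(2) by simp
  then have M: "0 <= max (2 * L * (LI x. g x)) ((abs ?I - ?E) / h0)" by (simp add: le_max_iff_disj)
  have "abs ?I - ?E = (abs ?I - ?E) / h0 * h0" using h0 by simp
  also have "... <= max (2 * L * (LI x. g x)) ((abs ?I - ?E) / h0) * h0" using h0 by (intro mult_right_mono) auto
  also have "... <= max (2 * L * (LI x. g x)) ((abs ?I - ?E) / h0) * h" using M False by (intro mult_left_mono) auto
  finally show ?thesis .
 qed
 from vanish_limit[OF this] show ?thesis by linarith
qed

text \<open>With g = t^s the logarithm is beaten by one more power of t, so that half of t^(s+1)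
  absorbs the L log L terms.\<close>

lemma llog_power_bound:
 fixes s :: nat
 assumes "s >= 1"
 obtains C where "C >= 0" "!!t. t >= 0 ==> 24 * llog (t ^ s) + t ^ s <= t ^ Suc s / 2 + C"
proof -
 \<comment> \<open>2304 = 48^2 comes from completing the square in 48 s sqrt(1 + t); the 2 covers
   the remaining multiples of t^s.\<close>
 define K where "K = 2304 * (real s)^2 + 2"
 have K: "K > 0" by (simp add: K_def add_nonneg_pos)
 have "24 * llog (t ^ s) + t ^ s <= t ^ Suc s / 2 + (4 * K) ^ s * K" if t: "t >= 0" for t
 proof -
  have "1 + t ^ s <= (1 + t) ^ s"
  proof -
   have "1 ^ s + t ^ s <= (1 + t) ^ s" using assms
   proof (induction s rule: nat_induct_at_least)
   case (Suc n)
   have "1 + t ^ Suc n <= (1 + t) * (1 + t ^ n)" using t by (simp add: algebra_simps)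
   also have "... <= (1 + t) * (1 + t) ^ n" using Suc t by (intro mult_left_mono) auto
   finally show ?case by simp
   qed simp
   then show ?thesis by simp
  qed
  then have "ln (1 + t ^ s) <= ln ((1 + t) ^ s)" using t by (subst ln_le_cancel_iff) (auto intro: add_pos_nonneg)
  also have "... = real s * ln (1 + t)" using t by (simp add: ln_realpow)
  also have "ln (1 + t) <= 2 * sqrt (1 + t)"
  proof -
   have "ln (1 + t) = 2 * ln (sqrt (1 + t))" using t by (simp add: ln_sqrt)
   also have "ln (sqrt (1 + t)) <= sqrt (1 + t)" using ln_le_minus_one[of "sqrt (1 + t)"] t by simp
   finally show ?thesis by simp
  qed
  finally have l: "ln (1 + t ^ s) <= real s * (2 * sqrt (1 + t))" by (simp add: mult_left_mono)
  have sq: "48 * real s * sqrt (1 + t) <= (1 + t) / 4 + 2304 * (real s)^2"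
  proof -
   have "0 <= (sqrt (1 + t) / 2 - 48 * real s)^2" by simp
   also have "... = (1 + t) / 4 - 48 * real s * sqrt (1 + t) + 2304 * (real s)^2"
   using t by (simp add: power2_diff power_divide power_mult_distrib)
   finally show ?thesis by simp
  qed
  have "24 * llog (t ^ s) <= 24 * (t ^ s * (real s * (2 * sqrt (1 + t))))"
   using t by (intro mult_left_mono order_trans[OF llog_le mult_left_mono[OF l]]) auto
  also have "... = t ^ s * (48 * real s * sqrt (1 + t))" by simp
  also have "... <= t ^ s * ((1 + t) / 4 + 2304 * (real s)^2)" using t sq by (intro mult_left_mono) auto
  finally have "24 * llog (t ^ s) + t ^ s - t ^ Suc s / 2 <= t ^ s * (K - t / 4)"
   using zero_le_power[OF t, of s] by (simp add: K_def algebra_simps add_divide_distrib)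
  also have "... <= (4 * K) ^ s * K"
  proof (cases "t <= 4 * K")
   case True
   then have "t ^ s * (K - t / 4) <= (4 * K) ^ s * K"
   using t K by (intro mult_mono power_mono) auto
   then show ?thesis .
  next
   case False
   then have "t ^ s * (K - t / 4) <= 0" using t by (intro mult_nonneg_nonpos) auto
   also have "0 <= (4 * K) ^ s * K" using K by simp
   finally show ?thesis .
  qed
  finally show ?thesis by simp
 qed
 then show ?thesis using that[of "(4 * K) ^ s * K"] K by auto
qed

text \<open>In \<open>CZ_bilinear\<close> take for g the s-th power of the positive part A of the
  derivative: the left side is the integral of A^(s+1), and \<open>llog_power_bound\<close> returns
  only half of it. The negative part is the positive part for \<open>- phi\<close>.\<close>

lemma CZ_power:
 fixes s :: nat
 assumes "s >= 1"
 obtains C where "C >= 0" "!!phi x0 R i j. smooth phi ==> (!!x. x ~: cball x0 R ==> phi x = 0) ==>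
  (!!x. abs (lap phi x - phi x) <= 1 / 2) ==>
  (LI x. abs (pd j (pd i phi) x) ^ Suc s) <= C * measure lborel (cball x0 (R + 1))"
proof -
 obtain C where C: "C >= 0" "!!t. t >= 0 ==> 24 * llog (t ^ s) + t ^ s <= t ^ Suc s / 2 + C"
  using llog_power_bound[OF assms] by metis
 have half: "(LI x. (max 0 (pd j (pd i phi) x)) ^ Suc s) <= 2 * (C + 1) * measure lborel (cball x0 (R + 1))"
  and halfi: "integ (%x. (max 0 (pd j (pd i phi) x)) ^ Suc s)"
  if sm: "smooth phi" and z: "!!x. x ~: cball x0 R ==> phi x = 0" and b: "!!x. abs (lap phi x - phi x) <= 1 / 2" for phi x0 R i j
 proof -
  let ?A = "%x. max 0 (pd j (pd i phi) x)" and ?m = "measure lborel (cball x0 (R + 1))"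
  have Az: "?A x = 0" if "x ~: cball x0 (R + 1)" for x
   using that z by (subst partial_zero_outside[of "cball x0 R"]) (auto intro!: partial_zero_outside[of "cball x0 R"])
  have cA: "continuous_on UNIV (%x. ?A x ^ n)" for n
   by (intro continuous_intros smooth_continuous smooth_partial sm)
  have nA: "nice (%x. ?A x ^ n)" if "n >= 1" for n
   by (rule continuous_cpt_nice[OF cA compact_cball[of x0 "R + 1"]]) (use Az that in auto)
  show "integ (%x. ?A x ^ Suc s)" by (intro nice_integrable nA) simp
  have g: "nice (%x. ?A x ^ s)" "!!x. 0 <= ?A x ^ s" using nA assms by auto
  have ind: "integ (%x. C * indicat_real (cball x0 (R + 1)) x)"
   by (intro integrable_mult_right integrable_indicator_cpt compact_cball)
  have "(LI x. ?A x ^ Suc s) = (LI x. pd j (pd i phi) x * ?A x ^ s)"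
   using assms by (intro lint_cong) (auto simp: max_def)
  also have "... <= 24 * (LI x. llog (?A x ^ s)) + (LI x. ?A x ^ s) + ?m"
   using CZ_bilinear[OF sm _ b g, of x0 R j i] z by fastforce
  also have "24 * (LI x. llog (?A x ^ s)) + (LI x. ?A x ^ s) = (LI x. 24 * llog (?A x ^ s) + ?A x ^ s)"
   using nice_integrable[OF nice_llog[OF g]] nice_integrable[OF g(1)] by simp
  also have "... <= (LI x. ?A x ^ Suc s / 2 + C * ind (cball x0 (R + 1)) x)"
  proof (rule integral_mono)
   show "integ (%x. ?A x ^ Suc s / 2 + C * indicat_real (cball x0 (R + 1)) x)"
   using ind nice_integrable[OF nA[of "Suc s"]] by (intro integ_add) auto
   show "24 * llog (?A x ^ s) + ?A x ^ s <= ?A x ^ Suc s / 2 + C * ind (cball x0 (R + 1)) x" for x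
   proof (cases "x : cball x0 (R + 1)")
   case True then show ?thesis using C(2)[of "?A x"] by simp
   next
   case False
   then show ?thesis using Az[OF False] assms by (simp add: llog_def power_0_left)
   qed
  qed (use g nice_llog[OF g] in auto)
  also have "... = (LI x. ?A x ^ Suc s) / 2 + C * ?m"
   using ind nice_integrable[OF nA[of "Suc s"]] by (simp del: power_Suc)
  finally show "(LI x. ?A x ^ Suc s) <= 2 * (C + 1) * ?m" by (simp add: algebra_simps)
 qed
 show ?thesis
 proof (rule that[of "4 * (C + 1)"])
  fix phi x0 R i j
  assume a: "smooth phi" "!!x. x ~: cball x0 R ==> phi x = 0" "!!x. abs (lap phi x - phi x) <= 1 / 2"
  let ?n = "%x. (-1) * phi x"
  have p1: "pd i (%x. (-1) * u x) = (%x. (-1) * pd i u x)" if "smooth u" for u i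
   using partial_cmult[OF smooth_differentiable[OF that], of i "-1"] by auto
  have p2: "pd j (pd i ?n) = (%x. (-1) * pd j (pd i phi) x)" for i j
   unfolding p1[OF a(1)] by (rule p1[OF smooth_partial[OF a(1)]])
  have "abs (lap ?n x - ?n x) <= 1 / 2" for x
   using a(3)[of x] unfolding lap_def p2 by (simp add: sum_negf abs_minus_commute)
  note n = half[OF smooth_cmult[OF a(1), of "-1"], of x0 R, OF _ this] halfi[OF smooth_cmult[OF a(1), of "-1"], of x0 R, OF _ this]
  have "(LI x. abs (pd j (pd i phi) x) ^ Suc s)
   = (LI x. (max 0 (pd j (pd i phi) x)) ^ Suc s + (max 0 (pd j (pd i ?n) x)) ^ Suc s)"
   unfolding p2 by (intro lint_cong) (auto simp: max_def)
  also have "... = (LI x. (max 0 (pd j (pd i phi) x)) ^ Suc s) + (LI x. (max 0 (pd j (pd i ?n) x)) ^ Suc s)"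
   by (intro lint_add halfi[OF a] n) (use a(2) in auto)
  also have "... <= 2 * (C + 1) * measure lborel (cball x0 (R + 1)) + 2 * (C + 1) * measure lborel (cball x0 (R + 1))"
   by (intro add_mono half[OF a] n) (use a(2) in auto)
  finally show "(LI x. abs (pd j (pd i phi) x) ^ Suc s) <= 4 * (C + 1) * measure lborel (cball x0 (R + 1))"
   by (simp add: algebra_simps)
 qed (use C in simp)
qed

section \<open>A priori estimates for test functions\<close>

lemma Ck_on_inverse:
 assumes "open D" "Ck_on k D u" "!!x. x : D ==> u x ~= 0"
 shows "Ck_on k D (%x. inverse (u x))"
 using assms(2)
proof (induction k)
 case 0
 then show ?case using assms(3) by (auto intro: continuous_intros)
next
 case (Suc k)
 then have ud: "u differentiable (at x)" if "x : D" for x using that by simp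
 have IH: "Ck_on k D (%x. inverse (u x))" using Suc Ck_on_SucD by blast
 have "Ck_on k D (pd i (%x. inverse (u x)))" for i
 proof (rule Ck_on_cong[OF assms(1)])
  show "Ck_on k D (%x. (-1) * (pd i u x * (inverse (u x) * inverse (u x))))"
   using Suc.prems by (intro Ck_on_mult Ck_on_const assms(1) IH) auto
  show "(-1) * (pd i u x * (inverse (u x) * inverse (u x))) = pd i (%x. inverse (u x)) x" if "x : D" for x
   using assms(3)[OF that] ud[OF that] by (simp add: partial_inverse power2_eq_square divide_inverse)
 qed
 moreover have "(%x. inverse (u x)) differentiable (at x)" if "x : D" for x
  using ud[OF that] assms(3)[OF that] by (intro differentiable_inverse)
 ultimately show ?case by simp
qed

lemma smooth_parts:
 assumes "Ck_on 1 UNIV u" "smooth v" "compact K" "!!x. x ~: K ==> v x = 0"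
 shows "(LI x. u x * pd i v x) = - (LI x. pd i u x * v x)"
 using by_parts(3)[OF open_UNIV assms(1) smooth_C1c[OF assms(2-4)]] by simp

lemma smooth_Ck: "smooth u ==> Ck_on k UNIV u"
 by (simp add: smooth_def)

lemma cpt_partial:
 assumes "smooth u" "compact K" "!!x. x ~: K ==> u x = 0" "x ~: K"
 shows "pd i u x = 0"
 using C1cD(6)[OF smooth_C1c[OF assms(1-3)] assms(4)] .

text \<open>Two integrations by parts turn the integral of phi_ij^2 into that of phi_ii phi_jj, and
  these add up to the integral of (lap phi)^2.\<close>

lemma hessian_L2:
 assumes s: "smooth phi" "compact K" "!!x. x ~: K ==> phi x = 0"
 shows "(LI x. (pd j (pd i phi) x)^2) <= (LI x. (lap phi x)^2)"
proof -
 have s1: "smooth (pd i phi)" "pd i phi x = 0" if "x ~: K" for i x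
  using cpt_partial[OF s that] by (auto intro: smooth_partial s)
 have z1: "x ~: K ==> pd i phi x = 0" for i x using s1(2) .
 have sm: "smooth (pd i phi)" for i by (rule smooth_partial[OF s(1)])
 have z2: "x ~: K ==> pd j (pd i phi) x = 0" for i j x
  by (rule cpt_partial[OF sm s(2) z1])
 have n2: "nice (pd j (pd i phi))" for i j
  by (rule continuous_cpt_nice[OF smooth_continuous[OF smooth_partial[OF sm]] s(2) z2])
 have c: "pd j (pd i phi) = pd i (pd j phi)" for i j
  using partial_commute[OF s] by auto
 have c1: "pd j (pd i (pd k phi)) = pd i (pd j (pd k phi))" for i j k
  using partial_commute[OF sm s(2) z1] by auto
 have id: "(LI x. (pd j (pd i phi) x)^2) = (LI x. pd i (pd i phi) x * pd j (pd j phi) x)" for i j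
 proof -
  have "(LI x. (pd j (pd i phi) x)^2) = (LI x. pd j (pd i phi) x * pd j (pd i phi) x)"
   by (simp add: power2_eq_square)
  also have "... = - (LI x. pd j (pd j (pd i phi)) x * pd i phi x)"
   by (rule smooth_parts[OF smooth_Ck[OF smooth_partial[OF sm]] sm s(2) z1])
  also have "pd j (pd j (pd i phi)) = pd i (pd j (pd j phi))"
   by (simp only: c[of j i] c1[of j i])
  also have "- (LI x. pd i (pd j (pd j phi)) x * pd i phi x) = (LI x. pd j (pd j phi) x * pd i (pd i phi) x)"
   using smooth_parts[OF smooth_Ck[OF smooth_partial[OF sm]] sm s(2) z1, of j j i i] by simp
  finally show ?thesis by (simp add: mult.commute)
 qed
 have "(LI x. (pd j (pd i phi) x)^2) <= (SUM i:UNIV. SUM j:UNIV. (LI x. (pd j (pd i phi) x)^2))"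
  by (rule order_trans[OF member_le_sum[of j UNIV] member_le_sum[of i UNIV "%i. SUM j:UNIV. (LI x. (pd j (pd i phi) x)^2)"]])
   (auto intro!: sum_nonneg integral_nonneg_AE)
 also have "... = (SUM i:UNIV. SUM j:UNIV. (LI x. pd i (pd i phi) x * pd j (pd j phi) x))"
  by (simp only: id)
 also have "... = (LI x. (SUM i:UNIV. SUM j:UNIV. pd i (pd i phi) x * pd j (pd j phi) x))"
  using nice_integrable[OF nice_mult[OF n2 n2]] by (subst Bochner_Integration.integral_sum; simp)
 also have "... = (LI x. (lap phi x)^2)"
  by (simp add: lap_def power2_eq_square sum_product)
 finally show ?thesis .
qed

text \<open>With p and q the first and second derivative in direction i, one integration by parts
  gives -3 times the integral of phi p^2 q. The square (p^2 - 3 B |q|)^2 then absorbs half of p^4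
  and is the origin of 9 B^2.\<close>

lemma gradient_L4:
 assumes s: "smooth phi" "compact K" "!!x. x ~: K ==> phi x = 0" and B: "!!x. abs (phi x) <= B"
 shows "(LI x. (pd i phi x) ^ 4) <= 9 * B^2 * (LI x. (lap phi x)^2)"
proof -
 let ?p = "pd i phi" and ?q = "pd i (pd i phi)"
 have sm: "smooth ?p" by (rule smooth_partial[OF s(1)])
 have z1: "x ~: K ==> ?p x = 0" for x by (rule cpt_partial[OF s])
 have z2: "x ~: K ==> ?q x = 0" for x by (rule cpt_partial[OF sm s(2) z1])
 have n1: "nice ?p" by (rule continuous_cpt_nice[OF smooth_continuous[OF sm] s(2) z1])
 have n2: "nice ?q" by (rule continuous_cpt_nice[OF smooth_continuous[OF smooth_partial[OF sm]] s(2) z2])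
 have n0: "nice phi" by (rule continuous_cpt_nice[OF smooth_continuous[OF s(1)] s(2,3)])
 have B0: "B >= 0" using B[of 0] by linarith
 have s3: "smooth (%x. ?p x * (?p x * ?p x))" by (intro smooth_mult sm)
 have p3: "pd i (%x. ?p x * (?p x * ?p x)) x = 3 * ((?p x)^2 * ?q x)" for x
  using smooth_differentiable[OF sm] smooth_differentiable[OF smooth_mult[OF sm sm]]
  by (simp add: partial_mult power2_eq_square algebra_simps)
 have "(LI x. (?p x) ^ 4) = (LI x. ?p x * (?p x * (?p x * ?p x)))"
  by (simp add: power4_eq_xxxx mult.assoc)
 also have "... = - (LI x. phi x * pd i (%x. ?p x * (?p x * ?p x)) x)"
  using smooth_parts[OF smooth_Ck[OF s(1)] s3 s(2), of i] z1 by simp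
 also have "... <= (LI x. abs (phi x * pd i (%x. ?p x * (?p x * ?p x)) x))"
  using integral_abs_bound[of lborel "%x. phi x * pd i (%x. ?p x * (?p x * ?p x)) x"] by linarith
 also have "... = (LI x. 3 * abs (phi x) * ((?p x)^2 * abs (?q x)))"
  by (simp add: p3 abs_mult mult_ac)
 also have "... <= (LI x. (1/2) * (?p x) ^ 4 + (9 / 2) * B^2 * (?q x)^2)"
 proof (rule integral_mono)
  show "integ (%x. 3 * abs (phi x) * ((?p x)^2 * abs (?q x)))"
   by (intro nice_integrable nice_mult nice_cmult nice_abs nice_square n0 n1 n2)
  have "nice (%x. (?p x) ^ 4)" using nice_square[OF nice_square[OF n1]] by simp
  then show "integ (%x. (1/2) * (?p x) ^ 4 + (9 / 2) * B^2 * (?q x)^2)"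
   by (intro nice_integrable nice_add nice_cmult nice_square n2)
  show "3 * abs (phi x) * ((?p x)^2 * abs (?q x)) <= (1/2) * (?p x) ^ 4 + (9 / 2) * B^2 * (?q x)^2" for x
  proof -
   have "3 * abs (phi x) * ((?p x)^2 * abs (?q x)) <= 3 * B * ((?p x)^2 * abs (?q x))"
   using B by (intro mult_right_mono) auto
   moreover have "0 <= ((?p x)^2 - 3 * B * abs (?q x))^2" by simp
   ultimately show ?thesis by (simp add: power2_eq_square power4_eq_xxxx algebra_simps)
  qed
 qed
 also have "... = (1/2) * (LI x. (?p x) ^ 4) + (9 / 2) * B^2 * (LI x. (?q x)^2)"
  using nice_integrable[OF nice_square[OF nice_square[OF n1]]] nice_integrable[OF nice_square[OF n2]] by simp
 finally have "(LI x. (?p x) ^ 4) <= 9 * B^2 * (LI x. (?q x)^2)" by simp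
 also have "... <= 9 * B^2 * (LI x. (lap phi x)^2)"
  by (intro mult_left_mono hessian_L2[OF s]) auto
 finally show ?thesis .
qed

section \<open>Integrable kernels in the plane\<close>

lemma nn_integral_even:
 fixes f :: "real => ennreal"
 assumes [measurable]: "f : BM" and "!!t. f (- t) = f t"
  and "(NI t. f t * ind {0..} t) < \<infinity>"
 shows "(NI t. f t) < \<infinity>"
proof -
 have "(NI t. f t) <= (NI t. f t * ind {0..} t + f (- t) * ind {0..} (- t))"
  by (intro nn_integral_mono) (auto simp: assms(2) indicator_def)
 also have "... = (NI t. f t * ind {0..} t) + (NI t. f (- t) * ind {0..} (- t))"
  by (rule nn_integral_add) auto
 also have "(NI t. f (- t) * ind {0..} (- t)) = (NI t. f t * ind {0..} t)"
  using nn_integral_real_affine[of "%t. f t * ind {0..} t" "-1" 0] by simp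
 finally show ?thesis using assms(3) by (auto simp: ennreal_add_less_top elim!: le_less_trans)
qed

lemma Basis_plane: "(Basis :: plane set) = {e 1, e 2}" "e 1 ~= (e 2 :: plane)"
proof -
 show "(Basis :: plane set) = {e 1, e 2}"
  by (force simp: Basis_vec_def UNIV_2)
 show "e 1 ~= (e 2 :: plane)" by (simp add: axis_eq_axis)
qed

lemma nn_integral_plane_product:
 fixes f :: "real => real"
 assumes [measurable]: "f : BM" and "!!t. 0 <= f t" "(NI t. ennreal (f t)) < \<infinity>"
 shows "(\<integral>\<^sup>+x. ennreal (f (x $ 1) * f (x $ 2)) \<partial>(lborel :: plane measure)) < \<infinity>"
proof -
 have "(\<integral>\<^sup>+x. ennreal (f (x $ 1) * f (x $ 2)) \<partial>(lborel :: plane measure)) = (\<integral>\<^sup>+x. (\<Prod>b\<in>Basis. ennreal (f (x \<bullet> b))) \<partial>(lborel :: plane measure))"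
  using assms(2) Basis_plane(2) by (simp add: Basis_plane(1) ennreal_mult)
 also have "... = (\<Prod>b\<in>(Basis :: plane set). (NI t. ennreal (f t)))"
  by (rule nn_integral_lborel_prod) auto
 also have "... < \<infinity>" using assms(3) Basis_plane(2) by (simp add: Basis_plane(1) ennreal_mult_less_top)
 finally show ?thesis .
qed

lemma norm_plane: "(norm x)^2 = (x $ 1)^2 + (x $ 2)^2" for x :: plane
 unfolding power2_norm_eq_inner by (simp add: inner_vec_def sum_2 power2_eq_square)

text \<open>|x_1 x_2| is at most |x|^2, so the kernel is dominated by |x_1|^(-2/3) |x_2|^(-2/3), a
  product of locally integrable functions of one variable. The exponent 4/3 is conjugate to the 4 of
  the gradient estimates.\<close>

lemma riesz_kernel_integrable:
 "integ (%x::plane. ind (cball 0 R) x * (norm x) powr (-4/3))"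
proof (rule integrableI_bounded)
 let ?f = "%t. ind {-R..R} t * abs t powr (-2/3) :: real"
 have f1: "(NI t. ennreal (?f t)) < \<infinity>"
 proof (rule nn_integral_even)
  show "(NI t. ennreal (?f t) * ind {0..} t) < \<infinity>"
  proof (cases "R >= 0")
   case True
   have "((%t. t powr (-2/3)) has_integral (R powr (-2/3 + 1) / (-2/3 + 1))) {0..R}"
   using True by (intro has_integral_powr_from_0) auto
   then have "((%t. if t : {0..R} then t powr (-2/3) else 0) has_integral (R powr (-2/3 + 1) / (-2/3 + 1))) UNIV"
   unfolding has_integral_restrict_UNIV .
   then have "(NI t. ennreal (if t : {0..R} then t powr (-2/3) else 0)) = ennreal (R powr (-2/3 + 1) / (-2/3 + 1))"
   by (intro nn_integral_has_integral_lborel) auto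
   moreover have "(NI t. ennreal (?f t) * ind {0..} t) = (NI t. ennreal (if t : {0..R} then t powr (-2/3) else 0))"
   using True by (intro nn_integral_cong) (auto simp: indicator_def)
   ultimately show ?thesis by simp
  next
   case False
   then have "ennreal (?f t) * ind {0..} t = 0" for t by (auto simp: indicator_def)
   then show ?thesis by (simp only: nn_integral_0_iff_AE) simp
  qed
 qed (auto simp: indicator_def)
 have "(\<integral>\<^sup>+x. ennreal (norm (ind (cball 0 R) x * (norm x) powr (-4/3))) \<partial>(lborel :: plane measure))
  <= (\<integral>\<^sup>+x. ennreal (?f (x $ 1) * ?f (x $ 2)) \<partial>(lborel :: plane measure))"
 proof (rule nn_integral_mono_AE)
  have "AE x in (lborel :: plane measure). x $ i ~= 0" for i
  proof -
   have "negligible {x :: plane. x $ i = 0}" by (rule negligible_standard_hyperplane_cart)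
   then have "{x :: plane. x $ i = 0} : null_sets lebesgue" by (simp add: negligible_iff_null_sets)
   moreover have "{x :: plane. x $ i = 0} : sets lborel" unfolding sets_lborel by (intro borel_closed closed_Collect_eq continuous_intros)
   ultimately have "{x :: plane. x $ i = 0} : null_sets lborel" by (auto simp: null_sets_def)
   then show ?thesis by (rule AE_I'[of _ lborel]) auto
  qed
  from this[of 1] this[of 2]
  show "AE x in (lborel :: plane measure). ennreal (norm (ind (cball 0 R) x * (norm x) powr (-4/3))) <= ennreal (?f (x $ 1) * ?f (x $ 2))"
  proof eventually_elim
   fix x :: plane assume x: "x $ 1 ~= 0" "x $ 2 ~= 0"
   show "ennreal (norm (ind (cball 0 R) x * (norm x) powr (-4/3))) <= ennreal (?f (x $ 1) * ?f (x $ 2))"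
   proof (cases "x : cball 0 R")
   case True
   have "abs (x $ i) <= R" for i using component_le_norm_cart[of x i] True by simp
   then have ind: "x $ i : {-R..R}" for i by (simp add: abs_le_iff minus_le_iff)
   have "abs (x $ 1) * abs (x $ 2) <= (norm x)^2"
   proof -
   have "2 * (abs (x $ 1) * abs (x $ 2)) <= (norm x)^2"
   using sum_squares_bound[of "abs (x $ 1)" "abs (x $ 2)"] unfolding norm_plane by (simp add: mult.assoc)
   moreover have "0 <= abs (x $ 1) * abs (x $ 2)" by simp
   ultimately show ?thesis by linarith
   qed
   moreover have "0 < abs (x $ 1) * abs (x $ 2)" using x by simp
   ultimately have "((norm x)^2) powr (-2/3) <= (abs (x $ 1) * abs (x $ 2)) powr (-2/3)"
   by (intro powr_mono2') auto
   moreover have "((norm x)^2) powr (-2/3) = (norm x) powr (-4/3)"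
   using x by (simp add: powr_powr flip: powr_numeral)
   ultimately show ?thesis using True ind by (intro ennreal_leI) (simp add: powr_mult)
   qed simp
  qed
 qed
 also have "... < \<infinity>" by (rule nn_integral_plane_product[OF _ _ f1]) auto
 finally show "(\<integral>\<^sup>+x. ennreal (norm (ind (cball 0 R) x * (norm x) powr (-4/3))) \<partial>(lborel :: plane measure)) < \<infinity>" .
 show "(%x::plane. ind (cball 0 R) x * (norm x) powr (-4/3)) : borel_measurable lborel"
  using closed_cball[of "0::plane" R] by (intro borel_measurable_times borel_measurable_indicator powr_real_measurable borel_measurable_norm borel_measurable_const) auto
qed

lemma lborel_scale:
 fixes f :: "plane => real"
 assumes "c > 0" "f : BM"
 shows "(LI x. f x) = c^2 * (LI x. f (c *R x))"
proof -
 have "(lborel :: plane measure) = density (distr lborel borel (%x. 0 + c *R x)) (%_. ennreal (abs c^DIM(plane)))"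
  using assms by (intro lborel_affine) auto
 then have "(LI x. f x) = (\<integral>x. f x \<partial>density (distr lborel borel (%x. 0 + c *R x)) (%_. ennreal (abs c^DIM(plane))))"
  by simp
 also have "... = c^2 * (LI x. f (c *R x))"
  using assms by (subst integral_density) (auto simp: integral_distr)
 finally show ?thesis .
qed

text \<open>Again a product majorant: (1 + |x|^2)^2 is at least (1 + x_1^2)(1 + x_2^2).\<close>

lemma arctan_kernel_integrable:
 "integ (%x::plane. 2 / (1 + (norm x)^2)^2)"
proof (rule integrableI_bounded)
 let ?f = "%t. 1 / (1 + t^2) :: real"
 have pos: "0 < 1 + t^2" for t :: real by (simp add: add_pos_nonneg)
 have f1: "(NI t. ennreal (?f t)) < \<infinity>"
 proof (rule nn_integral_even)
  have "(NI t. ennreal (?f t) * ind {0..} t) = ennreal (pi / 2 - arctan 0)"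
   by (rule nn_integral_FTC_atLeast) (auto intro!: derivative_eq_intros tendsto_arctan_at_top simp: pos less_imp_le divide_simps)
  then show "(NI t. ennreal (?f t) * ind {0..} t) < \<infinity>" by simp
 qed auto
 have "(\<integral>\<^sup>+x. ennreal (norm (2 / (1 + (norm x)^2)^2)) \<partial>(lborel :: plane measure))
  <= (\<integral>\<^sup>+x. ennreal 2 * ennreal (?f (x $ 1) * ?f (x $ 2)) \<partial>(lborel :: plane measure))"
 proof (intro nn_integral_mono)
  fix x :: plane
  have "(1 + (x $ 1)^2) * (1 + (x $ 2)^2) <= (1 + (norm x)^2) * (1 + (norm x)^2)"
   unfolding norm_plane by (intro mult_mono) auto
  then have "2 / (1 + (norm x)^2)^2 <= 2 * (?f (x $ 1) * ?f (x $ 2))"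
   using pos[of "x $ 1"] pos[of "x $ 2"] by (simp add: power2_eq_square[of "1 + _"] frac_le)
  then show "ennreal (norm (2 / (1 + (norm x)^2)^2)) <= ennreal 2 * ennreal (?f (x $ 1) * ?f (x $ 2))"
   by (subst ennreal_mult[symmetric]) (auto intro: ennreal_leI)
 qed
 also have "... = ennreal 2 * (\<integral>\<^sup>+x. ennreal (?f (x $ 1) * ?f (x $ 2)) \<partial>(lborel :: plane measure))"
  by (rule nn_integral_cmult) auto
 also have "... < \<infinity>" using nn_integral_plane_product[OF _ _ f1] by (simp add: ennreal_mult_less_top)
 finally show "(\<integral>\<^sup>+x. ennreal (norm (2 / (1 + (norm x)^2)^2)) \<partial>(lborel :: plane measure)) < \<infinity>" .
qed auto

text \<open>The regularised logarithm, whose Laplacian is an approximate identity up to a constant factor.\<close>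

definition reglog :: "real => plane => real" where
 "reglog h x = ln (x \<bullet> x + h^2) / 2"

lemma
 assumes h: "h > 0"
 shows partial_reglog: "pd i (reglog h) = (%x. x $ i * inverse (x \<bullet> x + h^2))"
  and partial2_reglog: "pd j (pd i (reglog h)) x =
   (if i = j then 1 else 0) / (x \<bullet> x + h^2) - 2 * (x $ i) * (x $ j) / (x \<bullet> x + h^2)^2"
  and Ck_partial_reglog: "Ck_on k UNIV (pd i (reglog h))"
  and Ck_reglog: "Ck_on (Suc k) UNIV (reglog h)"
  and lap_reglog: "lap (reglog h) x = 2 * h^2 / (x \<bullet> x + h^2)^2"
proof -
 let ?S = "%x::plane. x \<bullet> x + h^2"
 have pos: "?S x > 0" for x :: plane using h by (simp add: add_nonneg_pos)
 have d: "(?S has_derivative (%k. 2 * (x \<bullet> k))) (at x)" for x :: plane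
  by (auto intro!: derivative_eq_intros simp: inner_commute)
 have dS: "?S differentiable (at x)" for x :: plane using d unfolding differentiable_def by blast
 have pS: "pd i ?S x = 2 * x $ i" for i x using partial_eqI[OF d] by simp
 have "((%s. ln s / 2) has_real_derivative (inverse (?S x) / 2)) (at (?S x))" for x :: plane
  using pos[of x] by (auto intro!: derivative_eq_intros simp: field_simps)
 from partial_chain[OF dS this] pS
 have p: "pd i (reglog h) x = x $ i * inverse (?S x)" and dR: "reglog h differentiable (at x)" for i x
  by (auto simp: reglog_def[abs_def])
 show p1: "pd i (reglog h) = (%x. x $ i * inverse (?S x))" for i using p by auto
 have "Ck_on k UNIV ?S" for k
 proof -
  have "(%x::plane. x \<bullet> x + h^2) = (%x. (x $ 1 * x $ 1 + x $ 2 * x $ 2) + h^2)"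
   by (auto simp: inner_vec_def sum_2)
  moreover have "Ck_on k UNIV (%x::plane. (x $ 1 * x $ 1 + x $ 2 * x $ 2) + h^2)"
   by (intro Ck_on_add Ck_on_mult Ck_on_nth Ck_on_const open_UNIV)
  ultimately show ?thesis by simp
 qed
 then have ci: "Ck_on k UNIV (%x. inverse (?S x))" for k
  using pos by (intro Ck_on_inverse) (auto simp: less_imp_neq[THEN not_sym])
 show c: "Ck_on k UNIV (pd i (reglog h))" for k i
  unfolding p1 by (intro Ck_on_mult ci) auto
 show "Ck_on (Suc k) UNIV (reglog h)" for k using c dR by simp
 show p2: "pd j (pd i (reglog h)) x = (if i = j then 1 else 0) / ?S x - 2 * (x $ i) * (x $ j) / (?S x)^2" for i j x
 proof -
  have "(%x. inverse (?S x)) differentiable (at x)" using ci[of 1] by simp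
  moreover have "pd j (%x. inverse (?S x)) x = - (2 * x $ j) / (?S x)^2"
   using partial_inverse[OF dS] pos[of x] by (simp add: pS)
  ultimately have "pd j (%x. x $ i * inverse (?S x)) x = x $ i * (- (2 * x $ j) / (?S x)^2) + (if j = i then 1 else 0) * inverse (?S x)"
   by (simp only: partial_mult[OF differentiable_nth] partial_nth)
  then show ?thesis unfolding p1 by (auto simp: divide_inverse)
 qed
 show "lap (reglog h) x = 2 * h^2 / (?S x)^2" for x
 proof -
  have "lap (reglog h) x = 2 / ?S x - (2 * x $ 1 * x $ 1 + 2 * x $ 2 * x $ 2) / (?S x)^2"
   unfolding lap_def p2 by (simp add: sum_2 add_divide_distrib)
  also have "2 * x $ 1 * x $ 1 + 2 * x $ 2 * x $ 2 = 2 * (x \<bullet> x)" by (simp add: inner_vec_def sum_2)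
  also have "2 / ?S x - 2 * (x \<bullet> x) / (?S x)^2 = 2 * h^2 / (?S x)^2"
  proof -
   have "2 / S - 2 * (S - k) / S^2 = 2 * k / S^2" if "S ~= 0" for S k :: real
   using that by (simp add: field_simps power2_eq_square)
   from this[of "?S x" "h^2"] pos[of x] show ?thesis by simp
  qed
  finally show ?thesis .
 qed
qed

lemma smooth_translate:
 assumes "smooth u"
 shows "smooth (%x. u (x + a))" "pd j (%x. u (x + a)) = (%x. pd j u (x + a))"
proof -
 have d: "((%x. v (x + a)) has_derivative (%h. grad v (x + a) \<bullet> h)) (at x)" if "smooth v" for v x
 proof -
  have "((%x. x + a) has_derivative (%h. h)) (at x)" by (auto intro!: derivative_eq_intros)
  from has_derivative_compose[OF this has_derivative_grad[OF smooth_differentiable[OF that]]] show ?thesis .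
 qed
 have p: "pd j (%x. v (x + a)) = (%x. pd j v (x + a))" if "smooth v" for v j
  using partial_eqI[OF d[OF that]] by auto
 show "smooth (%x. u (x + a))"
 proof (rule smooth_coinduct[of "%w. EX v. smooth v & w = (%x. v (x + a))"])
  show "EX v. smooth v & pd i w = (%x. v (x + a))" if "EX v. smooth v & w = (%x. v (x + a))" for w i
   using that p smooth_partial by blast
  show "w differentiable (at x)" if "EX v. smooth v & w = (%x. v (x + a))" for w x
   using that d unfolding differentiable_def by blast
 qed (use assms in blast)
 show "pd j (%x. u (x + a)) = (%x. pd j u (x + a))" by (rule p[OF assms])
qed

text \<open>Three integrations by parts and the symmetry of second derivatives move the Laplacian
  onto the kernel, where it is an explicit positive bump.\<close>

lemma reglog_parts:
 assumes s: "smooth phi" "compact K" "!!x. x ~: K ==> phi x = 0" and h: "h > 0"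
 shows "(LI y. lap phi y * pd i (reglog h) y) = - (LI y. pd i phi y * lap (reglog h) y)"
proof -
 have sm: "smooth (pd i phi)" for i by (rule smooth_partial[OF s(1)])
 have z1: "x ~: K ==> pd i phi x = 0" for i x by (rule cpt_partial[OF s])
 have z2: "x ~: K ==> pd j (pd i phi) x = 0" for i j x by (rule cpt_partial[OF sm s(2) z1])
 let ?G = "reglog h"
 have cG: "Ck_on 1 UNIV ?G" "Ck_on 1 UNIV (pd i ?G)" for i
  using Ck_reglog[OF h, of 0] Ck_partial_reglog[OF h, of 1] by simp_all
 have comm: "pd j (pd i ?G) x = pd i (pd j ?G) x" for i j x
  unfolding partial2_reglog[OF h] by auto
 have ic: "integ (%y. u y * v y)" if "continuous_on UNIV u" "continuous_on UNIV v" "!!x. x ~: K ==> v x = 0" for u v :: "plane => real"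
  using that s(2) by (intro integrable_mult_cpt[of K]) (auto intro: continuous_on_subset)
 have each: "(LI y. pd i ?G y * pd j (pd j phi) y) = - (LI y. pd j (pd j ?G) y * pd i phi y)" for j
 proof -
  have "(LI y. pd i ?G y * pd j (pd j phi) y) = - (LI y. pd j (pd i ?G) y * pd j phi y)"
   by (rule smooth_parts[OF cG(2) sm s(2) z1])
  also have "... = - (LI y. pd i (pd j ?G) y * pd j phi y)" by (simp only: comm[of j i])
  also have "... = (LI y. pd j ?G y * pd i (pd j phi) y)"
   by (rule smooth_parts[OF cG(2) sm s(2) z1, symmetric])
  also have "... = (LI y. pd j ?G y * pd j (pd i phi) y)"
   using partial_commute[OF s, of i j] by simp
  also have "... = - (LI y. pd j (pd j ?G) y * pd i phi y)"
   by (rule smooth_parts[OF cG(2) sm s(2) z1])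
  finally show ?thesis .
 qed
 have cc: "continuous_on UNIV (pd i ?G)" "continuous_on UNIV (pd j (pd i ?G))" for i j
  using cG(2)[of i] Ck_on_imp_continuous_on[OF cG(2)[of i]] by auto
 have "(LI y. lap phi y * pd i ?G y) = (SUM j:UNIV. (LI y. pd i ?G y * pd j (pd j phi) y))"
  unfolding lap_def sum_distrib_right using z2
  by (subst Bochner_Integration.integral_sum) (auto simp: mult.commute[of _ "pd i ?G _"] intro!: ic cc smooth_continuous smooth_partial s)
 also have "... = - (SUM j:UNIV. (LI y. pd j (pd j ?G) y * pd i phi y))"
  by (simp add: each sum_negf)
 also have "(SUM j:UNIV. (LI y. pd j (pd j ?G) y * pd i phi y)) = (LI y. pd i phi y * lap ?G y)"
  unfolding lap_def sum_distrib_left using z1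
  by (subst Bochner_Integration.integral_sum) (auto simp: mult.commute[of "pd i phi _"] intro!: ic cc smooth_continuous smooth_partial s)
 finally show ?thesis .
qed

text \<open>Young's inequality with exponents 4 and 4/3: comparing \<open>a\<close> with t^(-1/3)
  decides which of the two terms dominates.\<close>

lemma young_kernel: "a >= 0 ==> t > 0 ==> a * (1 / t) <= a ^ 4 + t powr (-4/3)" for a t :: real
proof -
 assume a: "a >= 0" and t: "t > 0"
 show ?thesis
 proof (cases "a <= t powr (-1/3)")
  case True
  have "a * (1 / t) <= t powr (-1/3) * t powr (-1)" using True t by (intro mult_mono) (auto simp: powr_minus_divide)
  also have "... = t powr (-4/3)" by (subst powr_add[symmetric]) simp
  finally show ?thesis using a by (simp add: add_increasing)
 next
  case False
  then have p1: "(t powr (-1/3)) ^ 3 <= a ^ 3" by (intro power_mono) auto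
  have p2: "(t powr (-1/3)) ^ 3 = 1 / t"
  proof -
   have "(t powr (-1/3)) ^ 3 = t powr (-1/3 + -1/3 + -1/3)" by (simp only: power3_eq_cube powr_add)
   also have "... = 1 / t" using t by (simp add: powr_minus_divide)
   finally show ?thesis .
  qed
  have "a * (1 / t) <= a * a ^ 3" using a p1 unfolding p2 by (intro mult_left_mono)
  also have "... = a ^ 4" by (simp add: eval_nat_numeral)
  finally show ?thesis by (simp add: add_increasing2)
 qed
qed

text \<open>After scaling, the Laplacian of \<open>reglog h\<close> is a fixed positive kernel of
  mass \<open>c0\<close> that concentrates at 0 as h -> 0, so pairing it with the partial derivative
  recovers \<open>c0\<close> times the value at one point. Moving the Laplacian back onto phi leaves
  a kernel of size at most 1/|y|, which \<open>young_kernel\<close> splits.\<close>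

lemma gradient_sup_bound:
 obtains C where "C >= 0" "!!phi x0 R i x. smooth phi ==> ALL x. x ~: cball x0 R --> phi x = 0 ==>
  abs (pd i phi x) <= C * ((LI y. (lap phi y) ^ 4) + (LI y. ind (cball (0::plane) (2 * R)) y * (norm y) powr (-4/3)))"
proof -
 define m where "m = (%z::plane. 2 / (1 + (norm z)^2)^2)"
 define c0 where "c0 = (LI z. m z)"
 have pos1: "1 + (norm z)^2 > 0" for z :: plane by (simp add: add_pos_nonneg)
 have mpos: "m z > 0" for z using pos1[of z] by (simp add: m_def)
 have im: "integ m" unfolding m_def by (rule arctan_kernel_integrable)
 then have [measurable]: "m : BM" by auto
 have c0: "c0 > 0"
 proof -
  have "c0 ~= 0"
  proof
   assume "c0 = 0"
   then have "AEL z. m z = 0"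
   using integral_nonneg_eq_0_iff_AE[OF im] mpos by (simp add: c0_def less_imp_le)
   then have "AEL z::plane. False" by (rule eventually_mono) (use mpos in \<open>metis less_irrefl\<close>)
   then have "ae_filter (lborel :: plane measure) = bot" by (simp add: trivial_limit_def)
   then show False by (simp add: ae_filter_eq_bot_iff)
  qed
  moreover have "c0 >= 0" unfolding c0_def using mpos by (intro integral_nonneg_AE) (auto intro: less_imp_le)
  ultimately show ?thesis by simp
 qed
 have main: "c0 * abs (pd i phi x) <= (LI y. (lap phi y) ^ 4) + (LI y. ind (cball (0::plane) (2 * R)) y * (norm y) powr (-4/3))"
  (is "_ <= ?I + ?J")
  if s: "smooth phi" "!!x. x ~: cball x0 R ==> phi x = 0" and xB: "x : cball x0 R" for phi x0 R i x
 proof -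
  \<comment> \<open>Translation puts the evaluation point at the origin; the support then lies in a
    ball of twice the radius.\<close>
  define u where "u = (%y. phi (y + x))"
  have su: "smooth u" unfolding u_def by (rule smooth_translate(1)[OF s(1)])
  have pu: "pd j u y = pd j phi (y + x)" "pd k (pd j u) y = pd k (pd j phi) (y + x)" for j k y
   unfolding u_def smooth_translate(2)[OF s(1)] smooth_translate(2)[OF smooth_partial[OF s(1)]] by auto
  have lu: "lap u y = lap phi (y + x)" for y by (simp add: lap_def pu)
  let ?K = "cball (0::plane) (2 * R)"
  have uz: "u y = 0" if "y ~: ?K" for y
   unfolding u_def
  proof (rule s(2))
   show "y + x ~: cball x0 R"
   proof
   assume "y + x : cball x0 R"
   then have "dist x (y + x) <= 2 * R" using xB dist_triangle[of x "y + x" x0] by (simp add: dist_commute)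
   then show False using that by (simp add: dist_norm)
   qed
  qed
  have sp: "smooth (pd j u)" for j by (rule smooth_partial[OF su])
  have z1: "y ~: ?K ==> pd j u y = 0" for j y by (rule cpt_partial[OF su compact_cball uz])
  have z2: "lap u y = 0" if "y ~: ?K" for y
  proof -
   have "pd j (pd j u) y = 0" for j by (rule cpt_partial[OF sp compact_cball z1 that])
   then show ?thesis by (simp add: lap_def)
  qed
  have cl: "continuous_on UNIV (lap u)" "continuous_on UNIV (pd i u)"
   unfolding lap_def[abs_def]
   by (rule continuous_on_sum, rule smooth_continuous, intro smooth_partial su)
   (intro smooth_continuous smooth_partial su)
  have nl: "nice (lap u)" by (rule continuous_cpt_nice[OF cl(1) compact_cball z2])
  have n4: "integ (%y. (lap u y) ^ 4)"
   using nice_integrable[OF nice_square[OF nice_square[OF nl]]] by simp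
  obtain B where B: "!!y. abs (pd i u y) <= B" using continuous_cpt_bounded[OF cl(2) compact_cball z1] by metis
  have [measurable]: "pd i u : BM" by (rule borel_measurable_continuous_onI[OF cl(2)])
  have bound: "abs ((LI y. pd i u y * lap (reglog h) y)) <= ?I + ?J" if h: "h > 0" for h
  proof -
   have cr: "continuous_on UNIV (pd i (reglog h))" using Ck_partial_reglog[OF h, of 0] by simp
   have "abs ((LI y. pd i u y * lap (reglog h) y)) = abs ((LI y. lap u y * pd i (reglog h) y))"
   using reglog_parts[OF su compact_cball[of 0 "2 * R"] uz h, where i=i] by simp
   also have "... <= (LI y. abs (lap u y * pd i (reglog h) y))" by (rule integral_abs_bound)
   also have "... <= (LI y. (lap u y) ^ 4 + ind ?K y * (norm y) powr (-4/3))"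
   proof (rule integral_mono_AE)
   have "integ (%y. pd i (reglog h) y * lap u y)"
   using z2 by (intro integrable_mult_cpt[of ?K]) (auto intro: continuous_on_subset[OF cr] continuous_on_subset[OF cl(1)])
   then show "integ (%y. abs (lap u y * pd i (reglog h) y))" by (simp add: mult.commute)
   show "AEL y. abs (lap u y * pd i (reglog h) y) <= (lap u y) ^ 4 + ind ?K y * (norm y) powr (-4/3)"
   using AE_lborel_singleton[of 0]
   proof eventually_elim
   fix y :: plane assume y: "y ~= 0"
   show "abs (lap u y * pd i (reglog h) y) <= (lap u y) ^ 4 + ind ?K y * (norm y) powr (-4/3)"
   proof (cases "y : ?K")
   case True
   have "abs (pd i (reglog h) y) <= 1 / norm y"
   proof -
   have "abs (y $ i) * norm y <= (norm y)^2 + h^2"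
   using mult_right_mono[OF component_le_norm_cart[of y i], of "norm y"] by (simp add: power2_eq_square add_increasing2)
   then show ?thesis
   using y unfolding partial_reglog[OF h] power2_norm_eq_inner[symmetric]
   by (simp add: abs_mult divide_simps add_pos_nonneg abs_of_nonneg)
   qed
   then have "abs (lap u y * pd i (reglog h) y) <= abs (lap u y) * (1 / norm y)"
   unfolding abs_mult by (intro mult_left_mono) auto
   also have "... <= abs (lap u y) ^ 4 + (norm y) powr (-4/3)" using y by (intro young_kernel) auto
   finally show ?thesis using True by (simp add: power_even_abs)
   qed (simp add: z2)
   qed
   qed (use n4 riesz_kernel_integrable in auto)
   also have "... = (LI y. (lap u y) ^ 4) + ?J"
   using n4 riesz_kernel_integrable[of "2 * R"] by simp
   also have "(LI y. (lap u y) ^ 4) = ?I"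
   unfolding lu using lborel_integral_translate(1)[of "%y. (lap phi y) ^ 4" x] by simp
   finally show ?thesis .
  qed
  have scale: "(LI y. pd i u y * lap (reglog h) y) = (LI z. pd i u (h *R z) * m z)" if h: "h > 0" for h
  proof -
   have "(%y. lap (reglog h) y) = (%y. 2 * h^2 / (y \<bullet> y + h^2)^2)" using lap_reglog[OF h] by auto
   then have [measurable]: "lap (reglog h) : BM" by simp
   have "(LI y. pd i u y * lap (reglog h) y) = h^2 * (LI z. pd i u (h *R z) * lap (reglog h) (h *R z))"
   by (rule lborel_scale[OF h]) simp
   also have "... = (LI z. h^2 * (pd i u (h *R z) * lap (reglog h) (h *R z)))" by simp
   also have "... = (LI z. pd i u (h *R z) * m z)"
   proof (rule lint_cong)
   fix z :: plane
   have "(h *R z) \<bullet> (h *R z) + h^2 = h^2 * (1 + (norm z)^2)"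
   unfolding power2_norm_eq_inner by (simp add: power2_eq_square algebra_simps)
   then have "lap (reglog h) (h *R z) = 2 * h^2 / (h^2 * (1 + (norm z)^2))^2" by (simp only: lap_reglog[OF h])
   then have "h^2 * lap (reglog h) (h *R z) = m z"
   using h pos1[of z] unfolding m_def by (simp add: power_mult_distrib power2_eq_square)
   then show "h^2 * (pd i u (h *R z) * lap (reglog h) (h *R z)) = pd i u (h *R z) * m z"
   by (metis mult.left_commute)
   qed simp
   finally show ?thesis .
  qed
  let ?h = "%n. 1 / real (Suc n)"
  have "(%n. (LI z. pd i u (?h n *R z) * m z)) ~~> (LI z. pd i u 0 * m z)"
  proof (rule integral_dominated_convergence[where w="%z. B * m z"])
   show "AEL z. (%n. pd i u (?h n *R z) * m z) ~~> pd i u 0 * m z"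
   proof (intro AE_I2 tendsto_mult tendsto_const)
   fix z :: plane
   have "(%n. ?h n *R z) ~~> 0 *R z"
   by (intro tendsto_scaleR lim_1_over_n[THEN LIMSEQ_Suc] tendsto_const)
   then show "(%n. pd i u (?h n *R z)) ~~> pd i u 0"
   by (intro continuous_on_tendsto_compose[OF cl(2)]) auto
   qed
   show "AEL z. norm (pd i u (?h n *R z) * m z) <= B * m z" for n
   using B mpos by (intro AE_I2) (auto simp: abs_mult less_imp_le intro!: mult_right_mono)
  qed (use im in auto)
  then have "(%n. abs ((LI z. pd i u (?h n *R z) * m z))) ~~> abs (pd i u 0 * c0)"
   unfolding c0_def by (intro tendsto_rabs) simp
  then have "abs (pd i u 0 * c0) <= ?I + ?J"
   by (rule LIMSEQ_le_const2) (use bound scale in \<open>auto intro!: exI[of _ 0] simp del: of_nat_Suc\<close>)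
  then show ?thesis using c0 by (simp add: abs_mult pu mult.commute)
 qed
 show ?thesis
 proof (rule that[of "1 / c0"])
  fix phi x0 R i x assume s': "smooth phi" "ALL x. x ~: cball x0 R --> phi x = 0"
  note s = s'(1) s'(2)[rule_format]
  show "abs (pd i phi x) <= 1 / c0 * ((LI y. (lap phi y) ^ 4) + (LI y. ind (cball (0::plane) (2 * R)) y * (norm y) powr (-4/3)))"
  proof (cases "x : cball x0 R")
   case True
   have "c0 * abs (pd i phi x) <= (LI y. (lap phi y) ^ 4) + (LI y. ind (cball (0::plane) (2 * R)) y * (norm y) powr (-4/3))"
   by (rule main[OF s True])
   then show ?thesis using c0 by (simp add: field_simps)
  next
   case False
   then have "pd i phi x = 0" using s by (intro cpt_partial[OF s(1) compact_cball[of x0 R]]) auto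
   then show ?thesis using c0 by (auto intro!: mult_nonneg_nonneg add_nonneg_nonneg integral_nonneg_AE)
  qed
 qed (use c0 in simp)
qed

section \<open>Local regularity of weak solutions\<close>

text \<open>Bounded weak solutions of -div(U / b) = b z with U the weak gradient of u. One constant
  M bounds u, z and the Dirichlet integrals, so that estimates can be stated uniformly over all such
  solutions.\<close>

definition wsol :: "plane set => (plane => real) => real => (plane => real) => (2 => plane => real) => (plane => real) => bool" where
 "wsol D b M u U z \<longleftrightarrow> u : BM & z : BM \<and>
  (ALL x. abs (u x) <= M) & (ALL x. abs (z x) <= M) & (ALL i. U i : BM & wpd D i u (U i) \<and>
   integ (%x. ind D x * (U i x)^2) & (LI x. ind D x * (U i x)^2) <= M) \<and>
  (ALL phi. test_fun D phi --> (SUM i:UNIV. (LI x. (inverse (b x) * U i x) * pd i phi x)) = (LI x. (b x * z x) * phi x))"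

lemma wsolD:
 assumes "wsol D b M u U z"
 shows "u : BM" "z : BM" "abs (u x) <= M" "abs (z x) <= M"
  "U i : BM" "wpd D i u (U i)" "integ (%x. ind D x * (U i x)^2)"
  "(LI x. ind D x * (U i x)^2) <= M"
  "test_fun D phi ==> (SUM i:UNIV. (LI x. (inverse (b x) * U i x) * pd i phi x)) = (LI x. (b x * z x) * phi x)"
 using assms by (auto simp: wsol_def)

text \<open>Expanding -div(grad u / b) = b z gives lap u = (grad b . grad u) / b - b^2 z; this is
  the right-hand side.\<close>

definition lapF :: "(plane => real) => (2 => plane => real) => (plane => real) => plane => real" where
 "lapF b U z x = (SUM i:UNIV. (inverse (b x) * pd i b x) * U i x) + (- (b x * b x)) * z x"

lemma loc_int_bounded:
 fixes f :: "plane => real"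
 assumes "f : BM" "!!x. abs (f x) <= M"
 shows "loc_int D f"
 unfolding loc_int_def
proof (intro allI impI)
 fix K assume K: "compact K & K <= D"
 show "integ (%x. ind K x * f x)"
  by (rule integrable_bounded_mult(1)[OF integrable_indicator_cpt]) (use K assms in auto)
qed

lemma loc_int_sum: "finite I ==> (!!i. i : I ==> loc_int D (f i)) ==> loc_int D (%x. SUM i:I. f i x)"
proof (induction I rule: finite_induct)
 case empty
 then show ?case by (simp add: loc_int_def)
next
 case (insert i I)
 then show ?case by (simp add: loc_int_add)
qed

lemma integral_sum2:
 fixes f :: "2 => plane => real"
 assumes "!!i. integ (f i)"
 shows "(LI x. (SUM i:UNIV. f i x)) = (SUM i:UNIV. (LI x. f i x))"
 using assms by (intro Bochner_Integration.integral_sum) auto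

text \<open>A parametrised substitute for Cauchy-Schwarz: choosing \<open>s\<close> afterwards
  converts smallness in L^2 into smallness in L^1 on sets of finite measure.\<close>

lemma abs_le_sq: "abs v <= s + v * v / s" if "s > 0" for s v :: real
proof -
 have "0 <= (s - abs v)^2" by simp
 then have "2 * (s * abs v) <= s * s + v * v" by (simp add: power2_eq_square algebra_simps)
 moreover have "0 <= s * abs v" using that by simp
 ultimately have "s * abs v <= s * s + v * v" by linarith
 then show ?thesis using that by (simp add: field_simps)
qed

text \<open>The cutoff is the indicator of the \<open>e / 2\<close>-neighbourhood, mollified at a
  scale below \<open>e / 4\<close>.\<close>

lemma cutoff_compact:
 fixes K :: "plane set" and e :: real
 assumes K: "compact K" and e: "e > 0"
 obtains xi :: "plane => real" where "smooth xi" "!!x. x ~: (UN y:K. cball y e) ==> xi x = 0"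
  "!!x y. y : K ==> dist y x <= e / 4 ==> xi x = 1"
proof -
 let ?J = "UN y:K. cball y (e / 2)"
 let ?f = "indicat_real ?J"
 obtain n where n: "1 / real (Suc n) < e / 4"
  using eventually_small[of "e / 4"] e by (auto simp: eventually_sequentially)
 have J: "compact ?J" by (rule compact_thicken[OF K])
 have f: "integ ?f" by (rule integrable_indicator_cpt[OF J])
 show ?thesis
 proof (rule that[of "mcv n ?f"])
  show "smooth (mcv n ?f)" by (rule smooth_mcv[OF f])
  show "mcv n ?f x = 0" if x: "x ~: (UN y:K. cball y e)" for x
  proof (rule mcv_zero)
   fix t assume "t : cball x (1 / real (Suc n))"
   then have t: "dist x t < e / 4" using n by (simp del: of_nat_Suc)
   have "t ~: ?J"
   proof
   assume "t : ?J"
   then obtain y where "y : K" "dist y t <= e / 2" by auto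
   then show False using x t dist_triangle[of y x t] e by (auto simp: dist_commute)
   qed
   then show "?f t = 0" by simp
  qed
  show "mcv n ?f x = 1" if y: "y : K" "dist y x <= e / 4" for x y
  proof -
   have "mcv n ?f x = mcv n (%_. 1) x"
   proof (rule mcv_local)
   fix t assume "t : cball x (1 / real (Suc n))"
   then have "dist y t <= e / 2" using n y(2) dist_triangle[of y t x] by (simp add: dist_commute del: of_nat_Suc)
   then show "?f t = 1" using y(1) by (auto simp: indicator_def)
   qed
   then show ?thesis by (simp add: cv_def integral_moll_shift)
  qed
 qed
qed

locale lake_coeff =
 fixes D :: "plane set" and b :: "plane => real"
 assumes D: "open D" and b1: "Ck_on 1 D b" and bpos: "!!x. x : D ==> b x > 0"
begin

lemma b_cont: "continuous_on D b" "continuous_on D (pd i b)" "continuous_on D (%x. inverse (b x))"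
 "Ck_on 1 D (%x. inverse (b x))"
proof -
 show 1: "continuous_on D b" "continuous_on D (pd i b)" using b1 Ck_on_imp_continuous_on[OF b1] by auto
 show "Ck_on 1 D (%x. inverse (b x))" using bpos by (intro Ck_on_inverse D b1) (auto simp: less_imp_neq[THEN not_sym])
 then show "continuous_on D (%x. inverse (b x))" by (rule Ck_on_imp_continuous_on)
qed

lemma wsol_loc_int:
 assumes "wsol D b M u U z"
 shows "loc_int D u" "loc_int D (U i)" "loc_int D z" "loc_int D (lapF b U z)" "loc_int D (%x. inverse (b x) * U i x)"
  "loc_int D (%x. b x * z x)"
proof -
 note w = wsolD[OF assms]
 show 1: "loc_int D u" "loc_int D (U i)" for i using w(6) by (auto simp: wpd_def)
 show 2: "loc_int D z" by (rule loc_int_bounded[OF w(2,4)])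
 show "loc_int D (%x. inverse (b x) * U i x)" "loc_int D (%x. b x * z x)"
  by (intro loc_int_mult_C 1 2 b_cont)+
 show "loc_int D (lapF b U z)"
  unfolding lapF_def by (intro loc_int_add loc_int_sum loc_int_mult_C 1 2 continuous_intros b_cont) auto
qed

text \<open>Testing the divergence-form equation with \<open>b\<close> times a test function.\<close>

lemma laplace_identity:
 assumes w: "wsol D b M u U z" and c: "C1c K phi" "K <= D"
 shows "(SUM i:UNIV. (LI x. U i x * pd i phi x)) = - (LI x. lapF b U z x * phi x)"
proof -
 note l = wsol_loc_int[OF w] and p = C1cD[OF c(1)]
 note m = C1c_mult[OF D b1 c] and K = C1cD(1)[OF c(1)]
 have "(SUM i:UNIV. (LI x. (inverse (b x) * U i x) * pd i (%x. b x * phi x) x)) = - (LI x. (- (b x * z x)) * (b x * phi x))"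
 proof (rule weak_identity_C1c[OF D _ _ _ _ m(1) c(2)])
  show "loc_int D (%x. - (b x * z x))" using loc_int_mult_C[OF l(6), of "%_. -1"] by simp
  show "(SUM i:UNIV. (LI x. (inverse (b x) * U i x) * pd i phi x)) = - (LI x. (- (b x * z x)) * phi x)" if "test_fun D phi" for phi
   using wsolD(9)[OF w that] by simp
 qed (use l in auto)
 moreover have "(inverse (b x) * U i x) * pd i (%x. b x * phi x) x = U i x * pd i phi x + ((inverse (b x) * pd i b x) * U i x) * phi x" for i x
 proof (cases "x : D")
  case True
  then show ?thesis using bpos[OF True] unfolding m(2)[OF True] by (simp add: field_simps)
 next
  case False
  then have "x ~: K" using c(2) by auto
  then show ?thesis using p(5,6) C1cD(6)[OF m(1)] by simp
 qed
 moreover have i1: "integ (%x. U i x * pd i phi x)" for i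
  by (rule loc_int_mult_cont[OF l(2) K c(2) p(3) p(6)])
 moreover have i2: "integ (%x. ((inverse (b x) * pd i b x) * U i x) * phi x)" for i
  by (rule loc_int_mult_cont[OF loc_int_mult_C[OF l(2)] K c(2) p(4) p(5)]) (intro continuous_intros b_cont)
 moreover have i3: "integ (%x. ((- (b x * b x)) * z x) * phi x)"
  by (rule loc_int_mult_cont[OF loc_int_mult_C[OF l(3)] K c(2) p(4) p(5)]) (intro continuous_intros b_cont)
 moreover have "(LI x. lapF b U z x * phi x) = (SUM i:UNIV. (LI x. ((inverse (b x) * pd i b x) * U i x) * phi x)) + (LI x. ((- (b x * b x)) * z x) * phi x)"
 proof -
  have "(LI x. lapF b U z x * phi x) = (LI x. (SUM i:UNIV. ((inverse (b x) * pd i b x) * U i x) * phi x) + ((- (b x * b x)) * z x) * phi x)"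
   unfolding lapF_def distrib_right sum_distrib_right ..
  also have "... = (LI x. (SUM i:UNIV. ((inverse (b x) * pd i b x) * U i x) * phi x)) + (LI x. ((- (b x * b x)) * z x) * phi x)"
   by (intro lint_add Bochner_Integration.integrable_sum i2 i3)
  finally show ?thesis unfolding integral_sum2[OF i2] .
 qed
 ultimately show ?thesis by (simp add: sum.distrib mult_ac)
qed

end

text \<open>Leibniz formulas: \<open>cutv\<close> and \<open>cutw\<close> are the weak gradient and
  Laplacian of u xi, the Laplacian of u being replaced by \<open>lapF\<close>.\<close>

definition cutv :: "(plane => real) => (plane => real) => (2 => plane => real) => 2 => plane => real" where
 "cutv xi u U i x = U i x * xi x + u x * pd i xi x"

definition cutw :: "(plane => real) => (plane => real) => (plane => real) => (2 => plane => real) => (plane => real) => plane => real" where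
 "cutw xi b u U z x = lapF b U z x * xi x + 2 * (SUM i:UNIV. U i x * pd i xi x) + u x * lap xi x"

context lake_coeff
begin

text \<open>Multiplication by \<open>xi\<close> makes the weak derivatives global, so they commute
  with mollification and the estimates for smooth functions apply to the mollified products. In the
  proof \<open>phi\<close> is merely smooth; it is the product with \<open>xi\<close> that is tested
  with.\<close>

lemma cut_identities:
 assumes w: "wsol D b M u U z" and s': "smooth xi" "compact K" "K <= D" "ALL x. x ~: K --> xi x = 0"
 shows "integ (%x. u x * xi x)" "integ (cutv xi u U i)" "integ (cutw xi b u U z)"
  and "pd i (mcv n (%x. u x * xi x)) = mcv n (cutv xi u U i)"
  and "lap (mcv n (%x. u x * xi x)) x = mcv n (cutw xi b u U z) x"
proof -
 note s = s'(1-3) s'(4)[rule_format]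
 note l = wsol_loc_int[OF w]
 have c: "C1c K xi" by (rule smooth_C1c[OF s(1,2,4)])
 note p = C1cD[OF c]
 have sp: "smooth (pd j xi)" for j by (rule smooth_partial[OF s(1)])
 have cp: "C1c K (pd j xi)" for j by (rule smooth_C1c[OF sp s(2) p(6)])
 have cl: "continuous_on UNIV (lap xi)" "x ~: K ==> lap xi x = 0" for x
  using C1cD(3,6)[OF cp] unfolding lap_def[abs_def] by (auto intro!: continuous_on_sum)
 show iw: "integ (%x. u x * xi x)" by (rule loc_int_mult_cont[OF l(1) s(2,3) p(4,5)])
 have i1: "integ (%x. U i x * xi x)" "integ (%x. u x * pd i xi x)" "integ (%x. U i x * pd i xi x)" for i
  using p(3-6) by (auto intro!: loc_int_mult_cont[OF _ s(2,3)] l)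
 show iv: "integ (cutv xi u U i)" for i
  unfolding cutv_def by (intro integ_add i1)
 have i2: "integ (%x. lapF b U z x * xi x)" "integ (%x. u x * lap xi x)"
  using p(3-6) cl by (auto intro!: loc_int_mult_cont[OF _ s(2,3)] l)
 show iW: "integ (cutw xi b u U z)"
  unfolding cutw_def by (intro integ_add integrable_mult_right Bochner_Integration.integrable_sum i1 i2)
 have id1: "(LI x. u x * xi x * pd i phi x) = - (LI x. cutv xi u U i x * phi x)" if f: "smooth phi" for phi i
 proof -
  note m = C1c_mult[OF open_UNIV smooth_Ck[OF f] c subset_UNIV]
  have mp: "pd i (%x. phi x * xi x) x = phi x * pd i xi x + pd i phi x * xi x" for x using m(2)[OF UNIV_I] .
  have w1: "(LI x. u x * pd i (%x. phi x * xi x) x) = - (LI x. U i x * (phi x * xi x))"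
   by (rule wpd_C1c[OF D wsolD(6)[OF w] m(1) s(3)])
  have j: "integ (%x. u x * (phi x * pd i xi x))" "integ (%x. u x * (pd i phi x * xi x))"
   "integ (%x. U i x * (phi x * xi x))"
   using p by (auto intro!: loc_int_mult_cont[OF _ s(2,3)] l smooth_continuous smooth_mult smooth_partial f s(1))
  have "(LI x. u x * (pd i phi x * xi x)) = - ((LI x. U i x * (phi x * xi x)) + (LI x. u x * (phi x * pd i xi x)))"
   using w1 j unfolding mp distrib_left by simp
  then show ?thesis unfolding cutv_def using j by (simp add: algebra_simps)
 qed
 have id2: "(SUM i:UNIV. (LI x. cutv xi u U i x * pd i phi x)) = - (LI x. cutw xi b u U z x * phi x)" if f: "smooth phi" for phi
 proof -
  note m = C1c_mult[OF open_UNIV smooth_Ck[OF f] c subset_UNIV]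
  have mp: "pd i (%x. phi x * xi x) x = phi x * pd i xi x + pd i phi x * xi x" for i x using m(2)[OF UNIV_I] .
  note m2 = C1c_mult[OF open_UNIV smooth_Ck[OF f] cp subset_UNIV]
  have mp2: "pd i (%x. phi x * pd i xi x) x = phi x * pd i (pd i xi) x + pd i phi x * pd i xi x" for i x using m2(2)[OF UNIV_I] .
  have j: "integ (%x. U i x * (phi x * pd i xi x))" "integ (%x. U i x * (pd i phi x * xi x))"
   "integ (%x. u x * (phi x * pd i (pd i xi) x))" "integ (%x. u x * (pd i phi x * pd i xi x))" for i
   using p C1cD[OF cp] by (auto intro!: loc_int_mult_cont[OF _ s(2,3)] l smooth_continuous smooth_mult smooth_partial f s(1))
  have jF: "integ (%x. lapF b U z x * (phi x * xi x))"
   using p by (auto intro!: loc_int_mult_cont[OF _ s(2,3)] l smooth_continuous smooth_mult f s(1))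
  have A: "(SUM i:UNIV. (LI x. U i x * (pd i phi x * xi x))) =
   - (LI x. lapF b U z x * (phi x * xi x)) - (SUM i:UNIV. (LI x. U i x * (phi x * pd i xi x)))"
   using laplace_identity[OF w m(1) s(3)] j unfolding mp distrib_left by (simp add: sum.distrib)
  have B: "(LI x. u x * (pd i phi x * pd i xi x)) =
   - (LI x. U i x * (phi x * pd i xi x)) - (LI x. u x * (phi x * pd i (pd i xi) x))" for i
  proof -
   have "(LI x. u x * pd i (%x. phi x * pd i xi x) x) = - (LI x. U i x * (phi x * pd i xi x))"
   by (rule wpd_C1c[OF D wsolD(6)[OF w] m2(1) s(3)])
   then show ?thesis using j unfolding mp2 distrib_left by simp
  qed
  have "(SUM i:UNIV. (LI x. cutv xi u U i x * pd i phi x))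
   = (SUM i:UNIV. (LI x. U i x * (pd i phi x * xi x)) + (LI x. u x * (pd i phi x * pd i xi x)))"
   unfolding cutv_def using j by (simp add: algebra_simps)
  also have "... = - (LI x. lapF b U z x * (phi x * xi x)) - 2 * (SUM i:UNIV. (LI x. U i x * (phi x * pd i xi x)))
   - (SUM i:UNIV. (LI x. u x * (phi x * pd i (pd i xi) x)))"
   unfolding sum.distrib A B by (simp add: sum_subtractf sum_negf)
  also have "... = - (LI x. cutw xi b u U z x * phi x)"
  proof -
   have "cutw xi b u U z x * phi x = lapF b U z x * (phi x * xi x) + 2 * (SUM i:UNIV. U i x * (phi x * pd i xi x)) + (SUM i:UNIV. u x * (phi x * pd i (pd i xi) x))" for x
   unfolding cutw_def lap_def by (simp add: algebra_simps sum_distrib_left sum_distrib_right)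
   then have "(LI x. cutw xi b u U z x * phi x) = (LI x. lapF b U z x * (phi x * xi x)) + 2 * (LI x. (SUM i:UNIV. U i x * (phi x * pd i xi x)))
   + (LI x. (SUM i:UNIV. u x * (phi x * pd i (pd i xi) x)))"
   using j jF by simp
   then show ?thesis unfolding integral_sum2[OF j(1)] integral_sum2[OF j(3)] by simp
  qed
  finally show ?thesis .
 qed
 have pm: "pd i (mcv n (%x. u x * xi x)) = mcv n (cutv xi u U i)" for i
 proof
  fix x
  have "pd i (mcv n (%x. u x * xi x)) x = - (LI y. u y * xi y * pd i (%y. moll n (x - y)) y)"
   unfolding partial_mcv[OF iw] cv_def moll_shift(2) by simp
  then show "pd i (mcv n (%x. u x * xi x)) x = mcv n (cutv xi u U i) x"
   unfolding id1[OF moll_shift(3)] by (simp add: cv_def)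
 qed
 then show "pd i (mcv n (%x. u x * xi x)) = mcv n (cutv xi u U i)" .
 show "lap (mcv n (%x. u x * xi x)) x = mcv n (cutw xi b u U z) x"
 proof -
  have "lap (mcv n (%x. u x * xi x)) x = (SUM i:UNIV. pd i (mcv n (cutv xi u U i)) x)"
   by (simp add: lap_def pm)
  also have "... = - (SUM i:UNIV. (LI y. cutv xi u U i y * pd i (%y. moll n (x - y)) y))"
   unfolding partial_mcv[OF iv] cv_def moll_shift(2) by (simp add: sum_negf)
  finally show ?thesis unfolding id2[OF moll_shift(3)] by (simp add: cv_def)
 qed
qed

end

section \<open>From estimates for smooth functions to weak solutions\<close>

lemma integrable_nonneg_le:
 fixes f g :: "plane => real"
 assumes "integ g" "f : BM" "AEL x. 0 <= f x & f x <= g x"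
 shows "integ f" "(LI x. f x) <= (LI x. g x)"
proof -
 show i: "integ f"
 proof (rule integ_bound[OF assms(1)])
  show "AEL x. norm (f x) <= norm (g x)" using assms(3) by (rule eventually_mono) auto
 qed (use assms(2) in simp)
 show "(LI x. f x) <= (LI x. g x)"
  by (rule integral_mono_AE[OF i assms(1)]) (use assms(3) in \<open>auto elim!: eventually_mono\<close>)
qed

lemma nonneg_integral_bound:
 fixes f :: "plane => real"
 assumes "f : BM" "!!x. 0 <= f x" "(NI x. ennreal (f x)) <= ennreal C" "C >= 0"
 shows "integ f" "(LI x. f x) <= C"
proof -
 show i: "integ f"
  using assms by (intro integrableI_bounded) (auto simp: le_less_trans[OF _ ennreal_less_top])
 then have "ennreal (LI x. f x) <= ennreal C"
  using nn_integral_eq_integral[OF i] assms(2,3) by simp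
 then show "(LI x. f x) <= C" using assms(4) by (simp add: ennreal_le_iff)
qed

lemma mcv_L2:
 assumes f: "integ f" "integ (%x. (f x)^2)"
 shows "integ (%x. (mcv n f x)^2)" "(LI x. (mcv n f x)^2) <= (LI x. (f x)^2)"
proof -
 have [measurable]: "f : BM" using f by auto
 have "(NI x. ennreal ((mcv n f x)^2)) <= (NI x. ennreal (mcv n (%x. (f x)^2) x))"
  by (intro nn_integral_mono ennreal_leI mcv_square f)
 also have "... = (NI x. ennreal ((f x)^2))" by (rule nn_integral_mcv[OF f(2)]) simp
 also have "... = ennreal (LI x. (f x)^2)" by (rule nn_integral_eq_integral[OF f(2)]) simp
 finally have "(NI x. ennreal ((mcv n f x)^2)) <= ennreal (LI x. (f x)^2)" .
 from nonneg_integral_bound[OF _ _ this]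
 show "integ (%x. (mcv n f x)^2)" "(LI x. (mcv n f x)^2) <= (LI x. (f x)^2)"
  by simp_all
qed

lemma mcv_L4:
 assumes f: "integ f" "integ (%x. (f x)^2)" "integ (%x. (f x) ^ 4)"
 shows "(LI x. (mcv n f x) ^ 4) <= (LI x. (f x) ^ 4)"
proof -
 have e: "(t^2)^2 = t ^ 4" for t :: real by simp
 note m = mcv_L2[OF f(2), of n]
 have f4: "integ (%x. ((f x)^2)^2)" using f(3) by simp
 have [measurable]: "f : BM" using f by auto
 have "(LI x. ((mcv n f x)^2)^2) <= (LI x. (mcv n (%x. (f x)^2) x)^2)"
 proof (rule integrable_nonneg_le(2)[OF m(1)[OF f4]])
  have "((mcv n f x)^2)^2 <= (mcv n (%x. (f x)^2) x)^2" for x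
   by (intro power_mono mcv_square f) simp
  then show "AEL x. 0 <= ((mcv n f x)^2)^2 & ((mcv n f x)^2)^2 <= (mcv n (%x. (f x)^2) x)^2"
   by (intro AE_I2 conjI) auto
 qed simp
 also have "... <= (LI x. ((f x)^2)^2)" by (rule m(2)[OF f4])
 finally show ?thesis by simp
qed

lemma fatou_bound:
 fixes f :: "nat => plane => real"
 assumes "!!n. integ (f n)" "!!n x. 0 <= f n x" "!!n. (LI x. f n x) <= C"
  "g : BM" "!!x. 0 <= g x" "AEL x. (%n. f n x) ~~> g x"
 shows "integ g" "(LI x. g x) <= C"
proof -
 have C: "C >= 0" by (rule order_trans[OF _ assms(3)[of 0]]) (intro integral_nonneg_AE AE_I2 assms(2))
 have "(NI x. ennreal (g x)) = (NI x. liminf (%n. ennreal (f n x)))"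
 proof (rule nn_integral_cong_AE, use assms(6) in eventually_elim)
  fix x assume "(%n. f n x) ~~> g x"
  then have "(%n. ennreal (f n x)) ~~> ennreal (g x)" by (rule tendsto_ennrealI)
  then show "ennreal (g x) = liminf (%n. ennreal (f n x))" by (simp add: lim_imp_Liminf)
 qed
 also have "... <= liminf (%n. (NI x. ennreal (f n x)))"
  using assms(1) by (intro nn_integral_liminf) auto
 also have "... <= ennreal C"
 proof -
  have "(NI x. ennreal (f n x)) <= ennreal C" for n
   using nn_integral_eq_integral[OF assms(1)[of n]] assms(2,3) by (simp add: ennreal_leI)
  then have "liminf (%n. (NI x. ennreal (f n x))) <= liminf (%n. ennreal C)"
   by (intro Liminf_mono always_eventually allI)
  then show ?thesis by (simp add: Liminf_const)
 qed
 finally have "(NI x. ennreal (g x)) <= ennreal C" .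
 from nonneg_integral_bound[OF assms(4,5) this C] show "integ g" "(LI x. g x) <= C" .
qed

context lake_coeff
begin

text \<open>The Laplacian of the localised solution grows only linearly in the gradient, which is
  what drives the bootstrap. The constant comes from the cutoff, from \<open>b\<close> over
  \<open>K\<close> and from \<open>M\<close>, and is therefore chosen before the solution.\<close>

lemma cutw_bound:
 assumes s: "smooth xi" "compact K" "K <= D" "!!x. x ~: K ==> xi x = 0" and M: "M >= 0"
 obtains c where "c >= 0" "!!u U z x. wsol D b M u U z ==> abs (u x * xi x) <= c"
  "!!u U z x. wsol D b M u U z ==> abs (cutw xi b u U z x) <= c * (1 + abs (U 1 x) + abs (U 2 x)) * ind K x"
proof -
 have c: "C1c K xi" by (rule smooth_C1c[OF s(1,2,4)])
 note p = C1cD[OF c]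
 have cp: "C1c K (pd j xi)" for j by (rule smooth_C1c[OF smooth_partial[OF s(1)] s(2) p(6)])
 have cl: "continuous_on UNIV (lap xi)" "x ~: K ==> lap xi x = 0" for x
  using C1cD(3,6)[OF cp] unfolding lap_def[abs_def] by (auto intro!: continuous_on_sum)
 have bd: "EX B>=0. ALL x:K. abs (f x) <= B" if "continuous_on D f" for f :: "plane => real"
 proof -
  have "compact (f ` K)" using that s(2,3) by (intro compact_continuous_image) (auto intro: continuous_on_subset)
  then obtain B where "ALL y:f ` K. abs y <= B" using compact_imp_bounded bounded_real by metis
  then have "ALL x:K. abs (f x) <= abs B" by force
  then show ?thesis by (intro exI[of _ "abs B"]) auto
 qed
 have cont: "continuous_on D (%x. inverse (b x) * pd i b x)" "continuous_on D (%x. b x * b x)" for i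
  by (intro continuous_intros b_cont)+
 obtain B1 where B1: "B1 >= 0" "!!x. x : K ==> abs (inverse (b x) * pd 1 b x) <= B1" using bd[OF cont(1)] by metis
 obtain B2 where B2: "B2 >= 0" "!!x. x : K ==> abs (inverse (b x) * pd 2 b x) <= B2" using bd[OF cont(1)] by metis
 obtain B3 where B3: "B3 >= 0" "!!x. x : K ==> abs (b x * b x) <= B3" using bd[OF cont(2)] by metis
 obtain B4 where B4: "B4 > 0" "!!x. abs (xi x) <= B4" using continuous_cpt_bounded[OF p(4) s(2) p(5)] by metis
 obtain B5 where B5: "B5 > 0" "!!x. abs (pd 1 xi x) <= B5" using continuous_cpt_bounded[OF p(3) s(2) p(6)] by metis
 obtain B6 where B6: "B6 > 0" "!!x. abs (pd 2 xi x) <= B6" using continuous_cpt_bounded[OF p(3) s(2) p(6)] by metis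
 obtain B7 where B7: "B7 > 0" "!!x. abs (lap xi x) <= B7" using continuous_cpt_bounded[OF cl(1) s(2) cl(2)] by metis
 define bet where "bet = B1 + B2 + B3 + B4 + B5 + B6 + B7"
 have bet: "bet >= 0" using B1(1) B2(1) B3(1) B4(1) B5(1) B6(1) B7(1) by (simp add: bet_def)
 have ex: "i = 1 | i = 2" for i :: 2 by (rule exhaust_2)
 have b1: "abs (inverse (b x) * pd i b x) <= bet" "abs (b x * b x) <= bet" if "x : K" for x i
  using B1(2)[OF that] B2(2)[OF that] B3(2)[OF that] B1(1) B2(1) B3(1) B4(1) B5(1) B6(1) B7(1) ex[of i] by (auto simp: bet_def)
 have b2: "abs (xi x) <= bet" "abs (pd i xi x) <= bet" "abs (lap xi x) <= bet" for x i
  using B4(2)[of x] B5(2)[of x] B6(2)[of x] B7(2)[of x] B1(1) B2(1) B3(1) B4(1) B5(1) B6(1) B7(1) ex[of i] by (auto simp: bet_def)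
 define k where "k = bet * bet + 2 * bet + bet * M * bet + M * bet"
 have k: "k >= 0" using bet M by (simp add: k_def)
 show ?thesis
 proof (rule that[OF k])
  fix u U z x assume w: "wsol D b M u U z"
  have "abs (u x * xi x) <= M * bet" unfolding abs_mult using wsolD(3)[OF w, of x] b2(1)[of x] M by (intro mult_mono) auto
  also have "... <= k" using bet M by (simp add: k_def)
  finally show "abs (u x * xi x) <= k" .
  show "abs (cutw xi b u U z x) <= k * (1 + abs (U 1 x) + abs (U 2 x)) * ind K x"
  proof (cases "x : K")
   case False
   then show ?thesis using p(5,6) cl(2) by (simp add: cutw_def)
  next
   case True
   define A where "A = abs (U 1 x) + abs (U 2 x)"
   have A: "A >= 0" by (simp add: A_def)
   have t: "abs ((inverse (b x) * pd i b x) * U i x) <= bet * abs (U i x)" "abs (U i x * pd i xi x) <= bet * abs (U i x)" for i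
   using mult_right_mono[OF b1(1)[OF True, of i], of "abs (U i x)"] mult_right_mono[OF b2(2)[of i x], of "abs (U i x)"]
   by (simp_all only: abs_mult abs_ge_zero mult.commute[of "abs (U i x)"])
   have t3: "abs ((- (b x * b x)) * z x) <= bet * M"
   unfolding abs_mult[of "- (b x * b x)"] abs_minus_cancel using b1(2)[OF True] wsolD(4)[OF w, of x] bet by (intro mult_mono) auto
   have "abs (lapF b U z x) <= bet * A + bet * M"
   using t(1)[of 1] t(1)[of 2] t3 unfolding lapF_def A_def sum_2 distrib_left by linarith
   then have 1: "abs (lapF b U z x * xi x) <= (bet * A + bet * M) * bet"
   unfolding abs_mult using b2(1)[of x] bet A M by (intro mult_mono) auto
   have 2: "abs (2 * (SUM i:UNIV. U i x * pd i xi x)) <= 2 * (bet * A)"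
   using t(2)[of 1] t(2)[of 2] unfolding sum_2 A_def distrib_left by linarith
   have 3: "abs (u x * lap xi x) <= M * bet"
   unfolding abs_mult using wsolD(3)[OF w, of x] b2(3)[of x] M by (intro mult_mono) auto
   have "abs (cutw xi b u U z x) <= (bet * A + bet * M) * bet + 2 * (bet * A) + M * bet"
   unfolding cutw_def using 1 2 3 by linarith
   also have "... = (bet * bet + 2 * bet) * A + (bet * M * bet + M * bet)" by (simp add: algebra_simps)
   also have "... <= k * A + k * 1"
   using bet M A by (intro add_mono mult_right_mono) (auto simp: k_def)
   finally show ?thesis using True by (simp add: A_def algebra_simps)
  qed
 qed
qed

lemma wsol_cpt_L2:
 assumes w: "wsol D b M u U z" and K: "K <= D" "K : sets borel"
 shows "integ (%x. ind K x * abs (U i x) ^ 2)" "(LI x. ind K x * abs (U i x) ^ 2) <= M"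
proof -
 note [measurable] = wsolD(5)[OF w] K(2)
 have "AEL x. 0 <= ind K x * abs (U i x) ^ 2 & ind K x * abs (U i x) ^ 2 <= ind D x * (U i x)^2"
  using K(1) by (intro AE_I2) (auto simp: indicator_def)
 from integrable_nonneg_le[OF wsolD(7)[OF w] _ this] wsolD(8)[OF w, of i]
 show "integ (%x. ind K x * abs (U i x) ^ 2)" "(LI x. ind K x * abs (U i x) ^ 2) <= M" by simp_all
qed

lemma sum3_power_le: "(1 + p + q) ^ k <= 3 ^ k * (1 + p ^ k + q ^ k)" if "0 <= p" "0 <= q" for p q :: real
proof -
 define m where "m = max 1 (max p q)"
 have "(1 + p + q) ^ k <= (3 * m) ^ k" using that by (intro power_mono) (auto simp: m_def)
 also have "... = 3 ^ k * m ^ k" by (rule power_mult_distrib)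
 also have "m ^ k <= 1 + p ^ k + q ^ k" using that zero_le_power[of p k] zero_le_power[of q k] by (auto simp: m_def max_def)
 finally show ?thesis by simp
qed

lemma cutw_power:
 fixes K :: "plane set" and U :: "2 => plane => real"
 assumes K: "compact K" and W: "W : BM" and c: "c >= 0" "!!x. abs (W x) <= c * (1 + abs (U 1 x) + abs (U 2 x)) * ind K x"
  and U: "!!i. integ (%x. ind K x * abs (U i x) ^ k)" "!!i. (LI x. ind K x * abs (U i x) ^ k) <= C" and k: "k > 0"
 shows "integ (%x. abs (W x) ^ k)" "(LI x. abs (W x) ^ k) <= (3 * c) ^ k * (measure lborel K + 2 * C)"
proof -
 note [measurable] = W
 let ?g = "%x. (3 * c) ^ k * (ind K x + (ind K x * abs (U 1 x) ^ k + ind K x * abs (U 2 x) ^ k))"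
 have ig: "integ ?g"
  using integrable_indicator_cpt[OF K] U(1) by (intro integrable_mult_right integ_add) auto
 have "abs (W x) ^ k <= ?g x" for x
 proof (cases "x : K")
  case True
  then have "abs (W x) ^ k <= (c * (1 + abs (U 1 x) + abs (U 2 x))) ^ k" using c(2)[of x] by (intro power_mono) auto
  also have "... = c ^ k * (1 + abs (U 1 x) + abs (U 2 x)) ^ k" by (rule power_mult_distrib)
  also have "... <= c ^ k * (3 ^ k * (1 + abs (U 1 x) ^ k + abs (U 2 x) ^ k))" using c(1) by (intro mult_left_mono sum3_power_le) auto
  finally show ?thesis using True by (simp add: power_mult_distrib algebra_simps)
 qed (use c(2)[of x] k in \<open>simp add: zero_power\<close>)
 then have ae: "AEL x. 0 <= abs (W x) ^ k & abs (W x) ^ k <= ?g x" by simp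
 have m: "(%x. abs (W x) ^ k) : BM" by measurable
 show "integ (%x. abs (W x) ^ k)" by (rule integrable_nonneg_le(1)[OF ig m ae])
 have "(LI x. abs (W x) ^ k) <= (LI x. ?g x)" by (rule integrable_nonneg_le(2)[OF ig m ae])
 also have "... = (3 * c) ^ k * (measure lborel K + ((LI x. ind K x * abs (U 1 x) ^ k) + (LI x. ind K x * abs (U 2 x) ^ k)))"
  using U(1) integrable_indicator_cpt[OF K] by simp
 also have "... <= (3 * c) ^ k * (measure lborel K + 2 * C)" using U(2)[of 1] U(2)[of 2] c(1) by (intro mult_left_mono) auto
 finally show "(LI x. abs (W x) ^ k) <= (3 * c) ^ k * (measure lborel K + 2 * C)" .
qed

text \<open>The gradient is in L^2 by assumption, hence so is the Laplacian of the localised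
  solution, and boundedness of \<open>u\<close> upgrades the gradient to L^4 by
  \<open>gradient_L4\<close>. Fatou's lemma removes the mollifier.\<close>

lemma stage1:
 assumes R: "0 < R" "cball x0 R <= D" and s: "smooth xi" "!!x. x ~: cball x0 R ==> xi x = 0" and M: "M >= 0"
 obtains C where "!!u U z i. wsol D b M u U z ==> integ (%x. (cutv xi u U i x) ^ 4)"
  "!!u U z i. wsol D b M u U z ==> (LI x. (cutv xi u U i x) ^ 4) <= C"
proof -
 let ?K = "cball x0 R"
 have s2: "ALL x. x ~: ?K --> xi x = 0" using s(2) by blast
 obtain c where c: "c >= 0" "!!u U z x. wsol D b M u U z ==> abs (u x * xi x) <= c"
  "!!u U z x. wsol D b M u U z ==> abs (cutw xi b u U z x) <= c * (1 + abs (U 1 x) + abs (U 2 x)) * ind ?K x"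
  by (rule cutw_bound[OF s(1) compact_cball R(2) s(2) M]) (assumption, rule that)
 define C1 where "C1 = (3 * c) ^ 2 * (measure lborel ?K + 2 * M)"
 have key: "integ (%x. (cutv xi u U i x) ^ 4) & (LI x. (cutv xi u U i x) ^ 4) <= 9 * c^2 * C1"
  if w: "wsol D b M u U z" for u U z i
 proof -
  note id = cut_identities[OF w s(1) compact_cball R(2) s2]
  let ?W = "cutw xi b u U z" and ?u = "%x. u x * xi x"
  have Wm: "?W : BM" using id(3) by auto
  have iW2: "integ (%x. (?W x)^2)" and W2: "(LI x. (?W x)^2) <= C1"
   using cutw_power[of ?K ?W c U 2 M, OF compact_cball Wm c(1) c(3)[OF w] wsol_cpt_L2[OF w R(2)]] unfolding C1_def by auto
  have z: "mcv n ?u x = 0" if "x ~: cball x0 (R + 1)" for n x by (rule mcv_cpt[OF _ that]) (simp add: s(2))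
  have B: "abs (mcv n ?u x) <= c" for n x
   using c(2)[OF w] by (intro mcv_abs_bound[OF id(1)]) auto
  have 4: "(LI x. (mcv n (cutv xi u U i) x) ^ 4) <= 9 * c^2 * C1" for n
  proof -
   have "(LI x. (pd i (mcv n ?u) x) ^ 4) <= 9 * c^2 * (LI x. (lap (mcv n ?u) x)^2)"
   by (rule gradient_L4[OF smooth_mcv[OF id(1)] compact_cball z B])
   also have "... <= 9 * c^2 * C1"
   unfolding id(5) using mcv_L2(2)[OF id(3) iW2, of n] W2 by (intro mult_left_mono) auto
   finally show ?thesis unfolding id(4) .
  qed
  obtain t where t: "strict_mono t" "AEL x. (%n. mcv (t n) (cutv xi u U i) x) ~~> cutv xi u U i x"
   by (rule mcv_AE[OF id(2)])
  have [measurable]: "cutv xi u U i : BM" using id(2) by auto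
  have i4: "integ (%x. (mcv n (cutv xi u U i) x) ^ 4)" for n
  proof (rule continuous_cpt_integrable[OF _ compact_cball[of x0 "R + 1"]])
   show "continuous_on UNIV (%x. (mcv n (cutv xi u U i) x) ^ 4)" by (intro continuous_intros mcv_continuous id(2))
   show "(mcv n (cutv xi u U i) x) ^ 4 = 0" if "x ~: cball x0 (R + 1)" for x
   using cpt_partial[OF smooth_mcv[OF id(1)] compact_cball z that, of i n] unfolding id(4) by simp
  qed
  have a: "AEL x. (%n. (mcv (t n) (cutv xi u U i) x) ^ 4) ~~> (cutv xi u U i x) ^ 4"
   using t(2) by (rule eventually_mono) (rule tendsto_power)
  show ?thesis
   using fatou_bound[of "%n x. (mcv (t n) (cutv xi u U i) x) ^ 4", OF i4 _ 4 _ _ a] by simp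
 qed
 show ?thesis by (rule that[of "9 * c^2 * C1"]) (use key in blast)+
qed

text \<open>\<open>C'\<close> is an L^4 bound for the gradient on the ball, as \<open>stage1\<close>
  provides. The Laplacian is then in L^4 and \<open>gradient_sup_bound\<close> applies. The
  conclusion is kept at the level of mollified gradients, from which the Lipschitz bound for
  \<open>u\<close> will be read off.\<close>

lemma stage2:
 assumes R: "0 < R" "cball x0 R <= D" and s: "smooth xi" "!!x. x ~: cball x0 R ==> xi x = 0" and M: "M >= 0"
 obtains C where "C >= 0" "!!u U z i n x. wsol D b M u U z ==>
  (ALL i. integ (%x. ind (cball x0 R) x * abs (U i x) ^ 4) & (LI x. ind (cball x0 R) x * abs (U i x) ^ 4) <= C')
  ==> abs (mcv n (cutv xi u U i) x) <= C"
proof -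
 let ?K = "cball x0 R"
 have s2: "ALL x. x ~: ?K --> xi x = 0" using s(2) by blast
 obtain c where c: "c >= 0" "!!u U z x. wsol D b M u U z ==> abs (u x * xi x) <= c"
  "!!u U z x. wsol D b M u U z ==> abs (cutw xi b u U z x) <= c * (1 + abs (U 1 x) + abs (U 2 x)) * ind ?K x"
  by (rule cutw_bound[OF s(1) compact_cball R(2) s(2) M]) (assumption, rule that)
 obtain G where G: "G >= 0" "!!phi x0 R i x. smooth phi ==> ALL x. x ~: cball x0 R --> phi x = 0 ==>
  abs (pd i phi x) <= G * ((LI y. (lap phi y) ^ 4) + (LI y. ind (cball (0::plane) (2 * R)) y * (norm y) powr (-4/3)))"
  using gradient_sup_bound by blast
 define J where "J = (LI y. ind (cball (0::plane) (2 * (R + 1))) y * (norm y) powr (-4/3))"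
 define C1 where "C1 = (3 * c) ^ 4 * (measure lborel ?K + 2 * abs C')"
 have key: "abs (mcv n (cutv xi u U i) x) <= G * (C1 + J)"
  if w: "wsol D b M u U z" and U4': "ALL i. integ (%x. ind ?K x * abs (U i x) ^ 4) & (LI x. ind ?K x * abs (U i x) ^ 4) <= C'"
  for u U z i n x
 proof -
  note id = cut_identities[OF w s(1) compact_cball R(2) s2]
  let ?W = "cutw xi b u U z" and ?u = "%x. u x * xi x"
  have Wm: "?W : BM" using id(3) by auto
  have iW2: "integ (%x. (?W x)^2)"
   using cutw_power(1)[of ?K ?W c U 2 M, OF compact_cball Wm c(1) c(3)[OF w] wsol_cpt_L2[OF w R(2)]] by auto
  have "(LI x. ind ?K x * abs (U i x) ^ 4) <= abs C'" for i using U4'[rule_format, of i] by linarith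
  then have iW4: "integ (%x. (?W x) ^ 4)" and W4: "(LI x. (?W x) ^ 4) <= C1"
   using cutw_power[of ?K ?W c U 4 "abs C'", OF compact_cball Wm c(1) c(3)[OF w]] U4' unfolding C1_def by auto
  have z: "mcv n ?u x = 0" if "x ~: cball x0 (R + 1)" for n x by (rule mcv_cpt[OF _ that]) (simp add: s(2))
  have "abs (pd i (mcv n ?u) x) <= G * ((LI y. (lap (mcv n ?u) y) ^ 4) + J)"
   unfolding J_def by (rule G(2)[OF smooth_mcv[OF id(1)]]) (use z in blast)
  also have "... <= G * (C1 + J)"
   unfolding id(5) using mcv_L4[OF id(3) iW2 iW4, of n] W4 G(1) by (intro mult_left_mono add_right_mono) auto
  finally show ?thesis unfolding id(4) .
 qed
 have "C1 >= 0" "J >= 0" unfolding C1_def J_def using c(1) by (auto intro!: integral_nonneg_AE)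
 then show ?thesis using that[of "G * (C1 + J)"] key G(1) by simp
qed

text \<open>Bootstrap: bounded solutions have gradients in \<open>L^4\<close>, hence a Laplacian in \<open>L^4\<close>, hence bounded gradients.\<close>

lemma gradient_bound:
 assumes R: "0 < R" "cball x0 R <= D" and M: "M >= 0"
 obtains C where "C >= 0" "!!u U z i. wsol D b M u U z ==> AEL x. x : cball x0 (R/64) --> abs (U i x) <= C"
  "!!u U z. wsol D b M u U z ==> EX N:null_sets lborel. ALL x:cball x0 (R/64) - N. ALL y:cball x0 (R/64) - N. abs (u x - u y) <= C * dist x y"
proof -
 \<comment> \<open>Each cutoff is 1 near the ball that is used next, so that its gradient vanishes
   there and \<open>cutv\<close> equals \<open>U\<close>: \<open>xi1\<close> is 1 on radius R/4 and
   used on R/8, \<open>xi2\<close> is 1 on R/32 and used on R/64.\<close>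
 obtain xi1 where x1: "smooth xi1" "!!x. x ~: cball x0 R ==> xi1 x = 0" "!!x. x : cball x0 (R / 4) ==> xi1 x = 1"
  using cutoff_compact[of "{x0}" R] R by auto
 obtain xi2 where x2: "smooth xi2" "!!x. x ~: cball x0 (R/8) ==> xi2 x = 0" "!!x. x : cball x0 (R / 32) ==> xi2 x = 1"
  using cutoff_compact[of "{x0}" "R/8"] R by auto
 obtain C1 where C1: "!!u U z i. wsol D b M u U z ==> integ (%x. (cutv xi1 u U i x) ^ 4)"
  "!!u U z i. wsol D b M u U z ==> (LI x. (cutv xi1 u U i x) ^ 4) <= C1"
  by (rule stage1[OF R x1(1,2) M]) (assumption, rule that)
 have s2: "ALL x. x ~: cball x0 (R/8) --> xi2 x = 0" using x2(2) by blast
 have R2: "0 < R/8" "cball x0 (R/8) <= D" using R subset_cball[of "R/8" R x0] by auto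
 obtain C where C: "C >= 0" "!!u U z i n x. wsol D b M u U z ==>
  (ALL i. integ (%x. ind (cball x0 (R/8)) x * abs (U i x) ^ 4) & (LI x. ind (cball x0 (R/8)) x * abs (U i x) ^ 4) <= C1)
  ==> abs (mcv n (cutv xi2 u U i) x) <= C"
  by (rule stage2[OF R2 x2(1,2) M, where C'=C1]) (assumption, rule that)
 have v1: "cutv xi u U i x = U i x" if "!!x. x : cball x0 r' ==> xi x = 1" "r < r'" "x : cball x0 r" for xi u U i x r r'
 proof -
  have "x : ball x0 r'" using that(2,3) by simp
  then have "pd i xi x = pd i (%_. 1) x" using that(1) by (intro partial_cong[of "ball x0 r'"]) auto
  then show ?thesis using that by (simp add: cutv_def)
 qed
 have U4: "integ (%x. ind (cball x0 (R/8)) x * abs (U i x) ^ 4) & (LI x. ind (cball x0 (R/8)) x * abs (U i x) ^ 4) <= C1"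
  if w: "wsol D b M u U z" for u U z i
 proof -
  have "0 <= ind (cball x0 (R/8)) x * abs (U i x) ^ 4 & ind (cball x0 (R/8)) x * abs (U i x) ^ 4 <= (cutv xi1 u U i x) ^ 4" for x
   using v1[of "R / 4" xi1 "R/8" x u U i, OF x1(3)] R by (auto simp: indicator_def)
  then have "AEL x. 0 <= ind (cball x0 (R/8)) x * abs (U i x) ^ 4 & ind (cball x0 (R/8)) x * abs (U i x) ^ 4 <= (cutv xi1 u U i x) ^ 4"
   by (rule AE_I2)
  moreover have "(%x. ind (cball x0 (R/8)) x * abs (U i x) ^ 4) : BM"
   using wsolD(5)[OF w, of i] by (intro borel_measurable_times borel_measurable_indicator borel_measurable_power) auto
  ultimately have "integ (%x. ind (cball x0 (R/8)) x * abs (U i x) ^ 4)"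
   "(LI x. ind (cball x0 (R/8)) x * abs (U i x) ^ 4) <= (LI x. (cutv xi1 u U i x) ^ 4)"
   by (rule integrable_nonneg_le[OF C1(1)[OF w, of i], rotated])+
  then show ?thesis using C1(2)[OF w, of i] by linarith
 qed
 have g: "abs (mcv n (cutv xi2 u U i) x) <= C" if w: "wsol D b M u U z" for u U z i n x
  by (rule C(2)[OF w]) (use U4[OF w] in blast)
 show ?thesis
 proof (rule that[of "2 * C"])
  fix u U z assume w: "wsol D b M u U z"
  note id = cut_identities[OF w x2(1) compact_cball R2(2) s2]
  show "AEL x. x : cball x0 (R/64) --> abs (U i x) <= 2 * C" for i
  proof -
   obtain t where t: "strict_mono t" "AEL x. (%n. mcv (t n) (cutv xi2 u U i) x) ~~> cutv xi2 u U i x"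
   by (rule mcv_AE[OF id(2)])
   show ?thesis using t(2)
   proof eventually_elim
   fix x assume l: "(%n. mcv (t n) (cutv xi2 u U i) x) ~~> cutv xi2 u U i x"
   have "abs (cutv xi2 u U i x) <= C" by (rule LIMSEQ_le_const2[OF tendsto_rabs[OF l]]) (use g[OF w] in blast)
   then show "x : cball x0 (R/64) --> abs (U i x) <= 2 * C"
   using v1[of "R / 32" xi2 "R/64" x u U i, OF x2(3)] R C(1) by auto
   qed
  qed
  show "EX N:null_sets lborel. ALL x:cball x0 (R/64) - N. ALL y:cball x0 (R/64) - N. abs (u x - u y) <= 2 * C * dist x y"
  proof -
   let ?u = "%x. u x * xi2 x"
   obtain t where t: "strict_mono t" "AEL x. (%n. mcv (t n) ?u x) ~~> ?u x"
   by (rule mcv_AE[OF id(1)])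
   obtain N where N: "N : null_sets lborel" "{x : space lborel. ~ (%n. mcv (t n) ?u x) ~~> ?u x} <= N"
   using t(2) unfolding eventually_ae_filter by blast
   \<comment> \<open>The mollified products are Lipschitz with a constant independent of
     \<open>n\<close>; the bound passes to \<open>u\<close> at the points where they converge, that
     is off \<open>N\<close>.\<close>
   have lip: "abs (mcv n ?u x - mcv n ?u y) <= 2 * C * dist x y" for n x y
   proof -
   have "norm (mcv n ?u x - mcv n ?u y) <= 2 * C * norm (x - y)"
   proof (rule differentiable_bound[of UNIV _ "%x h. grad (mcv n ?u) x \<bullet> h"])
   show "(mcv n ?u has_derivative (\<bullet>) (grad (mcv n ?u) x)) (at x within UNIV)" for x
   by (rule has_derivative_grad[OF smooth_differentiable[OF smooth_mcv[OF id(1)]]])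
   have "norm (grad (mcv n ?u) x) <= (SUM i:UNIV. abs (grad (mcv n ?u) x $ i))" for x by (rule norm_le_l1_cart)
   also have "(SUM i:UNIV. abs (grad (mcv n ?u) x $ i)) <= (SUM i:(UNIV::2 set). C)" for x
   unfolding grad_nth id(4) by (intro sum_mono g[OF w])
   finally show "onorm ((\<bullet>) (grad (mcv n ?u) x)) <= 2 * C" for x by (intro onorm_inner_le) simp
   qed auto
   then show ?thesis by (simp add: dist_norm)
   qed
   have "abs (u x - u y) <= 2 * C * dist x y" if "x : cball x0 (R/64) - N" "y : cball x0 (R/64) - N" for x y
   proof -
   have "(%n. mcv (t n) ?u x) ~~> ?u x" "(%n. mcv (t n) ?u y) ~~> ?u y" using N(2) that by auto
   then have l: "(%n. abs (mcv (t n) ?u x - mcv (t n) ?u y)) ~~> abs (?u x - ?u y)" by (intro tendsto_intros)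
   have "abs (?u x - ?u y) <= 2 * C * dist x y" by (rule LIMSEQ_le_const2[OF l]) (use lip in blast)
   moreover have "x : cball x0 (R / 32)" "y : cball x0 (R / 32)" using that R by auto
   ultimately show ?thesis using x2(3) by simp
   qed
   then show ?thesis using N(1) by blast
  qed
 qed (use C in simp)
qed

end

section \<open>Second weak derivatives\<close>

lemma AE_bound_compact:
 fixes f :: "plane => real"
 assumes K: "compact K" and l: "!!x. x : K ==> EX r>0. EX C. AEL y. y : ball x r --> abs (f y) <= C"
 obtains C where "C >= 0" "AEL y. y : K --> abs (f y) <= C"
proof -
 define Q where "Q x r C \<longleftrightarrow> (AEL y. y : ball x r --> abs (f y) <= C)" for x r C
 obtain r C where r: "!!x. x : K ==> r x > 0 & Q x (r x) (C x)" using l unfolding Q_def[symmetric] by metis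
 have "K <= (UN x:K. ball x (r x))" using r by fastforce
 then obtain F where F: "F <= K" "finite F" "K <= (UN x:F. ball x (r x))"
  using compactE_image[OF K, of K "%x. ball x (r x)"] by auto
 have "AEL y. ALL x:F. y : ball x (r x) --> abs (f y) <= C x" using F r unfolding Q_def by (subst AE_finite_all) auto
 then have "AEL y. y : K --> abs (f y) <= (SUM x:F. abs (C x))"
 proof eventually_elim
  fix y assume a: "ALL x:F. y : ball x (r x) --> abs (f y) <= C x"
  show "y : K --> abs (f y) <= (SUM x:F. abs (C x))"
  proof
   assume "y : K"
   then obtain x where x: "x : F" "y : ball x (r x)" using F(3) by auto
   then have "abs (f y) <= abs (C x)" using a by force
   also have "... <= (SUM x:F. abs (C x))" using F(2) x(1) by (intro member_le_sum) auto
   finally show "abs (f y) <= (SUM x:F. abs (C x))" .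
  qed
 qed
 then show ?thesis by (rule that[rotated]) (simp add: sum_nonneg)
qed

lemma loc_int_integrable: "loc_int D f" if "integ f"
 unfolding loc_int_def using that by (auto intro!: integrable_bounded_mult(2)[where B=1] borel_measurable_indicator simp: borel_compact)

text \<open>The Riesz-Fischer argument for increments with summable norms: the telescoping series
  has an integrable majorant, which gives pointwise and weak convergence at once.\<close>

lemma fast_Cauchy_limit:
 fixes h :: "nat => plane => real"
 assumes h: "!!n. integ (h n)" and c: "!!k. (LI x. abs (h (Suc k) x - h k x)) <= C * (1/2) ^ k"
 obtains g where "integ g" "AEL x. (%n. h n x) ~~> g x"
  "!!phi B. phi : BM ==> (!!x. abs (phi x) <= B) ==> (%n. (LI x. h n x * phi x)) ~~> (LI x. g x * phi x)"
proof -
 note [measurable] = h[THEN borel_measurable_integrable]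
 define d where "d k x = h (Suc k) x - h k x" for k x
 have d: "integ (d k)" for k unfolding d_def[abs_def] by (intro integ_diff h)
 have s: "summable (%k. (LI x. norm (d k x)))"
 proof (rule summable_comparison_test')
  show "summable (%k. C * (1/2::real) ^ k)" by (intro summable_mult summable_geometric) simp
  show "norm (LI x. norm (d k x)) <= C * (1/2) ^ k" for k using c[of k] by (simp add: d_def)
 qed
 have ae: "AEL x. summable (%k. norm (d k x))"
 proof -
  have "(NI x. (\<Sum>k. ennreal (norm (d k x)))) = (\<Sum>k. (NI x. ennreal (norm (d k x))))"
   using d by (intro nn_integral_suminf) auto
  also have "... = (\<Sum>k. ennreal (LI x. norm (d k x)))" using d by (simp add: nn_integral_eq_integral)
  also have "... = ennreal (\<Sum>k. (LI x. norm (d k x)))" by (rule suminf_ennreal2[OF _ s]) simp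
  finally have "AEL x. (\<Sum>k. ennreal (norm (d k x))) ~= \<infinity>" using d by (intro nn_integral_PInf_AE) auto
  then show ?thesis by (rule eventually_mono) (auto intro: summable_suminf_not_top)
 qed
 define g where "g x = h 0 x + (\<Sum>k. d k x)" for x
 define w where "w x = abs (h 0 x) + (\<Sum>k. norm (d k x))" for x
 have ig: "integ g" unfolding g_def[abs_def] by (intro integ_add h integrable_suminf d ae s)
 have iw: "integ w" unfolding w_def[abs_def]
  using ae s by (intro integ_add integrable_abs h integrable_suminf integrable_norm d) auto
 have tel: "h n x = h 0 x + (\<Sum>k<n. d k x)" for n x by (simp add: d_def sum_lessThan_telescope[of "%k. h k x"])
 have lim: "AEL x. (%n. h n x) ~~> g x & (ALL n. abs (h n x) <= w x)" using ae
 proof eventually_elim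
  fix x assume s: "summable (%k. norm (d k x))"
  have "(%n. h 0 x + (\<Sum>k<n. d k x)) ~~> g x"
   unfolding g_def by (intro tendsto_intros summable_LIMSEQ summable_norm_cancel[OF s])
  moreover have "abs (h n x) <= w x" for n
  proof -
   have "abs (\<Sum>k<n. d k x) <= (\<Sum>k<n. norm (d k x))" by (simp add: sum_abs)
   also have "... <= (\<Sum>k. norm (d k x))" by (rule sum_le_suminf[OF s]) auto
   finally show ?thesis unfolding tel[of n] w_def by linarith
  qed
  ultimately show "(%n. h n x) ~~> g x & (ALL n. abs (h n x) <= w x)" unfolding tel[symmetric] by blast
 qed
 show ?thesis
 proof (rule that[OF ig])
  show "AEL x. (%n. h n x) ~~> g x" using lim by (rule eventually_mono) blast
  fix phi :: "plane => real" and B assume [measurable]: "phi : BM" and B: "!!x. abs (phi x) <= B"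
  note [measurable] = ig[THEN borel_measurable_integrable]
  show "(%n. (LI x. h n x * phi x)) ~~> (LI x. g x * phi x)"
  proof (rule integral_dominated_convergence[where w="%x. B * w x"])
   show "AEL x. (%n. h n x * phi x) ~~> g x * phi x" using lim by (rule eventually_mono) (auto intro: tendsto_mult)
   show "AEL x. norm (h n x * phi x) <= B * w x" for n using lim
   proof eventually_elim
   fix x assume "(%n. h n x) ~~> g x & (ALL n. abs (h n x) <= w x)"
   then show "norm (h n x * phi x) <= B * w x"
   using mult_mono[OF B[of x], of "abs (h n x)" "w x"] B[of x] by (auto simp: abs_mult mult.commute)
   qed
  qed (use iw in auto)
 qed
qed

text \<open>The hypothesis is what \<open>abs_le_sq\<close> produces from a Cauchy sequence in L^2.
  Where E is at most 4^(-k), the choice s = 2^(-k) makes both terms O(2^(-k)).\<close>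

lemma L1_Cauchy_limit:
 fixes h :: "nat => plane => real"
 assumes h: "!!n. integ (h n)" and e: "!!s m n. s > 0 ==> n <= m ==> (LI x. abs (h m x - h n x)) <= s * B + E m n / s"
  and E: "!!d. d > 0 ==> EX N. ALL n>=N. ALL m>=n. E m n <= d"
 obtains r g where "strict_mono r" "integ g" "AEL x. (%n. h (r n) x) ~~> g x"
  "!!phi B. phi : BM ==> (!!x. abs (phi x) <= B) ==> (%n. (LI x. h (r n) x * phi x)) ~~> (LI x. g x * phi x)"
proof -
 have "ALL k. EX N. ALL n>=N. ALL m>=n. E m n <= (1/4) ^ k" by (intro allI E) simp
 then obtain N where N: "!!k n m. n >= N k ==> m >= n ==> E m n <= (1/4) ^ k" by metis
 \<comment> \<open>The summand \<open>k\<close> makes the partial sums of the thresholds strictly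
   increasing, and they are at least \<open>N k\<close>.\<close>
 define r where "r k = k + (SUM i<=k. N i)" for k
 have r: "strict_mono r" by (rule strict_mono_Suc_iff[THEN iffD2]) (auto simp: r_def)
 have "(LI x. abs (h (r (Suc k)) x - h (r k) x)) <= (B + 1) * (1/2) ^ k" for k
 proof -
  have le: "r k <= r (Suc k)" by (simp add: r_def)
  have "N k <= r k" using member_le_sum[of k "{..k}" N] by (simp add: r_def)
  then have "E (r (Suc k)) (r k) / (1/2) ^ k <= (1/4) ^ k / (1/2) ^ k" by (intro divide_right_mono N le) auto
  also have "... = (1/2) ^ k" by (simp add: power_divide[symmetric])
  finally show ?thesis using e[OF _ le, of "(1/2) ^ k"] by (simp add: algebra_simps)
 qed
 then show ?thesis by (rule fast_Cauchy_limit[of "%n. h (r n)", OF h]) (rule that[OF r], assumption, assumption, blast)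
qed

text \<open>The mollified functions have second derivatives that are Cauchy in \<open>L^2\<close> and bounded in every \<open>L\<^sup>p\<close>.\<close>

lemma hessian_bounded_laplacian:
 fixes f v W :: "plane => real"
 assumes f: "integ f" "!!x. abs (f x) <= c" "!!x. x ~: cball x0 R ==> f x = 0"
  and v: "integ v" "!!n. pd i (mcv n f) = mcv n v"
  and W: "integ W" "AEL x. abs (W x) <= L" "!!n x. lap (mcv n f) x = mcv n W x" and L: "L >= 0"
 obtains g where "integ g" "!!K phi. C1c K phi ==> (LI x. v x * pd j phi x) = - (LI x. g x * phi x)"
  "!!s. s >= 1 ==> integ (%x. abs (g x) ^ Suc s)"
proof -
 have c: "c >= 0" using f(2)[of 0] by linarith
 let ?J = "cball x0 (R + 1)"
 define h where "h n = pd j (pd i (mcv n f))" for n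
 have sm: "smooth (mcv n f)" for n by (rule smooth_mcv[OF f(1)])
 have z: "mcv n f x = 0" if "x ~: ?J" for n x by (rule mcv_cpt[OF f(3) that])
 have z2: "h n x = 0" if "x ~: ?J" for n x
  unfolding h_def by (rule cpt_partial[OF smooth_partial[OF sm] compact_cball cpt_partial[OF sm compact_cball z] that])
 have hc: "continuous_on UNIV (h n)" for n unfolding h_def by (intro smooth_continuous smooth_partial sm)
 have ih: "integ (h n)" for n by (rule continuous_cpt_integrable[OF hc compact_cball z2])
 note iW = integrable_mcv[OF W(1)]
 have wL: "abs (mcv n W x) <= L" for n x by (rule mcv_abs_bound[OF W(1,2)])
 have pc: "abs (mcv n f x) <= c" for n x using f(2) by (intro mcv_abs_bound[OF f(1)]) auto
 define a where "a n = (LI x. abs (mcv n W x - W x))" for n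
 have "(%n. ennreal (a n)) ~~> ennreal 0"
  using mcv_L1conv[OF W(1)] iW W(1) by (simp add: a_def nn_integral_eq_integral)
 then have a0: "a ~~> 0" by (subst (asm) tendsto_ennreal_iff) (auto simp: a_def)
 \<comment> \<open>A difference of Hessians is bounded in L^2 by the difference of the Laplacians.
   These are at most \<open>L\<close> in size, so their convergence in L^1 is enough.\<close>
 have 2: "(LI x. (h m x - h n x)^2) <= 2 * L * (a m + a n)" for m n
 proof -
  let ?g = "%x. mcv m f x - mcv n f x"
  have pg: "pd k ?g = (%x. pd k (mcv m f) x - pd k (mcv n f) x)" for k
   by (rule ext) (rule partial_diff[OF smooth_differentiable[OF sm] smooth_differentiable[OF sm]])
  have pg2: "pd l (pd k ?g) = (%x. pd l (pd k (mcv m f)) x - pd l (pd k (mcv n f)) x)" for k l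
   unfolding pg by (rule ext) (rule partial_diff[OF smooth_differentiable[OF smooth_partial[OF sm]] smooth_differentiable[OF smooth_partial[OF sm]]])
  have lg: "lap ?g x = mcv m W x - mcv n W x" for x
   unfolding lap_def pg2 W(3)[unfolded lap_def, symmetric] by (simp add: sum_subtractf)
  have "(LI x. (h m x - h n x)^2) <= (LI x. (mcv m W x - mcv n W x)^2)"
   using hessian_L2[OF smooth_diff[OF sm[of m] sm[of n]] compact_cball[of x0 "R + 1"], where j=j and i=i] z unfolding pg2 lg h_def by simp
  also have "... <= (LI x. 2 * L * (abs (mcv m W x - W x) + abs (mcv n W x - W x)))"
  proof (rule integrable_nonneg_le(2))
   have "(mcv m W x - mcv n W x)^2 <= 2 * L * (abs (mcv m W x - W x) + abs (mcv n W x - W x))" for x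
   proof -
   have "(mcv m W x - mcv n W x)^2 = abs (mcv m W x - mcv n W x) * abs (mcv m W x - mcv n W x)" by (simp add: power2_eq_square)
   also have "... <= (2 * L) * (abs (mcv m W x - W x) + abs (mcv n W x - W x))"
   using wL[of m x] wL[of n x] L by (intro mult_mono) auto
   finally show ?thesis .
   qed
   then show "AEL x. 0 <= (mcv m W x - mcv n W x)^2 & (mcv m W x - mcv n W x)^2 <= 2 * L * (abs (mcv m W x - W x) + abs (mcv n W x - W x))" by simp
  qed (use iW W(1) in auto)
  also have "... = 2 * L * (a m + a n)" using iW W(1) by (simp add: a_def)
  finally show ?thesis .
 qed
 let ?V = "measure lborel ?J"
 have 1: "(LI x. abs (h m x - h n x)) <= s * ?V + 2 * L * (a m + a n) / s" if s: "s > 0" for s m n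
 proof -
  have i2: "integ (%x. (h m x - h n x)^2)"
   by (rule continuous_cpt_integrable[OF _ compact_cball[of x0 "R + 1"]]) (use z2 hc in \<open>auto intro!: continuous_intros\<close>)
  have "(LI x. abs (h m x - h n x)) <= (LI x. s * ind ?J x + (h m x - h n x)^2 / s)"
  proof (rule integral_mono)
   show "abs (h m x - h n x) <= s * ind ?J x + (h m x - h n x)^2 / s" for x
   using abs_le_sq[OF s, of "h m x - h n x"] z2[of x] by (cases "x : ?J") (auto simp: power2_eq_square)
  qed (use ih i2 integrable_indicator_cpt[OF compact_cball] in auto)
  also have "... = s * ?V + (LI x. (h m x - h n x)^2) / s" using i2 integrable_indicator_cpt[OF compact_cball] by simp
  also have "... <= s * ?V + 2 * L * (a m + a n) / s" using 2 s by (intro add_left_mono divide_right_mono) auto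
  finally show ?thesis .
 qed
 have E: "EX N. ALL n>=N. ALL m>=n. 2 * L * (a m + a n) <= d" if "d > 0" for d
 proof -
  have "(%n. 4 * L * a n) ~~> 4 * L * 0" by (intro tendsto_intros a0)
  then have "\<forall>\<^sub>F n in sequentially. 4 * L * a n < d" using that by (intro order_tendstoD) auto
  then obtain N where N: "!!n. n >= N ==> 4 * L * a n < d" unfolding eventually_sequentially by blast
  have "2 * L * (a m + a n) <= d" if "n >= N" "m >= n" for m n
   using N[of n] N[of m] that unfolding distrib_left by linarith
  then show ?thesis by blast
 qed
 obtain r g where r: "strict_mono r" and g: "integ g" "AEL x. (%n. h (r n) x) ~~> g x"
  "!!phi B. phi : BM ==> (!!x. abs (phi x) <= B) ==> (%n. (LI x. h (r n) x * phi x)) ~~> (LI x. g x * phi x)"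
  by (rule L1_Cauchy_limit[of h, OF ih 1 E]) (assumption+, rule that, assumption, assumption, assumption, blast)
 show ?thesis
 proof (rule that[OF g(1)])
  fix K and phi :: "plane => real" assume K: "C1c K phi"
  note p = C1cD[OF K]
  obtain B where B: "!!x. abs (phi x) <= B" using continuous_cpt_bounded[OF p(4,1,5)] by metis
  obtain B' where B': "!!x. abs (pd j phi x) <= B'" using continuous_cpt_bounded[OF p(3,1,6)] by metis
  have [measurable]: "pd j phi : BM" "phi : BM"
   using p(3,4) by (auto intro: borel_measurable_continuous_onI)
  have "(%n. (LI x. (mcv (r n) v x - v x) * pd j phi x)) ~~> 0"
   using LIMSEQ_subseq_LIMSEQ[OF mcv_L1conv[OF v(1)] r] v(1) integrable_mcv[OF v(1)] B'
   by (intro nn_integral_abs_product_null[where B=B']) (auto simp: o_def)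
  moreover have "(LI x. (mcv n v x - v x) * pd j phi x) = - (LI x. h n x * phi x) - (LI x. v x * pd j phi x)" for n
  proof -
   note bp = by_parts[where i=j, OF open_UNIV smooth_Ck[OF smooth_partial[OF sm[of n], of i]] K subset_UNIV]
   have "integ (%x. v x * pd j phi x)" by (rule integrable_bounded_mult(1)[OF v(1), where B=B']) (use B' in auto)
   then show ?thesis using bp(1,3) unfolding h_def v(2) by (simp add: left_diff_distrib)
  qed
  moreover have "(%n. - (LI x. h (r n) x * phi x) - (LI x. v x * pd j phi x)) ~~> - (LI x. g x * phi x) - (LI x. v x * pd j phi x)"
   by (intro tendsto_intros g(3)[OF _ B]) measurable
  ultimately have "0 = - (LI x. g x * phi x) - (LI x. v x * pd j phi x)" by (intro LIMSEQ_unique[of _ 0]) auto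
  then show "(LI x. v x * pd j phi x) = - (LI x. g x * phi x)" by linarith
 next
  fix s :: nat assume s: "s >= 1"
  obtain C where C: "!!phi x0 R i j. smooth phi ==> (!!x. x ~: cball x0 R ==> phi x = 0) ==> (!!x. abs (lap phi x - phi x) <= 1 / 2) ==>
   (LI x. abs (pd j (pd i phi) x) ^ Suc s) <= C * measure lborel (cball x0 (R + 1))"
   by (rule CZ_power[OF s]) blast
  \<comment> \<open>Scaling by \<open>e\<close> brings lap - identity of the mollified function
    below the threshold 1/2 of \<open>CZ_power\<close>.\<close>
  define e where "e = 1 / (2 * (L + c + 1))"
  have e: "e > 0" using L c by (simp add: e_def)
  let ?A = "(1 / e) ^ Suc s * (C * measure lborel (cball x0 (R + 1 + 1)))"
  have A: "(LI x. abs (h n x) ^ Suc s) <= ?A" for n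
  proof -
   let ?g = "%x. e * mcv n f x"
   have pg: "pd k ?g = (%x. e * pd k (mcv n f) x)" for k
   by (rule ext) (rule partial_cmult[OF smooth_differentiable[OF sm]])
   have pg2: "pd l (pd k ?g) = (%x. e * pd l (pd k (mcv n f)) x)" for k l
   unfolding pg by (rule ext) (rule partial_cmult[OF smooth_differentiable[OF smooth_partial[OF sm]]])
   have "(LI x. abs (pd j (pd i ?g) x) ^ Suc s) <= C * measure lborel (cball x0 (R + 1 + 1))"
   proof (rule C[OF smooth_cmult[OF sm]])
   show "e * mcv n f x = 0" if "x ~: ?J" for x using z[OF that] by simp
   have "lap ?g x - ?g x = e * (mcv n W x - mcv n f x)" for x
   unfolding lap_def pg2 W(3)[of n x, unfolded lap_def, symmetric] by (simp add: sum_distrib_left algebra_simps)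
   moreover have "abs (e * (mcv n W x - mcv n f x)) <= e * (L + c + 1)" for x
   unfolding abs_mult using e wL[of n x] pc[of n x] by (intro mult_mono) auto
   moreover have "e * (L + c + 1) = 1/2" using L c by (simp add: e_def field_simps)
   ultimately show "abs (lap ?g x - ?g x) <= 1/2" for x by simp
   qed
   then have "e ^ Suc s * (LI x. abs (h n x) ^ Suc s) <= C * measure lborel (cball x0 (R + 1 + 1))"
   using e by (simp only: pg2 h_def abs_mult power_mult_distrib abs_of_pos integral_mult_right_zero)
   then have "(1 / e) ^ Suc s * (e ^ Suc s * (LI x. abs (h n x) ^ Suc s)) <= ?A" using e by (intro mult_left_mono) auto
   then show ?thesis using e by (simp add: power_one_over)
  qed
  have I: "integ (%x. abs (h n x) ^ Suc s)" for n
   by (rule continuous_cpt_integrable[OF _ compact_cball[of x0 "R + 1"]])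
   (use z2 hc in \<open>auto intro!: continuous_intros simp del: power_Suc\<close>)
  have m: "(%x. abs (g x) ^ Suc s) : BM" using g(1) by measurable
  have l: "AEL x. (%n. abs (h (r n) x) ^ Suc s) ~~> abs (g x) ^ Suc s"
   using g(2) by (rule eventually_mono) (intro tendsto_intros)
  show "integ (%x. abs (g x) ^ Suc s)" by (rule fatou_bound(1)[OF I _ A m _ l]) simp_all
 qed
qed

context lake_coeff
begin

lemma gradient_bound_compact:
 assumes w: "wsol D b M u U z" and K: "compact K" "K <= D"
 obtains C where "C >= 0" "AEL y. y : K --> abs (U 1 y) + abs (U 2 y) <= C"
proof -
 have M: "M >= 0" using wsolD(3)[OF w, of 0] by linarith
 have l: "EX r>0. EX C. AEL y. y : ball x r --> abs (abs (U 1 y) + abs (U 2 y)) <= C" if "x : K" for x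
 proof -
  have "x : D" using that K(2) by blast
  then obtain R where R: "R > 0" "cball x R <= D" using D open_contains_cball by metis
  obtain C where C: "!!u U z i. wsol D b M u U z ==> AEL y. y : cball x (R/64) --> abs (U i y) <= C"
   by (rule gradient_bound[OF R M]) (rule that)
  have "AEL y. y : ball x (R/64) --> abs (abs (U 1 y) + abs (U 2 y)) <= C + C"
   using C[OF w, of 1] C[OF w, of 2] by eventually_elim (auto intro: add_mono)
  then show ?thesis using R(1) by (intro exI[of _ "R/64"]) auto
 qed
 obtain C where "C >= 0" "AEL y. y : K --> abs (abs (U 1 y) + abs (U 2 y)) <= C"
  by (rule AE_bound_compact[OF K(1) l])
 then show ?thesis using that by simp
qed

text \<open>With gradients bounded near \<open>K\<close>, the Laplacian of the localised solution is
  bounded, as \<open>hessian_bounded_laplacian\<close> requires. Near points of \<open>K\<close> the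
  cutoff is constant, so \<open>cutv\<close> is \<open>U\<close> there.\<close>

lemma hessian_compact:
 assumes w: "wsol D b M u U z" and K: "compact K" "K <= D"
 obtains g where "integ g" "!!phi. C1c K phi ==> (LI x. U i x * pd j phi x) = - (LI x. g x * phi x)"
  "!!s. s >= 1 ==> integ (%x. abs (g x) ^ Suc s)"
proof -
 obtain e where e: "e > 0" "(UN y:K. cball y e) <= D"
  using compact_subset_open_imp_cball_epsilon_subset[OF K(1) D K(2)] by metis
 let ?K = "UN y:K. cball y e"
 have cK: "compact ?K" by (rule compact_thicken[OF K(1)])
 obtain xi :: "plane => real" where xi: "smooth xi" "!!x. x ~: ?K ==> xi x = 0" "!!x y. y : K ==> dist y x <= e / 4 ==> xi x = 1"
  by (rule cutoff_compact[OF K(1) e(1)]) (rule that)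
 have M: "M >= 0" using wsolD(3)[OF w, of 0] by linarith
 obtain C where C: "C >= 0" "AEL y. y : ?K --> abs (U 1 y) + abs (U 2 y) <= C" by (rule gradient_bound_compact[OF w cK e(2)])
 have xi2: "ALL x. x ~: ?K --> xi x = 0" using xi(2) by blast
 note id = cut_identities[OF w xi(1) cK e(2) xi2]
 obtain c where c': "c >= 0" "!!u U z x. wsol D b M u U z ==> abs (u x * xi x) <= c"
  "!!u U z x. wsol D b M u U z ==> abs (cutw xi b u U z x) <= c * (1 + abs (U 1 x) + abs (U 2 x)) * ind ?K x"
  by (rule cutw_bound[OF xi(1) cK e(2) xi(2) M]) (assumption, rule that)
 note c = c'(1) c'(2,3)[OF w]
 have WL: "AEL x. abs (cutw xi b u U z x) <= c * (1 + C)" using C(2)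
 proof eventually_elim
  fix x assume "x : ?K --> abs (U 1 x) + abs (U 2 x) <= C"
  then have "c * (1 + abs (U 1 x) + abs (U 2 x)) * ind ?K x <= c * (1 + C)"
   using c(1) C(1) by (cases "x : ?K") (auto intro!: mult_left_mono simp: indicator_def)
  then show "abs (cutw xi b u U z x) <= c * (1 + C)" using c(3)[of x] by linarith
 qed
 obtain R where "?K <= ball 0 R" using bounded_subset_ballD[OF compact_imp_bounded[OF cK], of 0] by (elim exE conjE)
 then have R: "?K <= cball 0 R" using ball_subset_cball by (rule order_trans)
 have z: "u x * xi x = 0" if "x ~: cball 0 R" for x using xi(2)[of x] that R by fastforce
 have L: "c * (1 + C) >= 0" using c(1) C(1) by simp
 have v: "cutv xi u U i x = U i x" if "x : K" for x
 proof -
  have "pd i xi x = pd i (%_. 1) x"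
   using e(1) that xi(3) by (intro partial_cong[of "ball x (e/4)"]) auto
  then show ?thesis using that xi(3)[of x x] e(1) by (simp add: cutv_def)
 qed
 show ?thesis
 proof (rule hessian_bounded_laplacian[OF id(1) c(2) _ id(2,4,3) WL id(5) L, of 0 R i j])
  fix g assume g: "integ g" "!!K phi. C1c K phi ==> (LI x. cutv xi u U i x * pd j phi x) = - (LI x. g x * phi x)"
   "!!s. s >= 1 ==> integ (%x. abs (g x) ^ Suc s)"
  show ?thesis
  proof (rule that[OF g(1) _ g(3)])
   fix phi assume "C1c K phi"
   note p = this C1cD[OF this]
   have "U i x * pd j phi x = cutv xi u U i x * pd j phi x" for x using v[of x] p(7)[of x j] by (cases "x : K") auto
   then show "(LI x. U i x * pd j phi x) = - (LI x. g x * phi x)" by (simp only: g(2)[OF p(1)])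
  qed
 qed (rule z)
qed

lemma hessian_exists:
 assumes w: "wsol D b M u U z"
 obtains f where "f : BM" "wpd D j (U i) f" "!!s. s >= 1 ==> loc_int D (%x. abs (f x) ^ Suc s)"
proof -
 obtain E where E: "!!n. compact (E n)" "!!n. E n <= D" "\<Union>(range E) = D"
  "!!K. compact K ==> K <= D ==> EX N. ALL n>=N. K <= E n" "!!n. E n <= interior (E (Suc n))"
  using open_Union_compact_subsets[OF D] by metis
 have mono: "E m <= E n" if "m <= n" for m n
  using lift_Suc_mono_le[of E, OF _ that] E(5) interior_subset by blast
 define P where "P k g \<longleftrightarrow> integ g & (ALL phi. C1c (E k) phi --> (LI x. U i x * pd j phi x) = - (LI x. g x * phi x))
  & (ALL s>=1. integ (%x. abs (g x) ^ Suc s))" for k and g :: "plane => real"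
 have "EX g. P k g" for k
 proof (rule hessian_compact[OF w E(1,2), of k i j])
  fix g assume "integ g" "!!phi. C1c (E k) phi ==> (LI x. U i x * pd j phi x) = - (LI x. g x * phi x)"
   "!!s. s >= 1 ==> integ (%x. abs (g x) ^ Suc s)"
  then show ?thesis unfolding P_def by (intro exI[of _ g] conjI allI impI)
 qed
 then obtain G where G: "!!k. P k (G k)" by metis
 then have g: "integ (G k)" "C1c (E k) phi ==> (LI x. U i x * pd j phi x) = - (LI x. G k x * phi x)"
  "s >= 1 ==> integ (%x. abs (G k x) ^ Suc s)" for k phi s unfolding P_def by blast+
 note [measurable] = g(1)[THEN borel_measurable_integrable]
 \<comment> \<open>The Hessians on an exhaustion are glued as a pointwise limit, which is Borel by
   construction; on each \<open>interior (E k)\<close> the sequence is almost everywhere constant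
   from \<open>k\<close> on.\<close>
 define f where "f x = lim (%k. G k x)" for x
 have f[measurable]: "f : BM" unfolding f_def[abs_def] by measurable
 have C1c_mono: "C1c K' phi" if "C1c K phi" "K <= K'" "compact K'" for K K' phi using that unfolding C1c_def by blast
 have eq: "AEL x. x : interior (E k) --> G m x - G k x = 0" if "k <= m" for k m
 proof (rule fundamental_lemma)
  have "integ (%x. G m x - G k x)" using g(1) by simp
  then show "loc_int (interior (E k)) (%x. G m x - G k x)" by (rule loc_int_integrable)
  fix phi assume "test_fun (interior (E k)) phi"
  then obtain K where K: "K <= interior (E k)" "C1c K phi" by (rule test_funD)
  have k: "C1c (E k) phi" "C1c (E m) phi" using K(1) mono[OF that] interior_subset[of "E k"] by (auto intro!: C1c_mono[OF K(2)] E(1))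
  note p = C1cD[OF k(1)]
  have "integ (%x. G n x * phi x)" for n
   using loc_int_mult_cont[OF loc_int_integrable[OF g(1)] p(1) subset_UNIV p(4,5)] .
  then show "(LI x. (G m x - G k x) * phi x) = 0" using g(2)[OF k(1)] g(2)[OF k(2)] by (simp add: left_diff_distrib)
 qed simp
 have fG: "AEL x. x : interior (E k) --> f x = G k x" for k
 proof -
  have "AEL x. ALL m. k <= m --> x : interior (E k) --> G m x - G k x = 0"
   unfolding AE_all_countable using eq[of k] by auto
  then show ?thesis
  proof eventually_elim
   fix x assume a: "ALL m. k <= m --> x : interior (E k) --> G m x - G k x = 0"
   show "x : interior (E k) --> f x = G k x"
   proof
   assume x: "x : interior (E k)"
   have "\<forall>\<^sub>F m in sequentially. G m x = G k x" by (rule eventually_sequentiallyI[of k]) (metis a x eq_iff_diff_eq_0)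
   then show "f x = G k x" unfolding f_def by (intro limI tendsto_eventually)
   qed
  qed
 qed
 have sub: "EX k. K <= interior (E k)" if K: "compact K" "K <= D" for K
 proof -
  obtain k where "K <= E k" using E(4)[OF K] by blast
  then show ?thesis using E(5)[of k] by (intro exI[of _ "Suc k"]) (rule order_trans)
 qed
 have cg: "loc_int D F" if F[measurable]: "F : BM" and H: "!!k. integ (H k)"
   "!!k. AEL x. x : interior (E k) --> F x = H k x" for F and H :: "nat => plane => real"
  unfolding loc_int_def
 proof (intro allI impI)
  fix K :: "plane set" assume K: "compact K & K <= D"
  then obtain k where k: "K <= interior (E k)" using sub by blast
  have [measurable]: "K : sets borel" "H k : BM" using K H(1)[of k] by (auto simp: borel_compact)
  have "AEL x. ind K x * H k x = ind K x * F x" using H(2)[of k] by (rule eventually_mono) (use k in \<open>auto simp: indicator_def\<close>)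
  moreover have "integ (%x. ind K x * H k x)" using loc_intD[OF loc_int_integrable[OF H(1)]] K by blast
  ultimately show "integ (%x. ind K x * F x)" by (subst integrable_cong_AE[symmetric]) auto
 qed
 show ?thesis
 proof (rule that[OF f])
  show "loc_int D (%x. abs (f x) ^ Suc s)" if s: "s >= 1" for s
  proof (rule cg)
   show "AEL x. x : interior (E k) --> abs (f x) ^ Suc s = abs (G k x) ^ Suc s" for k using fG[of k] by (rule eventually_mono) simp
  qed (measurable, rule g(3)[OF s])
  have lf: "loc_int D f" by (rule cg[OF f g(1) fG])
  show "wpd D j (U i) f" unfolding wpd_def
  proof (intro conjI allI impI lf wsol_loc_int(2)[OF w])
   fix phi assume "test_fun D phi"
   then obtain K where K: "K <= D" "C1c K phi" by (rule test_funD)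
   note p = C1cD[OF K(2)]
   obtain k where k: "K <= interior (E k)" using sub[OF p(1) K(1)] by blast
   have [measurable]: "phi : BM" using p(4) by (rule borel_measurable_continuous_onI)
   have "AEL x. f x * phi x = G k x * phi x" using fG[of k] by (rule eventually_mono) (use k p(5) in auto)
   then have "(LI x. f x * phi x) = (LI x. G k x * phi x)" by (intro integral_cong_AE) auto
   moreover have "C1c (E k) phi" using k interior_subset[of "E k"] by (intro C1c_mono[OF K(2)] E(1)) auto
   ultimately show "(LI x. U i x * pd j phi x) = - (LI x. f x * phi x)" using g(2) by simp
  qed
 qed
qed

end

text \<open>Locally in every L^p, encoded by integer exponents from 2 on; a real exponent p is
  reached through t^p <= 1 + t^(s+1) with s + 1 >= p.\<close>

definition loc_Lall :: "plane set => (plane => real) => bool" where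
 "loc_Lall D f \<longleftrightarrow> f : BM & (ALL s>=1. loc_int D (%x. abs (f x) ^ Suc s))"

lemma loc_LallD: "loc_Lall D f ==> f : BM" "loc_Lall D f ==> s >= 1 ==> loc_int D (%x. abs (f x) ^ Suc s)"
 by (auto simp: loc_Lall_def)

lemma abs_add_power_le: "abs (a + b) ^ k <= 2 ^ k * (abs a ^ k + abs b ^ k)" for a b :: real
proof -
 have "abs (a + b) ^ k <= (2 * max (abs a) (abs b)) ^ k" by (intro power_mono) auto
 also have "... = 2 ^ k * (max (abs a) (abs b)) ^ k" by (rule power_mult_distrib)
 also have "(max (abs a) (abs b)) ^ k <= abs a ^ k + abs b ^ k" by (auto simp: max_def)
 finally show ?thesis by simp
qed

lemma borel_indicator_times:
 "compact K ==> f : BM ==> (%x. ind K x * f x) : BM" for K :: "plane set" and f :: "plane => real"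
 by (intro borel_measurable_times borel_measurable_indicator) (auto simp: borel_compact)

lemma loc_int_cong:
 assumes "loc_int D f" "!!x. x : D ==> f x = f' x"
 shows "loc_int D f'"
 unfolding loc_int_def
proof (intro allI impI)
 fix K assume K: "compact K & K <= D"
 have "indicat_real K x * f x = ind K x * f' x" for x using K assms(2)[of x] by (cases "x : K") auto
 moreover have "integ (%x. ind K x * f x)" using loc_intD[OF assms(1), of K] K by blast
 ultimately show "integ (%x. ind K x * f' x)" by (simp only:)
qed

lemma loc_int_le:
 assumes "loc_int D g" "f : BM" "!!x. x : D ==> abs (f x) <= g x"
 shows "loc_int D f"
 unfolding loc_int_def
proof (intro allI impI)
 fix K :: "plane set" assume K: "compact K & K <= D"
 show "integ (%x. ind K x * f x)"
 proof (rule integ_bound[OF loc_intD[OF assms(1)]])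
  show "(%x. ind K x * f x) : borel_measurable lborel"
   using K assms(2) borel_indicator_times by simp
  have "abs (f x) <= abs (g x)" if "x : K" for x using assms(3)[of x] that K by fastforce
  then show "AEL x. norm (ind K x * f x) <= norm (ind K x * g x)"
   by (intro AE_I2) (auto simp: indicator_def)
 qed (use K in auto)
qed

lemma loc_Lall_add:
 assumes "loc_Lall D f" "loc_Lall D g"
 shows "loc_Lall D (%x. f x + g x)"
 unfolding loc_Lall_def
proof (intro conjI allI impI)
 note [measurable] = assms[THEN loc_LallD(1)]
 show "(%x. f x + g x) : BM" by measurable
 fix s :: nat assume s: "s >= 1"
 show "loc_int D (%x. abs (f x + g x) ^ Suc s)"
 proof (rule loc_int_le)
  show "loc_int D (%x. 2 ^ Suc s * (abs (f x) ^ Suc s + abs (g x) ^ Suc s))"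
   using assms s by (intro loc_int_mult_C loc_int_add loc_LallD(2)) auto
  show "abs (abs (f x + g x) ^ Suc s) <= 2 ^ Suc s * (abs (f x) ^ Suc s + abs (g x) ^ Suc s)" for x
   using abs_add_power_le[of "f x" "g x" "Suc s"] by (simp del: power_Suc)
 qed measurable
qed

lemma loc_Lall_cont:
 assumes "open D" "continuous_on D c"
 shows "loc_Lall D (%x. ind D x * c x)"
 unfolding loc_Lall_def
proof (intro conjI allI impI)
 have "(%x. ind D x *R c x) : BM"
  using assms by (intro borel_measurable_continuous_on_indicator) auto
 then show "(%x. ind D x * c x) : BM" by simp
 fix s :: nat assume s: "s >= 1"
 have "loc_int D (%x. abs (c x) ^ Suc s)" by (intro loc_int_continuous continuous_intros assms)
 then show "loc_int D (%x. abs (ind D x * c x) ^ Suc s)" by (rule loc_int_cong) simp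
qed

lemma loc_Lall_bounded:
 assumes m: "f : BM" and b: "!!K. compact K ==> K <= D ==> EX C. AEL y. y : K --> abs (f y) <= C"
 shows "loc_Lall D f"
 unfolding loc_Lall_def loc_int_def
proof (intro conjI allI impI m)
 fix s :: nat and K assume K: "compact K & K <= D"
 then obtain C where C: "AEL y. y : K --> abs (f y) <= C" using b by blast
 show "integ (%x. ind K x * abs (f x) ^ Suc s)"
 proof (rule integrable_nonneg_le(1))
  show "integ (%x. abs C ^ Suc s * ind K x)" using K by (intro integrable_mult_right integrable_indicator_cpt) auto
  show "(%x. ind K x * abs (f x) ^ Suc s) : BM" using K m by (simp add: borel_indicator_times del: power_Suc)
  show "AEL x. 0 <= ind K x * abs (f x) ^ Suc s & ind K x * abs (f x) ^ Suc s <= abs C ^ Suc s * ind K x" using C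
   by (rule eventually_mono) (auto simp: indicator_def simp del: power_Suc intro!: power_mono)
 qed
qed

lemma Lp_locI:
 assumes D: "D : sets borel" and u: "u : BL D" "AEL x. x : D --> u x = g x"
  and g: "loc_Lall D g" and p: "p >= 1"
 shows "u : Lp_loc D p"
 unfolding Lp_loc_def Lp_def mem_Collect_eq
proof (intro allI impI conjI)
 fix K :: "plane set" assume K: "compact K & K <= D"
 have Kb[measurable]: "K : sets borel" using K by (simp add: borel_compact)
 note [measurable] = loc_LallD(1)[OF g]
 have ae: "AEL x. x : K --> u x = g x" using u(2) by (rule eventually_mono) (use K in auto)
 show m: "u : BL K" using measurable_restrict_mono[OF u(1)] K by blast
 obtain s :: nat where s: "s >= 1" "real (Suc s) >= p"
  using real_arch_simple[of p] by (metis le_Suc_eq max.cobounded1 max.cobounded2 of_nat_le_iff order_trans)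
 have "integ (%x. ind K x * (abs (g x) powr p))"
 proof (rule integ_bound)
  show "integ (%x. ind K x + ind K x * abs (g x) ^ Suc s)"
   using K by (intro integ_add integrable_indicator_cpt loc_intD[OF loc_LallD(2)[OF g s(1)]]) auto
  have "t powr p <= 1 + t ^ Suc s" if "t >= 0" for t :: real
  proof (cases "t <= 1")
   case True
   then have "t powr p <= 1" using that p by (intro powr_le1) auto
   moreover have "0 <= t ^ Suc s" using that by (rule zero_le_power)
   ultimately show ?thesis by linarith
  next
   case False
   then have "t powr p <= t powr real (Suc s)" using s(2) by (intro powr_mono) auto
   also have "... = t ^ Suc s" using False by (intro powr_realpow) auto
   finally show ?thesis by linarith
  qed
  from this[of "abs (g x)" for x] show "AEL x. norm (ind K x * (abs (g x) powr p)) <= norm (ind K x + ind K x * abs (g x) ^ Suc s)"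
   by (intro AE_I2) (auto simp: indicator_def simp del: power_Suc)
  show "(%x. ind K x * (abs (g x) powr p)) : borel_measurable lborel" by measurable
 qed
 then show "integrable (lebesgue_on K) (%x. abs (u x) powr p)"
 proof (subst integral_lebesgue_on(2)[OF Kb])
  show "(%x. abs (g x) powr p) : BM" by measurable
  show "AEL x. x : K --> abs (u x) powr p = abs (g x) powr p" using ae by (rule eventually_mono) auto
  show "(%x. abs (u x) powr p) : BL K" using m by measurable
 qed
qed

lemma borel_lebesgue_on: "f : BM ==> f : BL D" for f :: "plane => real"
 by (intro measurable_restrict_space1 measurable_completion) simp

lemma has_weak_partialI:
 assumes D: "open D" and u: "u : BL D" "AEL x. x : D --> u x = g x"
  and g: "loc_Lall D g" and v: "loc_Lall D v" and w: "wpd D i g v"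
 shows "has_weak_partial D i u v"
 unfolding has_weak_partial_def
proof (intro conjI allI impI)
 have Db[measurable]: "D : sets borel" using D by simp
 note [measurable] = loc_LallD(1)[OF g] loc_LallD(1)[OF v]
 show "u : Lp_loc D 1" by (rule Lp_locI[OF Db u g]) simp
 show "v : Lp_loc D 1" by (rule Lp_locI[OF Db borel_lebesgue_on _ v]) auto
 fix phi assume t: "test_fun D phi"
 then obtain K where K: "K <= D" "C1c K phi" by (rule test_funD)
 note p = C1cD[OF K(2)]
 have [measurable]: "phi : BM" "pd i phi : BM"
  using p(3,4) by (auto intro: borel_measurable_continuous_onI)
 note [measurable] = u(1) borel_lebesgue_on
 have z: "ind D x * (g x * pd i phi x) = g x * pd i phi x" "ind D x * (v x * phi x) = v x * phi x" for x
  using p(5,6) K(1) by (auto simp: indicator_def subset_iff)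
 have m: "(%x. u x * pd i phi x) : BL D"
  by (intro borel_measurable_times u(1) borel_lebesgue_on) measurable
 have "(\<integral>x. u x * pd i phi x \<partial>lebesgue_on D) = (LI x. ind D x * (g x * pd i phi x))"
  by (rule integral_lebesgue_on(1)[OF Db _ _ m]) (measurable, use u(2) in \<open>auto elim!: eventually_mono\<close>)
 also have "... = - (LI x. ind D x * (v x * phi x))"
  unfolding z using w t by (simp add: wpd_def)
 also have "(LI x. ind D x * (v x * phi x)) = (\<integral>x. v x * phi x \<partial>lebesgue_on D)"
  by (rule integral_lebesgue_on(1)[symmetric, OF Db]) (auto intro!: borel_lebesgue_on borel_measurable_times)
 finally show "(\<integral>x. u x * pd i phi x \<partial>lebesgue_on D) = - (\<integral>x. v x * phi x \<partial>lebesgue_on D)" .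
qed

lemma wpd_cong:
 assumes "wpd D i u v" "!!x. x : D ==> u x = u' x" "!!x. x : D ==> v x = v' x"
 shows "wpd D i u' v'"
proof -
 show ?thesis unfolding wpd_def
 proof (intro conjI allI impI)
  show "loc_int D u'" "loc_int D v'" using assms loc_int_cong unfolding wpd_def by metis+
  fix phi assume t: "test_fun D phi"
  then obtain K where K: "K <= D" "C1c K phi" by (rule test_funD)
  note p = C1cD[OF K(2)]
  have "(%x. u' x * pd i phi x) = (%x. u x * pd i phi x)" "(%x. v' x * phi x) = (%x. v x * phi x)"
   using p(5,6) K(1) assms(2,3) by (metis mult_zero_right subset_iff)+
  then show "(LI x. u' x * pd i phi x) = - (LI x. v' x * phi x)"
   using assms(1) t unfolding wpd_def by simp
 qed
qed

context lake_coeff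
begin

text \<open>\<open>\<psi>\<close> is compared with the Borel function g = u + q - mu, whose
  derivatives are those of the solution plus those of q, and q adds nothing to the divergence. For
  the last claim \<open>wpd_level_set\<close> is used twice: where g vanishes so does its gradient,
  where the gradient over b vanishes so do the derivatives \<open>d\<close>, and \<open>d\<close>
  computes \<open>\<zeta>\<close>.\<close>

lemma regularity:
 assumes w: "wsol D b M u U z"
  and q: "Ck_on 2 D q" "!!x. x : D ==> divergence (%y. (1 / b y) *R grad q y) x = 0"
  and \<psi>: "\<psi> : BL D" "AEL x. x : D --> \<psi> x = u x + q x - \<mu>"
  and \<zeta>: "AEL x. x : D --> \<zeta> x = z x"
 shows "p > 1 ==> \<psi> : W2p_loc D p" and "is_L_ae D b \<psi> \<zeta>"
  and "AEL x. x : D --> \<psi> x = 0 --> \<zeta> x = 0"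
proof -
 have Db[measurable]: "D : sets borel" using D by simp
 have q1: "Ck_on 1 D q" "Ck_on 1 D (pd i q)" "continuous_on D q" "continuous_on D (pd i q)" "continuous_on D (pd j (pd i q))" for i j
 proof -
  have 2: "Ck_on (Suc (Suc 0)) D q" using q(1) by (simp add: numeral_2_eq_2)
  then have 1: "Ck_on 1 D (pd i q)" for i by simp
  then show "Ck_on 1 D (pd i q)" for i .
  show "continuous_on D (pd j (pd i q))" "continuous_on D (pd i q)" for i j
   using 1[of i] Ck_on_imp_continuous_on[OF 1[of i]] by auto
  show "Ck_on 1 D q" using Ck_on_SucD[OF 2] by simp
  then show "continuous_on D q" by (rule Ck_on_imp_continuous_on)
 qed
 have fex: "EX f. loc_Lall D f & wpd D j (U i) f" for i j
  by (rule hessian_exists[OF w, of j i]) (auto simp: loc_Lall_def)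
 define f where "f i j = (SOME f. loc_Lall D f & wpd D j (U i) f)" for i j
 have f: "loc_Lall D (f i j)" "wpd D j (U i) (f i j)" for i j using someI_ex[OF fex] unfolding f_def by blast+
 note [measurable] = loc_LallD(1)[OF f(1)] wsolD(1,2,5)[OF w]
 have Lu: "loc_Lall D u" by (rule loc_Lall_bounded[OF wsolD(1)[OF w]]) (use wsolD(3)[OF w] in auto)
 have LU: "loc_Lall D (U i)" for i
 proof (rule loc_Lall_bounded[OF wsolD(5)[OF w]])
  fix K assume K: "compact K" "K <= D"
  obtain C where "AEL y. y : K --> abs (U 1 y) + abs (U 2 y) <= C" by (rule gradient_bound_compact[OF w K])
  then have "AEL y. y : K --> abs (U i y) <= C" by (rule eventually_mono) (use exhaust_2[of i] in auto)
  then show "EX C. AEL y. y : K --> abs (U i y) <= C" by blast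
 qed
 define g where "g x = u x + ind D x * (q x - \<mu>)" for x
 define G where "G i x = U i x + ind D x * pd i q x" for i x
 define H where "H i j x = f i j x + ind D x * pd j (pd i q) x" for i j x
 have Lg: "loc_Lall D g" unfolding g_def by (intro loc_Lall_add Lu loc_Lall_cont D continuous_intros q1)
 have LG: "loc_Lall D (G i)" for i unfolding G_def by (intro loc_Lall_add LU loc_Lall_cont D q1)
 have LH: "loc_Lall D (H i j)" for i j unfolding H_def by (intro loc_Lall_add f(1) loc_Lall_cont D q1)
 have qm: "Ck_on 1 D (%x. q x + - \<mu>)" "x : D ==> pd i (%x. q x + - \<mu>) x = pd i q x" for i x
 proof -
  have c: "Ck_on 1 UNIV (%x::plane. - \<mu>)" using smooth_Ck[OF smooth_const] .
  show "Ck_on 1 D (%x. q x + - \<mu>)" by (intro Ck_on_add D q1) (use c in simp)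
  assume "x : D"
  then have "q differentiable (at x)" using q1(1) by simp
  then show "pd i (%x. q x + - \<mu>) x = pd i q x"
   using partial_diff[of q x "%_. \<mu>" i] by simp
 qed
 have wg: "wpd D i g (G i)" for i
  by (rule wpd_cong[OF wpd_add[OF wsolD(6)[OF w] wpd_Ck[OF D qm(1)]]]) (simp_all add: g_def G_def qm(2)[simplified])
 have wG: "wpd D j (G i) (H i j)" for i j
  by (rule wpd_cong[OF wpd_add[OF f(2) wpd_Ck[OF D q1(2)]]]) (auto simp: G_def H_def)
 have psg: "AEL x. x : D --> \<psi> x = g x" using \<psi>(2) by (rule eventually_mono) (auto simp: g_def)
 have hG: "has_weak_partial D i \<psi> (G i)" for i by (rule has_weak_partialI[OF D \<psi>(1) psg Lg LG wg])
 have hH: "has_weak_partial D j (G i) (H i j)" for i j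
  by (rule has_weak_partialI[OF D borel_lebesgue_on[OF loc_LallD(1)[OF LG]] _ LG LH wG]) simp
 show "\<psi> : W2p_loc D p" if "p > 1"
 proof -
  have 1: "\<psi> : Lp_loc D p" using that by (intro Lp_locI[OF Db \<psi>(1) psg Lg]) simp
  have 2: "G i : Lp_loc D p" "H i j : Lp_loc D p" for i j
   using that by (auto intro!: Lp_locI[OF Db borel_lebesgue_on] loc_LallD LG LH)
  show ?thesis unfolding W2p_loc_def using 1 2 hG hH by blast
 qed
 let ?c = "%x. inverse (b x)"
 define E where "E i x = ?c x * f i i x + pd i ?c x * U i x" for i x
 have wE: "wpd D i (%x. ?c x * U i x) (E i)" for i unfolding E_def by (rule wpd_mult[OF D f(2) b_cont(4)])
 define d where "d i x = ind D x * (?c x * H i i x + pd i ?c x * G i x)" for i x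
 have wd: "wpd D i (%x. ind D x * (?c x * G i x)) (d i)" for i
  by (rule wpd_cong[OF wpd_mult[OF D wG b_cont(4)]]) (auto simp: d_def)
 have c1: "continuous_on D (pd i ?c)" for i using b_cont(4) by simp
 have Lm: "loc_Lall D (%x. ind D x * (c x * h x))" if c: "continuous_on D c" and h: "loc_Lall D h" for c h :: "plane => real"
  unfolding loc_Lall_def
 proof (intro conjI allI impI)
  have "(%x. (ind D x * c x) * h x) : BM"
   by (intro borel_measurable_times loc_LallD(1)[OF loc_Lall_cont[OF D c]] loc_LallD(1)[OF h])
  then show "(%x. ind D x * (c x * h x)) : BM" by (simp add: mult.assoc)
  fix s :: nat assume s: "s >= 1"
  have "loc_int D (%x. abs (c x) ^ Suc s * abs (h x) ^ Suc s)"
   by (intro loc_int_mult_C loc_LallD(2)[OF h s] continuous_intros c)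
  then show "loc_int D (%x. abs (ind D x * (c x * h x)) ^ Suc s)" by (rule loc_int_cong) (simp add: abs_mult power_mult_distrib)
 qed
 have Ld: "loc_Lall D (d i)" for i
  unfolding d_def distrib_left by (intro loc_Lall_add Lm b_cont c1 LG LH)
 have Lc: "loc_Lall D (%x. ind D x * (?c x * G i x))" for i by (intro Lm b_cont LG)
 have hd: "has_weak_partial D i (%x. G i x / b x) (d i)" for i
 proof (rule has_weak_partialI[OF D _ _ Lc Ld wd])
  show "AEL x. x : D --> G i x / b x = ind D x * (?c x * G i x)" by (intro AE_I2) (simp add: field_simps)
  have "(%x. ind D x * (?c x * G i x)) : BL D" by (rule borel_lebesgue_on[OF loc_LallD(1)[OF Lc]])
  then show "(%x. G i x / b x) : BL D"
   by (rule measurable_cong[THEN iffD1, rotated]) (auto simp: field_simps)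
 qed
 have lE: "loc_int D (E i)" for i using wE by (simp add: wpd_def)
 have lbz: "loc_int D (%x. b x * z x)" by (rule wsol_loc_int(6)[OF w])
 have ae: "AEL x. x : D --> (SUM i:UNIV. E i x) + b x * z x = 0"
 proof (rule fundamental_lemma[OF D])
  show "loc_int D (%x. (SUM i:UNIV. E i x) + b x * z x)" by (intro loc_int_add loc_int_sum lE lbz) auto
  fix phi assume t: "test_fun D phi"
  then obtain K where K: "K <= D" "C1c K phi" by (rule test_funD)
  note p = C1cD[OF K(2)]
  have i1: "integ (%x. E i x * phi x)" for i by (rule loc_int_mult_cont[OF lE p(1) K(1) p(4,5)])
  have i2: "integ (%x. (b x * z x) * phi x)" by (rule loc_int_mult_cont[OF lbz p(1) K(1) p(4,5)])
  have "(LI x. (b x * z x) * phi x) = (SUM i:UNIV. (LI x. (?c x * U i x) * pd i phi x))"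
   using wsolD(9)[OF w t] by simp
  also have "... = - (SUM i:UNIV. (LI x. E i x * phi x))"
   using wE t unfolding wpd_def by (simp add: sum_negf)
  also have "(SUM i:UNIV. (LI x. E i x * phi x)) = (LI x. (SUM i:UNIV. E i x * phi x))"
   by (rule integral_sum2[OF i1, symmetric])
  finally show "(LI x. ((SUM i:UNIV. E i x) + b x * z x) * phi x) = 0"
   using i1 i2 unfolding distrib_right sum_distrib_right by (subst lint_add) auto
 qed
 have qdiv: "(SUM i:UNIV. ?c x * pd i (pd i q) x + pd i ?c x * pd i q x) = 0" if x: "x : D" for x
 proof -
  have "pd i (%y. ((1 / b y) *R grad q y) $ i) x = ?c x * pd i (pd i q) x + pd i ?c x * pd i q x" for i
  proof -
   have "(%y. ((1 / b y) *R grad q y) $ i) = (%y. ?c y * pd i q y)" by (simp add: grad_def inverse_eq_divide)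
   moreover have "?c differentiable (at x)" "pd i q differentiable (at x)" using b_cont(4) q1(2) x by auto
   ultimately show ?thesis by (simp add: partial_mult)
  qed
  then show ?thesis using q(2)[OF x] unfolding divergence_def by simp
 qed
 have L: "AEL x. x : D --> - (1 / b x) * (SUM i:UNIV. d i x) = \<zeta> x" using ae \<zeta>
 proof eventually_elim
  fix x assume a: "x : D --> (SUM i:UNIV. E i x) + b x * z x = 0" "x : D --> \<zeta> x = z x"
  show "x : D --> - (1 / b x) * (SUM i:UNIV. d i x) = \<zeta> x"
  proof
   assume x: "x : D"
   have "(SUM i:UNIV. d i x) = (SUM i:UNIV. E i x) + (SUM i:UNIV. ?c x * pd i (pd i q) x + pd i ?c x * pd i q x)"
   unfolding sum.distrib[symmetric] using x by (intro sum.cong) (auto simp: d_def E_def G_def H_def algebra_simps)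
   then have "(SUM i:UNIV. d i x) = - (b x * z x)" using a x qdiv[OF x] by simp
   then show "- (1 / b x) * (SUM i:UNIV. d i x) = \<zeta> x" using a(2) x bpos[OF x] by simp
  qed
 qed
 have lev: "AEL x. x : D --> g x = 0 --> d i x = 0" for i
  using wpd_level_set[OF D wg[of i]] wpd_level_set[OF D wd[of i]] by eventually_elim auto
 show "AEL x. x : D --> \<psi> x = 0 --> \<zeta> x = 0"
  using lev[of 1] lev[of 2] L psg by eventually_elim (auto simp: sum_2)
 have "AE x in lebesgue_on D. - (1 / b x) * (SUM i:UNIV. d i x) = \<zeta> x"
  using L by (subst AE_restrict_space_iff) (auto intro: AE_completion)
 then show "is_L_ae D b \<psi> \<zeta>" unfolding is_L_ae_def using hG hd by blast
qed

end

section \<open>Potential estimates\<close>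

text \<open>A positive \<open>k\<close> would make \<open>g\<close>, which vanishes at the maximum,
  positive just to the right of 0, and \<open>f\<close> would increase there.\<close>

lemma second_derivative_max:
 fixes f :: "real => real"
 assumes r: "r > 0" and f: "!!t. abs t < r ==> (f has_real_derivative g t) (at t)" and g: "(g has_real_derivative k) (at 0)"
  and m: "!!t. abs t < r ==> f t <= f 0"
 shows "k <= 0"
proof (rule ccontr)
 assume k: "~ k <= 0"
 have "g 0 = 0" using r f[of 0] m by (intro DERIV_local_max[of f "g 0" 0 r]) auto
 then obtain d where d: "d > 0" "!!h. 0 < h ==> h < d ==> 0 < g h"
  using DERIV_pos_inc_right[OF g] k by auto
 define h where "h = min d r / 2"
 have h: "0 < h" "h < d" "h < r" using d(1) r by (auto simp: h_def)
 obtain z where z: "0 < z" "z < h" "f h - f 0 = (h - 0) * g z"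
  using MVT2[of 0 h f g] h f by auto
 then have "f h - f 0 > 0" using d(2)[of z] h by simp
 then show False using m[of h] h by simp
qed

lemma smooth_reglog: "h > 0 ==> smooth (reglog h)"
 unfolding smooth_def by (metis Ck_reglog Ck_on.simps(1) Ck_on_imp_continuous_on not0_implies_Suc)

text \<open>A small multiple of \<open>reglog 1\<close> makes the Laplacian strictly positive, which
  rules out interior maxima, while it changes the values only a little.\<close>

lemma max_principle:
 assumes D: "open D" "bounded D" and w: "continuous_on (closure D) w" "Ck_on 2 D w" "!!x. x : D ==> lap w x >= 0"
  and c: "!!x. x : frontier D ==> w x <= c" and x1: "x1 : D"
 shows "w x1 <= c"
proof (rule ccontr)
 assume n: "~ w x1 <= c"
 let ?r = "reglog 1"
 have sr: "smooth ?r" by (rule smooth_reglog) simp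
 have cD: "compact (closure D)" using D(2) by simp
 have "compact (?r ` closure D)" by (rule compact_continuous_image[OF smooth_continuous[OF sr] cD])
 then obtain B where "ALL y:?r ` closure D. abs y <= B" using compact_imp_bounded bounded_real by metis
 then have B: "abs (?r x) <= B" if "x : closure D" for x using that by blast
 have x1c: "x1 : closure D" using x1 closure_subset by blast
 have B0: "B >= 0" using B[OF x1c] by linarith
 \<comment> \<open>Small enough that a perturbation of size at most \<open>h * B\<close> at two
   points stays below the gap \<open>w x1 - c\<close>.\<close>
 define h where "h = (w x1 - c) / (3 * (B + 1))"
 have h: "h > 0" "2 * (h * B) < w x1 - c"
 proof -
  show "h > 0" using n B0 by (simp add: h_def)
  then have "2 * (h * B) < h * (3 * (B + 1))" using B0 by (simp add: algebra_simps add_nonneg_pos)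
  also have "... = w x1 - c" using B0 by (simp add: h_def)
  finally show "2 * (h * B) < w x1 - c" .
 qed
 let ?v = "%x. w x + h * ?r x"
 have "continuous_on (closure D) ?v" by (intro continuous_intros w smooth_continuous sr)
 from continuous_attains_sup[OF cD _ this] obtain a where a: "a : closure D" "!!y. y : closure D ==> ?v y <= ?v a"
  using x1 by (metis empty_iff closure_eq_empty)
 have hB: "h * ?r x <= h * B" "- (h * B) <= h * ?r x" if "x : closure D" for x
 proof -
  show "h * ?r x <= h * B" using B[OF that] h(1) by (intro mult_left_mono) auto
  have "h * (- B) <= h * ?r x" using B[OF that] h(1) by (intro mult_left_mono) auto
  then show "- (h * B) <= h * ?r x" by simp
 qed
 have "a : D"
 proof (rule ccontr)
  assume "a ~: D"
  then have "a : frontier D" using a(1) D(1) by (simp add: frontier_def interior_open)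
  then show False using c[of a] a(2)[OF x1c] hB[OF x1c] hB[OF a(1)] h(2) by linarith
 qed
 then obtain r where e: "r > 0" "ball a r <= D" using D(1) open_contains_ball by metis
 have C2: "Ck_on 2 D ?v" by (intro Ck_on_add Ck_on_cmult D w Ck_on_mono[OF smooth_Ck[OF sr]]) auto
 then have dv: "x : D ==> ?v differentiable (at x)" "x : D ==> pd i ?v differentiable (at x)" for x i
  by (auto simp: numeral_2_eq_2)
 have w2: "x : D ==> w differentiable (at x)" "x : D ==> pd i w differentiable (at x)" for x i
  using w(2) by (auto simp: numeral_2_eq_2)
 have p1: "pd i ?v x = pd i w x + h * pd i ?r x" if "x : D" for i x
  using that by (simp add: partial_add[OF w2(1)] partial_cmult smooth_differentiable[OF sr])
 have p2: "pd i (pd i ?v) a = pd i (pd i w) a + h * pd i (pd i ?r) a" for i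
 proof -
  have "pd i (pd i ?v) a = pd i (%x. pd i w x + h * pd i ?r x) a"
   by (rule partial_cong[OF D(1) \<open>a : D\<close> p1])
  also have "... = pd i (pd i w) a + h * pd i (pd i ?r) a"
   using \<open>a : D\<close> by (simp add: partial_add[OF w2(2)] partial_cmult smooth_differentiable[OF smooth_partial[OF sr]])
  finally show ?thesis .
 qed
 have "pd i (pd i ?v) a <= 0" for i
 proof (rule second_derivative_max[OF e(1)])
  have t: "a + t *R e i : D" if "abs t < r" for t
  proof -
   have "dist a (a + t *R e i) = abs t" by (simp add: dist_norm norm_axis_1)
   then show ?thesis using e(2) that by (auto simp: subset_iff)
  qed
  show "((%t. ?v (a + t *R e i)) has_real_derivative pd i ?v (a + t *R e i)) (at t)" if "abs t < r" for t
   by (rule line_deriv[OF dv(1)[OF t[OF that]]])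
  show "((%t. pd i ?v (a + t *R e i)) has_real_derivative pd i (pd i ?v) a) (at 0)"
   using line_deriv[of "pd i ?v" a 0 i, OF dv(2)] \<open>a : D\<close> by simp
  show "?v (a + t *R e i) <= ?v (a + 0 *R e i)" if "abs t < r" for t
   using a(2) t[OF that] closure_subset by auto
 qed
 then have "(SUM i:UNIV. pd i (pd i ?v) a) <= 0" by (rule sum_nonpos)
 moreover have "(SUM i:UNIV. pd i (pd i ?v) a) = lap w a + h * lap ?r a"
  unfolding p2 lap_def by (simp add: sum.distrib sum_distrib_left)
 moreover have "lap ?r a > 0"
 proof -
  have "a \<bullet> a + 1^2 > 0" by (simp add: add_nonneg_pos)
  then show ?thesis unfolding lap_reglog[OF zero_less_one] by (intro divide_pos_pos zero_less_power) auto
 qed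
 moreover have "h * lap ?r a > 0" using h calculation(3) by simp
 ultimately show False using w(3)[OF \<open>a : D\<close>] by linarith
qed

text \<open>Both bounds compare the regular part h with explicit functions on the boundary. For the
  upper bound, the logarithm there is at least ln(1/d0) up to the factor 1/(2 pi). For the lower
  bound the singular logarithm is replaced by the subharmonic \<open>reglog s\<close>, at the price
  of a boundary error of order s^2 / rho^2 with rho the distance from y to the boundary; then s ->
  0.\<close>

lemma green_bounds:
 assumes G: "is_dirichlet_green D G" and D: "open D" "bounded D" and xy: "x : D" "y : D" "x ~= y"
  and d0: "d0 > 0" "!!x y. x : closure D ==> y : closure D ==> dist x y <= d0"
 shows "0 <= G x y" "G x y <= 1 / (2 * pi) * ln (d0 / dist x y)"
proof -
 obtain h where h: "continuous_on (closure D) h" "Ck_on 2 D h" "!!x. x : D ==> lap h x = 0"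
  "!!x. x : frontier D ==> h x = 1 / (2 * pi) * ln (1 / dist x y)" "G x y = 1 / (2 * pi) * ln (1 / dist x y) - h x"
 proof -
  obtain h where h: "continuous_on (closure D) h" "harmonic_on D h"
   "ALL x:frontier D. h x = 1 / (2 * pi) * ln (1 / dist x y)" "ALL x:D - {y}. G x y = 1 / (2 * pi) * ln (1 / dist x y) - h x"
   using G xy(2) unfolding is_dirichlet_green_def by blast
  show ?thesis
   by (rule that[of h]) (use h xy in \<open>auto simp: harmonic_on_def divergence_def lap_def\<close>)
 qed
 have fr: "z : closure D" "z ~= y" if "z : frontier D" for z using that xy(2) D(1) by (auto simp: frontier_def interior_open)
 have yc: "y : closure D" "x : closure D" using xy closure_subset by blast+
 have sm: "smooth (%x. c * h x)" if "smooth h" for c h using smooth_cmult[OF that] .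
 have C2: "Ck_on 2 D (%x. (-1) * h x)" by (rule Ck_on_cmult[OF D(1) h(2)])
 have h2: "x : D ==> h differentiable (at x)" "x : D ==> pd i h differentiable (at x)" for x i
  using h(2) by (auto simp: numeral_2_eq_2)
 have lap_lin: "lap (%x. c * h x + k x) x = c * lap h x + lap k x" if x: "x : D" and k: "smooth k" for c k x
 proof -
  have "pd i (pd i (%x. c * h x + k x)) x = c * pd i (pd i h) x + pd i (pd i k) x" for i
  proof -
   have "pd i (pd i (%x. c * h x + k x)) x = pd i (%x. c * pd i h x + pd i k x) x"
   by (rule partial_cong[OF D(1) x]) (simp add: partial_add h2 smooth_differentiable[OF k] partial_cmult)
   then show ?thesis using x h2(2)[OF x] smooth_differentiable[OF smooth_partial[OF k]] by (simp add: partial_add partial_cmult)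
  qed
  then show ?thesis by (simp add: lap_def sum.distrib sum_distrib_left)
 qed
 have p0: "pd i (%x. 0) = (%x. 0)" for i by (rule ext) simp
 have "(-1) * h x + 0 <= - (1 / (2 * pi) * ln (1 / d0))"
 proof (rule max_principle[OF D _ _ _ _ xy(1)])
  show "continuous_on (closure D) (%x. (-1) * h x + 0)" by (intro continuous_intros h)
  show "Ck_on 2 D (%x. (-1) * h x + 0)" using C2 by simp
  show "0 <= lap (%x. (-1) * h x + 0) x" if "x : D" for x
   using lap_lin[OF that smooth_const, of "-1" 0] h(3)[OF that] by (simp add: lap_def p0)
  fix z assume z: "z : frontier D"
  have "ln (1 / d0) <= ln (1 / dist z y)" using d0 fr[OF z] yc by (subst ln_le_cancel_iff) (auto simp: frac_le)
  then have "1 / (2 * pi) * ln (1 / d0) <= 1 / (2 * pi) * ln (1 / dist z y)" by (intro mult_left_mono) auto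
  then show "(-1) * h z + 0 <= - (1 / (2 * pi) * ln (1 / d0))" unfolding h(4)[OF z] by simp
 qed
 moreover have "ln (d0 / dist x y) = ln (1 / dist x y) - ln (1 / d0)" using d0(1) xy by (simp add: ln_div)
 ultimately show "G x y <= 1 / (2 * pi) * ln (d0 / dist x y)" unfolding h(5) by (simp add: right_diff_distrib)
 define \<rho> where "\<rho> = infdist y (frontier D)"
 have fne: "frontier D ~= {}"
  using D xy(1) frontier_eq_empty[of D] by (metis bounded_empty empty_iff not_bounded_UNIV)
 have \<rho>: "\<rho> > 0" unfolding \<rho>_def
  using fr(2) fne infdist_pos_not_in_closed[of "frontier D" y] frontier_closed by metis
 define c where "c = 1 / (2 * pi)"
 have c: "c > 0" by (simp add: c_def)
 have key: "h x + c * reglog s (x - y) <= c * (s^2 / (2 * \<rho>^2))" if s: "s > 0" for s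
 proof -
  let ?k = "%x. c * reglog s (x + - y)"
  note st = smooth_translate[OF smooth_reglog[OF s], where a="- y"]
  note st2 = smooth_translate[OF smooth_partial[OF smooth_reglog[OF s]], where a="- y"]
  have sk: "smooth ?k" by (intro smooth_cmult st)
  have lk: "lap ?k x = c * lap (reglog s) (x + - y)" for x
  proof -
   have "pd i ?k = (%x. c * pd i (reglog s) (x + - y))" for i
   by (rule ext) (subst partial_cmult[OF smooth_differentiable[OF st(1)]], simp only: st(2))
   moreover have "pd i (%x. c * pd i (reglog s) (x + - y)) x = c * pd i (pd i (reglog s)) (x + - y)" for i
   by (subst partial_cmult[OF smooth_differentiable[OF st2(1)]], simp only: st2(2))
   ultimately show ?thesis by (simp only: lap_def sum_distrib_left)
  qed
  have "1 * h x + ?k x <= c * (s^2 / (2 * \<rho>^2))"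
  proof (rule max_principle[OF D _ _ _ _ xy(1)])
   show "continuous_on (closure D) (%x. 1 * h x + ?k x)" by (intro continuous_on_add continuous_on_mult continuous_on_const h(1) smooth_continuous[OF sk])
   show "Ck_on 2 D (%x. 1 * h x + ?k x)" using h(2) by (intro Ck_on_add D Ck_on_cmult Ck_on_mono[OF smooth_Ck[OF sk]]) auto
   show "0 <= lap (%x. 1 * h x + ?k x) x" if "x : D" for x
   unfolding lap_lin[OF that sk] lk lap_reglog[OF s] h(3)[OF that] using c by simp
   fix z assume z: "z : frontier D"
   define r where "r = dist z y"
   have r: "r >= \<rho>" "r > 0" using infdist_le[OF z, of y] \<rho> by (auto simp: r_def \<rho>_def dist_commute)
   have e: "(z + - y) \<bullet> (z + - y) = r^2" by (simp add: r_def dist_norm power2_norm_eq_inner)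
   have "ln (1 / r) + reglog s (z + - y) = ln ((r^2 + s^2) / r^2) / 2"
   unfolding reglog_def e using r s by (simp add: ln_div ln_realpow add_pos_pos)
   also have "(r^2 + s^2) / r^2 = 1 + s^2 / r^2" using r by (simp add: field_simps)
   also have "ln (1 + s^2 / r^2) <= s^2 / r^2" by (rule ln_add_one_self_le_self) simp
   also have "s^2 / r^2 <= s^2 / \<rho>^2" using r \<rho> by (intro divide_left_mono power_mono) auto
   finally have "ln (1 / r) + reglog s (z + - y) <= s^2 / (2 * \<rho>^2)" by simp
   then have "c * (ln (1 / r) + reglog s (z + - y)) <= c * (s^2 / (2 * \<rho>^2))" using c by (intro mult_left_mono) auto
   then show "1 * h z + ?k z <= c * (s^2 / (2 * \<rho>^2))"
   unfolding h(4)[OF z] r_def[symmetric] c_def[symmetric] by (simp add: distrib_left)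
  qed
  then show ?thesis by simp
 qed
 let ?R = "dist x y"
 have R: "?R > 0" using xy by simp
 have "((%s. h x + c * (ln (?R^2 + s^2) / 2)) \<longlongrightarrow> h x + c * (ln (?R^2 + 0^2) / 2)) (at_right 0)"
  using R by (intro tendsto_intros) auto
 moreover have "((%s. c * (s^2 / (2 * \<rho>^2))) \<longlongrightarrow> c * (0^2 / (2 * \<rho>^2))) (at_right 0)"
  using \<rho> by (intro tendsto_intros) auto
 moreover have "\<forall>\<^sub>F s in at_right 0. h x + c * (ln (?R^2 + s^2) / 2) <= c * (s^2 / (2 * \<rho>^2))"
  by (rule eventually_mono[OF eventually_at_right_less]) (use key in \<open>simp add: reglog_def dist_norm power2_norm_eq_inner\<close>)
 ultimately have "h x + c * (ln (?R^2 + 0^2) / 2) <= c * (0^2 / (2 * \<rho>^2))"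
  by (intro tendsto_le[OF trivial_limit_at_right_real])
 then have "h x + c * ln ?R <= 0" using R by (simp add: ln_realpow)
 then show "0 <= G x y" unfolding h(5) c_def[symmetric] using R by (simp add: ln_div)
qed

lemma inverse_norm_integrable: "integ (%x::plane. ind (cball 0 R) x * inverse (norm x))"
proof (rule integrable_nonneg_le(1))
 show "integ (%x::plane. ind (cball 0 R) x + ind (cball 0 R) x * (norm x) powr (-4/3))"
  by (intro integ_add integrable_indicator_cpt compact_cball riesz_kernel_integrable)
 show "(%x::plane. ind (cball 0 R) x * inverse (norm x)) : BM"
  by (intro borel_measurable_times borel_measurable_indicator borel_measurable_inverse) auto
 have "inverse t <= 1 + t powr (-4/3)" if "t >= 0" for t :: real
 proof (cases "t >= 1 | t = 0")
  case True
  then have "inverse t <= 1" by (auto simp: inverse_le_1_iff)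
  then show ?thesis by (simp add: add_increasing2)
 next
  case False
  then have "inverse t = t powr (-1)" using that by (simp add: powr_minus)
  also have "... <= t powr (-4/3)" using False that by (intro powr_mono') auto
  finally show ?thesis by simp
 qed
 then show "AEL x::plane. 0 <= ind (cball 0 R) x * inverse (norm x) \<and>
  ind (cball 0 R) x * inverse (norm x) <= ind (cball 0 R) x + ind (cball 0 R) x * (norm x) powr (-4/3)"
  by (intro AE_I2) (auto simp: indicator_def)
qed

text \<open>The self-similar core \<open>ln (eps/r) <= eps/r\<close> of the logarithmic potential.\<close>

lemma log_potential:
 fixes Z :: "plane => real"
 defines "c1 \<equiv> (LI x. ind (cball 0 1) (x::plane) * inverse (norm x))"
 assumes Z: "integ Z" "!!y. 0 <= Z y" "!!y. Z y <= L" and ep: "0 < eps" "eps <= d0"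
 obtains g where "integ g" "!!y. y ~= x ==> ln (d0 / dist x y) * Z y <= g y" "!!y. 0 <= g y"
  "(LI y. g y) = (ln (d0 / eps) + 1) * (LI y. Z y) + L * (eps^2 * c1)"
proof -
 let ?f = "%y::plane. ind (cball 0 eps) y * (eps * inverse (norm y))"
 have L: "L >= 0" using Z(2,3)[of 0] by linarith
 have if0: "integ ?f" using integrable_mult_right[OF inverse_norm_integrable[of eps], of eps] by (simp add: mult_ac)
 have fm: "?f : BM" by (intro borel_measurable_times borel_measurable_indicator borel_measurable_inverse) auto
 have "(LI y. ?f y) = eps^2 * (LI y. ?f (eps *R y))" by (rule lborel_scale[OF ep(1) fm])
 also have "(%y. ?f (eps *R y)) = (%y. ind (cball 0 1) y * inverse (norm y))"
  using ep(1) by (intro ext) (auto simp: indicator_def field_simps)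
 finally have f0: "(LI y. ?f y) = eps^2 * c1" by (simp add: c1_def)
 note tr = lborel_integral_translate[of ?f "- x"]
 let ?g = "%y. (ln (d0 / eps) + 1) * Z y + L * ?f (y + - x)"
 have lpos: "ln (d0 / eps) >= 0" using ep by simp
 have it: "integ (%y. ?f (y + - x))" using tr(2) if0 by simp
 show ?thesis
 proof (rule that[of ?g])
  show "integ ?g" by (intro integ_add integrable_mult_right Z it)
  show "0 <= ?g y" for y using Z(2) L ep lpos by (intro add_nonneg_nonneg mult_nonneg_nonneg) auto
  have "(LI y. ?g y) = (ln (d0 / eps) + 1) * (LI y. Z y) + L * (LI y. ?f (y + - x))"
   using Z(1) it by (subst lint_add) simp_all
  also have "(LI y. ?f (y + - x)) = eps^2 * c1" using tr(1) f0 by simp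
  finally show "(LI y. ?g y) = (ln (d0 / eps) + 1) * (LI y. Z y) + L * (eps^2 * c1)" .
  fix y assume y: "y ~= x"
  let ?r = "dist x y"
  have r: "?r > 0" using y by simp
  have n: "norm (y + - x) = ?r" by (simp add: dist_norm norm_minus_commute)
  have "ln (d0 / ?r) = ln (d0 / eps) + ln (eps / ?r)" using r ep by (simp add: ln_div)
  also have "ln (eps / ?r) <= eps / ?r" using ln_le_minus_one[of "eps / ?r"] r ep by simp
  finally have 1: "ln (d0 / ?r) * Z y <= (ln (d0 / eps) + eps / ?r) * Z y" using Z(2)[of y] by (intro mult_right_mono) auto
  \<comment> \<open>Inside the disc of radius \<open>eps\<close> the height bound is used, outside
    it the factor \<open>eps / r\<close> is below 1.\<close>
  have 2: "eps / ?r * Z y <= Z y + L * ?f (y + - x)"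
  proof (cases "?r <= eps")
   case True
   then have "?f (y + - x) = eps / ?r" unfolding n by (simp add: indicator_def dist_norm norm_minus_commute divide_inverse)
   moreover have "eps / ?r * Z y <= eps / ?r * L" using r ep Z(3)[of y] by (intro mult_left_mono) auto
   ultimately show ?thesis using Z(2)[of y] by (simp add: mult.commute)
  next
   case False
   then have "eps / ?r * Z y <= 1 * Z y" using r Z(2)[of y] by (intro mult_right_mono) auto
   moreover have "0 <= L * ?f (y + - x)" using L ep by auto
   ultimately show ?thesis by linarith
  qed
  show "ln (d0 / ?r) * Z y <= ?g y" using 1 2 by (simp add: algebra_simps)
 qed
qed

section \<open>The solution operator\<close>

lemma L2_weak:
 fixes f :: "nat => plane => real"
 assumes D: "bounded D" "D : sets borel" and m[measurable]: "!!n. f n : BM" "g : BM"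
  and l: "(%n. (NI x. ennreal (ind D x * (f n x - g x)^2))) ~~> 0"
  and h: "h : BM" "!!x. abs (h x) <= B" "!!x. x ~: D ==> h x = 0"
  and i: "!!n. integ (%x. f n x * h x)" "integ (%x. g x * h x)"
 shows "(%n. LI x. f n x * h x) ~~> (LI x. g x * h x)"
proof (rule LIMSEQ_I)
 fix d :: real assume d: "d > 0"
 let ?q = "%n x. ind D x * (f n x - g x)^2"
 note [measurable] = D(2) h(1)
 have B: "B >= 0" using h(2)[of 0] by linarith
 have iD: "integ (indicat_real D)" using D emeasure_bounded_finite by (intro integrable_real_indicator) auto
 define m where "m = (LI x. ind D x)"
 have m: "m >= 0" by (simp add: m_def)
 define s where "s = d / (2 * (m + 1))"
 have s: "s > 0" "s * m <= d / 2"
 proof -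
  show s0: "s > 0" using d m by (simp add: s_def)
  have "s * m <= s * (m + 1)" using s0 by simp
  also have "... = d / 2" using m unfolding s_def by (auto simp: divide_simps)
  finally show "s * m <= d / 2" .
 qed
 define r where "r = d * s / (4 * (B^2 + 1))"
 have r: "r > 0" using d s by (simp add: r_def add_nonneg_pos)
 have "\<forall>\<^sub>F n in sequentially. (NI x. ennreal (?q n x)) < ennreal r"
  using l r by (intro order_tendstoD) auto
 then obtain N where N: "!!n. n >= N ==> (NI x. ennreal (?q n x)) < ennreal r"
  unfolding eventually_sequentially by auto
 have "norm ((LI x. f n x * h x) - (LI x. g x * h x)) < d" if n: "n >= N" for n
 proof -
  have q: "integ (?q n)" "(LI x. ?q n x) <= r"
   using nonneg_integral_bound[of "?q n" r] N[OF n] r by (simp_all add: less_imp_le)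
  have "norm ((LI x. f n x * h x) - (LI x. g x * h x)) = norm (LI x. f n x * h x - g x * h x)"
   using i by simp
  also have "... <= (LI x. norm (f n x * h x - g x * h x))" by (rule integral_norm_bound)
  also have "... <= (LI x. s * ind D x + (B^2 / s) * ?q n x)"
  proof (rule integrable_nonneg_le(2))
   show "integ (%x. s * ind D x + (B^2 / s) * ?q n x)"
   by (intro integ_add integrable_mult_right iD q)
   have "norm (f n x * h x - g x * h x) <= s * ind D x + (B^2 / s) * ?q n x" for x
   proof (cases "x : D")
   case True
   let ?v = "abs (f n x - g x)"
   have "B * ?v <= s + B^2 / s * ?v^2" using abs_le_sq[OF s(1), of "B * ?v"] B by (simp add: power2_eq_square mult_ac)
   moreover have "norm (f n x * h x - g x * h x) <= B * ?v"
   unfolding left_diff_distrib[symmetric] real_norm_def abs_mult using h(2)[of x] by (subst mult.commute) (intro mult_right_mono, auto)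
   ultimately show ?thesis using True by simp
   qed (simp add: h(3))
   then show "AEL x. 0 <= norm (f n x * h x - g x * h x) \<and>
   norm (f n x * h x - g x * h x) <= s * ind D x + (B^2 / s) * ?q n x" by simp
  qed measurable
  also have "... = s * m + (B^2 / s) * (LI x. ?q n x)" using iD q(1) by (simp add: m_def)
  also have "... <= d / 2 + (B^2 / s) * r" using s q(2) by (intro add_mono mult_left_mono) auto
  also have "(B^2 / s) * r < d / 2"
  proof -
   have "(B^2 / s) * r = B^2 * d / (4 * (B^2 + 1))" using s by (simp add: r_def)
   also have "... < d / 2" using d by (simp add: field_simps add_pos_nonneg)
   finally show ?thesis .
  qed
  finally show ?thesis by simp
 qed
 then show "EX N. ALL n>=N. norm ((LI x. f n x * h x) - (LI x. g x * h x)) < d" by blast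
qed

locale lake = lake_coeff +
 fixes G R :: "plane => plane => real" and Bb BR d0 :: real
 assumes bd: "bounded D" and ne: "D ~= {}" and Bb: "!!x. x : D ==> b x <= Bb"
  and green: "is_dirichlet_green D G" and BR: "!!x y. x : D ==> y : D ==> abs (R x y) <= BR"
  and d0: "d0 > 0" "!!x y. x : closure D ==> y : closure D ==> dist x y <= d0"
  and K: "!!p z. p > 1 ==> z : Lp (lake_measure D b) p ==>
   is_K D b z (%x. b x * (\<integral>y. G x y * z y \<partial>lake_measure D b) + (\<integral>y. R x y * z y \<partial>lake_measure D b))"
begin

text \<open>A representative of K z defined at every point by the two kernels. Its bounds therefore
  hold everywhere in \<open>D\<close>, as uniform convergence to 0 demands.\<close>

definition T where "T z x = b x * (\<integral>y. G x y * z y \<partial>lake_measure D b) + (\<integral>y. R x y * z y \<partial>lake_measure D b)"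

text \<open>The density of nu and, in \<open>gam\<close>, its reciprocal, both extended by 0, so
  that integrals run over the plane with Borel integrands.\<close>

definition bet where "bet x = ind D x * b x"
definition gam where "gam x = ind D x * inverse (b x)"

lemma Db [measurable]: "D : sets borel" using D by simp

lemma Bb_pos: "Bb > 0" using ne Bb bpos by (meson ex_in_conv less_le_trans)
lemma BR_nonneg: "BR >= 0" using ne BR by (meson abs_ge_zero ex_in_conv order_trans)

lemma bet: "0 <= bet x" "bet x <= Bb" "bet : BM" "integ bet" "gam : BM" "0 <= gam x"
proof -
 show "0 <= bet x" "0 <= gam x" using bpos[of x] by (auto simp: bet_def gam_def indicator_def)
 show 1: "bet x <= Bb" for x using Bb[of x] Bb_pos by (auto simp: bet_def indicator_def)
 show m: "bet : BM" "gam : BM"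
  unfolding bet_def[abs_def] gam_def[abs_def] using loc_LallD(1)[OF loc_Lall_cont[OF D]] b_cont by auto
 have "integ (%x. ind D x * bet x)"
 proof (rule integrable_bounded_mult(1)[where B=Bb])
  show "integ (indicat_real D)" using bd emeasure_bounded_finite by (intro integrable_real_indicator) auto
  show "abs (bet x) <= Bb" for x using 1[of x] bpos[of x] Bb_pos by (auto simp: bet_def indicator_def)
 qed (use m in simp)
 then show "integ bet" by (rule integ_cong[THEN iffD1, OF refl, rotated]) (simp add: bet_def indicator_def)
qed

lemmas [measurable] = bet(3,5)

lemma b_meas: "b : BL D"
 by (rule measurable_cong[THEN iffD1, OF _ borel_lebesgue_on[OF bet(3)]]) (simp add: bet_def)

lemma lake_integral:
 assumes "f : BL D" "g : BM" "AEL x. x : D --> f x = g x"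
 shows "(\<integral>x. f x \<partial>lake_measure D b) = (LI x. bet x * g x)"
  and "integrable (lake_measure D b) f \<longleftrightarrow> integ (%x. bet x * g x)"
proof -
 have ae: "AE x in lebesgue_on D. 0 <= b x" using bpos by (intro AE_I2) (auto simp: less_imp_le)
 have m: "(%x. b x * f x) : BL D" using b_meas assms(1) by simp
 have [measurable]: "g : BM" by fact
 have g: "(%x. bet x * g x) : BM" by measurable
 have e: "AEL x. x : D --> b x * f x = bet x * g x" using assms(3) by (rule eventually_mono) (simp add: bet_def)
 have i: "ind D x * (bet x * g x) = bet x * g x" for x by (simp add: bet_def indicator_def)
 show "(\<integral>x. f x \<partial>lake_measure D b) = (LI x. bet x * g x)"
  unfolding lake_measure_def using integral_density[OF assms(1) b_meas ae] integral_lebesgue_on(1)[OF Db g e m] by (simp add: i)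
 show "integrable (lake_measure D b) f \<longleftrightarrow> integ (%x. bet x * g x)"
  unfolding lake_measure_def using integrable_density[OF assms(1) b_meas ae] integral_lebesgue_on(2)[OF Db g e m] by (simp add: i)
qed

text \<open>Measurability of the kernels in \<open>y\<close> is not at hand, hence a bound by a
  pointwise majorant: a function that is not integrable has Bochner integral 0 by convention. The
  point \<open>x\<close> is left out because G has no prescribed value on the diagonal.\<close>

lemma lake_integral_bound:
 assumes g: "integ g" "!!y. 0 <= g y" and f: "!!y. y : D ==> y ~= x ==> abs (f y) * b y <= g y"
 shows "abs (\<integral>y. f y \<partial>lake_measure D b) <= (LI y. g y)"
proof (cases "integrable (lake_measure D b) f")
 case False
 then show ?thesis using g(2) by (simp add: not_integrable_integral_eq)
next
 case True
 have fm: "f : BL D" using borel_measurable_integrable[OF True] by (simp add: lake_measure_def)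
 obtain f' where f': "f' : BM" "AEL x. x : D --> f x = f' x"
  by (rule borel_version[OF fm Db]) (rule that)
 have 1: "(\<integral>y. f y \<partial>lake_measure D b) = (LI y. bet y * f' y)" "integ (%y. bet y * f' y)"
  using lake_integral[OF fm f'] True by auto
 have "abs (LI y. bet y * f' y) <= (LI y. abs (bet y * f' y))" by (rule integral_abs_bound)
 also have "... <= (LI y. g y)"
 proof (rule integral_mono_AE[OF integrable_abs[OF 1(2)] g(1)])
  show "AEL y. abs (bet y * f' y) <= g y" using f'(2) AE_lborel_singleton[of x]
  proof eventually_elim
   fix y assume "y : D --> f y = f' y" "y ~= x"
   then show "abs (bet y * f' y) <= g y" using f[of y] g(2)[of y] bpos[of y]
   by (cases "y : D") (auto simp: bet_def abs_mult mult.commute)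
  qed
 qed
 finally show ?thesis unfolding 1 .
qed

definition c1 :: real where "c1 = (LI x. ind (cball 0 1) (x::plane) * inverse (norm x))"

definition bb :: "(plane => real) => bool" where "bb z \<longleftrightarrow> z : BM & (EX M. ALL x. abs (z x) <= M)"

lemma bb_int: "bb z ==> integ (%x. bet x * z x)"
 unfolding bb_def by (auto intro: integrable_bounded_mult(1)[OF bet(4)])

lemma bb_ops: "bb z ==> bb w ==> bb (%x. z x + w x)" "bb z ==> bb w ==> bb (%x. z x - w x)" "bb z ==> bb w ==> bb (%x. z x * w x)"
 "bb (%x. k)" "bb z ==> bb (%x. abs (z x))"
proof -
 assume "bb z" "bb w"
 then obtain M N where m: "z : BM" "w : BM" "!!x. abs (z x) <= M" "!!x. abs (w x) <= N"
  by (auto simp: bb_def)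
 have "abs (z x + w x) <= M + N" "abs (z x - w x) <= M + N" for x using m(3)[of x] m(4)[of x] by linarith+
 moreover have "abs (z x * w x) <= abs M * abs N" for x unfolding abs_mult using m(3)[of x] m(4)[of x] by (intro mult_mono) auto
 ultimately show "bb (%x. z x + w x)" "bb (%x. z x - w x)" "bb (%x. z x * w x)" unfolding bb_def using m(1,2) by auto
qed (auto simp: bb_def)

text \<open>The radius \<open>eps\<close> is free. The choice \<open>eps = d0\<close> gives the
  uniform bounds of the iteration; the small parameter of the problem as radius turns mass O(delta)
  and height O(delta / eps^2) into O(delta ln(1 / eps)).\<close>

lemma T_bound:
 assumes z: "z : BM" "!!x. abs (z x) <= L" and ep: "0 < eps" "eps <= d0" and x: "x : D"
 shows "abs (T z x) <= Bb / (2 * pi) * ((ln (d0 / eps) + 1) * (LI y. bet y * abs (z y)) + Bb * L * (eps^2 * c1)) + BR * (LI y. bet y * abs (z y))"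
proof -
 let ?Z = "%y. bet y * abs (z y)"
 have "bb z" using z by (auto simp: bb_def)
 then have iZ: "integ ?Z" by (intro bb_int bb_ops)
 have Zn: "0 <= ?Z y" for y using bet(1) by simp
 have ZL: "?Z y <= Bb * L" for y using bet(1,2)[of y] z(2)[of y] Bb_pos by (intro mult_mono) auto
 obtain g where g: "integ g" "!!y. y ~= x ==> ln (d0 / dist x y) * ?Z y <= g y" "!!y. 0 <= g y"
  "(LI y. g y) = (ln (d0 / eps) + 1) * (LI y. ?Z y) + (Bb * L) * (eps^2 * c1)"
  by (rule log_potential[of ?Z "Bb * L" eps d0 x, OF iZ Zn ZL ep, folded c1_def]) (rule that)
 have "abs (\<integral>y. G x y * z y \<partial>lake_measure D b) <= (LI y. 1 / (2 * pi) * g y)"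
 proof (rule lake_integral_bound[where x=x])
  fix y assume y: "y : D" "y ~= x"
  note gb = green_bounds[OF green D bd x y(1) y(2)[symmetric] d0]
  have "abs (G x y * z y) * b y = G x y * ?Z y" using gb(1) y by (simp add: abs_mult bet_def mult_ac)
  also have "... <= (1 / (2 * pi) * ln (d0 / dist x y)) * ?Z y" by (rule mult_right_mono[OF gb(2) Zn])
  also have "... = 1 / (2 * pi) * (ln (d0 / dist x y) * ?Z y)" by simp
  also have "... <= 1 / (2 * pi) * g y" by (intro mult_left_mono g(2) y) simp
  finally show "abs (G x y * z y) * b y <= 1 / (2 * pi) * g y" .
 qed (use g(1,3) in auto)
 then have 1: "abs (\<integral>y. G x y * z y \<partial>lake_measure D b) <= 1 / (2 * pi) * (LI y. g y)" by simp
 have 2: "abs (\<integral>y. R x y * z y \<partial>lake_measure D b) <= (LI y. BR * ?Z y)"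
 proof (rule lake_integral_bound[where x=x])
  fix y assume y: "y : D"
  have "abs (R x y * z y) * b y = abs (R x y) * ?Z y" using y by (simp add: abs_mult bet_def mult_ac)
  also have "... <= BR * ?Z y" by (rule mult_right_mono[OF BR[OF x y] Zn])
  finally show "abs (R x y * z y) * b y <= BR * ?Z y" .
 qed (use iZ Zn BR_nonneg in auto)
 have "abs (T z x) <= b x * abs (\<integral>y. G x y * z y \<partial>lake_measure D b) + abs (\<integral>y. R x y * z y \<partial>lake_measure D b)"
  unfolding T_def using bpos[OF x] by (intro order_trans[OF abs_triangle_ineq]) (simp add: abs_mult)
 also have "b x * abs (\<integral>y. G x y * z y \<partial>lake_measure D b) <= Bb * (1 / (2 * pi) * (LI y. g y))"
  using bpos[OF x] Bb[OF x] by (intro mult_mono 1) auto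
 finally show ?thesis using 2 unfolding g(4) by simp
qed

end

context lake
begin

section \<open>The energy space H(D) and weak gradients\<close>

lemma lake_nn_integral:
 assumes "f : BL D" "g : BM" "AEL x. x : D --> f x = g x"
 shows "(\<integral>\<^sup>+x. ennreal (f x) \<partial>lake_measure D b) = (NI x. ennreal (bet x * g x))"
proof -
 note [measurable] = b_meas assms(1,2)
 have "(\<integral>\<^sup>+x. ennreal (f x) \<partial>lake_measure D b) = (\<integral>\<^sup>+x. ennreal (b x) * ennreal (f x) \<partial>lebesgue_on D)"
  unfolding lake_measure_def by (rule nn_integral_density) measurable
 also have "... = (\<integral>\<^sup>+x. ennreal (b x * f x) \<partial>lebesgue_on D)"
  using bpos by (intro nn_integral_cong) (auto simp: ennreal_mult' less_imp_le)
 also have "... = (NI x. ennreal (bet x * g x) * ind D x)"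
  by (rule nn_integral_lebesgue_on[OF Db]) (measurable, use assms(3) in \<open>auto elim!: eventually_mono simp: bet_def\<close>)
 also have "... = (NI x. ennreal (bet x * g x))"
  by (intro nn_integral_cong) (simp add: bet_def indicator_def)
 finally show ?thesis .
qed

lemma betgam: "bet x * ((gam x)^2 * y) = gam x * y"
 using bpos[of x] by (auto simp: bet_def gam_def indicator_def power2_eq_square)

lemma norm_plane_sq: "(norm v)^2 = (v $ 1)^2 + (v $ 2)^2" for v :: plane
 unfolding power2_norm_eq_inner by (simp add: inner_vec_def sum_2 power2_eq_square)

lemma vec_meas: "W : borel_measurable M ==> (%x. (W x :: plane) $ i) : borel_measurable M"
 by (rule measurable_compose[OF _ borel_measurable_nth])

lemma lake_inner:
 fixes W V :: "plane => plane" and U V' :: "2 => plane => real"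
 assumes W: "W : BL D" "!!i. U i : BM" "!!i. AEL x. x : D --> W x $ i = U i x"
  and V: "V : BL D" "!!i. V' i : BM" "!!i. AEL x. x : D --> V x $ i = V' i x"
  and i: "!!i. integ (%x. gam x * (U i x * V' i x))"
 shows "(\<integral>x. 1 / (b x)^2 * (W x \<bullet> V x) \<partial>lake_measure D b) = (SUM i:UNIV. LI x. gam x * (U i x * V' i x))"
proof -
 note [measurable] = W(1,2) V(1,2) b_meas
 have "(\<integral>x. 1 / (b x)^2 * (W x \<bullet> V x) \<partial>lake_measure D b) = (LI x. bet x * ((gam x)^2 * (SUM i:UNIV. U i x * V' i x)))"
 proof (rule lake_integral(1))
  show "AEL x. x : D --> 1 / (b x)^2 * (W x \<bullet> V x) = (gam x)^2 * (SUM i:UNIV. U i x * V' i x)"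
   using W(3)[of 1] W(3)[of 2] V(3)[of 1] V(3)[of 2]
   by eventually_elim (auto simp: inner_vec_def sum_2 gam_def inverse_eq_divide power_one_over)
 qed measurable
 also have "... = (SUM i:UNIV. LI x. gam x * (U i x * V' i x))"
  unfolding betgam sum_distrib_left by (rule integral_sum2[OF i])
 finally show ?thesis .
qed

lemma in_H_test:
 assumes "test_fun D phi"
 shows "in_H D b phi (grad phi)"
proof -
 obtain K where K: "K <= D" "C1c K phi" by (rule test_funD[OF assms]) (rule that)
 note p = C1cD[OF K(2)]
 have "continuous_on UNIV (grad phi)" unfolding grad_def[abs_def] by (intro continuous_on_vec_lambda p)
 then have "grad phi : BL D" "phi : BL D"
  using p(4) by (auto intro!: measurable_restrict_space1 measurable_completion borel_measurable_continuous_onI)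
 then show ?thesis unfolding in_H_def using assms by (intro conjI exI[of _ "%_. phi"]) auto
qed

text \<open>As b is bounded, the norm of H(D) controls the L^2 norm of gradients, so integration by
  parts for the approximating test functions passes to the limit.\<close>

lemma in_H_weak:
 assumes H: "in_H D b w W"
  and t: "t : BM" "!!x. abs (t x) <= c" "AEL x. x : D --> w x = t x"
  and U: "!!i. U i : BM" "!!i. AEL x. x : D --> W x $ i = U i x"
 shows "integ (%x. gam x * (U i x)^2)" and "wpd D i t (U i)"
proof -
 obtain phi where phi: "!!n::nat. test_fun D (phi n)"
  "(%n. \<integral>\<^sup>+x. ennreal ((phi n x - w x)^2) \<partial>lebesgue_on D) ~~> 0"
  "(%n. \<integral>\<^sup>+x. ennreal (1 / (b x)^2 * (norm (grad (phi n) x - W x))^2) \<partial>lake_measure D b) ~~> 0"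
  and wm: "w : BL D" "W : BL D"
  using H unfolding in_H_def by blast
 have "EX K. K <= D & C1c K (phi n)" for n by (rule test_funD[OF phi(1)[of n]]) blast
 then obtain K where K: "!!n. K n <= D" "!!n. C1c (K n) (phi n)" by metis
 note p = C1cD[OF K(2)]
 have pm: "phi n : BM" "pd i (phi n) : BM" for n i
  using p(3,4) by (auto intro: borel_measurable_continuous_onI)
 note [measurable] = pm t(1) U(1) wm b_meas
 have gm[measurable]: "grad (phi n) : BL D" for n using in_H_test[OF phi(1)] by (simp add: in_H_def)
 have e1: "(\<integral>\<^sup>+x. ennreal ((phi n x - w x)^2) \<partial>lebesgue_on D) = (NI x. ennreal (ind D x * (phi n x - t x)^2))" for n
 proof -
  have "(\<integral>\<^sup>+x. ennreal ((phi n x - w x)^2) \<partial>lebesgue_on D) = (NI x. ennreal ((phi n x - t x)^2) * ind D x)"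
   by (rule nn_integral_lebesgue_on[OF Db]) (measurable, use t(3) in \<open>auto elim!: eventually_mono\<close>)
  also have "... = (NI x. ennreal (ind D x * (phi n x - t x)^2))" by (intro nn_integral_cong) (simp add: indicator_def)
  finally show ?thesis .
 qed
 let ?d = "%i n x. pd i (phi n) x - U i x"
 let ?G = "%i n. (NI x. ennreal (gam x * (?d i n x)^2))"
 have e2: "?G i n
   <= (\<integral>\<^sup>+x. ennreal (1 / (b x)^2 * (norm (grad (phi n) x - W x))^2) \<partial>lake_measure D b)" for n i
 proof -
  have "(\<integral>\<^sup>+x. ennreal (1 / (b x)^2 * (norm (grad (phi n) x - W x))^2) \<partial>lake_measure D b)
   = (NI x. ennreal (bet x * ((gam x)^2 * (SUM i:UNIV. (?d i n x)^2))))"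
  proof (rule lake_nn_integral)
   show "AEL x. x : D --> 1 / (b x)^2 * (norm (grad (phi n) x - W x))^2 = (gam x)^2 * (SUM i:UNIV. (?d i n x)^2)"
   using U(2)[of 1] U(2)[of 2]
   by eventually_elim (auto simp: norm_plane_sq sum_2 gam_def inverse_eq_divide power_one_over)
  qed measurable
  moreover have "gam x * (?d i n x)^2 <= gam x * (SUM i:UNIV. (?d i n x)^2)" for x
   by (intro mult_left_mono bet(6) member_le_sum) auto
  ultimately show ?thesis unfolding betgam by (auto intro!: nn_integral_mono ennreal_leI)
 qed
 have l2: "(%n. ?G i n) ~~> 0" for i
  by (rule tendsto_sandwich[OF _ _ tendsto_const phi(3)]) (use e2 in auto)
 have iU: "integ (%x. gam x * (U i x)^2)" for i
 proof -
  have "\<forall>\<^sub>F n in sequentially. (?G i n) < ennreal 1"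
   using l2 by (intro order_tendstoD) auto
  then obtain n where n: "?G i n < ennreal 1"
   unfolding eventually_sequentially by auto
  have i1: "integ (%x. gam x * (?d i n x)^2)"
   using nonneg_integral_bound(1)[of "%x. gam x * (?d i n x)^2" 1] n bet(6) by (simp add: less_imp_le)
  have i2: "integ (%x. gam x * (pd i (phi n) x)^2)"
  proof -
   have z: "x ~: D ==> pd i (phi n) x = 0" for x using p(6) K(1) by blast
   have "integ (%x. inverse (b x) * (pd i (phi n) x)^2)"
   by (rule loc_int_mult_cont[OF loc_int_continuous[OF b_cont(3)] p(1) K(1)]) (use p(3,6) in \<open>auto intro!: continuous_intros\<close>)
   then show ?thesis by (rule integ_cong[THEN iffD1, OF refl, rotated]) (use z in \<open>auto simp: gam_def indicator_def\<close>)
  qed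
  show ?thesis
  proof (rule integrable_nonneg_le(1))
   show "integ (%x. 2 * (gam x * (?d i n x)^2) + 2 * (gam x * (pd i (phi n) x)^2))"
   by (intro integ_add integrable_mult_right i1 i2)
   have "v^2 <= 2 * (u - v)^2 + 2 * u^2" for u v :: real
   proof -
   have "0 <= (2 * u - v)^2" by simp
   then show ?thesis by (simp add: power2_eq_square algebra_simps)
   qed
   then have "gam x * (U i x)^2 <= gam x * (2 * (?d i n x)^2 + 2 * (pd i (phi n) x)^2)" for x
   by (intro mult_left_mono bet(6))
   then show "AEL x. 0 <= gam x * (U i x)^2 & gam x * (U i x)^2 <= 2 * (gam x * (?d i n x)^2) + 2 * (gam x * (pd i (phi n) x)^2)"
   using bet(6) by (intro AE_I2) (simp add: algebra_simps)
  qed measurable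
 qed
 then show "integ (%x. gam x * (U i x)^2)" .
 have lU: "loc_int D (U i)" for i
 proof -
  \<comment> \<open>\<open>abs_le_sq\<close> with the point-dependent parameter s = b(x): |U| is at
    most b + U^2 / b, and both terms are locally integrable.\<close>
  have "loc_int D (%x. b x + inverse (b x) * (U i x)^2)"
  proof (rule loc_int_add[OF loc_int_continuous[OF b_cont(1)]])
   show "loc_int D (%x. inverse (b x) * (U i x)^2)" unfolding loc_int_def
   proof (intro allI impI)
   fix K :: "plane set" assume K: "compact K & K <= D"
   have "integ (%x. ind K x * (gam x * (U i x)^2))"
   by (rule integrable_bounded_mult(2)[OF iU, where B=1]) (use K in \<open>auto simp: borel_compact intro!: borel_measurable_indicator split: split_indicator\<close>)
   moreover have "ind K x * (gam x * (U i x)^2) = ind K x * (inverse (b x) * (U i x)^2)" for x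
   using K by (auto simp: indicator_def gam_def)
   ultimately show "integ (%x. ind K x * (inverse (b x) * (U i x)^2))" by simp
   qed
  qed
  moreover have "abs u <= r + inverse r * u^2" if "r > 0" for u r :: real
   using abs_le_sq[OF that, of u] by (simp add: power2_eq_square divide_inverse mult.commute)
  ultimately show ?thesis by (intro loc_int_le[of D _ "U i"]) (use U(1) bpos in auto)
 qed
 show "wpd D i t (U i)"
  unfolding wpd_def
 proof (intro conjI allI impI)
  show lt: "loc_int D t" by (rule loc_int_bounded[OF t(1,2)])
  show "loc_int D (U i)" by (rule lU)
  fix eta assume e: "test_fun D eta"
  obtain L where L: "L <= D" "C1c L eta" by (rule test_funD[OF e]) (rule that)
  note q = C1cD[OF L(2)]
  obtain B1 where B1: "!!x. abs (eta x) <= B1" using continuous_cpt_bounded[OF q(4,1,5)] by metis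
  obtain B2 where B2: "!!x. abs (pd i eta x) <= B2" using continuous_cpt_bounded[OF q(3,1,6)] by metis
  have qm: "eta : BM" "pd i eta : BM" using q(3,4) by (auto intro: borel_measurable_continuous_onI)
  have ci: "continuous_on UNIV (phi n)" "continuous_on UNIV (pd i (phi n))" for n using p(3,4) by auto
  have 1: "(%n. LI x. phi n x * pd i eta x) ~~> (LI x. t x * pd i eta x)"
  proof (rule L2_weak[OF bd Db pm(1) t(1) _ qm(2) B2])
   show "(%n. (NI x. ennreal (ind D x * (phi n x - t x)^2))) ~~> 0" using phi(2) unfolding e1 .
   show "integ (%x. phi n x * pd i eta x)" for n
   by (rule loc_int_mult_cont[OF loc_int_continuous[OF ci(1)] q(1) subset_UNIV q(3,6)])
   show "integ (%x. t x * pd i eta x)" by (rule loc_int_mult_cont[OF lt q(1) L(1) q(3,6)])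
   show "x ~: D ==> pd i eta x = 0" for x using q(6) L(1) by blast
  qed
  have 2: "(%n. LI x. pd i (phi n) x * eta x) ~~> (LI x. U i x * eta x)"
  proof (rule L2_weak[OF bd Db pm(2) U(1) _ qm(1) B1])
   have "(%n. ennreal Bb * (?G i n)) ~~> ennreal Bb * 0"
   by (intro ennreal_tendsto_cmult l2) simp
   then have l3: "(%n. ennreal Bb * (?G i n)) ~~> 0" by simp
   show "(%n. (NI x. ennreal (ind D x * (?d i n x)^2))) ~~> 0"
   proof (rule tendsto_sandwich[OF _ _ tendsto_const l3])
   have "(NI x. ennreal (ind D x * (?d i n x)^2))
   <= (NI x. ennreal Bb * ennreal (gam x * (?d i n x)^2))" for n
   proof (rule nn_integral_mono)
   fix x
   have "ind D x <= Bb * gam x" using bpos[of x] Bb[of x] by (auto simp: gam_def indicator_def field_simps)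
   then have "ind D x * (?d i n x)^2 <= Bb * (gam x * (?d i n x)^2)"
   unfolding mult.assoc[symmetric] by (intro mult_right_mono) auto
   then show "ennreal (ind D x * (?d i n x)^2) <= ennreal Bb * ennreal (gam x * (?d i n x)^2)"
   using Bb_pos bet(6)[of x] by (simp add: ennreal_leI flip: ennreal_mult)
   qed
   then show "\<forall>\<^sub>F n in sequentially. (NI x. ennreal (ind D x * (?d i n x)^2))
   <= ennreal Bb * (?G i n)"
   by (intro always_eventually allI) (simp add: nn_integral_cmult)
   qed simp
   show "integ (%x. pd i (phi n) x * eta x)" for n
   by (rule loc_int_mult_cont[OF loc_int_continuous[OF ci(2)] q(1) subset_UNIV q(4,5)])
   show "integ (%x. U i x * eta x)" by (rule loc_int_mult_cont[OF lU q(1) L(1) q(4,5)])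
   show "x ~: D ==> eta x = 0" for x using q(5) L(1) by blast
  qed
  have "(LI x. phi n x * pd i eta x) = - (LI x. pd i (phi n) x * eta x)" for n
   by (rule by_parts(3)[OF open_UNIV C1c_Ck[OF K(2)] L(2) subset_UNIV])
  then have "(%n. LI x. phi n x * pd i eta x) ~~> - (LI x. U i x * eta x)" using tendsto_minus[OF 2] by simp
  then show "(LI x. t x * pd i eta x) = - (LI x. U i x * eta x)" by (rule LIMSEQ_unique[OF 1])
 qed
qed

text \<open>Borel versions t of T z and U of its gradient, attached to one element W of H(D). The
  clause on \<open>c\<close> transfers every pointwise bound of T z on \<open>D\<close> to all
  values of t.\<close>

definition isol :: "(plane => real) => (plane => real) => (2 => plane => real) => bool" where
 "isol z t U \<longleftrightarrow> t : BM & (AEL x. x : D --> T z x = t x) \<and>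
  (ALL c. (ALL x:D. abs (T z x) <= c) --> (ALL x. abs (t x) <= c)) \<and>
  (ALL i. U i : BM & integ (%x. gam x * (U i x)^2) & wpd D i t (U i)) \<and>
  (EX W. in_H D b (T z) W & (ALL i. AEL x. x : D --> W x $ i = U i x) \<and>
   (ALL v V. in_H D b v V --> (\<integral>x. 1 / (b x)^2 * (W x \<bullet> V x) \<partial>lake_measure D b) = (\<integral>x. z x * v x \<partial>lake_measure D b)))"

lemma is_K_T: "bb z ==> is_K D b z (T z)"
 unfolding T_def[abs_def]
proof (rule K[of 2])
 assume z: "bb z"
 have e: "abs (z x) powr 2 = z x * z x" for x by (simp add: powr_numeral power2_eq_square)
 have m: "z : BL D" "integ (%x. bet x * abs (z x) powr 2)" "z : BM"
  using bb_int[OF bb_ops(3)[OF z z]] z unfolding e by (auto simp: bb_def intro: borel_lebesgue_on)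
 note [measurable] = m(1,3)
 have "integrable (lake_measure D b) (%x. abs (z x) powr 2)"
  by (subst lake_integral(2)[where g="%x. abs (z x) powr 2"]) (use m(2) in auto)
 then show "z : Lp (lake_measure D b) 2" using m(1) by (simp add: Lp_def lake_measure_def)
qed simp

lemma isol_exists:
 assumes z: "bb z"
 shows "EX t U. isol z t U"
proof -
 obtain W where W: "in_H D b (T z) W" "!!v V. in_H D b v V ==>
   (\<integral>x. 1 / (b x)^2 * (W x \<bullet> V x) \<partial>lake_measure D b) = (\<integral>x. z x * v x \<partial>lake_measure D b)"
  using is_K_T[OF z] unfolding is_K_def by blast
 obtain L where L: "z : BM" "!!x. abs (z x) <= L" using z by (auto simp: bb_def)
 let ?c0 = "Bb / (2 * pi) * ((ln (d0 / d0) + 1) * (LI y. bet y * abs (z y)) + Bb * L * (d0^2 * c1)) + BR * (LI y. bet y * abs (z y))"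
 have c0: "!!x. x : D ==> abs (T z x) <= ?c0" by (rule T_bound[OF L d0(1) order_refl])
 define c where "c = (SUP x\<in>D. abs (T z x))"
 have c: "abs (T z x) <= c" if "x : D" for x
  unfolding c_def using c0 that by (intro cSUP_upper bdd_aboveI2[where M="?c0"]) auto
 have c1: "c <= c'" if "ALL x:D. abs (T z x) <= c'" for c' unfolding c_def using that ne by (intro cSUP_least) auto
 have cpos: "c >= 0" using ne c by (meson abs_ge_zero ex_in_conv order_trans)
 have wm: "T z : BL D" "W : BL D" using W(1) by (auto simp: in_H_def)
 obtain g where g: "g : BM" "AEL x. x : D --> T z x = g x"
  by (rule borel_version[OF wm(1) Db]) (rule that)
 note [measurable] = g(1)
 \<comment> \<open>Clipping at the supremum \<open>c\<close> of |T z| leaves the version unchanged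
   almost everywhere in \<open>D\<close> and makes the bound hold at every point.\<close>
 define t where "t x = max (- c) (min c (g x))" for x
 have t: "t : BM" unfolding t_def[abs_def] by measurable
 have tb: "abs (t x) <= c" for x using cpos by (auto simp: t_def)
 have tT: "AEL x. x : D --> T z x = t x" using g(2)
 proof (rule eventually_mono, intro impI)
  fix x assume "x : D --> T z x = g x" "x : D"
  then show "T z x = t x" using c[of x] by (auto simp: t_def)
 qed
 have ex: "EX U. U : BM & (AEL x. x : D --> W x $ i = U x)" for i
  by (rule borel_version[OF vec_meas[OF wm(2), of i] Db]) (rule exI, rule conjI)
 define U where "U i = (SOME U. U : BM & (AEL x. x : D --> W x $ i = U x))" for i
 have U: "U i : BM" "AEL x. x : D --> W x $ i = U i x" for i
  using someI_ex[OF ex[of i]] unfolding U_def by simp_all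
 have "isol z t U" unfolding isol_def
  by (intro conjI allI impI exI[of _ W] t tT U W in_H_weak[OF W(1) t tb tT U] order_trans[OF tb c1])
 then show ?thesis by blast
qed

definition tt where "tt z = fst (SOME p. isol z (fst p) (snd p))"
definition UU where "UU z = snd (SOME p. isol z (fst p) (snd p))"

lemma isol: "bb z ==> isol z (tt z) (UU z)"
 unfolding tt_def UU_def by (rule someI_ex[of "%p. isol z (fst p) (snd p)"]) (use isol_exists in auto)

lemma tt:
 assumes "bb z"
 shows "tt z : BM" "AEL x. x : D --> T z x = tt z x" "(!!x. x : D ==> abs (T z x) <= c) ==> abs (tt z x) <= c"
  "UU z i : BM" "integ (%x. gam x * (UU z i x)^2)" "wpd D i (tt z) (UU z i)" "bb (tt z)"
  "T z : BL D"
proof -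
 note I = isol[OF assms, unfolded isol_def]
 show 1: "tt z : BM" "AEL x. x : D --> T z x = tt z x" and b: "(!!x. x : D ==> abs (T z x) <= c) ==> abs (tt z x) <= c"
  "UU z i : BM" "integ (%x. gam x * (UU z i x)^2)" "wpd D i (tt z) (UU z i)" for c x
  using I by blast+
 obtain L where L: "z : BM" "!!x. abs (z x) <= L" using assms by (auto simp: bb_def)
 show "bb (tt z)" unfolding bb_def using 1(1) b(1)[OF T_bound[OF L d0(1) order_refl]] by blast
 show "T z : BL D" using I by (auto simp: in_H_def)
qed

lemma isol_grad:
 assumes "bb z"
 obtains W where "in_H D b (T z) W" "!!i. AEL x. x : D --> W x $ i = UU z i x" "!!v V. in_H D b v V ==>
   (\<integral>x. 1 / (b x)^2 * (W x \<bullet> V x) \<partial>lake_measure D b) = (\<integral>x. z x * v x \<partial>lake_measure D b)"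
proof -
 have "EX W. in_H D b (T z) W & (ALL i. AEL x. x : D --> W x $ i = UU z i x) \<and>
   (ALL v V. in_H D b v V --> (\<integral>x. 1 / (b x)^2 * (W x \<bullet> V x) \<partial>lake_measure D b) = (\<integral>x. z x * v x \<partial>lake_measure D b))"
  using isol[OF assms] unfolding isol_def by (elim conjE)
 then obtain W where W: "in_H D b (T z) W" "ALL i. AEL x. x : D --> W x $ i = UU z i x" "ALL v V. in_H D b v V -->
   (\<integral>x. 1 / (b x)^2 * (W x \<bullet> V x) \<partial>lake_measure D b) = (\<integral>x. z x * v x \<partial>lake_measure D b)"
  by (elim exE conjE) (rule that)
 show ?thesis by (rule that[OF W(1) W(2)[rule_format] W(3)[rule_format]])
qed

section \<open>The quadratic form of the solution operator\<close>

lemma gam_prod: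
 assumes "bb z" "bb w"
 shows "integ (%x. gam x * (UU z i x * UU w i x))"
proof (rule integ_bound)
 note [measurable] = tt(4)[OF assms(1), of i] tt(4)[OF assms(2), of i]
 show "integ (%x. gam x * (UU z i x)^2 + gam x * (UU w i x)^2)" by (intro integ_add tt assms)
 have "abs (u * v) <= u^2 + v^2" for u v :: real
 proof -
  have "0 <= (abs u - abs v)^2" "0 <= abs (u * v)" by auto
  moreover have "(abs u - abs v)^2 = u^2 + v^2 - 2 * abs (u * v)" by (simp add: power2_diff abs_mult)
  ultimately show ?thesis by linarith
 qed
 then have "gam x * abs (UU z i x * UU w i x) <= gam x * ((UU z i x)^2 + (UU w i x)^2)" for x by (intro mult_left_mono bet(6))
 then show "AEL x. norm (gam x * (UU z i x * UU w i x)) <= norm (gam x * (UU z i x)^2 + gam x * (UU w i x)^2)"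
  using bet(6) by (intro AE_I2) (simp add: abs_mult distrib_left)
 show "(%x. gam x * (UU z i x * UU w i x)) : borel_measurable lborel" by measurable
qed

text \<open>The integral of z K w against nu. By the weak equation for K z tested with K w it is the
  scalar product of K z and K w in H(D), hence symmetric.\<close>

definition A where "A z w = (LI x. bet x * (z x * tt w x))"

lemma A_eq:
 assumes z: "bb z" and w: "bb w"
 shows "A z w = (SUM i:UNIV. LI x. gam x * (UU z i x * UU w i x))"
proof -
 obtain W where W: "in_H D b (T z) W" "!!i. AEL x. x : D --> W x $ i = UU z i x" "!!v V. in_H D b v V ==>
   (\<integral>x. 1 / (b x)^2 * (W x \<bullet> V x) \<partial>lake_measure D b) = (\<integral>x. z x * v x \<partial>lake_measure D b)"
  by (rule isol_grad[OF z]) (rule that)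
 obtain V where V: "in_H D b (T w) V" "!!i. AEL x. x : D --> V x $ i = UU w i x"
  by (rule isol_grad[OF w]) (rule that)
 have m: "W : BL D" "V : BL D" using W(1) V(1) by (auto simp: in_H_def)
 have zm: "z : BM" using z by (simp add: bb_def)
 have "(\<integral>x. z x * T w x \<partial>lake_measure D b) = A z w"
  unfolding A_def
 proof (rule lake_integral(1))
  show "AEL x. x : D --> z x * T w x = z x * tt w x" using tt(2)[OF w] by (rule eventually_mono) simp
 qed (intro borel_measurable_times borel_lebesgue_on zm tt(1,8) w)+
 then show ?thesis
  using W(3)[OF V(1)] lake_inner[OF m(1) tt(4)[OF z] W(2) m(2) tt(4)[OF w] V(2) gam_prod[OF z w]] by simp
qed

lemma A_sym: "bb z ==> bb w ==> A z w = A w z"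
 by (simp add: A_eq mult.commute)

text \<open>The expression A z z - 2 A z w + A w w stands for the form at z - w; it is kept expanded
  so that linearity of the chosen versions \<open>tt\<close> and \<open>UU\<close> is not invoked.
  The second claim is Cauchy-Schwarz with a free parameter.\<close>

lemma A_quad:
 assumes x: "bb x" and z: "bb z" and w: "bb w" and s: "s > 0"
 shows "0 <= A z z - 2 * A z w + A w w" "abs (A x z - A x w) <= s * A x x + (A z z - 2 * A z w + A w w) / s"
proof -
 have S: "A z z - 2 * A z w + A w w = (SUM i:UNIV. LI y. gam y * (UU z i y - UU w i y)^2)"
 proof -
  have "(LI y. gam y * (UU z i y - UU w i y)^2) = (LI y. gam y * (UU z i y * UU z i y) - 2 * (gam y * (UU z i y * UU w i y)) + gam y * (UU w i y * UU w i y))" for i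
   by (intro lint_cong) (auto simp: power2_eq_square algebra_simps)
  also have "... i = (LI y. gam y * (UU z i y * UU z i y)) - 2 * (LI y. gam y * (UU z i y * UU w i y)) + (LI y. gam y * (UU w i y * UU w i y))" for i
   using gam_prod[OF z z, of i] gam_prod[OF z w, of i] gam_prod[OF w w, of i] by simp
  finally show ?thesis unfolding A_eq[OF z z] A_eq[OF z w] A_eq[OF w w]
   by (simp add: sum.distrib sum_subtractf sum_distrib_left)
 qed
 show "0 <= A z z - 2 * A z w + A w w" unfolding S by (intro sum_nonneg integral_nonneg_AE AE_I2 mult_nonneg_nonneg bet(6)) auto
 have iq: "integ (%y. gam y * (UU z i y - UU w i y)^2)" for i
 proof -
  have "integ (%y. gam y * (UU z i y * UU z i y) - 2 * (gam y * (UU z i y * UU w i y)) + gam y * (UU w i y * UU w i y))"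
   by (intro integ_add integ_diff integrable_mult_right gam_prod z w)
  then show ?thesis by (simp add: power2_eq_square algebra_simps)
 qed
 have "abs ((LI y. gam y * (UU x i y * UU z i y)) - (LI y. gam y * (UU x i y * UU w i y)))
  <= s * (LI y. gam y * (UU x i y * UU x i y)) + (LI y. gam y * (UU z i y - UU w i y)^2) / s" for i
 proof -
  have "abs ((LI y. gam y * (UU x i y * UU z i y)) - (LI y. gam y * (UU x i y * UU w i y)))
   = abs (LI y. gam y * (UU x i y * UU z i y) - gam y * (UU x i y * UU w i y))"
   using gam_prod[OF x z, of i] gam_prod[OF x w, of i] by simp
  also have "... <= (LI y. abs (gam y * (UU x i y * UU z i y) - gam y * (UU x i y * UU w i y)))" by (rule integral_abs_bound)
  also have "... <= (LI y. s * (gam y * (UU x i y * UU x i y)) + gam y * (UU z i y - UU w i y)^2 / s)"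
  proof (rule integral_mono_AE)
   show "integ (%y. abs (gam y * (UU x i y * UU z i y) - gam y * (UU x i y * UU w i y)))"
   by (intro integrable_abs integ_diff gam_prod x z w)
   show "integ (%y. s * (gam y * (UU x i y * UU x i y)) + gam y * (UU z i y - UU w i y)^2 / s)"
   by (intro integ_add integrable_mult_right integrable_divide iq gam_prod x)
   have ineq: "abs (u * v - u * r) <= s * (u * u) + (v - r)^2 / s" for u v r :: real
   proof -
   have "0 <= (s * abs u - abs (v - r))^2" by simp
   then have "2 * (s * (abs u * abs (v - r))) <= s * s * (u * u) + (v - r)^2"
   by (simp add: power2_diff power_mult_distrib) (simp add: power2_eq_square mult_ac)
   moreover have "0 <= s * (abs u * abs (v - r))" using s by simp
   ultimately have "s * (abs u * abs (v - r)) <= s * s * (u * u) + (v - r)^2" by linarith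
   then have "abs u * abs (v - r) <= s * (u * u) + (v - r)^2 / s" using s by (simp add: field_simps)
   then show ?thesis by (simp flip: abs_mult right_diff_distrib)
   qed
   have "gam y * abs (UU x i y * UU z i y - UU x i y * UU w i y) <= gam y * (s * (UU x i y * UU x i y) + (UU z i y - UU w i y)^2 / s)" for y
   by (intro mult_left_mono ineq bet(6))
   moreover have "abs (gam y * (UU x i y * UU z i y) - gam y * (UU x i y * UU w i y)) = gam y * abs (UU x i y * UU z i y - UU x i y * UU w i y)" for y
   unfolding right_diff_distrib[symmetric] abs_mult using bet(6)[of y] by simp
   ultimately show "AEL y. abs (gam y * (UU x i y * UU z i y) - gam y * (UU x i y * UU w i y)) <= s * (gam y * (UU x i y * UU x i y)) + gam y * (UU z i y - UU w i y)^2 / s"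
   by (intro AE_I2) (simp add: algebra_simps)
  qed
  also have "... = s * (LI y. gam y * (UU x i y * UU x i y)) + (LI y. gam y * (UU z i y - UU w i y)^2) / s"
   using gam_prod[OF x x, of i] iq[of i] by simp
  finally show ?thesis .
 qed
 note t = this[of 1] this[of 2]
 show "abs (A x z - A x w) <= s * A x x + (A z z - 2 * A z w + A w w) / s"
  unfolding S A_eq[OF x z] A_eq[OF x w] A_eq[OF x x] sum_2 distrib_left add_divide_distrib using t by linarith
qed

text \<open>Test functions belong to H(D), so the weak equation for K z is the divergence-form
  equation of \<open>wsol\<close>; b <= Bb converts the weighted energy into the Dirichlet
  integral.\<close>

lemma wsol_tt:
 assumes z: "bb z" and M: "!!x. abs (z x) <= M" "!!x. x : D ==> abs (T z x) <= M" "Bb * A z z <= M"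
 shows "wsol D b M (tt z) (UU z) z"
 unfolding wsol_def
proof (intro conjI allI impI)
 show "z : BM" using z by (simp add: bb_def)
 show "abs (tt z x) <= M" for x by (rule tt(3)[OF z M(2)])
 fix i
 note [measurable] = tt(4)[OF z]
 have le: "ind D x * (UU z i x)^2 <= Bb * (gam x * (UU z i x)^2)" for x
 proof -
  have "ind D x <= Bb * gam x" using bpos[of x] Bb[of x] by (auto simp: gam_def indicator_def field_simps)
  then show ?thesis unfolding mult.assoc[symmetric] by (intro mult_right_mono) auto
 qed
 have i: "integ (%x. Bb * (gam x * (UU z i x)^2))" by (intro integrable_mult_right tt z)
 have ae: "AEL x. 0 <= ind D x * (UU z i x)^2 & ind D x * (UU z i x)^2 <= Bb * (gam x * (UU z i x)^2)" using le by simp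
 show "integ (%x. ind D x * (UU z i x)^2)" by (rule integrable_nonneg_le(1)[OF i _ ae]) measurable
 have "(LI x. ind D x * (UU z i x)^2) <= Bb * (LI x. gam x * (UU z i x)^2)"
  using integrable_nonneg_le(2)[OF i _ ae] by simp
 also have "(LI x. gam x * (UU z i x)^2) <= (SUM i:UNIV. LI x. gam x * (UU z i x)^2)"
  by (rule member_le_sum) (auto intro!: integral_nonneg_AE AE_I2 mult_nonneg_nonneg bet)
 also have "... = A z z" by (simp add: A_eq[OF z z] power2_eq_square)
 finally show "(LI x. ind D x * (UU z i x)^2) <= M" using M(3) Bb_pos by (simp add: mult_left_mono)
next
 fix phi assume t: "test_fun D phi"
 obtain W where W: "in_H D b (T z) W" "!!i. AEL x. x : D --> W x $ i = UU z i x" "!!v V. in_H D b v V ==>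
   (\<integral>x. 1 / (b x)^2 * (W x \<bullet> V x) \<partial>lake_measure D b) = (\<integral>x. z x * v x \<partial>lake_measure D b)"
  by (rule isol_grad[OF z]) (rule that)
 obtain L where L: "L <= D" "C1c L phi" by (rule test_funD[OF t]) (rule that)
 note q = C1cD[OF L(2)]
 have zm: "z : BM" using z by (simp add: bb_def)
 have qm: "phi : BM" "pd i phi : BM" for i using q(3,4) by (auto intro: borel_measurable_continuous_onI)
 have m: "W : BL D" "grad phi : BL D" using W(1) in_H_test[OF t] by (auto simp: in_H_def)
 have lU: "loc_int D (%x. inverse (b x) * UU z i x)" for i using tt(6)[OF z, of i] by (intro loc_int_mult_C b_cont) (simp add: wpd_def)
 have e: "gam x * (UU z i x * pd i phi x) = (inverse (b x) * UU z i x) * pd i phi x" "bet x * (z x * phi x) = (b x * z x) * phi x" for i x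
  using q(5,6)[of x] L(1) by (auto simp: gam_def bet_def indicator_def subset_iff)
 have "(SUM i:UNIV. LI x. gam x * (UU z i x * pd i phi x)) = (\<integral>x. 1 / (b x)^2 * (W x \<bullet> grad phi x) \<partial>lake_measure D b)"
 proof (rule lake_inner[OF m(1) tt(4)[OF z] W(2) m(2) qm(2), symmetric])
  show "integ (%x. gam x * (UU z i x * pd i phi x))" for i unfolding e by (rule loc_int_mult_cont[OF lU q(1) L(1) q(3,6)])
 qed simp
 also have "... = (\<integral>x. z x * phi x \<partial>lake_measure D b)" by (rule W(3)[OF in_H_test[OF t]])
 also have "... = (LI x. bet x * (z x * phi x))"
  by (rule lake_integral(1)) (intro borel_measurable_times borel_lebesgue_on zm qm AE_I2 impI refl)+
 finally show "(SUM i:UNIV. LI x. (inverse (b x) * UU z i x) * pd i phi x) = (LI x. (b x * z x) * phi x)" unfolding e .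
qed (fact tt(1)[OF z] M(1) tt(4)[OF z] tt(6)[OF z])+

end

section \<open>Existence by monotone rearrangement steps\<close>

text \<open>Closure under midpoints is all that the parallelogram identity asks for, and it keeps
  inductions free of weights.\<close>

inductive_set mhull :: "(plane => real) set => (plane => real) set" for X where
 base: "z : X ==> z : mhull X"
| mid: "z : mhull X ==> w : mhull X ==> (%x. (z x + w x) / 2) : mhull X"

lemma mhull_mono: "z : mhull X ==> X <= Y ==> z : mhull Y"
 by (induction rule: mhull.induct) (auto intro: mhull.intros)

lemma mhull_affine:
 assumes "z : mhull X" "!!z w. z : mhull X ==> w : mhull X ==> \<Phi> (%x. (z x + w x) / 2) = (\<Phi> z + \<Phi> w) / 2"
  "!!z. z : X ==> lo <= \<Phi> z & \<Phi> z <= hi"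
 shows "lo <= \<Phi> z & \<Phi> z <= (hi :: real)"
 using assms(1)
proof (induction rule: mhull.induct)
 case (mid z w)
 have "lo <= (a + c) / 2 & (a + c) / 2 <= hi" if "lo <= a & a <= hi" "lo <= c & c <= hi" for a c using that by simp
 then show ?case unfolding assms(2)[OF mid(1,2)] using mid(3,4) by blast
qed (use assms(3) in blast)

section \<open>Compactness of bounded families of solutions\<close>

lemma diagonal_convergent:
 fixes f :: "nat => nat => real"
 assumes "!!n i. abs (f n i) <= M"
 obtains k where "strict_mono k" "!!i. convergent (%n. f (k n) i)"
proof -
 interpret subseqs "%i s. convergent (%n. f (s n) i)"
 proof
  fix i and s :: "nat => nat"
  have "bounded (range (%n. f (s n) i))" using assms by (auto simp: bounded_iff)
  from bounded_imp_convergent_subsequence[OF this] obtain a r where "strict_mono r" "((%n. f (s n) i) \<circ> r) ~~> a" by blast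
  then show "EX r'. strict_mono r' & convergent (%n. f ((s \<circ> r') n) i)" by (auto simp: o_def convergent_def)
 qed
 have "convergent (%n. f ((diagseq \<circ> ((+) (Suc i))) n) i)" for i
  by (rule diagseq_holds) (auto simp: o_def dest: convergent_subseq_convergent)
 moreover have "(%n. f (diagseq (n + Suc i)) i) = (%n. f ((diagseq \<circ> ((+) (Suc i))) n) i)" for i
  by (rule ext) (simp only: o_def add.commute)
 ultimately have "convergent (%n. f (diagseq n) i)" for i
  using convergent_ignore_initial_segment[of "%n. f (diagseq n) i" "Suc i"] by metis
 with subseq_diagseq show ?thesis by (rule that)
qed

text \<open>A diagonal sequence converges on a countable dense set and local equicontinuity spreads
  this. Each function is Lipschitz only off its own null sets, so the dense set is taken in the
  complement of their countable union \<open>E\<close>.\<close>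

lemma equi_lipschitz_convergent:
 fixes u :: "nat => plane => real"
 assumes D: "open D" and M: "!!n x. abs (u n x) <= M"
  and lip: "!!x0. x0 : D ==> EX r>0. EX C>=0. ALL n. EX N:null_sets lborel. ALL x:ball x0 r - N. ALL y:ball x0 r - N. abs (u n x - u n y) <= C * dist x y"
 obtains k where "strict_mono k" "AEL x. x : D --> convergent (%n. u (k n) x)"
proof -
 obtain r C where r: "!!x0. x0 : D ==> r x0 > 0 & C x0 >= 0 \<and>
   (ALL n. EX N:null_sets lborel. ALL x:ball x0 (r x0) - N. ALL y:ball x0 (r x0) - N. abs (u n x - u n y) <= C x0 * dist x y)"
  using lip by metis
 obtain F where F: "F <= (%x. ball x (r x)) ` D" "countable F" "\<Union>F = \<Union>((%x. ball x (r x)) ` D)"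
  by (rule Lindelof[of "(%x. ball x (r x)) ` D"]) auto
 obtain D' where D': "countable D'" "D' <= D" "F = (%x. ball x (r x)) ` D'"
  using F(1,2) countable_subset_image[of F "%x. ball x (r x)" D] by auto
 obtain N where N: "!!x0 n. x0 : D ==> N x0 n : null_sets lborel"
  "!!x0 n x y. x0 : D ==> x : ball x0 (r x0) - N x0 n ==> y : ball x0 (r x0) - N x0 n ==> abs (u n x - u n y) <= C x0 * dist x y"
  using r by metis
 define E where "E = (UN x0:D'. \<Union>n. N x0 n)"
 have E: "E : null_sets lborel" unfolding E_def using D' N(1) by (intro null_sets_UN' null_sets_UN) auto
 obtain Q where Q: "countable Q" "Q <= D - E" "D - E <= closure Q" using separable[of "D - E"] by metis
 obtain k where k: "strict_mono k" "!!i. convergent (%n. u (k n) (from_nat_into Q i))"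
  by (rule diagonal_convergent[of "%n i. u n (from_nat_into Q i)" M, OF M]) (rule that)
 have kQ: "convergent (%n. u (k n) y)" if "y : Q" for y
  using k(2)[of "to_nat_on Q y"] from_nat_into_to_nat_on[OF Q(1) that] by simp
 have "convergent (%n. u (k n) x)" if x: "x : D - E" for x
 proof -
  have "x : \<Union>F" unfolding F(3) using x r[of x] by force
  then obtain x0 where x0: "x0 : D'" "x : ball x0 (r x0)" using D'(3) by auto
  have xD: "x0 : D" using x0 D' by auto
  have "Cauchy (%n. u (k n) x)"
  proof (rule metric_CauchyI)
   fix d :: real assume d: "d > 0"
   have C0: "C x0 >= 0" using r[OF xD] by blast
   define s where "s = min (r x0 - dist x0 x) (d / (4 * (C x0 + 1)))"
   have s: "s > 0" "s <= d / (4 * (C x0 + 1))" using x0 d C0 by (auto simp: s_def)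
   obtain y where y: "y : Q" "dist y x < s" using Q(3) x s(1) by (meson closure_approachable subsetD)
   have yb: "y : ball x0 (r x0)" using y(2) dist_triangle[of x0 y x] by (simp add: s_def dist_commute)
   have "C x0 * dist x y <= C x0 * (d / (4 * (C x0 + 1)))" using y(2) s C0 by (intro mult_left_mono) (auto simp: dist_commute)
   also have "... <= d / 4" using d C0 by (simp add: field_simps)
   finally have Cd: "C x0 * dist x y <= d / 4" .
   have near: "abs (u n x - u n y) <= d / 4" for n
   by (rule order_trans[OF N(2)[OF xD] Cd]) (use x y(1) Q(2) x0 yb in \<open>auto simp: E_def\<close>)
   obtain n0 where n0: "!!m n. m >= n0 ==> n >= n0 ==> dist (u (k m) y) (u (k n) y) < d / 4"
   using metric_CauchyD[OF convergent_Cauchy[OF kQ[OF y(1)]], of "d/4"] d by auto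
   have "dist (u (k m) x) (u (k n) x) < d" if "m >= n0" "n >= n0" for m n
   using near[of "k m"] near[of "k n"] n0[OF that] d unfolding dist_real_def by linarith
   then show "EX M. ALL m>=M. ALL n>=M. dist (u (k m) x) (u (k n) x) < d" by blast
  qed
  then show ?thesis by (simp add: Cauchy_convergent_iff)
 qed
 then have "AEL x. x : D --> convergent (%n. u (k n) x)"
  by (intro AE_I'[OF E]) auto
 with k(1) show ?thesis by (rule that)
qed

context lake_coeff
begin

lemma wsol_compact:
 fixes u :: "nat => plane => real"
 assumes w: "!!n. wsol D b M (u n) (U n) (z n)"
 obtains k where "strict_mono k" "AEL x. x : D --> convergent (%n. u (k n) x)"
proof (rule equi_lipschitz_convergent[OF D wsolD(3)[OF w]])
 fix x0 assume "x0 : D"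
 then obtain R where R: "R > 0" "cball x0 R <= D" using D open_contains_cball by metis
 have M: "M >= 0" by (rule order_trans[OF abs_ge_zero wsolD(3)[OF w]])
 obtain C where C: "C >= 0" "!!u U z. wsol D b M u U z ==> EX N:null_sets lborel. ALL x:cball x0 (R/64) - N. ALL y:cball x0 (R/64) - N. abs (u x - u y) <= C * dist x y"
  by (rule gradient_bound[OF R M]) (rule that)
 have "EX N:null_sets lborel. ALL x:ball x0 (R/64) - N. ALL y:ball x0 (R/64) - N. abs (u n x - u n y) <= C * dist x y" for n
 proof -
  obtain N where "N : null_sets lborel" "ALL x:cball x0 (R/64) - N. ALL y:cball x0 (R/64) - N. abs (u n x - u n y) <= C * dist x y"
   using C(2)[OF w[of n]] by (rule bexE)
  moreover have "ball x0 (R/64) <= cball x0 (R/64)" by auto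
  ultimately show ?thesis by blast
 qed
 then show "EX r>0. EX C>=0. ALL n. EX N:null_sets lborel. ALL x:ball x0 r - N. ALL y:ball x0 r - N. abs (u n x - u n y) <= C * dist x y"
  using R(1) C(1) by (intro exI[of _ "R/64"] conjI exI[of _ C] allI) simp_all
qed (rule that)

end

section \<open>The truncated profile and its primitive\<close>

locale profile =
 fixes ft :: "real => real" and L l :: real
 assumes ft0: "!!s. s <= 0 ==> ft s = 0" and ft_mono: "mono ft" and ftL: "!!s. ft s <= L"
  and ft_cont: "!!s. s ~= 0 ==> isCont ft s" and l: "0 <= l" "(ft \<longlongrightarrow> l) (at_right 0)"
begin

lemma ft_nonneg: "0 <= ft s" using monoD[OF ft_mono, of "min s 0" s] ft0[of "min s 0"] by simp

lemma l_le: "s > 0 ==> l <= ft s"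
proof (rule tendsto_upperbound[OF l(2)])
 assume "s > 0"
 then show "\<forall>\<^sub>F x in at_right 0. ft x <= ft s"
  using eventually_at_right_real[of 0 s] by (auto elim!: eventually_mono intro: monoD[OF ft_mono])
qed simp

lemma lL: "l <= L" using l_le[of 1] ftL[of 1] by simp

lemma ft_meas: "ft : BM" by (rule borel_measurable_mono[OF ft_mono])

definition F where "F s = integral {0..s} ft"

lemma ft_int: "ft integrable_on {s..t}"
 by (rule integrable_on_mono_on) (use ft_mono in \<open>simp add: mono_on_def mono_def\<close>)

lemma F_diff:
 assumes "s <= t"
 shows "ft s * (t - s) <= F t - F s" "F t - F s <= ft t * (t - s)"
proof -
 have i: "ft s * (t - s) <= integral {s..t} ft" "integral {s..t} ft <= ft t * (t - s)" if "s <= t" for s t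
 proof -
  have "integral {s..t} (%_. ft s) <= integral {s..t} ft" by (intro integral_le ft_int) (auto intro: monoD[OF ft_mono])
  then show "ft s * (t - s) <= integral {s..t} ft" using that by (simp add: mult.commute)
  have "integral {s..t} ft <= integral {s..t} (%_. ft t)" by (intro integral_le ft_int) (auto intro: monoD[OF ft_mono])
  then show "integral {s..t} ft <= ft t * (t - s)" using that by (simp add: mult.commute)
 qed
 have "ft s * (t - s) <= F t - F s & F t - F s <= ft t * (t - s)"
 proof (cases "0 <= s")
  case True
  have "integral {0..s} ft + integral {s..t} ft = integral {0..t} ft"
   using True assms by (intro Henstock_Kurzweil_Integration.integral_combine ft_int)
  then show ?thesis using i[OF assms] by (simp add: F_def)
 next
  case False
  then have s: "F s = 0" "ft s = 0" using ft0[of s] by (auto simp: F_def)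
  show ?thesis
  proof (cases "0 <= t")
   case True
   have "ft t * (t - 0) <= ft t * (t - s)" using False ft_nonneg by (intro mult_left_mono) auto
   moreover have "0 <= integral {0..t} ft" "integral {0..t} ft <= ft t * (t - 0)" using i[OF True] ft0[of 0] by auto
   ultimately show ?thesis unfolding s F_def[of t] by simp
  qed (use ft0[of t] s in \<open>auto simp: F_def\<close>)
 qed
 then show "ft s * (t - s) <= F t - F s" "F t - F s <= ft t * (t - s)" by auto
qed

text \<open>\<open>F\<close> is convex with derivative \<open>ft\<close> off 0, and at 0 its
  subdifferential is the interval [0, l], from which \<open>tht\<close> selects an element. The
  slope l is obtained from points r > 0 decreasing to 0.\<close>

lemma F_subgradient:
 assumes "0 <= tht" "tht <= 1"
 shows "F s + (ft s + (if s = 0 then tht * l else 0)) * (t - s) <= F t"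
proof (cases "s = 0 & t > 0")
 case False
 have 1: "F s + ft s * (t - s) <= F t"
  using F_diff[of s t] F_diff[of t s] by (cases "s <= t") (auto simp: algebra_simps)
 have "(if s = 0 then tht * l else 0) * (t - s) <= 0" using False assms l(1) by (auto intro!: mult_nonneg_nonpos)
 then show ?thesis using 1 by (simp add: distrib_right)
next
 case True
 have F0: "F 0 = 0" by (simp add: F_def)
 have "((%r. l * (t - r)) \<longlongrightarrow> l * (t - 0)) (at_right 0)" by (intro tendsto_intros)
 moreover have "\<forall>\<^sub>F r in at_right 0. l * (t - r) <= F t"
 proof (rule eventually_mono[OF eventually_at_right_real[of 0 t]])
  fix r assume r: "r : {0<..<t}"
  have "l * (t - r) <= ft r * (t - r)" using r by (intro mult_right_mono l_le) auto
  also have "... <= F t - F r" using r by (intro F_diff) auto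
  also have "... <= F t" using F_diff(1)[of 0 r] r ft0[of 0] F0 by simp
  finally show "l * (t - r) <= F t" .
 qed (use True in simp)
 ultimately have "l * t <= F t" using tendsto_upperbound[of _ _ "at_right 0" "F t"] by force
 moreover have "tht * (l * t) <= 1 * (l * t)" using assms True l(1) by (intro mult_right_mono) auto
 ultimately show ?thesis using True ft0[of 0] F0 by simp
qed

lemma F_props: "mono F" "0 <= F s" "F s <= L * abs s"
proof -
 show m: "mono F"
 proof (rule monoI)
  fix s t :: real assume "s <= t"
  then have "0 <= ft s * (t - s)" using ft_nonneg by simp
  then show "F s <= F t" using F_diff(1)[OF \<open>s <= t\<close>] by linarith
 qed
 have F0: "F t = 0" if "t <= 0" for t using that by (cases "t = 0") (auto simp: F_def)
 show "0 <= F s" using monoD[OF m, of "min s 0" s] F0[of "min s 0"] by simp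
 show "F s <= L * abs s"
 proof (cases "s <= 0")
  case False
  then have "F s <= ft s * s" using F_diff(2)[of 0 s] F0[of 0] by simp
  also have "... <= L * s" using False ftL by (intro mult_right_mono) auto
  finally show ?thesis using False by simp
 qed (use F0[of s] ftL[of 0] ft0[of 0] in \<open>auto intro: mult_nonneg_nonpos\<close>)
qed

text \<open>Left continuity extends to 0 because \<open>ft\<close> vanishes on the closed half-line;
  the jump is seen only from the right.\<close>

lemma left_lim: assumes "!!n. r n > 0" "r ~~> 0" shows "(%n. ft (s - r n)) ~~> ft s"
proof (cases "s = 0")
 case True
 then have "ft (s - r n) = 0" for n using ft0[of "s - r n"] assms(1)[of n] by simp
 then show ?thesis using True ft0[of 0] by simp
next
 case False
 have "(%n. s - r n) ~~> s - 0" by (intro tendsto_intros assms)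
 then show ?thesis using isCont_tendsto_compose[OF ft_cont[OF False]] by simp
qed

lemma right_lim: assumes "!!n. r n > 0" "r ~~> 0" shows "(%n. ft (s + r n)) ~~> ft s + (if s = 0 then l else 0)"
proof (cases "s = 0")
 case True
 have "filterlim r (at_right 0) sequentially" using assms less_imp_neq[OF assms(1), THEN not_sym] by (simp add: filterlim_at)
 from filterlim_compose[OF l(2) this] show ?thesis using True ft0[of 0] by simp
next
 case False
 have "(%n. s + r n) ~~> s + 0" by (intro tendsto_intros assms)
 then show ?thesis using isCont_tendsto_compose[OF ft_cont[OF False]] False by simp
qed

end

context lake
begin

lemma dominated:
 assumes "!!n. z n : BM" "w : BM" "!!n x. abs (z n x) <= M"
  and "AEL x. x : D --> (%n. z n x) ~~> w x"
 shows "(%n. LI x. bet x * z n x) ~~> (LI x. bet x * w x)"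
proof (rule integral_dominated_convergence[where w="%x. bet x * M"])
 note [measurable] = assms(1,2)
 show "(%x. bet x * w x) : borel_measurable lborel" "!!n. (%x. bet x * z n x) : borel_measurable lborel" by measurable
 show "integ (%x. bet x * M)" using bet(4) by simp
 show "AEL x. (%n. bet x * z n x) ~~> bet x * w x" using assms(4)
 proof eventually_elim
  fix x assume "x : D --> (%n. z n x) ~~> w x"
  then show "(%n. bet x * z n x) ~~> bet x * w x" by (cases "x : D") (auto simp: bet_def intro: tendsto_mult_left)
 qed
 show "!!n. AEL x. norm (bet x * z n x) <= bet x * M"
  using assms(3) bet(1) by (intro AE_I2) (auto simp: abs_mult intro!: mult_left_mono)
qed

lemma bet_mono: "bb z ==> bb w ==> (!!x. z x <= w x) ==> (LI x. bet x * z x) <= (LI x. bet x * w x)"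
 by (intro integral_mono bb_int mult_left_mono bet)

lemma bet_zero:
 assumes "bb z" "!!x. 0 <= z x" "(LI x. bet x * z x) = 0"
 shows "AEL x. x : D --> z x = 0"
proof -
 have "AEL x. bet x * z x = 0"
  using assms(3) integral_nonneg_eq_0_iff_AE[OF bb_int[OF assms(1)]] assms(2) bet(1) by simp
 then show ?thesis by (rule eventually_mono) (use bpos in \<open>force simp: bet_def\<close>)
qed

lemma A_nonneg: "bb z ==> 0 <= A z z"
 by (simp add: A_eq) (intro sum_nonneg integral_nonneg_AE AE_I2 mult_nonneg_nonneg[OF bet(6) zero_le_square])

end

section \<open>Realising weak limits of vorticities\<close>

context lake
begin

text \<open>A weak limit is realised by midpoint combinations of the tails, which form an \<open>L^2\<close> Cauchy sequence by the
 parallelogram identity.\<close>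

lemma hull_limit:
 assumes y: "!!n. y n : BM" "!!n x. 0 <= y n x & y n x <= L" "!!n. (LI x. bet x * y n x) = m"
  and v: "v : BM" "!!x. abs (v x) <= c\<^sub>0" "!!n x. abs (tt (y n) x) <= c\<^sub>0" "AEL x. x : D --> (%n. tt (y n) x) ~~> v x"
  and g: "AEL x. x : D --> P x --> (%n. y n x) ~~> g x"
 obtains z where "z : BM" "!!x. 0 <= z x & z x <= L" "(LI x. bet x * z x) = m"
  "AEL x. x : D --> tt z x = v x" "AEL x. x : D --> P x --> z x = g x"
proof -
 have L: "L >= 0" using y(2)[of 0 0] by linarith
 define C where "C N = mhull (y ` {N..})" for N
 have C: "z : BM" "0 <= z x & z x <= L" if "z : C N" for z x N
 proof -
  have "z : BM" using that unfolding C_def by (induction rule: mhull.induct) (use y in auto)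
  then show "z : BM" .
  have "ALL x. 0 <= z x & z x <= L" using that unfolding C_def
  proof (induction rule: mhull.induct)
   case (mid z w)
   have "0 <= (a + c) / 2 & (a + c) / 2 <= L" if "0 <= a & a <= L" "0 <= c & c <= L" for a c using that by simp
   with mid(3,4) show ?case by blast
  qed (use y(2) in auto)
  then show "0 <= z x & z x <= L" by blast
 qed
 have bbI: "bb z" if "z : BM" "!!x. 0 <= z x & z x <= L" for z
  unfolding bb_def using that(1) by (intro conjI exI[of _ L] allI) (use that(2) in \<open>simp_all add: abs_le_iff order_trans[of "- _" 0]\<close>)
 have Cb: "bb z" if "z : C N" for z N using C[OF that] by (intro bbI) auto
 have yb: "bb (y n)" for n using y by (intro bbI) auto
 have half: "(LI x. bet x * ((z x + w x) / 2 * h x)) = ((LI x. bet x * (z x * h x)) + (LI x. bet x * (w x * h x))) / 2"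
  if "bb z" "bb w" "bb h" for z w h
 proof -
  have "(LI x. bet x * ((z x + w x) / 2 * h x)) = (LI x. (bet x * (z x * h x) + bet x * (w x * h x)) / 2)"
   by (intro lint_cong) (auto simp: field_simps)
  then show ?thesis using bb_int[OF bb_ops(3)[OF that(1,3)]] bb_int[OF bb_ops(3)[OF that(2,3)]] by simp
 qed
 have Cm: "C N <= C M" if "M <= N" for M N unfolding C_def using that by (auto intro: mhull_mono)
 define I where "I z = (LI x. bet x * (z x * z x))" for z
 \<comment> \<open>The infimum of the squared norm over the hulls of the tails increases with
   \<open>N\<close> and is bounded. Near-minimisers therefore form a Cauchy sequence: the midpoint
   of two of them still lies in the larger of the two hulls.\<close>
 define c where "c N = Inf (I ` C N)" for N
 have I0: "0 <= I z" for z unfolding I_def by (intro integral_nonneg_AE AE_I2 mult_nonneg_nonneg[OF bet(1) zero_le_square])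
 have bdd: "bdd_below (I ` C N)" for N by (rule bdd_belowI2[of _ 0]) (rule I0)
 have neC: "C N ~= {}" for N using mhull.base[of "y N" "y ` {N..}"] by (auto simp: C_def)
 have c_le: "z : C N ==> c N <= I z" for z N unfolding c_def by (rule cInf_lower[OF _ bdd]) auto
 have "EX z:C N. I z < c N + 1 / real (Suc N)" for N
  using cInf_lessD[of "I ` C N" "c N + 1 / real (Suc N)"] neC[of N] unfolding c_def[symmetric] by auto
 then obtain w where w: "!!N. w N : C N" "!!N. I (w N) < c N + 1 / real (Suc N)" by metis
 have c_mono: "c M <= c N" if "M <= N" for M N
  unfolding c_def using Cm[OF that] neC bdd by (intro cInf_superset_mono) auto
 have cU: "abs (c N) <= (LI x. bet x * (L * L))" for N
 proof -
  have "c N <= I (w N)" by (rule c_le[OF w(1)])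
  also have "... <= (LI x. bet x * (L * L))" unfolding I_def
   using C(2)[OF w(1)] L by (intro bet_mono bb_ops Cb[OF w(1)] mult_mono) auto
  finally have "c N <= (LI x. bet x * (L * L))" .
  moreover have "0 <= c N" unfolding c_def by (rule cInf_greatest) (use neC I0 in auto)
  ultimately show ?thesis by simp
 qed
 have "convergent c"
  by (rule Bseq_mono_convergent) (use cU c_mono in \<open>auto simp: Bseq_eq_bounded bounded_iff\<close>)
 then have Cc: "Cauchy c" by (rule convergent_Cauchy)
 have par: "I (%x. z x - w x) = 2 * I z + 2 * I w - 4 * I (%x. (z x + w x) / 2)" if "bb z" "bb w" for z w
 proof -
  have "I (%x. (z x + w x) / 2) = (LI x. (bet x * (z x * z x)) / 2 + (bet x * (w x * w x)) / 2 - (bet x * ((z x - w x) * (z x - w x))) / 4)"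
   unfolding I_def by (intro lint_cong) (auto simp: field_simps)
  also have "... = I z / 2 + I w / 2 - I (%x. z x - w x) / 4"
   unfolding I_def using that[THEN bb_ops(3)] bb_int bb_ops(2)[OF that] bb_ops(3) that by simp
  finally show ?thesis by simp
 qed
 have wI: "I (%x. w M x - w N x) <= 2 * (c M - c N) + 4 * (1 / real (Suc N))" if MN: "N <= M" for M N
 proof -
  have "(%x. (w M x + w N x) / 2) : C N" using Cm[OF MN] w(1) unfolding C_def by (blast intro: mhull.mid)
  from c_le[OF this] have "c N <= I (%x. (w M x + w N x) / 2)" .
  moreover have "1 / real (Suc M) <= 1 / real (Suc N)" using MN by (intro divide_left_mono) auto
  moreover have "2 * a + 2 * b - 4 * i <= 2 * (p - q) + 4 * k" if "q <= i" "j <= k" "a < p + j" "b < q + k" for a b i p q j k :: real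
   using that by simp
  ultimately show ?thesis unfolding par[OF Cb[OF w(1)] Cb[OF w(1)]] using w(2)[of M] w(2)[of N] by blast
 qed
 have wm[measurable]: "w n : BM" for n by (rule C(1)[OF w(1)])
 have ib: "integ (%x. bet x * w n x)" for n by (intro bb_int Cb[OF w(1)])
 have e: "(LI x. abs (bet x * w m x - bet x * w n x)) <= s * (LI x. bet x) + I (%x. w m x - w n x) / s" if s: "s > 0" for s m n
 proof -
  let ?h = "%x. w m x - w n x"
  have hb: "bb ?h" by (intro bb_ops Cb[OF w(1)])
  have "(LI x. abs (bet x * w m x - bet x * w n x)) = (LI x. bet x * abs (?h x))"
   using bet(1) by (simp add: abs_mult flip: right_diff_distrib)
  also have "... <= (LI x. bet x * (s + ?h x * ?h x * (1 / s)))"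
   using abs_le_sq[OF s] by (intro bet_mono bb_ops hb) simp
  also have "... = (LI x. s * bet x + (1 / s) * (bet x * (?h x * ?h x)))" by (intro lint_cong) (auto simp: algebra_simps)
  also have "... = s * (LI x. bet x) + I ?h / s" unfolding I_def using bet(4) bb_int[OF bb_ops(3)[OF hb hb]] by simp
  finally show ?thesis .
 qed
 have E: "EX N. ALL n>=N. ALL m>=n. I (%x. w m x - w n x) <= d" if d: "d > 0" for d
 proof -
  have d8: "d / 8 > 0" using d by simp
  obtain N1 where N1: "!!m n. m >= N1 ==> n >= N1 ==> dist (c m) (c n) < d / 8" using metric_CauchyD[OF Cc d8] by auto
  obtain N2 where N2: "!!n. n >= N2 ==> 1 / real (Suc n) < d / 8" using eventually_small[OF d8] unfolding eventually_sequentially by auto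
  have a: "i <= e * 8" if "i <= 2 * (p - q) + 4 * k" "abs (p - q) < e" "k < e" for i p q k e :: real using that by (smt (verit))
  have "I (%x. w m x - w n x) <= d" if mn: "max N1 N2 <= n" "n <= m" for m n
   using a[OF wI[OF mn(2)] N1[of m n, unfolded dist_real_def] N2[of n]] mn by simp
  then show ?thesis by blast
 qed
 obtain r h where r: "strict_mono r" "integ h" "AEL x. (%n. bet x * w (r n) x) ~~> h x"
 proof (rule L1_Cauchy_limit[of "%n x. bet x * w n x", OF ib e E])
  fix r h assume "strict_mono r" "integ h" "AEL x. (%n. bet x * w (r n) x) ~~> h x"
  then show thesis by (rule that)
 qed
 note [measurable] = r(2)[THEN borel_measurable_integrable]
 \<comment> \<open>The L^1 limit is that of \<open>bet\<close> times the combinations; dividing by b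
   and clipping to [0, L] gives a function with the bounds at every point.\<close>
 define z where "z x = max 0 (min L (gam x * h x))" for x
 have zm: "z : BM" unfolding z_def[abs_def] by measurable
 have zb: "0 <= z x & z x <= L" for x using L by (auto simp: z_def)
 have zbb: "bb z" by (rule bbI[OF zm zb])
 have lim: "AEL x. x : D --> (%n. w (r n) x) ~~> z x" using r(3)
 proof (rule eventually_mono, intro impI)
  fix x assume "(%n. bet x * w (r n) x) ~~> h x" "x : D"
  then have "(%n. gam x * (bet x * w (r n) x)) ~~> gam x * h x" by (intro tendsto_intros) auto
  moreover have "gam x * (bet x * t) = t" for t using bpos[OF \<open>x : D\<close>] \<open>x : D\<close> by (simp add: gam_def bet_def)
  ultimately have l: "(%n. w (r n) x) ~~> gam x * h x" by simp
  then have "0 <= gam x * h x" "gam x * h x <= L"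
   using C(2)[OF w(1)] by (auto intro: LIMSEQ_le_const[OF l] LIMSEQ_le_const2[OF l])
  then show "(%n. w (r n) x) ~~> z x" using l by (simp add: z_def)
 qed
 have rn: "w (r n) : C N" if "N <= n" for n N using w(1)[of "r n"] Cm[of N "r n"] seq_suble[OF r(1), of n] that by auto
 have abs: "abs (w n x) <= L" for n x using C(2)[OF w(1), of n x] by simp
 \<comment> \<open>By symmetry A eta y is the integral of y K eta, which is affine in y. Bounds
   valid on a tail of \<open>y\<close> therefore hold on its hull, and the combinations inherit the
   limit.\<close>
 have key: "A eta z = (LI x. bet x * (eta x * v x))" if eta: "bb eta" for eta
 proof -
  note t = tt(7)[OF eta]
  obtain B where B: "!!x. abs (tt eta x) <= B" using t by (auto simp: bb_def)
  obtain B' where B': "!!x. abs (eta x) <= B'" using eta by (auto simp: bb_def)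
  have [measurable]: "tt eta : BM" "eta : BM" using t eta by (auto simp: bb_def)
  have B0: "B >= 0" "B' >= 0" using B[of 0] B'[of 0] by linarith+
  have "(%n. LI x. bet x * (w (r n) x * tt eta x)) ~~> (LI x. bet x * (z x * tt eta x))"
  proof (rule dominated[where M="L * B"])
   show "abs (w (r n) x * tt eta x) <= L * B" for n x unfolding abs_mult using abs B L by (intro mult_mono) auto
   show "AEL x. x : D --> (%n. w (r n) x * tt eta x) ~~> z x * tt eta x"
   using lim by (rule eventually_mono) (auto intro: tendsto_mult_right)
  qed (use zm in measurable)
  moreover have "(%n. LI x. bet x * (w (r n) x * tt eta x)) ~~> (LI x. bet x * (eta x * v x))"
  proof (rule LIMSEQ_I)
   fix d :: real assume d: "d > 0"
   let ?c = "LI x. bet x * (eta x * v x)"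
   have "(%n. LI x. bet x * (eta x * tt (y n) x)) ~~> ?c"
   proof (rule dominated[where M="B' * c\<^sub>0"])
   show "abs (eta x * tt (y n) x) <= B' * c\<^sub>0" for n x unfolding abs_mult using v(3)[of n x] B' B0 by (intro mult_mono) auto
   show "AEL x. x : D --> (%n. eta x * tt (y n) x) ~~> eta x * v x"
   using v(4) by (rule eventually_mono) (auto intro: tendsto_mult_left)
   qed (use v(1) tt(1)[OF yb] in measurable)
   then have "(%n. LI x. bet x * (y n x * tt eta x)) ~~> ?c" using A_sym[OF eta yb] unfolding A_def by simp
   then obtain N where N: "!!n. n >= N ==> abs ((LI x. bet x * (y n x * tt eta x)) - ?c) < d/2"
   using LIMSEQ_D[of "%n. LI x. bet x * (y n x * tt eta x)" ?c "d/2"] d unfolding real_norm_def by auto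
   have "abs ((LI x. bet x * (w (r n) x * tt eta x)) - ?c) <= d/2" if n: "n >= N" for n
   proof -
   have "?c - d/2 <= (LI x. bet x * (w (r n) x * tt eta x)) & (LI x. bet x * (w (r n) x * tt eta x)) <= ?c + d/2"
   proof (rule mhull_affine[OF rn[OF n, unfolded C_def], of "%z. LI x. bet x * (z x * tt eta x)"])
   fix z assume "z : y ` {N..}"
   then obtain n where n: "n >= N" "z = y n" by auto
   show "?c - d/2 <= (LI x. bet x * (z x * tt eta x)) & (LI x. bet x * (z x * tt eta x)) <= ?c + d/2"
   using N[OF n(1)] unfolding n(2) by (simp add: abs_if split: if_splits)
   qed (use half Cb t in \<open>auto simp: C_def\<close>)
   then show ?thesis by linarith
   qed
   then show "EX N. ALL n>=N. norm ((LI x. bet x * (w (r n) x * tt eta x)) - ?c) < d" using d by (force simp: real_norm_def)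
  qed
  ultimately have "(LI x. bet x * (z x * tt eta x)) = (LI x. bet x * (eta x * v x))" by (rule LIMSEQ_unique)
  then show ?thesis using A_sym[OF eta zbb] by (simp add: A_def)
 qed
 have vb: "bb v" using v(1,2) by (auto simp: bb_def)
 have tzb: "bb (tt z)" by (rule tt(7)[OF zbb])
 have eq: "AEL x. x : D --> tt z x = v x"
 proof -
  \<comment> \<open>The difference of the two candidates is itself a bounded Borel function, so it
    may be inserted as eta and has norm 0.\<close>
  let ?eta = "%x. tt z x - v x"
  have eta: "bb ?eta" by (intro bb_ops tzb vb)
  have "(LI x. bet x * (?eta x * ?eta x)) = (LI x. bet x * (?eta x * tt z x) - bet x * (?eta x * v x))"
   by (intro lint_cong) (auto simp: algebra_simps)
  also have "... = A ?eta z - (LI x. bet x * (?eta x * v x))" unfolding A_def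
   using bb_int[OF bb_ops(3)[OF eta tzb]] bb_int[OF bb_ops(3)[OF eta vb]] by simp
  finally have "(LI x. bet x * (?eta x * ?eta x)) = 0" using key[OF eta] by simp
  from bet_zero[OF bb_ops(3)[OF eta eta] zero_le_square this] show ?thesis by (rule eventually_mono) auto
 qed
 have mass: "(LI x. bet x * z x) = m"
 proof (rule LIMSEQ_unique)
  show "(%n. LI x. bet x * w (r n) x) ~~> (LI x. bet x * z x)" by (rule dominated[OF wm zm abs lim])
  have "(LI x. bet x * w n x) = m" for n
   using mhull_affine[OF w(1)[of n, unfolded C_def], of "%z. LI x. bet x * z x" m m] y(3) half[OF Cb Cb bb_ops(4)[of 1]]
   unfolding C_def by force
  then show "(%n. LI x. bet x * w (r n) x) ~~> m" by simp
 qed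
 have "AEL x. x : D --> P x --> z x = g x" using lim g
 proof eventually_elim
  fix x assume 1: "x : D --> (%n. w (r n) x) ~~> z x" and 2: "x : D --> P x --> (%n. y n x) ~~> g x"
  show "x : D --> P x --> z x = g x"
  proof (intro impI)
   assume x: "x : D" "P x"
   have "(%n. w (r n) x) ~~> g x"
   proof (rule LIMSEQ_I)
   fix d :: real assume d: "d > 0"
   then obtain N where N: "!!n. n >= N ==> abs (y n x - g x) < d/2"
   using LIMSEQ_D[OF 2[rule_format, OF x], of "d/2"] by auto
   have "abs (w (r n) x - g x) <= d/2" if n: "n >= N" for n
   proof -
   have "g x - d/2 <= w (r n) x & w (r n) x <= g x + d/2"
   proof (rule mhull_affine[OF rn[OF n, unfolded C_def], of "%z. z x"])
   fix z assume "z : y ` {N..}"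
   then obtain n where n: "n >= N" "z = y n" by auto
   show "g x - d/2 <= z x & z x <= g x + d/2" using N[OF n(1)] unfolding n(2) by (simp add: abs_if split: if_splits)
   qed simp
   then show ?thesis by linarith
   qed
   then show "EX N. ALL n>=N. norm (w (r n) x - g x) < d" using d by (force simp: real_norm_def)
   qed
   then show "z x = g x" using 1 x LIMSEQ_unique by blast
  qed
 qed
 then show ?thesis by (rule that[OF zm zb mass eq])
qed

end

section \<open>The iteration and its energy\<close>

locale lake_profile = lake D b G R Bb BR d0 + profile ft L l
 for D b G R Bb BR d0 ft L l +
 fixes q :: "plane => real" and Q lam m :: real
 assumes q: "Ck_on 2 D q" "!!x. x : D ==> divergence (%y. (1 / b y) *R grad q y) x = 0" "!!x. x : D ==> abs (q x) <= Q"
  and lam: "lam > 0" and m: "0 < m" "m < lam * ft 1 * (LI x. bet x)"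
begin

lemma bb_ft: "bb a ==> bb (%x. ft (a x + k))"
 unfolding bb_def using ft_nonneg ftL measurable_compose[OF _ ft_meas, of "%x. a x + k"]
 by (auto simp: abs_of_nonneg intro!: exI[of _ L])

text \<open>\<open>lam\<close> times a subgradient of \<open>F\<close> at
  \<open>a x - \<mu>\<close>, the same fraction \<open>tht\<close> of the jump being taken on the
  whole level set.\<close>

definition stp :: "(plane => real) => real => real => plane => real" where
 "stp a \<mu> tht x = lam * (ft (a x - \<mu>) + (if a x - \<mu> = 0 then tht * l else 0))"

text \<open>The multiplier is the largest level at which the superlevel sets carry at least the mass \<open>m\<close>; the jump of
 the profile at \<open>0\<close> is used only partially on the level set itself.\<close>

lemma multiplier_exists:
 assumes a: "bb a" "!!x. abs (a x) <= B"
 obtains \<mu> tht where "abs \<mu> <= B + 1" "0 <= tht" "tht <= 1" "(LI x. bet x * stp a \<mu> tht x) = m"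
proof -
 have am[measurable]: "a : BM" using a by (simp add: bb_def)
 have bf: "bb (%x. ft (a x - \<mu>))" for \<mu> using bb_ft[OF a(1), of "- \<mu>"] by simp
 define M where "M \<mu> = (LI x. bet x * ft (a x - \<mu>))" for \<mu>
 define k where "k = m / lam"
 have k: "0 < k" "k < ft 1 * (LI x. bet x)" using m lam by (auto simp: k_def field_simps)
 have M_mono: "M \<mu>' <= M \<mu>" if "\<mu> <= \<mu>'" for \<mu> \<mu>' unfolding M_def by (intro bet_mono bf monoD[OF ft_mono]) (use that in simp)
 define S where "S = {\<mu>. M \<mu> <= k}"
 have B: "B >= 0" using a(2)[of 0] by linarith
 have "M B = 0"
 proof -
  have "ft (a x - B) = 0" for x using a(2)[of x] by (intro ft0) simp
  then show ?thesis by (simp add: M_def)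
 qed
 then have BS: "B : S" using k by (simp add: S_def)
 \<comment> \<open>For a level below -B - 1 the argument of \<open>ft\<close> exceeds 1 everywhere,
   and the assumed upper bound on m is contradicted. This keeps the multiplier bounded.\<close>
 have lo: "- B - 1 <= \<mu>" if "\<mu> : S" for \<mu>
 proof (rule ccontr)
  assume "~ - B - 1 <= \<mu>"
  then have "ft 1 <= ft (a x - \<mu>)" for x using a(2)[of x] by (intro monoD[OF ft_mono]) linarith
  then have "(LI x. bet x * ft 1) <= M \<mu>" unfolding M_def by (intro bet_mono bf bb_ops)
  then show False using that k by (simp add: S_def mult.commute)
 qed
 define \<mu> where "\<mu> = Inf S"
 have bdd: "bdd_below S" using lo by (rule bdd_belowI)
 have \<mu>: "- B - 1 <= \<mu>" "\<mu> <= B" unfolding \<mu>_def using BS lo by (auto intro: cInf_greatest cInf_lower[OF _ bdd])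
 define r where "r n = 1 / real (Suc n)" for n
 have r: "r n > 0" "r ~~> 0" for n unfolding r_def[abs_def] by (simp, rule LIMSEQ_Suc[OF lim_1_over_n])
 define J where "J = (LI x. bet x * (if a x - \<mu> = 0 then l else 0))"
 have bJ: "bb (%x. if a x - \<mu> = 0 then l else 0)"
 proof -
  have "(%x. if a x - \<mu> = 0 then l else 0) : BM" by measurable
  then show ?thesis unfolding bb_def using l(1) by (intro conjI exI[of _ l] allI) simp_all
 qed
 have ftb: "abs (ft s) <= L" for s using ft_nonneg[of s] ftL[of s] by simp
 \<comment> \<open>Left continuity of \<open>ft\<close> makes \<open>M\<close> right continuous, so
   the infimum belongs to \<open>S\<close>.\<close>
 have 1: "M \<mu> <= k"
 proof (rule LIMSEQ_le_const2)
  show "(%n. LI x. bet x * ft (a x - \<mu> - r n)) ~~> M \<mu>" unfolding M_def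
   by (rule dominated[where M=L]) (use ftb left_lim[OF r] in \<open>auto intro!: measurable_compose[OF _ ft_meas]\<close>)
  have "(LI x. bet x * ft (a x - \<mu> - r n)) <= k" for n
  proof -
   obtain s where "s : S" "s < \<mu> + r n" using cInf_lessD[of S "\<mu> + r n"] BS r(1)[of n] by (auto simp: \<mu>_def)
   then have "M (\<mu> + r n) <= k" using M_mono[of s "\<mu> + r n"] by (simp add: S_def)
   then show ?thesis by (simp add: M_def diff_diff_eq)
  qed
  then show "EX N. ALL n>=N. (LI x. bet x * ft (a x - \<mu> - r n)) <= k" by blast
 qed
 have MJ: "(LI x. bet x * (ft (a x - \<mu>) + (if a x - \<mu> = 0 then l else 0))) = M \<mu> + J"
  unfolding distrib_left M_def J_def by (rule lint_add[OF bb_int[OF bf] bb_int[OF bJ]])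
 \<comment> \<open>Levels just below the infimum are outside \<open>S\<close>; along them
   \<open>M\<close> tends to its value plus \<open>J\<close>, the part of the jump carried by the
   level set.\<close>
 have 2: "k <= M \<mu> + J"
 proof (rule LIMSEQ_le_const)
  show "(%n. LI x. bet x * ft (a x - \<mu> + r n)) ~~> M \<mu> + J" unfolding MJ[symmetric]
  proof (rule dominated[where M=L])
   show "(%x. ft (a x - \<mu>) + (if a x - \<mu> = 0 then l else 0)) : BM"
   using bf bJ unfolding bb_def by (intro borel_measurable_add) auto
   show "AEL x. x : D --> (%n. ft (a x - \<mu> + r n)) ~~> ft (a x - \<mu>) + (if a x - \<mu> = 0 then l else 0)"
   by (intro AE_I2 impI right_lim[OF r])
  qed (use ftb in \<open>auto intro!: measurable_compose[OF _ ft_meas]\<close>)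
  have "k <= (LI x. bet x * ft (a x - \<mu> + r n))" for n
  proof -
   have "\<mu> - r n ~: S" using cInf_lower[OF _ bdd, of "\<mu> - r n"] r(1)[of n] by (auto simp: \<mu>_def)
   then show ?thesis by (simp add: S_def M_def algebra_simps)
  qed
  then show "EX N. ALL n>=N. k <= (LI x. bet x * ft (a x - \<mu> + r n))" by blast
 qed
 \<comment> \<open>If \<open>J\<close> is 0 the two inequalities already give equality, and 0 serves
   as a default.\<close>
 define tht where "tht = (if J = 0 then 0 else (k - M \<mu>) / J)"
 have J0: "0 <= J" unfolding J_def using l(1) by (intro integral_nonneg_AE AE_I2 mult_nonneg_nonneg bet) auto
 have tht: "0 <= tht" "tht <= 1" "M \<mu> + tht * J = k" using 1 2 J0 by (auto simp: tht_def field_simps)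
 show ?thesis
 proof (rule that[of \<mu> tht])
  have "(LI x. bet x * stp a \<mu> tht x) = (LI x. lam * (bet x * ft (a x - \<mu>)) + (lam * tht) * (bet x * (if a x - \<mu> = 0 then l else 0)))"
   by (intro lint_cong) (auto simp: stp_def algebra_simps)
  also have "... = lam * (M \<mu> + tht * J)" unfolding M_def J_def using bb_int[OF bf] bb_int[OF bJ] by (simp add: algebra_simps)
  also have "... = m" unfolding tht(3) k_def using lam by simp
  finally show "(LI x. bet x * stp a \<mu> tht x) = m" .
 qed (use \<mu> tht B in auto)
qed

definition adm :: "(plane => real) => bool" where
 "adm z \<longleftrightarrow> z : BM & (ALL x. 0 <= z x & z x <= lam * L)"

text \<open>The bound of \<open>T_bound\<close> at eps = d0 for the largest admissible vorticity,
  the constant lam L.\<close>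

definition c0 where "c0 = Bb / (2 * pi) * ((ln (d0 / d0) + 1) * (LI y. bet y * (lam * L)) + Bb * (lam * L) * (d0^2 * c1)) + BR * (LI y. bet y * (lam * L))"

lemma adm_bb: "adm z ==> bb z"
 unfolding adm_def bb_def by (auto simp: abs_of_nonneg)

lemma adm_T:
 assumes "adm z"
 shows "x : D ==> abs (T z x) <= c0" "abs (tt z x) <= c0"
proof -
 have z: "z : BM" "!!x. abs (z x) <= lam * L" using assms by (auto simp: adm_def)
 have le: "(LI y. bet y * abs (z y)) <= (LI y. bet y * (lam * L))" using z(2) by (intro bet_mono bb_ops adm_bb assms)
 show 1: "abs (T z x) <= c0" if "x : D" for x
 proof (rule order_trans[OF T_bound[OF z d0(1) order_refl that]])
  show "Bb / (2 * pi) * ((ln (d0 / d0) + 1) * (LI y. bet y * abs (z y)) + Bb * (lam * L) * (d0^2 * c1)) + BR * (LI y. bet y * abs (z y)) <= c0"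
   unfolding c0_def using le Bb_pos BR_nonneg d0(1) by (intro add_mono mult_left_mono order_refl) auto
 qed
 show "abs (tt z x) <= c0" by (rule tt(3)[OF adm_bb[OF assms] 1])
qed

definition av where "av z x = tt z x + ind D x * q x"

lemma q_meas: "(%x. ind D x * q x) : BM"
 by (rule loc_LallD(1)[OF loc_Lall_cont[OF D Ck_on_imp_continuous_on[OF q(1)]]])

lemma Q_nonneg: "Q >= 0" using ne q(3) by (meson abs_ge_zero ex_in_conv order_trans)

lemma av: assumes "adm z" shows "bb (av z)" "abs (av z x) <= c0 + Q"
proof -
 show b: "abs (av z x) <= c0 + Q" for x
  using adm_T(2)[OF assms, of x] q(3)[of x] Q_nonneg by (cases "x : D") (auto simp: av_def)
 have "av z : BM" unfolding av_def[abs_def] using tt(1)[OF adm_bb[OF assms]] q_meas by (rule borel_measurable_add)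
 then show "bb (av z)" using b by (auto simp: bb_def)
qed

lemma step_exists:
 assumes "adm z"
 shows "EX p. abs (fst p) <= c0 + Q + 1 & 0 <= snd p & snd p <= 1 & (LI x. bet x * stp (av z) (fst p) (snd p) x) = m"
 by (rule multiplier_exists[OF av[OF assms]]) (auto intro!: exI)

definition stpar where "stpar z = (SOME p. abs (fst p) <= c0 + Q + 1 & 0 <= snd p & snd p <= 1 & (LI x. bet x * stp (av z) (fst p) (snd p) x) = m)"
definition mu where "mu z = fst (stpar z)"
definition th where "th z = snd (stpar z)"
definition nx where "nx z = stp (av z) (mu z) (th z)"

lemma nx:
 assumes z: "adm z"
 shows "abs (mu z) <= c0 + Q + 1" "0 <= th z" "th z <= 1" "(LI x. bet x * nx z x) = m" "adm (nx z)"
proof -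
 show p: "abs (mu z) <= c0 + Q + 1" "0 <= th z" "th z <= 1" "(LI x. bet x * nx z x) = m"
  using someI_ex[OF step_exists[OF z]] unfolding mu_def th_def nx_def stpar_def by auto
 note [measurable] = ft_meas
 have [measurable]: "av z : BM" using av[OF z] by (simp add: bb_def)
 have "0 <= ft s + (if s = 0 then th z * l else 0) & ft s + (if s = 0 then th z * l else 0) <= L" for s
 proof (cases "s = 0")
  case True
  have "th z * l <= 1 * l" using p l(1) by (intro mult_right_mono) auto
  then show ?thesis using True ft0[of 0] lL p l(1) by simp
 qed (use ft_nonneg ftL in auto)
 moreover have "0 <= t & t <= L ==> 0 <= lam * t & lam * t <= lam * L" for t using lam by simp
 ultimately have "0 <= nx z x & nx z x <= lam * L" for x unfolding nx_def stp_def by blast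
 moreover have "nx z : BM" unfolding nx_def stp_def[abs_def] by measurable
 ultimately show "adm (nx z)" by (simp add: adm_def)
qed

definition en where "en z = - A z z / 2 + lam * (LI x. bet x * F (av z x - mu z)) + mu z * m"

lemma bb_F: assumes "adm z" shows "bb (%x. F (av z x - mu z))" "F (av z x - mu z) <= L * (2 * (c0 + Q) + 1)"
proof -
 have L: "L >= 0" using lL l(1) by simp
 show b: "F (av z x - mu z) <= L * (2 * (c0 + Q) + 1)" for x
 proof (rule order_trans[OF F_props(3)])
  show "L * abs (av z x - mu z) <= L * (2 * (c0 + Q) + 1)" using av(2)[OF assms, of x] nx(1)[OF assms] L by (intro mult_left_mono) auto
 qed
 have "(%x. F (av z x - mu z)) : BM"
  using av(1)[OF assms] by (intro measurable_compose[OF _ borel_measurable_mono[OF F_props(1)]]) (auto simp: bb_def)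
 then show "bb (%x. F (av z x - mu z))" using b F_props(2) by (auto simp: bb_def abs_of_nonneg)
qed

text \<open>\<open>nx z\<close> is lam times a subgradient of \<open>F\<close> at the old argument,
  so convexity compares the two integrals of \<open>F\<close>. The change of multiplier is paired
  with \<open>nx z\<close>, whose mass is m, and cancels against the last term of \<open>en\<close>;
  the remaining quadratic terms form a square.\<close>

lemma energy_step:
 assumes z: "adm z"
 shows "en z + (A z z - 2 * A z (nx z) + A (nx z) (nx z)) / 2 <= en (nx z)"
proof -
 let ?z = "nx z"
 note z' = nx(5)[OF z]
 note b = adm_bb[OF z] adm_bb[OF z']
 have pt: "lam * F (av z x - mu z) + (?z x * tt ?z x - ?z x * tt z x - (mu ?z - mu z) * ?z x) <= lam * F (av ?z x - mu ?z)" for x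
 proof -
  let ?s = "av z x - mu z" and ?t = "av ?z x - mu ?z"
  have "lam * (F ?s + (ft ?s + (if ?s = 0 then th z * l else 0)) * (?t - ?s)) <= lam * F ?t"
   using lam by (intro mult_left_mono F_subgradient nx z) auto
  moreover have "?z x = lam * (ft ?s + (if ?s = 0 then th z * l else 0))" by (simp add: nx_def stp_def)
  moreover have "?t - ?s = tt ?z x - tt z x - (mu ?z - mu z)" by (simp add: av_def)
  ultimately show ?thesis by (simp only: distrib_left mult.assoc[symmetric]) (simp add: algebra_simps)
 qed
 have bl: "bb (%x. lam * F (av z x - mu z) + (?z x * tt ?z x - ?z x * tt z x - (mu ?z - mu z) * ?z x))"
  by (intro bb_ops bb_F tt b z)
 have br: "bb (%x. lam * F (av ?z x - mu ?z))" by (intro bb_ops bb_F z')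
 have "(LI x. bet x * (lam * F (av z x - mu z) + (?z x * tt ?z x - ?z x * tt z x - (mu ?z - mu z) * ?z x))) <= (LI x. bet x * (lam * F (av ?z x - mu ?z)))"
  by (rule bet_mono[OF bl br pt])
 also have "(LI x. bet x * (lam * F (av z x - mu z) + (?z x * tt ?z x - ?z x * tt z x - (mu ?z - mu z) * ?z x)))
  = (LI x. lam * (bet x * F (av z x - mu z)) + (bet x * (?z x * tt ?z x) - bet x * (?z x * tt z x) - (mu ?z - mu z) * (bet x * ?z x)))"
  by (intro lint_cong) (auto simp: algebra_simps)
 also have "... = lam * (LI x. bet x * F (av z x - mu z)) + (A ?z ?z - A ?z z - (mu ?z - mu z) * m)"
  using bb_int[OF bb_F(1)[OF z]] bb_int[OF bb_ops(3)[OF b(2) tt(7)[OF b(2)]]] bb_int[OF bb_ops(3)[OF b(2) tt(7)[OF b(1)]]] bb_int[OF b(2)] nx(4)[OF z]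
  by (simp add: A_def)
 also have "(LI x. bet x * (lam * F (av ?z x - mu ?z))) = lam * (LI x. bet x * F (av ?z x - mu ?z))"
  by (simp add: mult.left_commute)
 finally show ?thesis unfolding en_def using A_sym[OF b] by (simp add: algebra_simps add_divide_distrib diff_divide_distrib)
qed

lemma energy_bound: assumes z: "adm z" shows "en z <= lam * (LI x. bet x * (L * (2 * (c0 + Q) + 1))) + (c0 + Q + 1) * m"
proof -
 have "lam * (LI x. bet x * F (av z x - mu z)) <= lam * (LI x. bet x * (L * (2 * (c0 + Q) + 1)))"
  using lam by (intro mult_left_mono bet_mono bb_F z bb_ops) auto
 moreover have "mu z * m <= (c0 + Q + 1) * m" using nx(1)[OF z] m(1) by (intro mult_right_mono) auto
 moreover have "0 <= A z z" by (rule A_nonneg[OF adm_bb[OF z]])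
 ultimately show ?thesis unfolding en_def by linarith
qed

definition Zs where "Zs n = (nx ^^ n) (%x. 0)"

lemma Zs: "adm (Zs n)" "Zs (Suc n) = nx (Zs n)"
proof -
 have "0 <= lam * L" using lam lL l(1) by simp
 then have "adm (%x. 0)" by (simp add: adm_def)
 then show "adm (Zs n)" by (induction n) (auto simp: Zs_def nx)
qed (simp add: Zs_def)

lemma increments_vanish: "(%n. A (Zs n) (Zs n) - 2 * A (Zs n) (Zs (Suc n)) + A (Zs (Suc n)) (Zs (Suc n))) ~~> 0"
proof -
 let ?S = "%n. A (Zs n) (Zs n) - 2 * A (Zs n) (Zs (Suc n)) + A (Zs (Suc n)) (Zs (Suc n))"
 have b: "bb (Zs n)" for n by (rule adm_bb[OF Zs(1)])
 have S0: "0 <= ?S n" for n by (rule A_quad(1)[OF b b b zero_less_one])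
 have st: "en (Zs n) + ?S n / 2 <= en (Zs (Suc n))" for n using energy_step[OF Zs(1)] by (simp add: Zs(2))
 have inc: "incseq (%n. en (Zs n))"
 proof (rule incseq_SucI)
  fix n show "en (Zs n) <= en (Zs (Suc n))" by (rule order_trans[OF _ st[of n]]) (use S0[of n] in simp)
 qed
 obtain E where E: "(%n. en (Zs n)) ~~> E" by (rule incseq_convergent[OF inc, of "lam * (LI x. bet x * (L * (2 * (c0 + Q) + 1))) + (c0 + Q + 1) * m"]) (use energy_bound[OF Zs(1)] in auto)
 have "(%n. 2 * (en (Zs (Suc n)) - en (Zs n))) ~~> 2 * (E - E)" by (intro tendsto_intros LIMSEQ_Suc E)
 then have l: "(%n. 2 * (en (Zs (Suc n)) - en (Zs n))) ~~> 0" by simp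
 show ?thesis
 proof (rule tendsto_sandwich[OF _ _ tendsto_const l])
  show "\<forall>\<^sub>F n in sequentially. 0 <= ?S n" using S0 by simp
  have "?S n <= 2 * (en (Zs (Suc n)) - en (Zs n))" for n using st[of n] by argo
  then show "\<forall>\<^sub>F n in sequentially. ?S n <= 2 * (en (Zs (Suc n)) - en (Zs n))" by simp
 qed
qed

text \<open>One M for all admissible z is what \<open>wsol_compact\<close> needs to treat the
  iterates as a bounded family.\<close>

lemma wsol_adm: obtains M where "!!z. adm z ==> wsol D b M (tt z) (UU z) z"
proof (rule that[of "max (lam * L) (max c0 (Bb * (LI x. bet x * (lam * L * c0))))"])
 fix z assume z: "adm z"
 note b = adm_bb[OF z]
 have "A z z <= (LI x. bet x * (lam * L * c0))"
  unfolding A_def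
 proof (intro bet_mono bb_ops b tt(7))
  fix x
  have zL: "abs (z x) <= lam * L" "0 <= lam * L" using z lam lL l(1) by (auto simp: adm_def)
  have "z x * tt z x <= abs (z x) * abs (tt z x)" unfolding abs_mult[symmetric] by (rule abs_ge_self)
  also have "... <= lam * L * c0" by (rule mult_mono[OF zL(1) adm_T(2)[OF z] zL(2) abs_ge_zero])
  finally show "z x * tt z x <= lam * L * c0" .
 qed
 then have "Bb * A z z <= Bb * (LI x. bet x * (lam * L * c0))" using Bb_pos by (intro mult_left_mono) auto
 moreover have "abs (z x) <= lam * L" for x using z by (auto simp: adm_def)
 ultimately show "wsol D b (max (lam * L) (max c0 (Bb * (LI x. bet x * (lam * L * c0))))) (tt z) (UU z) z"
  using adm_T(1)[OF z] by (intro wsol_tt[OF b]) (simp_all only: le_max_iff_disj simp_thms)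
qed

end

section \<open>Fixed points of the iteration\<close>

lemma limit_version:
 fixes f :: "nat => plane => real"
 assumes f: "!!n. f n : BM" "!!n x. abs (f n x) <= c" "AEL x. x : D --> convergent (%n. f n x)"
 obtains v where "v : BM" "!!x. abs (v x) <= c" "AEL x. x : D --> (%n. f n x) ~~> v x"
proof
 note [measurable] = f(1)
 let ?v = "%x. max (- c) (min c (lim (%n. f n x)))"
 show "?v : BM" by measurable
 have "c >= 0" using f(2)[of 0 0] by linarith
 then show "abs (?v x) <= c" for x by auto
 show "AEL x. x : D --> (%n. f n x) ~~> ?v x" using f(3)
 proof (rule eventually_mono, intro impI)
  fix x assume "x : D --> convergent (%n. f n x)" "x : D"
  then have l: "(%n. f n x) ~~> lim (%n. f n x)" by (simp add: convergent_LIMSEQ_iff)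
  have "abs (lim (%n. f n x)) <= c" by (rule LIMSEQ_le_const2[OF tendsto_rabs[OF l]]) (use f(2) in blast)
  then show "(%n. f n x) ~~> ?v x" using l by simp
 qed
qed

context lake_profile
begin

lemma existence:
 obtains z \<mu> where "adm z" "(LI x. bet x * z x) = m" "AEL x. x : D --> z x = lam * ft (T z x + q x - \<mu>)"
  "!!p. p > 1 ==> (%x. T z x + q x - \<mu>) : W2p_loc D p" "is_L_ae D b (%x. T z x + q x - \<mu>) z"
proof -
 obtain M where M: "!!z. adm z ==> wsol D b M (tt z) (UU z) z" by (rule wsol_adm) (rule that)
 have bZ: "bb (Zs n)" for n by (rule adm_bb[OF Zs(1)])
 \<comment> \<open>The iterates and their successors have to converge along the same indices; the
   two limits \<open>v\<close> and \<open>v'\<close> are identified afterwards.\<close>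
 obtain k1 where k1: "strict_mono k1" "AEL x. x : D --> convergent (%n. tt (Zs (k1 n)) x)"
  by (rule wsol_compact[OF M[OF Zs(1)]]) (rule that)
 obtain k2 where k2: "strict_mono k2" "AEL x. x : D --> convergent (%n. tt (Zs (Suc (k1 (k2 n)))) x)"
  by (rule wsol_compact[of M "%n. tt (Zs (Suc (k1 n)))", OF M[OF Zs(1)]]) (rule that)
 have "bounded (range (%n. mu (Zs (k1 (k2 n)))))" using nx(1)[OF Zs(1)] by (auto simp: bounded_iff)
 from bounded_imp_convergent_subsequence[OF this] obtain \<mu> k3
  where k3: "strict_mono k3" "(%n. mu (Zs (k1 (k2 (k3 n))))) ~~> \<mu>" by (auto simp: o_def)
 define k where "k n = k1 (k2 (k3 n))" for n
 have k23: "strict_mono (%n. k2 (k3 n))" using strict_mono_compose[OF k2(1) k3(1)] .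
 have k: "strict_mono k" using strict_mono_compose[OF k1(1) k23] by (simp add: k_def[abs_def])
 have mul: "(%n. mu (Zs (k n))) ~~> \<mu>" using k3(2) by (simp add: k_def)
 have sub: "convergent f ==> strict_mono j ==> convergent (%n. f (j n))" for f :: "nat => real" and j :: "nat => nat"
  using convergent_subseq_convergent[of f j] by (simp add: o_def)
 have cv1: "AEL x. x : D --> convergent (%n. tt (Zs (k n)) x)"
  using k1(2) by (rule eventually_mono) (use sub[OF _ k23] in \<open>auto simp: k_def\<close>)
 have cv2: "AEL x. x : D --> convergent (%n. tt (Zs (Suc (k n))) x)"
  using k2(2) by (rule eventually_mono) (use sub[OF _ k3(1)] in \<open>auto simp: k_def\<close>)
 obtain v where v: "v : BM" "!!x. abs (v x) <= c0" "AEL x. x : D --> (%n. tt (Zs (k n)) x) ~~> v x"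
  by (rule limit_version[OF tt(1)[OF bZ] adm_T(2)[OF Zs(1)] cv1]) (rule that)
 obtain v' where v': "v' : BM" "!!x. abs (v' x) <= c0" "AEL x. x : D --> (%n. tt (Zs (Suc (k n))) x) ~~> v' x"
  by (rule limit_version[OF tt(1)[OF bZ] adm_T(2)[OF Zs(1)] cv2]) (rule that)
 have vb: "bb v" "bb v'" using v v' by (auto simp: bb_def)
 let ?eta = "%x. v' x - v x"
 have eta: "bb ?eta" by (intro bb_ops vb)
 then obtain B where B: "?eta : BM" "!!x. abs (?eta x) <= B" unfolding bb_def by blast
 have Bp: "B >= 0" using B(2)[of 0] by linarith
 have lm: "(%n. A ?eta (Zs (j n))) ~~> (LI x. bet x * (?eta x * u x))"
  if u: "u : BM" "AEL x. x : D --> (%n. tt (Zs (j n)) x) ~~> u x" for j u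
  unfolding A_def
 proof (rule dominated[where M="B * c0"])
  show "(%x. ?eta x * tt (Zs (j n)) x) : BM" for n by (intro borel_measurable_times B tt bZ)
  show "(%x. ?eta x * u x) : BM" by (intro borel_measurable_times B u)
  show "abs (?eta x * tt (Zs (j n)) x) <= B * c0" for n x unfolding abs_mult by (intro mult_mono B adm_T Zs Bp abs_ge_zero)
  show "AEL x. x : D --> (%n. ?eta x * tt (Zs (j n)) x) ~~> ?eta x * u x"
   using u(2) by (rule eventually_mono) (auto intro: tendsto_mult_left)
 qed
 \<comment> \<open>Up to sign this is the squared L^2(nu) norm of \<open>?eta\<close>. It is also
   the limit of the form evaluated on increments, and \<open>A_quad\<close> with arbitrarily small
   \<open>s\<close> shows that it vanishes.\<close>
 define \<Delta> where "\<Delta> = (LI x. bet x * (?eta x * v x)) - (LI x. bet x * (?eta x * v' x))"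
 let ?S = "%n. A (Zs n) (Zs n) - 2 * A (Zs n) (Zs (Suc n)) + A (Zs (Suc n)) (Zs (Suc n))"
 have dl: "(%n. A ?eta (Zs (k n)) - A ?eta (Zs (Suc (k n)))) ~~> \<Delta>"
  unfolding \<Delta>_def by (intro tendsto_diff lm v v')
 have \<Delta>s: "abs \<Delta> <= s * A ?eta ?eta" if s: "s > 0" for s
 proof -
  have "(%n. ?S (k n)) ~~> 0" using LIMSEQ_subseq_LIMSEQ[OF increments_vanish k] by (simp add: o_def)
  then have "(%n. s * A ?eta ?eta + ?S (k n) / s) ~~> s * A ?eta ?eta + 0 / s" using s by (intro tendsto_intros) auto
  then have "abs \<Delta> <= s * A ?eta ?eta + 0 / s"
   by (rule LIMSEQ_le[OF tendsto_rabs[OF dl]]) (use A_quad(2)[OF eta bZ bZ s] in blast)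
  then show ?thesis by simp
 qed
 have "\<Delta> = 0"
 proof (rule ccontr)
  assume n: "\<Delta> ~= 0"
  define a where "a = A ?eta ?eta"
  have a: "a >= 0" unfolding a_def by (rule A_nonneg[OF eta])
  have "abs \<Delta> <= (abs \<Delta> / (2 * (a + 1))) * a" using \<Delta>s[of "abs \<Delta> / (2 * (a + 1))"] n a by (simp add: a_def)
  also have "... < abs \<Delta>" using n a by (simp add: field_simps add_nonneg_pos)
  finally show False by simp
 qed
 have "(LI x. bet x * (?eta x * ?eta x)) = (LI x. bet x * (?eta x * v' x) - bet x * (?eta x * v x))"
  by (intro lint_cong) (auto simp: algebra_simps)
 also have "... = - \<Delta>" unfolding \<Delta>_def using bb_int[OF bb_ops(3)[OF eta vb(1)]] bb_int[OF bb_ops(3)[OF eta vb(2)]] by simp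
 finally have "(LI x. bet x * (?eta x * ?eta x)) = 0" using \<open>\<Delta> = 0\<close> by simp
 from bet_zero[OF bb_ops(3)[OF eta eta] zero_le_square this] v'(3)
 have v2: "AEL x. x : D --> (%n. tt (Zs (Suc (k n))) x) ~~> v x" by eventually_elim auto
 \<comment> \<open>Off the level set the arguments \<open>s n\<close> are eventually different from
   0, so the jump term is absent and \<open>ft\<close> is continuous at the limit.\<close>
 have g: "AEL x. x : D --> v x + q x ~= \<mu> --> (%n. Zs (Suc (k n)) x) ~~> lam * ft (v x + q x - \<mu>)"
  using v(3)
 proof (rule eventually_mono, intro impI)
  fix x assume l: "x : D --> (%n. tt (Zs (k n)) x) ~~> v x" and x: "x : D" and ne: "v x + q x ~= \<mu>"
  define s where "s n = av (Zs (k n)) x - mu (Zs (k n))" for n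
  have sl: "s ~~> v x + q x - \<mu>" unfolding s_def[abs_def] av_def using l x by (intro tendsto_intros mul) auto
  have "(%n. lam * ft (s n)) ~~> lam * ft (v x + q x - \<mu>)"
   using ne by (intro tendsto_mult_left isCont_tendsto_compose[OF ft_cont sl]) auto
  moreover have "\<forall>\<^sub>F n in sequentially. s n ~= 0" by (rule tendsto_imp_eventually_ne[OF sl]) (use ne in simp)
  then have "\<forall>\<^sub>F n in sequentially. lam * ft (s n) = Zs (Suc (k n)) x"
   by (rule eventually_mono) (simp add: Zs(2) nx_def stp_def s_def)
  ultimately show "(%n. Zs (Suc (k n)) x) ~~> lam * ft (v x + q x - \<mu>)" by (rule Lim_transform_eventually)
 qed
 obtain z where z: "z : BM" "!!x. 0 <= z x & z x <= lam * L" "(LI x. bet x * z x) = m"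
  "AEL x. x : D --> tt z x = v x" "AEL x. x : D --> v x + q x ~= \<mu> --> z x = lam * ft (v x + q x - \<mu>)"
 proof (rule hull_limit[OF _ _ _ v(1,2) adm_T(2)[OF Zs(1)] v2 g])
  show "Zs (Suc (k n)) : BM" "0 <= Zs (Suc (k n)) x & Zs (Suc (k n)) x <= lam * L" for n x
   using Zs(1) by (auto simp: adm_def)
  show "(LI x. bet x * Zs (Suc (k n)) x) = m" for n unfolding Zs(2) by (rule nx(4)[OF Zs(1)])
 qed (rule that)
 have za: "adm z" using z(1,2) by (simp add: adm_def)
 note zb = adm_bb[OF za]
 let ?\<psi> = "%x. T z x + q x - \<mu>"
 have "(%x. T z x + ind D x * q x - \<mu>) : BL D"
  using tt(8)[OF zb] borel_lebesgue_on[OF q_meas] by (intro borel_measurable_diff borel_measurable_add) auto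
 then have pm: "?\<psi> : BL D" by (rule measurable_cong[THEN iffD1, rotated]) simp
 have pe: "AEL x. x : D --> ?\<psi> x = tt z x + q x - \<mu>" using tt(2)[OF zb] by (rule eventually_mono) simp
 note reg = regularity[OF M[OF za] q(1,2) pm pe, where \<zeta>=z]
 \<comment> \<open>On the level set the limit z is so far known only to lie between 0 and lam L.
   Regularity shows that it is 0 there, in agreement with ft 0 = 0.\<close>
 have "AEL x. x : D --> ?\<psi> x = 0 --> z x = 0" by (rule reg(3)) simp_all
 then have ae: "AEL x. x : D --> z x = lam * ft (?\<psi> x)" using pe z(4,5)
 proof eventually_elim
  fix x assume a: "x : D --> ?\<psi> x = 0 --> z x = 0" "x : D --> ?\<psi> x = tt z x + q x - \<mu>" "x : D --> tt z x = v x"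
   "x : D --> v x + q x ~= \<mu> --> z x = lam * ft (v x + q x - \<mu>)"
  show "x : D --> z x = lam * ft (?\<psi> x)"
  proof
   assume x: "x : D"
   then have e: "?\<psi> x = v x + q x - \<mu>" using a by simp
   show "z x = lam * ft (?\<psi> x)"
   proof (cases "?\<psi> x = 0")
   case True
   then show ?thesis using a(1) x ft0[of 0] by simp
   next
   case False
   then show ?thesis using a(4) x unfolding e by simp
   qed
  qed
 qed
 show ?thesis
  by (rule that[OF za z(3) ae reg(1) reg(2)]) simp_all
qed

end

lemma profile_f:
 assumes f: "vorticity_profile f"
 obtains l where "profile (%s. f (min s 1)) (f 1) l" "mono f" "!!s. s > 0 ==> f s > 0" "!!s. s <= 0 ==> f s = 0"
proof -
 have f0: "f s = 0" if "s <= 0" for s using f that by (simp add: vorticity_profile_def)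
 have sm: "f s < f t" if "0 <= s" "s < t" for s t
  using f that by (auto simp: vorticity_profile_def strict_mono_on_def)
 have pos: "f s > 0" if "s > 0" for s using sm[of 0 s] that f0[of 0] by simp
 have mono: "mono f"
 proof (rule monoI)
  fix s t :: real assume "s <= t"
  then show "f s <= f t" using f0[of s] f0[of t] pos[of t] sm[of s t] by (cases "s = t"; cases "0 <= s"; cases "0 < t") auto
 qed
 obtain l where l: "l >= 0" "(f \<longlongrightarrow> l) (at_right 0)" using f by (auto simp: vorticity_profile_def)
 have fc: "isCont f s" if "s ~= 0" for s
  using f that continuous_on_eq_continuous_at[of "UNIV - {0::real}" f] by (auto simp: vorticity_profile_def open_delete)
 have "profile (%s. f (min s 1)) (f 1) l"
 proof
  show "s <= 0 ==> f (min s 1) = 0" for s by (rule f0) simp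
  show "mono (%s. f (min s 1))" by (intro monoI monoD[OF mono]) auto
  show "f (min s 1) <= f 1" for s by (intro monoD[OF mono]) simp
  show "isCont (%s. f (min s 1)) s" if "s ~= 0" for s
  proof (rule isCont_o2[where g=f])
   show "isCont (%s. min s (1::real)) s" by (intro continuous_intros)
   show "isCont f (min s 1)" using that by (intro fc) (auto simp: min_def)
  qed
  have "\<forall>\<^sub>F s in at_right 0. f s = f (min s 1)"
   using eventually_at_right_real[of 0 1] by (auto elim!: eventually_mono)
  then show "((%s. f (min s 1)) \<longlongrightarrow> l) (at_right 0)" by (rule Lim_transform_eventually[OF l(2)])
 qed (use l in auto)
 then show ?thesis using that mono pos f0 by blast
qed

section \<open>The limit of small eps\<close>

context lake
begin

lemma bet_open_pos:
 assumes "open E" "E ~= {}" "E <= D"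
 shows "0 < (LI x. bet x * ind E x)"
proof -
 have b: "bb (ind E)" unfolding bb_def using assms(1) by (intro conjI exI[of _ 1] allI) auto
 have "0 <= (LI x. bet x * ind E x)" by (intro integral_nonneg_AE AE_I2 mult_nonneg_nonneg bet(1)) auto
 moreover have "(LI x. bet x * ind E x) ~= 0"
 proof
  assume "(LI x. bet x * ind E x) = 0"
  then have "AEL x. x : D --> indicat_real E x = 0" by (rule bet_zero[OF b, rotated]) simp
  then have "AEL x. x ~: E" by (rule eventually_mono) (use assms(3) in \<open>auto simp: indicator_def split: if_splits\<close>)
  then have "E : null_sets lborel" using assms(1) by (subst (asm) AE_iff_null_sets[symmetric]) auto
  then show False using assms(1,2) open_not_negligible[of E] by (simp add: negligible_iff_null_sets null_sets_completionI)
 qed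
 ultimately show ?thesis by simp
qed

lemma main:
 fixes q :: "plane => real" and f \<delta> :: "real => real" and kap :: real
 assumes qc: "continuous_on (closure D) q" and q: "Ck_on 2 D q" "!!x. x : D ==> divergence (%y. (1 / b y) *R grad q y) x = 0"
  and f: "vorticity_profile f" and kap: "kap > 0" and \<delta>_pos: "!!eps. eps > 0 ==> \<delta> eps > 0"
  and \<delta>_small: "((%eps. \<delta> eps * ln (1 / eps)) \<longlongrightarrow> 0) (at_right 0)"
 shows "EX eps\<^sub>0>0. EX \<psi> \<zeta> K\<zeta> :: real => plane => real. EX \<mu> :: real => real.
  (ALL eps:{0<..<eps\<^sub>0}.
   (ALL p>1. \<zeta> eps : Lp (lebesgue_on D) p & \<psi> eps : W2p_loc D p) \<and>
   is_L_ae D b (\<psi> eps) (\<zeta> eps) \<and>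
   is_K D b (\<zeta> eps) (K\<zeta> eps) \<and>
   (ALL x:D. \<psi> eps x = K\<zeta> eps x + q x - \<mu> eps) \<and>
   (ALL x:D. \<zeta> eps x = \<delta> eps / eps^2 * f (\<psi> eps x)) \<and>
   (\<integral>x. \<zeta> eps x \<partial>lake_measure D b) = kap * \<delta> eps) \<and>
  uniform_limit D K\<zeta> (%_. 0) (at_right 0) \<and>
  (\<mu> \<longlongrightarrow> (SUP x\<in>closure D. q x)) (at_right 0) \<and>
  (ALL l>0. \<forall>\<^sub>F eps in at_right 0. supp_in D (\<zeta> eps) <= max_nbhd D q l)"
proof -
 obtain l where pf: "profile (%s. f (min s 1)) (f 1) l" and mono: "mono f" and fpos: "!!s. s > 0 ==> f s > 0" and f0: "!!s. s <= 0 ==> f s = 0"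
  by (rule profile_f[OF f]) (rule that)
 define qm where "qm = (SUP x\<in>closure D. q x)"
 have cD: "compact (closure D)" using bd by simp
 obtain x0 where x0: "x0 : closure D" "!!y. y : closure D ==> q y <= q x0"
  using continuous_attains_sup[OF cD _ qc] ne by (metis closure_eq_empty)
 have qm: "q x0 = qm" "!!y. y : closure D ==> q y <= qm"
 proof -
  show "q x0 = qm" unfolding qm_def using x0 by (intro cSup_eq_maximum[symmetric]) auto
  then show "!!y. y : closure D ==> q y <= qm" using x0(2) by simp
 qed
 have DcD: "D <= closure D" by (rule closure_subset)
 have "compact (q ` closure D)" by (rule compact_continuous_image[OF qc cD])
 then obtain Q where Q: "!!x. x : D ==> abs (q x) <= Q" using DcD unfolding compact_eq_bounded_closed bounded_real by blast
 define V where "V E = (LI x. bet x * ind E x)" for E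
 have VD: "V D = (LI x. bet x)" unfolding V_def by (intro lint_cong) (auto simp: bet_def indicator_def)
 have VDp: "V D > 0" unfolding V_def by (rule bet_open_pos[OF D ne order_refl])
 \<comment> \<open>\<open>d0\<close> admits eps as radius in \<open>T_bound\<close>, 1 gives eps^2
   <= eps, and the last entry makes the mass kap delta attainable with the height
   \<open>Lam eps * f 1\<close>.\<close>
 define e1 where "e1 = min d0 (min 1 (f 1 * V D / kap))"
 have e1: "e1 > 0" using d0(1) fpos[of 1] VDp kap by (simp add: e1_def)
 define Lam where "Lam eps = \<delta> eps / eps^2" for eps
 \<comment> \<open>Solutions for the truncated profile. The estimates preceding the choice of
   \<open>zz\<close> are proved for every such pair, so that their thresholds in eps are independent
   of the choice.\<close>
 define sol where "sol eps z \<mu> \<longleftrightarrow> z : BM & (ALL x. 0 <= z x & z x <= Lam eps * f 1) & (LI x. bet x * z x) = kap * \<delta> eps \<and>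
  (AEL x. x : D --> z x = Lam eps * f (min (T z x + q x - \<mu>) 1)) \<and>
  (ALL p>1. (%x. T z x + q x - \<mu>) : W2p_loc D p) & is_L_ae D b (%x. T z x + q x - \<mu>) z" for eps z \<mu>
 have Lam: "Lam eps > 0" if "eps > 0" for eps using \<delta>_pos[OF that] that by (simp add: Lam_def)
 have ex: "EX z \<mu>. sol eps z \<mu>" if ep: "0 < eps" "eps < e1" for eps
 proof -
  have "eps^2 < f 1 * V D / kap"
  proof -
   have "eps * eps <= eps * 1" using ep by (intro mult_left_mono) (auto simp: e1_def)
   then have "eps^2 <= eps" by (simp add: power2_eq_square)
   also have "eps < f 1 * V D / kap" using ep by (simp add: e1_def)
   finally show ?thesis .
  qed
  then have "kap * eps^2 < f 1 * V D" using kap by (simp add: field_simps)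
  then have mm: "kap * \<delta> eps < Lam eps * f 1 * V D"
   using \<delta>_pos[OF ep(1)] ep(1) by (simp add: Lam_def field_simps)
  interpret lp: lake_profile D b G R Bb BR d0 "%s. f (min s 1)" "f 1" l q Q "Lam eps" "kap * \<delta> eps"
  proof -
   interpret profile "%s. f (min s 1)" "f 1" l by (rule pf)
   show "lake_profile D b G R Bb BR d0 (%s. f (min s 1)) (f 1) l q Q (Lam eps) (kap * \<delta> eps)"
   by unfold_locales (use q Q Lam[OF ep(1)] kap \<delta>_pos[OF ep(1)] mm in \<open>auto simp: VD\<close>)
  qed
  show ?thesis
  proof (rule lp.existence)
   fix z \<mu> assume "lp.adm z" "(LI x. bet x * z x) = kap * \<delta> eps" "AEL x. x : D --> z x = Lam eps * f (min (T z x + q x - \<mu>) 1)"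
   "!!p. p > 1 ==> (%x. T z x + q x - \<mu>) : W2p_loc D p" "is_L_ae D b (%x. T z x + q x - \<mu>) z"
   then show ?thesis unfolding sol_def lp.adm_def by (intro exI[of _ z] exI[of _ \<mu>]) blast
  qed
 qed
 \<comment> \<open>The right side of \<open>T_bound\<close> for mass kap delta and height Lam f(1),
   with ln(d0 / eps) written as ln d0 + ln(1 / eps).\<close>
 define eta where "eta eps = Bb / (2 * pi) * ((ln d0 + 1) * kap * \<delta> eps + kap * (\<delta> eps * ln (1 / eps)) + Bb * f 1 * c1 * \<delta> eps) + BR * kap * \<delta> eps" for eps
 \<comment> \<open>delta itself tends to 0, as ln(1 / eps) exceeds 1 once eps < exp(-1).\<close>
 have \<delta>0: "(\<delta> \<longlongrightarrow> 0) (at_right 0)"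
 proof (rule tendsto_sandwich[OF _ _ tendsto_const \<delta>_small])
  show "\<forall>\<^sub>F eps in at_right 0. 0 <= \<delta> eps"
   by (rule eventually_mono[OF eventually_at_right_less]) (use \<delta>_pos in \<open>simp add: less_imp_le\<close>)
  show "\<forall>\<^sub>F eps in at_right 0. \<delta> eps <= \<delta> eps * ln (1 / eps)"
  proof (rule eventually_mono[OF eventually_at_right_real[of 0 "exp (-1)"]])
   fix eps :: real assume e: "eps : {0<..<exp (-1)}"
   then have "ln eps < -1" by (metis greaterThanLessThan_iff ln_exp ln_less_cancel_iff exp_gt_zero)
   then have "1 <= ln (1 / eps)" using e by (simp add: ln_div)
   then show "\<delta> eps <= \<delta> eps * ln (1 / eps)" using \<delta>_pos[of eps] e mult_left_mono[of 1 "ln (1 / eps)" "\<delta> eps"] by simp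
  qed simp
 qed
 have eta0: "(eta \<longlongrightarrow> 0) (at_right 0)"
 proof -
  have "(eta \<longlongrightarrow> Bb / (2 * pi) * ((ln d0 + 1) * kap * 0 + kap * 0 + Bb * f 1 * c1 * 0) + BR * kap * 0) (at_right 0)"
   unfolding eta_def[abs_def] by (intro tendsto_intros \<delta>0 \<delta>_small)
  then show ?thesis by simp
 qed
 have Tb: "abs (T z x) <= eta eps" if s: "sol eps z \<mu>" and ep: "0 < eps" "eps < e1" and x: "x : D" for eps z \<mu> x
 proof -
  have z: "z : BM" "abs (z x) <= Lam eps * f 1" for x using s by (auto simp: sol_def)
  have "(%y. bet y * abs (z y)) = (%y. bet y * z y)" using s by (auto simp: sol_def)
  then have N: "(LI y. bet y * abs (z y)) = kap * \<delta> eps" using s by (simp add: sol_def)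
  have "abs (T z x) <= Bb / (2 * pi) * ((ln (d0 / eps) + 1) * (kap * \<delta> eps) + Bb * (Lam eps * f 1) * (eps^2 * c1)) + BR * (kap * \<delta> eps)"
   using T_bound[OF z ep(1) _ x] ep(2) unfolding N by (simp add: e1_def)
  also have "... = eta eps"
  proof -
   have "ln (d0 / eps) = ln d0 + ln (1 / eps)" using d0(1) ep(1) by (simp add: ln_div)
   moreover have "Lam eps * f 1 * (eps^2 * c1) = f 1 * c1 * \<delta> eps" using ep(1) by (simp add: Lam_def)
   ultimately show ?thesis by (simp add: eta_def algebra_simps)
  qed
  finally show ?thesis .
 qed
 \<comment> \<open>Positive mass forces psi > 0 somewhere, which will bound the multiplier from
   above.\<close>
 have massp: "EX x:D. T z x + q x - \<mu> > 0" if s: "sol eps z \<mu>" and ep: "0 < eps" for eps z \<mu>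
 proof (rule ccontr)
  assume n: "~ (EX x:D. T z x + q x - \<mu> > 0)"
  have "AEL x. x : D --> z x = Lam eps * f (min (T z x + q x - \<mu>) 1)" using s by (simp add: sol_def)
  then have "AEL x. bet x * z x = 0"
  proof (rule eventually_mono)
   fix x assume a: "x : D --> z x = Lam eps * f (min (T z x + q x - \<mu>) 1)"
   show "bet x * z x = 0"
   proof (cases "x : D")
   case True
   then have "f (min (T z x + q x - \<mu>) 1) = 0" using n by (intro f0) force
   then show ?thesis using a True by simp
   qed (simp add: bet_def)
  qed
  then have "(LI x. bet x * z x) = 0" by (rule integral_eq_zero_AE)
  then show False using s \<delta>_pos[OF ep] kap by (simp add: sol_def)
 qed
 have upper: "\<mu> < qm + eta eps" if s: "sol eps z \<mu>" and ep: "0 < eps" "eps < e1" for eps z \<mu>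
 proof -
  obtain x where x: "x : D" "T z x + q x - \<mu> > 0" using massp[OF s ep(1)] by blast
  then show ?thesis using Tb[OF s ep x(1)] qm(2)[of x] DcD by fastforce
 qed
 \<comment> \<open>If mu were below qm - s, then psi >= s/2 on the open set \<open>E\<close> where q
   > qm - s/4, because K z exceeds -s/4. The mass would be at least Lam cs V(E), of order delta /
   eps^2, against the prescribed kap delta.\<close>
 have lower: "EX e>0. ALL eps z \<mu>. 0 < eps --> eps < e --> sol eps z \<mu> --> eps < e1 & abs (eta eps) < s & qm - s <= \<mu>" if s: "s > 0" for s
 proof -
  define E where "E = {x\<in>D. q x > qm - s/4}"
  have Eo: "open E"
  proof -
   have "open (D Int q -` {qm - s/4<..})" by (rule continuous_open_preimage[OF continuous_on_subset[OF qc DcD] D]) simp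
   moreover have "D Int q -` {qm - s/4<..} = E" by (auto simp: E_def)
   ultimately show ?thesis by simp
  qed
  have "E ~= {}"
  proof -
   obtain r where r: "r > 0" "!!x. x : closure D ==> dist x x0 < r ==> dist (q x) (q x0) < s/4"
   using qc x0(1) s unfolding continuous_on_iff by (metis divide_pos_pos zero_less_numeral)
   obtain x where x: "x : D" "dist x x0 < r" using x0(1) r(1) closure_approachable by blast
   then have "dist (q x) (q x0) < s/4" using r(2) DcD by blast
   then have "q x > qm - s/4" unfolding dist_real_def qm(1) abs_less_iff by argo
   then have "x : E" using x(1) by (simp add: E_def)
   then show ?thesis by blast
  qed
  then have VE: "V E > 0" unfolding V_def by (intro bet_open_pos Eo) (auto simp: E_def)
  define cs where "cs = f (min (s/2) 1)"
  have cs: "cs > 0" unfolding cs_def using s by (intro fpos) simp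
  obtain e2 where e2: "e2 > 0" "!!eps. 0 < eps ==> eps < e2 ==> abs (eta eps) < s/4"
   using tendstoD[OF eta0, of "s/4"] s unfolding eventually_at_right_field by (auto simp: dist_real_def)
  define e where "e = min (min e1 e2) (min 1 (cs * V E / kap))"
  have "e > 0" using e1 e2 cs VE kap by (simp add: e_def)
  moreover have "eps < e1 & abs (eta eps) < s & qm - s <= \<mu>" if ep: "0 < eps" "eps < e" and sl: "sol eps z \<mu>" for eps z \<mu>
  proof (intro conjI)
   show ee: "eps < e1" using ep by (simp add: e_def)
   have et: "abs (eta eps) < s/4" using e2 ep by (simp add: e_def)
   then show "abs (eta eps) < s" using s by linarith
   show "qm - s <= \<mu>"
   proof (rule ccontr)
   assume n: "~ qm - s <= \<mu>"
   have zb: "bb z" using sl unfolding sol_def bb_def by (auto intro!: exI[of _ "Lam eps * f 1"])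
   have iE: "bb (%x. Lam eps * cs * ind E x)"
   proof -
   have "(%x. Lam eps * cs * ind E x) : BM"
   using Eo by (intro borel_measurable_times borel_measurable_const borel_measurable_indicator) simp
   moreover have "abs (Lam eps * cs * ind E x) <= Lam eps * cs" for x using Lam[OF ep(1)] cs by (simp add: indicator_def)
   ultimately show ?thesis unfolding bb_def by blast
   qed
   have "AEL x. x : D --> z x = Lam eps * f (min (T z x + q x - \<mu>) 1)" using sl by (simp add: sol_def)
   then have "AEL x. bet x * (Lam eps * cs * ind E x) <= bet x * z x"
   proof (rule eventually_mono)
   fix x assume a: "x : D --> z x = Lam eps * f (min (T z x + q x - \<mu>) 1)"
   show "bet x * (Lam eps * cs * ind E x) <= bet x * z x"
   proof (cases "x : E")
   case True
   then have x: "x : D" "q x > qm - s/4" by (auto simp: E_def)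
   have "T z x + q x - \<mu> >= s/2" using Tb[OF sl ep(1) ee x(1)] et x(2) n by argo
   then have "cs <= f (min (T z x + q x - \<mu>) 1)" unfolding cs_def by (intro monoD[OF mono]) auto
   then show ?thesis using a x(1) True bet(1)[of x] Lam[OF ep(1)] by (auto intro!: mult_left_mono)
   qed (use bet(1)[of x] sl in \<open>auto simp: sol_def\<close>)
   qed
   then have "(LI x. bet x * (Lam eps * cs * ind E x)) <= (LI x. bet x * z x)"
   by (rule integral_mono_AE[OF bb_int[OF iE] bb_int[OF zb]])
   also have "(LI x. bet x * (Lam eps * cs * ind E x)) = (LI x. (Lam eps * cs) * (bet x * ind E x))"
   by (intro lint_cong) auto
   finally have "Lam eps * cs * V E <= kap * \<delta> eps" using sl by (simp add: V_def sol_def)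
   then have "\<delta> eps * (cs * V E) <= \<delta> eps * (kap * eps^2)" using ep(1) by (simp add: Lam_def field_simps)
   then have "cs * V E <= kap * eps^2" using \<delta>_pos[OF ep(1)] by simp
   moreover have "kap * eps^2 < cs * V E"
   proof -
   have "eps * eps <= eps * 1" using ep by (intro mult_left_mono) (auto simp: e_def)
   then have "eps^2 <= eps" by (simp add: power2_eq_square)
   also have "eps < cs * V E / kap" using ep by (simp add: e_def)
   finally show ?thesis using kap by (simp add: field_simps)
   qed
   ultimately show False by simp
   qed
  qed
  ultimately show ?thesis by blast
 qed
 \<comment> \<open>With s = 1/2 the two contributions K z < 1/2 and q - mu <= 1/2 add up to at most
   1, so that truncating f at 1 has changed nothing.\<close>
 obtain e0 where e0: "e0 > 0" "!!eps z \<mu>. 0 < eps ==> eps < e0 ==> sol eps z \<mu> ==> eps < e1 & abs (eta eps) < 1/2 & qm - 1/2 <= \<mu>"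
  using lower[of "1/2"] by auto
 define eps\<^sub>0 where "eps\<^sub>0 = min e0 e1"
 have eps0: "eps\<^sub>0 > 0" using e0 e1 by (simp add: eps\<^sub>0_def)
 define p where "p eps = (SOME p. sol eps (fst p) (snd p))" for eps
 define zz where "zz eps = fst (p eps)" for eps
 define \<mu> where "\<mu> eps = snd (p eps)" for eps
 have sol: "sol eps (zz eps) (\<mu> eps)" if "0 < eps" "eps < e1" for eps
  unfolding zz_def \<mu>_def p_def by (rule someI_ex[of "%p. sol eps (fst p) (snd p)"]) (use ex[OF that] in auto)
 define K\<zeta> where "K\<zeta> eps = T (zz eps)" for eps
 define \<psi> where "\<psi> eps x = K\<zeta> eps x + q x - \<mu> eps" for eps x
 \<comment> \<open>The vorticity is given by the exact formula at every point and agrees with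
   \<open>zz\<close> only almost everywhere; the other properties are transported along this
   identity.\<close>
 define \<zeta> where "\<zeta> eps x = \<delta> eps / eps^2 * f (\<psi> eps x)" for eps x
 have props: "(ALL p>1. \<zeta> eps : Lp (lebesgue_on D) p & \<psi> eps : W2p_loc D p) & is_L_ae D b (\<psi> eps) (\<zeta> eps) & is_K D b (\<zeta> eps) (K\<zeta> eps) \<and>
   (\<integral>x. \<zeta> eps x \<partial>lake_measure D b) = kap * \<delta> eps" if ep: "eps : {0<..<eps\<^sub>0}" for eps
 proof -
  have ep: "0 < eps" "eps < e1" "eps < e0" using ep by (auto simp: eps\<^sub>0_def)
  note s = sol[OF ep(1,2)]
  have z: "zz eps : BM" "!!x. 0 <= zz eps x & zz eps x <= Lam eps * f 1" "(LI x. bet x * zz eps x) = kap * \<delta> eps"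
   "AEL x. x : D --> zz eps x = Lam eps * f (min (\<psi> eps x) 1)" "!!p. p > 1 ==> \<psi> eps : W2p_loc D p" "is_L_ae D b (\<psi> eps) (zz eps)"
   using s by (simp_all add: sol_def \<psi>_def[abs_def] K\<zeta>_def)
  have zb: "bb (zz eps)" using z(1,2) unfolding bb_def by (auto intro!: exI[of _ "Lam eps * f 1"])
  have p1: "\<psi> eps x <= 1" if "x : D" for x
   using Tb[OF s ep(1,2) that] e0(2)[OF ep(1,3) s] qm(2)[of x] that DcD by (auto simp: \<psi>_def K\<zeta>_def)
  have ae: "AEL x. x : D --> \<zeta> eps x = zz eps x"
   using z(4) by (rule eventually_mono) (simp add: \<zeta>_def Lam_def p1 min_absorb1)
  have "(%x. T (zz eps) x + ind D x * q x - \<mu> eps) : BL D"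
   by (intro borel_measurable_diff borel_measurable_add tt(8)[OF zb] borel_lebesgue_on borel_measurable_const
   loc_LallD(1)[OF loc_Lall_cont[OF D continuous_on_subset[OF qc DcD]]])
  then have "\<psi> eps : BL D"
   by (rule measurable_cong[THEN iffD1, rotated]) (simp add: \<psi>_def K\<zeta>_def)
  then have zm: "\<zeta> eps : BL D"
   unfolding \<zeta>_def[abs_def] by (intro borel_measurable_times borel_measurable_const measurable_compose[OF _ borel_measurable_mono[OF mono]])
  have Lp: "\<zeta> eps : Lp (lebesgue_on D) p" if "p > 1" for p
   unfolding Lp_def mem_Collect_eq
  proof (intro conjI zm)
   have "D : lmeasurable" using bd D by (intro bounded_set_imp_lmeasurable) auto
   then interpret finite_measure "lebesgue_on D" by (rule finite_measure_lebesgue_on)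
   show "integrable (lebesgue_on D) (%x. abs (\<zeta> eps x) powr p)"
   proof (rule integrable_const_bound[where B="(Lam eps * f 1) powr p"])
   have "0 <= \<zeta> eps x & \<zeta> eps x <= Lam eps * f 1" if "x : D" for x
   using monoD[OF mono p1[OF that]] Lam[OF ep(1)] monoD[OF mono, of "min (\<psi> eps x) 0" "\<psi> eps x"] f0[of "min (\<psi> eps x) 0"]
   \<delta>_pos[OF ep(1)]
   by (auto simp: \<zeta>_def Lam_def intro!: divide_right_mono mult_left_mono divide_nonneg_nonneg mult_nonneg_nonneg)
   then show "AE x in lebesgue_on D. norm (abs (\<zeta> eps x) powr p) <= (Lam eps * f 1) powr p"
   using that by (intro AE_I2) (auto intro!: powr_mono2)
   qed (use zm in measurable)
  qed
  have aeD: "AE x in lebesgue_on D. \<zeta> eps x = zz eps x"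
   using ae by (subst AE_restrict_space_iff) (auto intro: AE_completion)
  have aeN: "AE x in lake_measure D b. \<zeta> eps x = zz eps x"
   unfolding lake_measure_def using aeD b_meas by (subst AE_density) (auto elim: eventually_mono)
  have isL: "is_L_ae D b (\<psi> eps) (\<zeta> eps)"
  proof -
   obtain v d where vd: "ALL i. has_weak_partial D i (\<psi> eps) (v i) & has_weak_partial D i (%x. v i x / b x) (d i)"
   "AE x in lebesgue_on D. - (1 / b x) * (SUM i:UNIV. d i x) = zz eps x"
   using z(6) unfolding is_L_ae_def by blast
   have "AE x in lebesgue_on D. - (1 / b x) * (SUM i:UNIV. d i x) = \<zeta> eps x" using vd(2) aeD by eventually_elim simp
   then show ?thesis using vd(1) unfolding is_L_ae_def by blast
  qed
  have isK: "is_K D b (\<zeta> eps) (K\<zeta> eps)"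
  proof -
   obtain W where W: "in_H D b (T (zz eps)) W" "!!v V. in_H D b v V ==>
   (\<integral>x. 1 / (b x)^2 * (W x \<bullet> V x) \<partial>lake_measure D b) = (\<integral>x. zz eps x * v x \<partial>lake_measure D b)"
   using is_K_T[OF zb] unfolding is_K_def by blast
   have e: "(\<integral>x. zz eps x * v x \<partial>lake_measure D b) = (\<integral>x. \<zeta> eps x * v x \<partial>lake_measure D b)" if "in_H D b v V" for v V
   proof (rule integral_cong_AE)
   have v: "v : BL D" using that by (simp add: in_H_def)
   show "(%x. zz eps x * v x) : borel_measurable (lake_measure D b)" "(%x. \<zeta> eps x * v x) : borel_measurable (lake_measure D b)"
   using borel_measurable_times[OF borel_lebesgue_on[OF z(1)] v] borel_measurable_times[OF zm v] by (simp_all add: lake_measure_def)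
   show "AE x in lake_measure D b. zz eps x * v x = \<zeta> eps x * v x" using aeN by (rule eventually_mono) simp
   qed
   then show ?thesis unfolding is_K_def K\<zeta>_def by (intro exI[of _ W] conjI allI impI W(1)) (rule trans[OF W(2) e])
  qed
  have "(\<integral>x. \<zeta> eps x \<partial>lake_measure D b) = kap * \<delta> eps"
   using lake_integral(1)[OF zm z(1) ae] z(3) by simp
  then show ?thesis using Lp z(5) isL isK by blast
 qed
 have ul: "uniform_limit D K\<zeta> (%_. 0) (at_right 0)"
  unfolding uniform_limit_iff
 proof (intro allI impI)
  fix e :: real assume "e > 0"
  then have "\<forall>\<^sub>F eps in at_right 0. dist (eta eps) 0 < e" by (rule tendstoD[OF eta0])
  then show "\<forall>\<^sub>F eps in at_right 0. ALL x:D. dist (K\<zeta> eps x) 0 < e"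
   using eventually_at_right_real[OF e1]
  proof eventually_elim
   fix eps assume a: "dist (eta eps) 0 < e" "eps : {0<..<e1}"
   show "ALL x:D. dist (K\<zeta> eps x) 0 < e"
   proof
   fix x assume "x : D"
   then show "dist (K\<zeta> eps x) 0 < e" using Tb[OF sol, of eps x] a by (auto simp: K\<zeta>_def dist_real_def)
   qed
  qed
 qed
 have near: "\<forall>\<^sub>F eps in at_right 0. 0 < eps & eps < e1 & abs (eta eps) < s & abs (\<mu> eps - qm) <= s" if s: "s > 0" for s
 proof -
  obtain e where e: "e > 0" "!!eps z \<mu>. 0 < eps ==> eps < e ==> sol eps z \<mu> ==> eps < e1 & abs (eta eps) < s & qm - s <= \<mu>"
   using lower[OF s] by blast
  have "min e e1 > 0" using e e1 by simp
  then show ?thesis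
  proof (rule eventually_mono[OF eventually_at_right_real])
   fix eps assume "eps : {0<..<min e e1}"
   then have ep: "0 < eps" "eps < e" "eps < e1" by auto
   from e(2)[OF ep(1,2) sol[OF ep(1,3)]] upper[OF sol[OF ep(1,3)] ep(1,3)]
   show "0 < eps & eps < e1 & abs (eta eps) < s & abs (\<mu> eps - qm) <= s" using ep by (simp add: abs_le_iff abs_less_iff)
  qed
 qed
 have mul: "(\<mu> \<longlongrightarrow> qm) (at_right 0)"
 proof (rule tendstoI)
  fix e :: real assume "e > 0"
  then have "\<forall>\<^sub>F eps in at_right 0. abs (\<mu> eps - qm) <= e / 2" using near[of "e/2"] by (auto elim: eventually_mono)
  then show "\<forall>\<^sub>F eps in at_right 0. dist (\<mu> eps) qm < e" by (rule eventually_mono) (use \<open>e > 0\<close> in \<open>simp add: dist_real_def\<close>)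
 qed
 have supp: "\<forall>\<^sub>F eps in at_right 0. supp_in D (\<zeta> eps) <= max_nbhd D q l" if l: "l > 0" for l
 proof -
  define C where "C = {x\<in>closure D. l <= infdist x (max_set D q)}"
  have x0M: "x0 : max_set D q" using x0(1) qm(1) by (simp add: max_set_def qm_def)
  \<comment> \<open>The gap is \<open>2 * s\<close> because K z and the deviation of the multiplier
    from \<open>qm\<close> each cost up to \<open>s\<close>.\<close>
  obtain s where s: "s > 0" "!!x. x : C ==> q x < qm - 2 * s"
  proof (cases "C = {}")
   case True
   then show ?thesis using that[of 1] by simp
  next
   case False
   have "C = closure D Int (%x. infdist x (max_set D q)) -` {l..}" by (auto simp: C_def)
   then have "compact C" using continuous_closed_preimage[of "closure D" "%x. infdist x (max_set D q)" "{l..}"] cD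
   by (auto simp: continuous_on_infdist compact_eq_bounded_closed intro: bounded_subset)
   moreover have "continuous_on C q" using qc by (rule continuous_on_subset) (auto simp: C_def)
   ultimately obtain x1 where x1: "x1 : C" "!!y. y : C ==> q y <= q x1" using continuous_attains_sup[of C q] False by blast
   have "x1 ~: max_set D q" using x1(1) l infdist_zero[of x1 "max_set D q"] by (auto simp: C_def)
   then have "q x1 < qm" using x1(1) qm(2)[of x1] by (auto simp: C_def max_set_def qm_def)
   show ?thesis
   proof (rule that[of "(qm - q x1) / 4"])
   show "0 < (qm - q x1) / 4" using \<open>q x1 < qm\<close> by simp
   show "q x < qm - 2 * ((qm - q x1) / 4)" if "x : C" for x
   using x1(2)[OF that] \<open>q x1 < qm\<close> by argo
   qed
  qed
  show ?thesis
  proof (rule eventually_mono[OF near[OF s(1)]])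
   fix eps assume a: "0 < eps & eps < e1 & abs (eta eps) < s & abs (\<mu> eps - qm) <= s"
   have "q x >= qm - 2 * s" if x: "x : D" "\<zeta> eps x ~= 0" for x
   proof -
   have "\<psi> eps x > 0" using x(2) f0[of "\<psi> eps x"] by (force simp: \<zeta>_def)
   then have 1: "\<mu> eps < T (zz eps) x + q x" by (simp add: \<psi>_def K\<zeta>_def)
   have 2: "abs (T (zz eps) x) <= eta eps" using Tb[OF sol, of eps x] a x(1) by simp
   have "abs (eta eps) < s" "abs (\<mu> eps - qm) <= s" using a by auto
   then show ?thesis using 1 2 by (smt (verit))
   qed
   then have "{x\<in>D. \<zeta> eps x ~= 0} <= closure D Int q -` {qm - 2 * s..}" using DcD by auto
   moreover have "closed (closure D Int q -` {qm - 2 * s..})" by (rule continuous_closed_preimage[OF qc]) auto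
   ultimately have "closure {x\<in>D. \<zeta> eps x ~= 0} <= closure D Int q -` {qm - 2 * s..}" by (rule closure_minimal)
   then show "supp_in D (\<zeta> eps) <= max_nbhd D q l"
   using s(2) by (force simp: supp_in_def max_nbhd_def C_def not_less)
  qed
 qed
 show ?thesis
  using eps0 props ul mul supp unfolding qm_def
  by (intro exI[of _ eps\<^sub>0] conjI exI[of _ \<psi>] exI[of _ \<zeta>] exI[of _ K\<zeta>] exI[of _ \<mu>]) (auto simp: \<psi>_def \<zeta>_def)
qed

end

theorem theorem1p5:
  fixes D :: "(real^2) set" and b g q :: "real^2 \<Rightarrow> real"
    and f \<delta> :: "real \<Rightarrow> real" and \<kappa>\<^sub>0 :: real
  assumes lake: "continuous_regular_lake D b"
    and g_mean: "has_bochner_integral (surface_measure D) g 0"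
    and g_nontrivial: "\<not> (AE x in surface_measure D. g x = 0)"
    and flow: "background_flow D b g q"
    and f: "vorticity_profile f"
    and \<kappa>\<^sub>0: "\<kappa>\<^sub>0 > 0"
    and \<delta>_pos: "\<And>\<epsilon>. \<epsilon> > 0 \<Longrightarrow> \<delta> \<epsilon> > 0"
    and \<delta>_small: "((\<lambda>\<epsilon>. \<delta> \<epsilon> * ln (1 / \<epsilon>)) \<longlongrightarrow> 0) (at_right 0)"
  shows "\<exists>\<epsilon>\<^sub>0>0. \<exists>\<psi> \<zeta> K\<zeta> :: real \<Rightarrow> real^2 \<Rightarrow> real. \<exists>\<mu> :: real \<Rightarrow> real.
    (\<forall>\<epsilon>\<in>{0<..<\<epsilon>\<^sub>0}.
      (\<forall>p>1. \<zeta> \<epsilon> \<in> Lp (lebesgue_on D) p \<and> \<psi> \<epsilon> \<in> W2p_loc D p) \<and>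
      is_L_ae D b (\<psi> \<epsilon>) (\<zeta> \<epsilon>) \<and>
      is_K D b (\<zeta> \<epsilon>) (K\<zeta> \<epsilon>) \<and>
      (\<forall>x\<in>D. \<psi> \<epsilon> x = K\<zeta> \<epsilon> x + q x - \<mu> \<epsilon>) \<and>
      (\<forall>x\<in>D. \<zeta> \<epsilon> x = \<delta> \<epsilon> / \<epsilon>\<^sup>2 * f (\<psi> \<epsilon> x)) \<and>
      (\<integral>x. \<zeta> \<epsilon> x \<partial>lake_measure D b) = \<kappa>\<^sub>0 * \<delta> \<epsilon>) \<and>
    uniform_limit D K\<zeta> (\<lambda>_. 0) (at_right 0) \<and>
    (\<mu> \<longlongrightarrow> (SUP x\<in>closure D. q x)) (at_right 0) \<and>
    (\<forall>l>0. \<forall>\<^sub>F \<epsilon> in at_right 0. supp_in D (\<zeta> \<epsilon>) \<subseteq> max_nbhd D q l)"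
proof -
 have D: "bounded D" "lipschitz_domain D" "Ck_on 1 D b" "!!x. x : D ==> b x > 0" "continuous_lake D b"
  using lake by (auto simp: continuous_regular_lake_def)
 then have oD: "open D" "D ~= {}" by (auto simp: lipschitz_domain_def)
 obtain \<alpha> C where \<alpha>: "\<alpha> : {0<..<1}" and hold: "ALL x:closure D. ALL y:closure D. \<bar>b x - b y\<bar> <= C * dist x y powr \<alpha>"
  using lake unfolding continuous_regular_lake_def holder_on_def by blast
 define d0 where "d0 = diameter (closure D) + 1"
 have bc: "bounded (closure D)" by (rule bounded_closure[OF D(1)])
 have d0: "d0 > 0" "!!x y. x : closure D ==> y : closure D ==> dist x y <= d0"
  using diameter_ge_0[OF bc] diameter_bounded_bound[OF bc] unfolding d0_def by (simp, fastforce)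
 obtain y0 where y0: "y0 : D" using oD by blast
 have DcD: "D <= closure D" by (rule closure_subset)
 \<comment> \<open>The Hoelder condition bounds b on \<open>D\<close> by its value at one point, the
   distances being at most \<open>d0\<close>.\<close>
 have Bb: "b x <= b y0 + \<bar>C\<bar> * d0 powr \<alpha>" if "x : D" for x
 proof -
  have x: "x : closure D" "y0 : closure D" using that y0 DcD by auto
  have "\<bar>b x - b y0\<bar> <= C * dist x y0 powr \<alpha>" using hold x by blast
  also have "... <= \<bar>C\<bar> * dist x y0 powr \<alpha>" by (intro mult_right_mono) auto
  also have "... <= \<bar>C\<bar> * d0 powr \<alpha>" using d0(2)[OF x] \<alpha> by (intro mult_left_mono powr_mono2) auto
  finally show ?thesis by simp
 qed
 obtain G R BR where GR: "is_dirichlet_green D G" "!!x y. x : D ==> y : D ==> \<bar>R x y\<bar> <= BR"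
  "!!p z. p > 1 ==> z : Lp (lake_measure D b) p ==>
   is_K D b z (%x. b x * (\<integral>y. G x y * z y \<partial>lake_measure D b) + (\<integral>y. R x y * z y \<partial>lake_measure D b))"
  using D(5) unfolding continuous_lake_def by blast
 have lk: "lake D b G R (b y0 + \<bar>C\<bar> * d0 powr \<alpha>) BR d0"
  by unfold_locales (fact oD D Bb GR d0)+
 show ?thesis
 proof (rule lake.main[OF lk])
  show "continuous_on (closure D) q" "Ck_on 2 D q" using flow by (auto simp: background_flow_def)
  show "divergence (%y. (1 / b y) *\<^sub>R grad q y) x = 0" if "x : D" for x
   using flow that by (auto simp: background_flow_def)
 qed (fact f \<kappa>\<^sub>0 \<delta>_pos \<delta>_small)+
qed

end
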